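(* Every Krull-Schmidt category $\mathcal{A}$ admits a unique maximal admissible exact structure, namely the exact structure $\mathcal{E}$ whose category of defects $\operatorname{eff}\mathcal{E}$ is the full subcategory of objects (modules) of finite length in $\operatorname{eff}(\mathcal{E}^{\max})$, where $\mathcal{E}^{\max}$ is the maximal exact structure on $\mathcal{A}$.
   Context: All categories are essentially small. An exact structure (in the sense of Quillen) on an additive category $\mathcal{A}$ is a class $\mathcal{E}$ of kernel-cokernel pairs, called conflations $A\rightarrowtail B\twoheadrightarrow C$ (first maps: inflations; second maps: deflations), closed under isomorphism and satisfying Quillen's axioms (identities are inflations and deflations; inflations, resp. deflations, are closed under composition; push-outs of inflations along arbitrary morphisms exist and are inflations; pull-backs of deflations along arbitrary morphisms exist and are deflations). Exact structures on $\mathcal{A}$ are ordered by inclusion of classes of conflations; they form a bounded complete lattice whose maximal element is denoted $\mathcal{E}^{\max}$. The contravariant defect of a conflation $\delta: A\to B\xrightarrow{g}C$ is $\delta^{\sharp}=\operatorname{Coker}(\operatorname{Hom}(-,g))$ in $\operatorname{Mod}\mathcal{A}$, the category of additive functors $\mathcal{A}^{\mathrm{op}}\to\mathbf{Ab}$; $\operatorname{eff}\mathcal{E}$ (the category of defects of $\mathcal{E}$) is the full subcategory of $\operatorname{Mod}\mathcal{A}$ of modules isomorphic to $\delta^\sharp$ for a conflation $\delta$ in $\mathcal{E}$ (an abelian category). The exact structure $\mathcal{E}$ is admissible if every object of $\operatorname{eff}\mathcal{E}$ has finite length. *)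

theory Defs
  imports "HOL-Algebra.Coset" "HOL-Algebra.FiniteProduct" "HOL-Algebra.Ring"
begin

section \<open>Preadditive and additive categories\<close>

text \<open>
  Arrows know their source and target, so hom-sets are disjoint. Composition is written in the
  order of function application: \<open>Comp C g f\<close> is \<open>g\<close> after \<open>f\<close>. All fields are
  meaningful only on objects, arrows, composable pairs and parallel pairs, respectively.
  Objects and arrows form sets of a type, so every category here is small.
\<close>

record ('o, 'm) cat =
  Obj :: "'o set"
  Mor :: "'m set"
  Dom :: "'m \<Rightarrow> 'o"
  Cod :: "'m \<Rightarrow> 'o"
  Idn :: "'o \<Rightarrow> 'm"
  Comp :: "'m \<Rightarrow> 'm \<Rightarrow> 'm"
  Plus :: "'m \<Rightarrow> 'm \<Rightarrow> 'm"
  Zero :: "'o \<Rightarrow> 'o \<Rightarrow> 'm"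

definition Hom :: "('o, 'm) cat \<Rightarrow> 'o \<Rightarrow> 'o \<Rightarrow> 'm set" where
  "Hom C X Y = {f \<in> Mor C. Dom C f = X \<and> Cod C f = Y}"

text \<open>
  Abelian groups are the (multiplicatively written) commutative groups of HOL-Algebra, whose
  quotient construction is used for cokernels below.
\<close>

definition hom_grp :: "('o, 'm) cat \<Rightarrow> 'o \<Rightarrow> 'o \<Rightarrow> 'm monoid" where
  "hom_grp C X Y = \<lparr>carrier = Hom C X Y, mult = Plus C, one = Zero C X Y\<rparr>"

definition End_ring :: "('o, 'm) cat \<Rightarrow> 'o \<Rightarrow> 'm ring" where
  "End_ring C X = \<lparr>carrier = Hom C X X, mult = Comp C, one = Idn C X, zero = Zero C X X, add = Plus C\<rparr>"

locale category =
  fixes C :: "('o, 'm) cat"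
  assumes Dom_Obj: "f \<in> Mor C \<Longrightarrow> Dom C f \<in> Obj C"
    and Cod_Obj: "f \<in> Mor C \<Longrightarrow> Cod C f \<in> Obj C"
    and Idn_Hom: "X \<in> Obj C \<Longrightarrow> Idn C X \<in> Hom C X X"
    and Comp_Hom: "f \<in> Hom C X Y \<Longrightarrow> g \<in> Hom C Y Z \<Longrightarrow> Comp C g f \<in> Hom C X Z"
    and Comp_Idn_right: "f \<in> Hom C X Y \<Longrightarrow> Comp C f (Idn C X) = f"
    and Comp_Idn_left: "f \<in> Hom C X Y \<Longrightarrow> Comp C (Idn C Y) f = f"
    and Comp_assoc: "f \<in> Hom C W X \<Longrightarrow> g \<in> Hom C X Y \<Longrightarrow> h \<in> Hom C Y Z \<Longrightarrow>
      Comp C h (Comp C g f) = Comp C (Comp C h g) f"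

locale preadditive_category = category C for C :: "('o, 'm) cat" +
  assumes comm_group_hom_grp: "X \<in> Obj C \<Longrightarrow> Y \<in> Obj C \<Longrightarrow> comm_group (hom_grp C X Y)"
    and Comp_Plus_right: "f \<in> Hom C X Y \<Longrightarrow> f' \<in> Hom C X Y \<Longrightarrow> g \<in> Hom C Y Z \<Longrightarrow>
      Comp C g (Plus C f f') = Plus C (Comp C g f) (Comp C g f')"
    and Comp_Plus_left: "f \<in> Hom C X Y \<Longrightarrow> g \<in> Hom C Y Z \<Longrightarrow> g' \<in> Hom C Y Z \<Longrightarrow>
      Comp C (Plus C g g') f = Plus C (Comp C g f) (Comp C g' f)"

text \<open>
  \<open>X\<close> is the direct sum (biproduct) of \<open>Y 0, \<dots>, Y (n - 1)\<close>, with inclusions \<open>i\<close> and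
  projections \<open>p\<close>. The \<open>finprod\<close> is the sum of the \<open>i k \<circ> p k\<close>, since \<open>hom_grp\<close> is written
  multiplicatively. For \<open>n = 0\<close> it says that \<open>X\<close> is a zero object.
\<close>

definition direct_sum ::
  "('o, 'm) cat \<Rightarrow> 'o \<Rightarrow> nat \<Rightarrow> (nat \<Rightarrow> 'o) \<Rightarrow> (nat \<Rightarrow> 'm) \<Rightarrow> (nat \<Rightarrow> 'm) \<Rightarrow> bool" where
  "direct_sum C X n Y i p \<longleftrightarrow>
     X \<in> Obj C \<and>
     (\<forall>k<n. Y k \<in> Obj C \<and> i k \<in> Hom C (Y k) X \<and> p k \<in> Hom C X (Y k)) \<and>
     (\<forall>k<n. \<forall>l<n. Comp C (p l) (i k) = (if k = l then Idn C (Y k) else Zero C (Y k) (Y l))) \<and>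
     finprod (hom_grp C X X) (\<lambda>k. Comp C (i k) (p k)) {..<n} = Idn C X"

locale additive_category = preadditive_category C for C :: "('o, 'm) cat" +
  assumes direct_sums_exist: "(\<forall>k<n. Y k \<in> Obj C) \<Longrightarrow> \<exists>X i p. direct_sum C X n Y i p"

definition local_ring :: "('a, 'b) ring_scheme \<Rightarrow> bool" where
  "local_ring R \<longleftrightarrow> ring R \<and> \<one>\<^bsub>R\<^esub> \<noteq> \<zero>\<^bsub>R\<^esub> \<and>
     (\<forall>x\<in>carrier R. \<forall>y\<in>carrier R. x \<notin> Units R \<longrightarrow> y \<notin> Units R \<longrightarrow> x \<oplus>\<^bsub>R\<^esub> y \<notin> Units R)"

definition Krull_Schmidt :: "('o, 'm) cat \<Rightarrow> bool" where
  "Krull_Schmidt C \<longleftrightarrow> additive_category C \<and>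
     (\<forall>X\<in>Obj C. \<exists>n Y i p. direct_sum C X n Y i p \<and> (\<forall>k<n. local_ring (End_ring C (Y k))))"

section \<open>Categorical notions\<close>

definition iso_mor :: "('o, 'm) cat \<Rightarrow> 'm \<Rightarrow> bool" where
  "iso_mor C f \<longleftrightarrow> f \<in> Mor C \<and>
     (\<exists>g\<in>Hom C (Cod C f) (Dom C f). Comp C g f = Idn C (Dom C f) \<and> Comp C f g = Idn C (Cod C f))"

definition iso_obj :: "('o, 'm) cat \<Rightarrow> 'o \<Rightarrow> 'o \<Rightarrow> bool" where
  "iso_obj C X Y \<longleftrightarrow> (\<exists>f\<in>Hom C X Y. iso_mor C f)"

definition mono_mor :: "('o, 'm) cat \<Rightarrow> 'm \<Rightarrow> bool" where
  "mono_mor C f \<longleftrightarrow> f \<in> Mor C \<and>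
     (\<forall>W\<in>Obj C. \<forall>g\<in>Hom C W (Dom C f). \<forall>h\<in>Hom C W (Dom C f). Comp C f g = Comp C f h \<longrightarrow> g = h)"

definition zero_obj :: "('o, 'm) cat \<Rightarrow> 'o \<Rightarrow> bool" where
  "zero_obj C X \<longleftrightarrow> X \<in> Obj C \<and> (\<forall>Y\<in>Obj C. (\<exists>!f. f \<in> Hom C X Y) \<and> (\<exists>!f. f \<in> Hom C Y X))"

definition is_kernel :: "('o, 'm) cat \<Rightarrow> 'm \<Rightarrow> 'm \<Rightarrow> bool" where
  "is_kernel C f g \<longleftrightarrow> f \<in> Mor C \<and> g \<in> Mor C \<and> Cod C f = Dom C g \<and>
     Comp C g f = Zero C (Dom C f) (Cod C g) \<and>
     (\<forall>W\<in>Obj C. \<forall>h\<in>Hom C W (Dom C g). Comp C g h = Zero C W (Cod C g) \<longrightarrow>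
        (\<exists>!u. u \<in> Hom C W (Dom C f) \<and> Comp C f u = h))"

definition is_cokernel :: "('o, 'm) cat \<Rightarrow> 'm \<Rightarrow> 'm \<Rightarrow> bool" where
  "is_cokernel C g f \<longleftrightarrow> f \<in> Mor C \<and> g \<in> Mor C \<and> Cod C f = Dom C g \<and>
     Comp C g f = Zero C (Dom C f) (Cod C g) \<and>
     (\<forall>W\<in>Obj C. \<forall>h\<in>Hom C (Cod C f) W. Comp C h f = Zero C (Dom C f) W \<longrightarrow>
        (\<exists>!u. u \<in> Hom C (Cod C g) W \<and> Comp C u g = h))"

definition ker_coker_pair :: "('o, 'm) cat \<Rightarrow> 'm \<Rightarrow> 'm \<Rightarrow> bool" where
  "ker_coker_pair C f g \<longleftrightarrow> is_kernel C f g \<and> is_cokernel C g f"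

text \<open>
  \<open>is_pushout C f a f' a'\<close>: for \<open>f : X \<rightarrow> Y\<close> and \<open>a : X \<rightarrow> X'\<close>, the maps \<open>f' : X' \<rightarrow> Y'\<close> and
  \<open>a' : Y \<rightarrow> Y'\<close> form a push-out; \<open>f'\<close> is the push-out of \<open>f\<close> along \<open>a\<close>.
\<close>

definition is_pushout :: "('o, 'm) cat \<Rightarrow> 'm \<Rightarrow> 'm \<Rightarrow> 'm \<Rightarrow> 'm \<Rightarrow> bool" where
  "is_pushout C f a f' a' \<longleftrightarrow> f \<in> Mor C \<and> a \<in> Mor C \<and> f' \<in> Mor C \<and> a' \<in> Mor C \<and>
     Dom C f = Dom C a \<and> Dom C f' = Cod C a \<and> Dom C a' = Cod C f \<and> Cod C f' = Cod C a' \<and>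
     Comp C f' a = Comp C a' f \<and>
     (\<forall>W\<in>Obj C. \<forall>s\<in>Hom C (Cod C a) W. \<forall>t\<in>Hom C (Cod C f) W. Comp C s a = Comp C t f \<longrightarrow>
        (\<exists>!u. u \<in> Hom C (Cod C f') W \<and> Comp C u f' = s \<and> Comp C u a' = t))"

text \<open>
  \<open>is_pullback C g c g' c'\<close>: for \<open>g : Y \<rightarrow> Z\<close> and \<open>c : Z' \<rightarrow> Z\<close>, the maps \<open>g' : Y' \<rightarrow> Z'\<close> and
  \<open>c' : Y' \<rightarrow> Y\<close> form a pull-back; \<open>g'\<close> is the pull-back of \<open>g\<close> along \<open>c\<close>.
\<close>

definition is_pullback :: "('o, 'm) cat \<Rightarrow> 'm \<Rightarrow> 'm \<Rightarrow> 'm \<Rightarrow> 'm \<Rightarrow> bool" where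
  "is_pullback C g c g' c' \<longleftrightarrow> g \<in> Mor C \<and> c \<in> Mor C \<and> g' \<in> Mor C \<and> c' \<in> Mor C \<and>
     Cod C g = Cod C c \<and> Cod C g' = Dom C c \<and> Cod C c' = Dom C g \<and> Dom C g' = Dom C c' \<and>
     Comp C c g' = Comp C g c' \<and>
     (\<forall>W\<in>Obj C. \<forall>s\<in>Hom C W (Dom C c). \<forall>t\<in>Hom C W (Dom C g). Comp C c s = Comp C g t \<longrightarrow>
        (\<exists>!u. u \<in> Hom C W (Dom C g') \<and> Comp C g' u = s \<and> Comp C c' u = t))"

definition full_subcategory :: "('o, 'm) cat \<Rightarrow> 'o set \<Rightarrow> ('o, 'm) cat" where
  "full_subcategory C S =
     C\<lparr>Obj := Obj C \<inter> S, Mor := {f \<in> Mor C. Dom C f \<in> S \<and> Cod C f \<in> S}\<rparr>"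

text \<open>
  The next two notions are meant for abelian categories. There, \<open>finite_length C M\<close> says that \<open>M\<close>
  has a composition series in \<open>C\<close>: a finite filtration starting at zero whose successive
  quotients, formed in \<open>C\<close>, are simple objects of \<open>C\<close>.
\<close>

definition simple_obj :: "('o, 'm) cat \<Rightarrow> 'o \<Rightarrow> bool" where
  "simple_obj C X \<longleftrightarrow> X \<in> Obj C \<and> \<not> zero_obj C X \<and>
     (\<forall>f. mono_mor C f \<and> Cod C f = X \<longrightarrow> zero_obj C (Dom C f) \<or> iso_mor C f)"

inductive finite_length :: "('o, 'm) cat \<Rightarrow> 'o \<Rightarrow> bool" for C :: "('o, 'm) cat" where
  zero: "zero_obj C M \<Longrightarrow> finite_length C M"
| extension: "ker_coker_pair C f g \<Longrightarrow> finite_length C (Dom C f) \<Longrightarrow> simple_obj C (Cod C g) \<Longrightarrow>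
    finite_length C (Cod C f)"

section \<open>Exact structures\<close>

definition inflations :: "('m \<times> 'm) set \<Rightarrow> 'm set" where
  "inflations E = {f. \<exists>g. (f, g) \<in> E}"

definition deflations :: "('m \<times> 'm) set \<Rightarrow> 'm set" where
  "deflations E = {g. \<exists>f. (f, g) \<in> E}"

definition pair_iso :: "('o, 'm) cat \<Rightarrow> 'm \<times> 'm \<Rightarrow> 'm \<times> 'm \<Rightarrow> bool" where
  "pair_iso C = (\<lambda>(f, g) (f', g').
     f' \<in> Mor C \<and> g' \<in> Mor C \<and> Cod C f' = Dom C g' \<and>
     (\<exists>a\<in>Hom C (Dom C f) (Dom C f'). \<exists>b\<in>Hom C (Cod C f) (Cod C f'). \<exists>c\<in>Hom C (Cod C g) (Cod C g').
        iso_mor C a \<and> iso_mor C b \<and> iso_mor C c \<and>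
        Comp C b f = Comp C f' a \<and> Comp C c g = Comp C g' b))"

definition exact_structure :: "('o, 'm) cat \<Rightarrow> ('m \<times> 'm) set \<Rightarrow> bool" where
  "exact_structure C E \<longleftrightarrow>
     (\<forall>(f, g)\<in>E. ker_coker_pair C f g) \<and>
     (\<forall>d\<in>E. \<forall>d'. pair_iso C d d' \<longrightarrow> d' \<in> E) \<and>
     (\<forall>X\<in>Obj C. Idn C X \<in> inflations E \<and> Idn C X \<in> deflations E) \<and>
     (\<forall>f\<in>inflations E. \<forall>f'\<in>inflations E. Cod C f = Dom C f' \<longrightarrow> Comp C f' f \<in> inflations E) \<and>
     (\<forall>g\<in>deflations E. \<forall>g'\<in>deflations E. Cod C g = Dom C g' \<longrightarrow> Comp C g' g \<in> deflations E) \<and>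
     (\<forall>f\<in>inflations E. \<forall>a\<in>Mor C. Dom C a = Dom C f \<longrightarrow>
        (\<exists>f' a'. is_pushout C f a f' a' \<and> f' \<in> inflations E)) \<and>
     (\<forall>g\<in>deflations E. \<forall>c\<in>Mor C. Cod C c = Cod C g \<longrightarrow>
        (\<exists>g' c'. is_pullback C g c g' c' \<and> g' \<in> deflations E))"

definition max_exact_structure :: "('o, 'm) cat \<Rightarrow> ('m \<times> 'm) set" where
  "max_exact_structure C = (GREATEST E. exact_structure C E)"

section \<open>The module category\<close>

text \<open>
  A module over \<open>A\<close> is an additive functor from the opposite of \<open>A\<close> to abelian groups; for
  \<open>u : X \<rightarrow> Y\<close>, the action \<open>Fmap F u\<close> goes from \<open>Fobj F Y\<close> to \<open>Fobj F X\<close>. The groups have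
  elements in a type \<open>'e\<close>. Two modules may agree on objects and arrows of \<open>A\<close> and on elements of
  their carriers without being equal as records; they are then isomorphic in \<open>Mod_cat A\<close>.
\<close>

record ('o, 'm, 'e) modul =
  Fobj :: "'o \<Rightarrow> 'e monoid"
  Fmap :: "'m \<Rightarrow> 'e \<Rightarrow> 'e"

definition is_module :: "('o, 'm) cat \<Rightarrow> ('o, 'm, 'e) modul \<Rightarrow> bool" where
  "is_module A F \<longleftrightarrow>
     (\<forall>X\<in>Obj A. comm_group (Fobj F X)) \<and>
     (\<forall>X\<in>Obj A. \<forall>Y\<in>Obj A. \<forall>u\<in>Hom A X Y. Fmap F u \<in> hom (Fobj F Y) (Fobj F X)) \<and>
     (\<forall>X\<in>Obj A. \<forall>x\<in>carrier (Fobj F X). Fmap F (Idn A X) x = x) \<and>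
     (\<forall>X\<in>Obj A. \<forall>Y\<in>Obj A. \<forall>Z\<in>Obj A. \<forall>u\<in>Hom A X Y. \<forall>v\<in>Hom A Y Z. \<forall>x\<in>carrier (Fobj F Z).
        Fmap F (Comp A v u) x = Fmap F u (Fmap F v x)) \<and>
     (\<forall>X\<in>Obj A. \<forall>Y\<in>Obj A. \<forall>u\<in>Hom A X Y. \<forall>v\<in>Hom A X Y. \<forall>x\<in>carrier (Fobj F Y).
        Fmap F (Plus A u v) x = Fmap F u x \<otimes>\<^bsub>Fobj F X\<^esub> Fmap F v x)"

record ('o, 'm, 'e) nat_trans =
  Ndom :: "('o, 'm, 'e) modul"
  Ncod :: "('o, 'm, 'e) modul"
  Ncomp :: "'o \<Rightarrow> 'e \<Rightarrow> 'e"

text \<open>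
  Components are functions with value \<open>undefined\<close> outside of the objects of \<open>A\<close> and outside of
  the carriers, so that equality of natural transformations is the usual one.
\<close>

definition is_nat_trans :: "('o, 'm) cat \<Rightarrow> ('o, 'm, 'e) nat_trans \<Rightarrow> bool" where
  "is_nat_trans A \<eta> \<longleftrightarrow> is_module A (Ndom \<eta>) \<and> is_module A (Ncod \<eta>) \<and>
     Ncomp \<eta> \<in> extensional (Obj A) \<and>
     (\<forall>X\<in>Obj A. Ncomp \<eta> X \<in> extensional (carrier (Fobj (Ndom \<eta>) X)) \<and>
        Ncomp \<eta> X \<in> hom (Fobj (Ndom \<eta>) X) (Fobj (Ncod \<eta>) X)) \<and>
     (\<forall>X\<in>Obj A. \<forall>Y\<in>Obj A. \<forall>u\<in>Hom A X Y. \<forall>x\<in>carrier (Fobj (Ndom \<eta>) Y).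
        Ncomp \<eta> X (Fmap (Ndom \<eta>) u x) = Fmap (Ncod \<eta>) u (Ncomp \<eta> Y x))"

definition Mod_cat ::
  "('o, 'm) cat \<Rightarrow> (('o, 'm, 'e) modul, ('o, 'm, 'e) nat_trans) cat" where
  "Mod_cat A = \<lparr>
     Obj = {F. is_module A F},
     Mor = {\<eta>. is_nat_trans A \<eta>},
     Dom = Ndom,
     Cod = Ncod,
     Idn = (\<lambda>F. \<lparr>Ndom = F, Ncod = F, Ncomp = (\<lambda>X\<in>Obj A. \<lambda>x\<in>carrier (Fobj F X). x)\<rparr>),
     Comp = (\<lambda>\<eta> \<theta>. \<lparr>Ndom = Ndom \<theta>, Ncod = Ncod \<eta>,
       Ncomp = (\<lambda>X\<in>Obj A. \<lambda>x\<in>carrier (Fobj (Ndom \<theta>) X). Ncomp \<eta> X (Ncomp \<theta> X x))\<rparr>),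
     Plus = (\<lambda>\<eta> \<theta>. \<lparr>Ndom = Ndom \<eta>, Ncod = Ncod \<eta>,
       Ncomp = (\<lambda>X\<in>Obj A. \<lambda>x\<in>carrier (Fobj (Ndom \<eta>) X).
         Ncomp \<eta> X x \<otimes>\<^bsub>Fobj (Ncod \<eta>) X\<^esub> Ncomp \<theta> X x)\<rparr>),
     Zero = (\<lambda>F G. \<lparr>Ndom = F, Ncod = G,
       Ncomp = (\<lambda>X\<in>Obj A. \<lambda>x\<in>carrier (Fobj F X). \<one>\<^bsub>Fobj G X\<^esub>)\<rparr>)\<rparr>"

definition rep_mod :: "('o, 'm) cat \<Rightarrow> 'o \<Rightarrow> ('o, 'm, 'm) modul" where
  "rep_mod A Z = \<lparr>Fobj = (\<lambda>X. hom_grp A X Z), Fmap = (\<lambda>u h. Comp A h u)\<rparr>"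

definition rep_trans :: "('o, 'm) cat \<Rightarrow> 'm \<Rightarrow> ('o, 'm, 'm) nat_trans" where
  "rep_trans A g = \<lparr>Ndom = rep_mod A (Dom A g), Ncod = rep_mod A (Cod A g),
     Ncomp = (\<lambda>X\<in>Obj A. \<lambda>h\<in>Hom A X (Dom A g). Comp A g h)\<rparr>"

text \<open>
  The cokernel of a natural transformation, formed objectwise. Elements are cosets of the image;
  \<open>u : X \<rightarrow> Y\<close> sends the coset of \<open>k\<close> to the coset of \<open>Fmap (Ncod \<eta>) u k\<close>, which is
  expressed as a union (of equal sets) over all representatives \<open>k\<close>.
\<close>

definition img :: "('o, 'm, 'e) nat_trans \<Rightarrow> 'o \<Rightarrow> 'e set" where
  "img \<eta> X = Ncomp \<eta> X ` carrier (Fobj (Ndom \<eta>) X)"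

definition Coker :: "('o, 'm) cat \<Rightarrow> ('o, 'm, 'e) nat_trans \<Rightarrow> ('o, 'm, 'e set) modul" where
  "Coker A \<eta> = \<lparr>
     Fobj = (\<lambda>X. Fobj (Ncod \<eta>) X Mod img \<eta> X),
     Fmap = (\<lambda>u K. \<Union>k\<in>K. img \<eta> (Dom A u) #>\<^bsub>Fobj (Ncod \<eta>) (Dom A u)\<^esub> Fmap (Ncod \<eta>) u k)\<rparr>"

section \<open>Defects and admissible exact structures\<close>

definition defect :: "('o, 'm) cat \<Rightarrow> 'm \<times> 'm \<Rightarrow> ('o, 'm, 'm set) modul" where
  "defect A \<delta> = Coker A (rep_trans A (snd \<delta>))"

text \<open>
  Defects have elements in \<open>'m set\<close>, so every module isomorphic to a defect has an isomorphic
  copy with elements in \<open>'m set\<close>; this is why modules with elements in this type suffice here.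
\<close>

definition eff ::
  "('o, 'm) cat \<Rightarrow> ('m \<times> 'm) set \<Rightarrow> (('o, 'm, 'm set) modul, ('o, 'm, 'm set) nat_trans) cat" where
  "eff A E = full_subcategory (Mod_cat A) {M. \<exists>\<delta>\<in>E. iso_obj (Mod_cat A) M (defect A \<delta>)}"

definition admissible :: "('o, 'm) cat \<Rightarrow> ('m \<times> 'm) set \<Rightarrow> bool" where
  "admissible A E \<longleftrightarrow> exact_structure A E \<and> (\<forall>M\<in>Obj (eff A E). finite_length (eff A E) M)"

definition maximal_admissible :: "('o, 'm) cat \<Rightarrow> ('m \<times> 'm) set \<Rightarrow> bool" where
  "maximal_admissible A E \<longleftrightarrow> admissible A E \<and> (\<forall>E'. admissible A E' \<longrightarrow> E \<subseteq> E' \<longrightarrow> E' = E)"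

end

theory Submission
  imports Defs
begin

text \<open>
  A deflation \<open>g : B \<rightarrow> X\<close> generates a sieve on \<open>X\<close>, the set of all arrows \<open>g x\<close>, and its defect is
  the quotient of the representable functor of \<open>X\<close> by this sieve. The proof replaces defects by
  sieves. For an exact structure \<open>E\<close>, the sieves generated by deflations of \<open>E\<close> are stable under
  pull-back, sums and intersections, so those on a fixed object form a modular lattice. This lattice
  is linked to the theorem by two facts.

  First, the quotient by a sieve \<open>S\<close> has finite length in \<open>eff E\<close> if and only if there is a bound on
  the length of chains of sieves of \<open>E\<close> from \<open>S\<close> up to the sieve of all arrows
  (\<open>finite_length_iff_bounded\<close>). Indeed the subobjects of the quotient are the quotients \<open>T / S\<close> for
  sieves \<open>T\<close> of \<open>E\<close> above \<open>S\<close>: if \<open>T\<close> is generated by \<open>h\<close>, then \<open>T / S\<close> is the quotient by the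
  preimage of \<open>S\<close> under \<open>h\<close>, again a sieve of \<open>E\<close>. Kernels of maps of defects are defects
  for the same reason, so monomorphisms of \<open>eff E\<close> are injective.

  Second, if \<open>h\<close> has a kernel and generates a sieve that contains a sieve of \<open>E\<close>, then \<open>h\<close> is a
  deflation of \<open>E\<close>. This is the obscure axiom (\<open>pairI_left_factor\<close>). It has two consequences: \<open>E\<close> is
  determined by its sieves, hence by \<open>eff E\<close>; and a larger exact structure has the same sieves as
  \<open>E\<close> above a sieve of \<open>E\<close>, so that it gives the same bounded chains (\<open>bounded_sub\<close>).

  For an exact structure \<open>E\<close>, consider the conflations in \<open>E\<close> whose sieves have bounded chains above
  them. Boundedness passes to pull-backs, to larger sieves, and to extensions by the modular law,
  and this is what the axioms of an exact structure require (\<open>exact_fin_pairs\<close>). If \<open>E\<close> is the greatest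
  exact structure, the conflations so obtained form an admissible exact structure which
  contains every admissible one, and its defects are the defects of \<open>E\<close> of finite length.

  The greatest exact structure consists of the kernel-cokernel pairs \<open>(f, g)\<close> such that all
  pull-backs of \<open>g\<close> exist and are cokernels, and all push-outs of \<open>f\<close> exist and are kernels. This is an
  exact structure if split epimorphisms have kernels (\<open>exact_stable_pairs\<close>). In a Krull-Schmidt
  category they do: a split epimorphism onto an object with local endomorphism ring is an
  isomorphism on some direct summand, and the general case follows by splitting off one summand of
  the target after the other.
\<close>

section \<open>Calculus of arrows in preadditive categories\<close>

lemma Hom_iff [simp]: "f \<in> Hom C X Y \<longleftrightarrow> f \<in> Mor C \<and> Dom C f = X \<and> Cod C f = Y"
  by (auto simp: Hom_def)

context category
begin

abbreviation cmp (infixr "\<cdot>" 75) where "g \<cdot> f \<equiv> Comp C g f"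

lemma comp_Mor [simp]:
  assumes "f \<in> Mor C" "g \<in> Mor C" "Cod C f = Dom C g"
  shows "g \<cdot> f \<in> Mor C" "Dom C (g \<cdot> f) = Dom C f" "Cod C (g \<cdot> f) = Cod C g"
  using Comp_Hom[of f "Dom C f" "Cod C f" g "Cod C g"] assms by auto

lemma Idn_Mor [simp]:
  assumes "X \<in> Obj C"
  shows "Idn C X \<in> Mor C" "Dom C (Idn C X) = X" "Cod C (Idn C X) = X"
  using Idn_Hom[of X] assms by auto

lemma comp_Idn [simp]:
  assumes "f \<in> Mor C"
  shows "Dom C f = X \<Longrightarrow> f \<cdot> Idn C X = f" "Cod C f = Y \<Longrightarrow> Idn C Y \<cdot> f = f"
  using Comp_Idn_left[of f] Comp_Idn_right[of f] assms by auto

lemma comp_assoc [simp]: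
  assumes "f \<in> Mor C" "g \<in> Mor C" "h \<in> Mor C" "Cod C f = Dom C g" "Cod C g = Dom C h"
  shows "(h \<cdot> g) \<cdot> f = h \<cdot> g \<cdot> f"
  using Comp_assoc[of f "Dom C f" "Cod C f" g "Cod C g" h "Cod C h"] assms by auto

lemma reassoc:
  assumes "h \<cdot> g = k" "g \<in> Mor C" "h \<in> Mor C" "Cod C g = Dom C h"
    "f \<in> Mor C" "Cod C f = Dom C g"
  shows "h \<cdot> g \<cdot> f = k \<cdot> f"
  using assms comp_assoc by metis

lemma Obj_ends [simp]:
  assumes "f \<in> Mor C" shows "Dom C f \<in> Obj C" "Cod C f \<in> Obj C"
  using Dom_Obj Cod_Obj assms by auto

end

context preadditive_category
begin

abbreviation add (infixl "\<^bold>+" 65) where "f \<^bold>+ g \<equiv> Plus C f g"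

definition neg where "neg f = inv\<^bsub>hom_grp C (Dom C f) (Cod C f)\<^esub> f"

lemma hom_grp_simps [simp]:
  "carrier (hom_grp C X Y) = Hom C X Y" "mult (hom_grp C X Y) = Plus C"
  "one (hom_grp C X Y) = Zero C X Y"
  by (auto simp: hom_grp_def)

lemma grp: "f \<in> Mor C \<Longrightarrow> comm_group (hom_grp C (Dom C f) (Cod C f))"
  using comm_group_hom_grp by simp

lemma add_Mor [simp]:
  assumes "f \<in> Mor C" "g \<in> Mor C" "Dom C f = Dom C g" "Cod C f = Cod C g"
  shows "f \<^bold>+ g \<in> Mor C" "Dom C (f \<^bold>+ g) = Dom C f" "Cod C (f \<^bold>+ g) = Cod C f"
proof -
  interpret G: comm_group "hom_grp C (Dom C g) (Cod C g)" using grp assms by blast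
  show "f \<^bold>+ g \<in> Mor C" "Dom C (f \<^bold>+ g) = Dom C f" "Cod C (f \<^bold>+ g) = Cod C f"
    using G.m_closed[of f g] assms by auto
qed

lemma Zero_Mor [simp]:
  assumes "X \<in> Obj C" "Y \<in> Obj C"
  shows "Zero C X Y \<in> Mor C" "Dom C (Zero C X Y) = X" "Cod C (Zero C X Y) = Y"
proof -
  interpret G: comm_group "hom_grp C X Y" using comm_group_hom_grp assms by blast
  show "Zero C X Y \<in> Mor C" "Dom C (Zero C X Y) = X" "Cod C (Zero C X Y) = Y"
    using G.one_closed by auto
qed

lemma neg_Mor [simp]:
  assumes "f \<in> Mor C"
  shows "neg f \<in> Mor C" "Dom C (neg f) = Dom C f" "Cod C (neg f) = Cod C f"
proof -
  interpret G: comm_group "hom_grp C (Dom C f) (Cod C f)" using grp assms by blast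
  show "neg f \<in> Mor C" "Dom C (neg f) = Dom C f" "Cod C (neg f) = Cod C f"
    using G.inv_closed[of f] assms by (auto simp: neg_def)
qed

lemma add_assoc:
  assumes "f \<in> Mor C" "g \<in> Mor C" "h \<in> Mor C" "Dom C f = Dom C g" "Cod C f = Cod C g"
    "Dom C g = Dom C h" "Cod C g = Cod C h"
  shows "(f \<^bold>+ g) \<^bold>+ h = f \<^bold>+ (g \<^bold>+ h)"
proof -
  interpret G: comm_group "hom_grp C (Dom C h) (Cod C h)" using grp assms by blast
  show ?thesis using G.m_assoc[of f g h] assms by auto
qed

lemma add_comm:
  assumes "f \<in> Mor C" "g \<in> Mor C" "Dom C f = Dom C g" "Cod C f = Cod C g"
  shows "f \<^bold>+ g = g \<^bold>+ f"
proof -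
  interpret G: comm_group "hom_grp C (Dom C g) (Cod C g)" using grp assms by blast
  show ?thesis using G.m_comm[of f g] assms by auto
qed

lemma add_lcomm:
  assumes "f \<in> Mor C" "g \<in> Mor C" "h \<in> Mor C" "Dom C f = Dom C g" "Cod C f = Cod C g"
    "Dom C g = Dom C h" "Cod C g = Cod C h"
  shows "f \<^bold>+ (g \<^bold>+ h) = g \<^bold>+ (f \<^bold>+ h)"
proof -
  interpret G: comm_group "hom_grp C (Dom C h) (Cod C h)" using grp assms by blast
  show ?thesis using G.m_lcomm[of f g h] assms by auto
qed

lemmas add_ac = add_assoc add_comm add_lcomm

lemma add_Zero [simp]:
  assumes "f \<in> Mor C" "Dom C f = X" "Cod C f = Y"
  shows "f \<^bold>+ Zero C X Y = f" "Zero C X Y \<^bold>+ f = f"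
proof -
  interpret G: comm_group "hom_grp C X Y" using grp assms by blast
  show "f \<^bold>+ Zero C X Y = f" "Zero C X Y \<^bold>+ f = f"
    using G.r_one[of f] G.l_one[of f] assms by auto
qed

lemma add_neg [simp]:
  assumes "f \<in> Mor C"
  shows "f \<^bold>+ neg f = Zero C (Dom C f) (Cod C f)" "neg f \<^bold>+ f = Zero C (Dom C f) (Cod C f)"
proof -
  interpret G: comm_group "hom_grp C (Dom C f) (Cod C f)" using grp assms by blast
  show "f \<^bold>+ neg f = Zero C (Dom C f) (Cod C f)" "neg f \<^bold>+ f = Zero C (Dom C f) (Cod C f)"
    using G.r_inv[of f] G.l_inv[of f] assms by (auto simp: neg_def)
qed

lemma add_neg_cancel [simp]:
  assumes "f \<in> Mor C" "g \<in> Mor C" "Dom C f = Dom C g" "Cod C f = Cod C g"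
  shows "f \<^bold>+ (neg f \<^bold>+ g) = g" "neg f \<^bold>+ (f \<^bold>+ g) = g"
    "g \<^bold>+ f \<^bold>+ neg f = g" "g \<^bold>+ neg f \<^bold>+ f = g"
  using assms add_assoc[of f "neg f" g] add_assoc[of "neg f" f g]
  by (simp_all add: add_assoc)

lemma add_left_cancel:
  assumes "f \<^bold>+ g = f \<^bold>+ h" "f \<in> Mor C" "g \<in> Mor C" "h \<in> Mor C" "Dom C f = Dom C g"
    "Cod C f = Cod C g" "Dom C f = Dom C h" "Cod C f = Cod C h"
  shows "g = h"
  using assms add_neg_cancel(2) by metis

lemma neg_unique:
  assumes "f \<^bold>+ g = Zero C (Dom C f) (Cod C f)" "f \<in> Mor C" "g \<in> Mor C" "Dom C f = Dom C g"
    "Cod C f = Cod C g"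
  shows "g = neg f"
  using assms by (intro add_left_cancel[of f g "neg f"]) auto

lemma neg_add [simp]:
  assumes "f \<in> Mor C" "g \<in> Mor C" "Dom C f = Dom C g" "Cod C f = Cod C g"
  shows "neg (f \<^bold>+ g) = neg f \<^bold>+ neg g"
  using assms by (intro neg_unique[symmetric]) (simp_all add: add_ac)

lemma comp_add [simp]:
  assumes "f \<in> Mor C" "f' \<in> Mor C" "g \<in> Mor C" "Dom C f = Dom C f'" "Cod C f = Cod C f'"
    "Cod C f' = Dom C g"
  shows "g \<cdot> (f \<^bold>+ f') = g \<cdot> f \<^bold>+ g \<cdot> f'"
  using Comp_Plus_right[of f "Dom C f'" "Dom C g" f' g "Cod C g"] assms by auto

lemma add_comp [simp]:
  assumes "g \<in> Mor C" "g' \<in> Mor C" "f \<in> Mor C" "Dom C g = Dom C g'" "Cod C g = Cod C g'"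
    "Cod C f = Dom C g'"
  shows "(g \<^bold>+ g') \<cdot> f = g \<cdot> f \<^bold>+ g' \<cdot> f"
  using Comp_Plus_left[of f "Dom C f" "Dom C g'" g "Cod C g'" g'] assms by auto

lemma add_self_Zero:
  assumes "f \<^bold>+ f = f" "f \<in> Mor C"
  shows "f = Zero C (Dom C f) (Cod C f)"
  using assms by (intro add_left_cancel[of f f]) auto

lemma comp_Zero [simp]:
  assumes "g \<in> Mor C"
  shows "X \<in> Obj C \<Longrightarrow> Dom C g = Y \<Longrightarrow> g \<cdot> Zero C X Y = Zero C X (Cod C g)"
    "Z \<in> Obj C \<Longrightarrow> Cod C g = Y \<Longrightarrow> Zero C Y Z \<cdot> g = Zero C (Dom C g) Z"
proof -
  assume X: "X \<in> Obj C" "Dom C g = Y"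
  then have Y: "Y \<in> Obj C" using assms by auto
  have "g \<cdot> Zero C X Y \<^bold>+ g \<cdot> Zero C X Y = g \<cdot> (Zero C X Y \<^bold>+ Zero C X Y)"
    using X Y assms by (subst comp_add) simp_all
  then show "g \<cdot> Zero C X Y = Zero C X (Cod C g)"
    using add_self_Zero[of "g \<cdot> Zero C X Y"] X Y assms by simp
next
  assume X: "Z \<in> Obj C" "Cod C g = Y"
  then have Y: "Y \<in> Obj C" using assms by auto
  have "Zero C Y Z \<cdot> g \<^bold>+ Zero C Y Z \<cdot> g = (Zero C Y Z \<^bold>+ Zero C Y Z) \<cdot> g"
    using X Y assms by (subst add_comp) simp_all
  then show "Zero C Y Z \<cdot> g = Zero C (Dom C g) Z"
    using add_self_Zero[of "Zero C Y Z \<cdot> g"] X Y assms by simp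
qed

lemma comp_neg [simp]:
  assumes "f \<in> Mor C" "g \<in> Mor C" "Cod C f = Dom C g"
  shows "g \<cdot> neg f = neg (g \<cdot> f)" "neg g \<cdot> f = neg (g \<cdot> f)"
proof -
  have "g \<cdot> f \<^bold>+ g \<cdot> neg f = g \<cdot> (f \<^bold>+ neg f)" using assms by (subst comp_add) simp_all
  then show "g \<cdot> neg f = neg (g \<cdot> f)" using assms by (intro neg_unique) simp_all
  have "g \<cdot> f \<^bold>+ neg g \<cdot> f = (g \<^bold>+ neg g) \<cdot> f" using assms by (subst add_comp) simp_all
  then show "neg g \<cdot> f = neg (g \<cdot> f)" using assms by (intro neg_unique) simp_all
qed

lemma neg_Zero [simp]:
  assumes "X \<in> Obj C" "Y \<in> Obj C" shows "neg (Zero C X Y) = Zero C X Y"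
  using assms by (intro neg_unique[symmetric]) simp_all

end

section \<open>The opposite category\<close>

definition op_cat :: "('o, 'm) cat \<Rightarrow> ('o, 'm) cat" where
  "op_cat C = \<lparr>Obj = Obj C, Mor = Mor C, Dom = Cod C, Cod = Dom C, Idn = Idn C,
     Comp = (\<lambda>g f. Comp C f g), Plus = Plus C, Zero = (\<lambda>X Y. Zero C Y X)\<rparr>"

lemma op_cat_simps [simp]:
  "Obj (op_cat C) = Obj C" "Mor (op_cat C) = Mor C" "Dom (op_cat C) = Cod C"
  "Cod (op_cat C) = Dom C" "Idn (op_cat C) = Idn C" "Comp (op_cat C) g f = Comp C f g"
  "Plus (op_cat C) = Plus C" "Zero (op_cat C) X Y = Zero C Y X" "op_cat (op_cat C) = C"
  by (simp_all add: op_cat_def)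

lemma Hom_op [simp]: "Hom (op_cat C) X Y = Hom C Y X"
  by (auto simp: Hom_def)

lemma hom_grp_op [simp]: "hom_grp (op_cat C) X Y = hom_grp C Y X"
  by (auto simp: hom_grp_def)

lemma (in category) category_op: "category (op_cat C)"
  by unfold_locales auto

lemma (in preadditive_category) preadditive_op: "preadditive_category (op_cat C)"
  by (intro preadditive_category.intro preadditive_category_axioms.intro category_op)
    (simp_all add: comm_group_hom_grp)

lemma direct_sum_op [simp]:
  "direct_sum (op_cat C) X n Y i p \<longleftrightarrow> direct_sum C X n Y p i" (is "?L = ?R")
proof -
  have "(\<forall>k<n. \<forall>l<n. Comp C (i k) (p l) = (if k = l then Idn C (Y k) else Zero C (Y l) (Y k))) \<longleftrightarrow>
    (\<forall>k<n. \<forall>l<n. Comp C (i l) (p k) = (if k = l then Idn C (Y k) else Zero C (Y k) (Y l)))"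
    by (rule iffI; intro allI impI; metis)
  then show ?thesis unfolding direct_sum_def by auto
qed

lemma is_kernel_op [simp]: "is_kernel (op_cat C) f g \<longleftrightarrow> is_cokernel C f g"
  unfolding is_kernel_def is_cokernel_def by (auto simp del: Hom_iff)

lemma is_cokernel_op [simp]: "is_cokernel (op_cat C) f g \<longleftrightarrow> is_kernel C f g"
  unfolding is_kernel_def is_cokernel_def by (auto simp del: Hom_iff)

lemma ker_coker_pair_op [simp]: "ker_coker_pair (op_cat C) f g \<longleftrightarrow> ker_coker_pair C g f"
  by (auto simp: ker_coker_pair_def)

lemma is_pullback_op [simp]: "is_pullback (op_cat C) f a f' a' \<longleftrightarrow> is_pushout C f a f' a'"
  unfolding is_pullback_def is_pushout_def by (auto simp del: Hom_iff)

lemma iso_mor_op [simp]: "iso_mor (op_cat C) f \<longleftrightarrow> iso_mor C f"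
  by (auto simp: iso_mor_def)

section \<open>Isomorphisms, kernels and pull-backs\<close>

context category
begin

lemma iso_morE:
  assumes "iso_mor C f"
  obtains g where "f \<in> Mor C" "g \<in> Mor C" "Dom C g = Cod C f" "Cod C g = Dom C f"
    "g \<cdot> f = Idn C (Dom C f)" "f \<cdot> g = Idn C (Cod C f)"
  using assms by (auto simp: iso_mor_def)

lemma iso_morI:
  assumes "f \<in> Mor C" "g \<in> Mor C" "Dom C g = Cod C f" "Cod C g = Dom C f"
    "g \<cdot> f = Idn C (Dom C f)" "f \<cdot> g = Idn C (Cod C f)"
  shows "iso_mor C f"
  using assms by (auto simp: iso_mor_def)

lemma iso_Idn: "X \<in> Obj C \<Longrightarrow> iso_mor C (Idn C X)"
  by (rule iso_morI[of _ "Idn C X"]) simp_all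

lemma pullbackD:
  assumes "is_pullback C g c g' c'"
  shows "g \<in> Mor C" "c \<in> Mor C" "g' \<in> Mor C" "c' \<in> Mor C" "Cod C g = Cod C c"
    "Cod C g' = Dom C c" "Cod C c' = Dom C g" "Dom C g' = Dom C c'" "c \<cdot> g' = g \<cdot> c'"
  using assms by (auto simp: is_pullback_def)

lemma pullback_ex:
  assumes "is_pullback C g c g' c'" "s \<in> Mor C" "t \<in> Mor C" "Dom C s = Dom C t"
    "Cod C s = Dom C c" "Cod C t = Dom C g" "c \<cdot> s = g \<cdot> t"
  shows "\<exists>u. u \<in> Mor C \<and> Dom C u = Dom C t \<and> Cod C u = Dom C c' \<and> g' \<cdot> u = s \<and> c' \<cdot> u = t"
proof -
  have "\<exists>u. u \<in> Hom C (Dom C t) (Dom C g') \<and> g' \<cdot> u = s \<and> c' \<cdot> u = t"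
  proof -
    have "Dom C t \<in> Obj C" "s \<in> Hom C (Dom C t) (Dom C c)" "t \<in> Hom C (Dom C t) (Dom C g)"
      using assms by simp_all
    with assms(1,7) show ?thesis unfolding is_pullback_def by meson
  qed
  then show ?thesis using pullbackD(8)[OF assms(1)] by simp
qed

lemma pullback_joint_mono:
  assumes "is_pullback C g c g' c'" "x \<in> Mor C" "y \<in> Mor C" "Dom C x = Dom C y"
    "Cod C x = Dom C c'" "Cod C y = Dom C c'" "g' \<cdot> x = g' \<cdot> y" "c' \<cdot> x = c' \<cdot> y"
  shows "x = y"
proof -
  note D = pullbackD[OF assms(1)]
  have "c \<cdot> g' \<cdot> y = g \<cdot> c' \<cdot> y" using reassoc[OF D(9)] D assms by simp
  then have "\<exists>!u. u \<in> Hom C (Dom C y) (Dom C g') \<and> g' \<cdot> u = g' \<cdot> y \<and> c' \<cdot> u = c' \<cdot> y"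
    using assms D unfolding is_pullback_def by simp
  then show ?thesis using assms D by auto
qed

lemma pullbackI:
  assumes "g \<in> Mor C" "c \<in> Mor C" "g' \<in> Mor C" "c' \<in> Mor C" "Cod C g = Cod C c"
    "Cod C g' = Dom C c" "Cod C c' = Dom C g" "Dom C g' = Dom C c'" "c \<cdot> g' = g \<cdot> c'"
    and ex: "\<And>s t. s \<in> Mor C \<Longrightarrow> t \<in> Mor C \<Longrightarrow> Dom C s = Dom C t \<Longrightarrow> Cod C s = Dom C c \<Longrightarrow>
      Cod C t = Dom C g \<Longrightarrow> c \<cdot> s = g \<cdot> t \<Longrightarrow>
      \<exists>u. u \<in> Mor C \<and> Dom C u = Dom C t \<and> Cod C u = Dom C c' \<and> g' \<cdot> u = s \<and> c' \<cdot> u = t"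
    and un: "\<And>x y. x \<in> Mor C \<Longrightarrow> y \<in> Mor C \<Longrightarrow> Dom C x = Dom C y \<Longrightarrow> Cod C x = Dom C c' \<Longrightarrow>
      Cod C y = Dom C c' \<Longrightarrow> g' \<cdot> x = g' \<cdot> y \<Longrightarrow> c' \<cdot> x = c' \<cdot> y \<Longrightarrow> x = y"
  shows "is_pullback C g c g' c'"
proof -
  have "\<exists>!u. u \<in> Hom C W (Dom C g') \<and> g' \<cdot> u = s \<and> c' \<cdot> u = t"
    if st: "s \<in> Hom C W (Dom C c)" "t \<in> Hom C W (Dom C g)" "c \<cdot> s = g \<cdot> t" for W s t
  proof -
    have "\<exists>u. u \<in> Mor C \<and> Dom C u = Dom C t \<and> Cod C u = Dom C c' \<and> g'
      \<cdot> u = s \<and> c' \<cdot> u = t"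
      using ex[of s t] st by simp
    then obtain u where u: "u \<in> Mor C" "Dom C u = Dom C t" "Cod C u = Dom C c'" "g' \<cdot> u = s"
      "c' \<cdot> u = t" by blast
    show ?thesis
    proof (rule ex1I[of _ u])
      fix w assume "w \<in> Hom C W (Dom C g') \<and> g' \<cdot> w = s \<and> c' \<cdot> w = t"
      then show "w = u" using u st assms(8) by (intro un[of w u]) simp_all
    qed (use u st assms(8) in simp)
  qed
  then show ?thesis using assms(1-9) unfolding is_pullback_def by (simp del: Hom_iff)
qed

lemma pullback_paste:
  assumes p: "is_pullback C h c h' c'" and q: "is_pullback C g c' g' c''"
  shows "is_pullback C (h \<cdot> g) c (h' \<cdot> g') c''"
proof (rule pullbackI)
  note P = pullbackD[OF p] and Q = pullbackD[OF q]
  note [simp] = P(1-8) Q(1-8)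
  show "c \<cdot> (h' \<cdot> g') = (h \<cdot> g) \<cdot> c''" using reassoc[OF P(9)] Q(9) by simp
  show "\<exists>u. u \<in> Mor C \<and> Dom C u = Dom C t \<and> Cod C u = Dom C c'' \<and> (h' \<cdot> g') \<cdot> u = s \<and> c'' \<cdot> u = t"
    if st: "s \<in> Mor C" "t \<in> Mor C" "Dom C s = Dom C t" "Cod C s = Dom C c" "Cod C t = Dom C (h \<cdot> g)"
      "c \<cdot> s = (h \<cdot> g) \<cdot> t" for s t
  proof -
    have "\<exists>v. v \<in> Mor C \<and> Dom C v = Dom C t \<and> Cod C v = Dom C c' \<and> h'
      \<cdot> v = s \<and> c' \<cdot> v = g \<cdot> t"
      using pullback_ex[OF p, of s "g \<cdot> t"] st by simp
    then obtain v where v: "v \<in> Mor C" "Dom C v = Dom C t" "Cod C v = Dom C c'" "h' \<cdot> v = s" "c' \<cdot> v = g \<cdot> t" by blast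
    have "\<exists>u. u \<in> Mor C \<and> Dom C u = Dom C t \<and> Cod C u = Dom C c'' \<and> g'
      \<cdot> u = v \<and> c'' \<cdot> u = t"
      using pullback_ex[OF q, of v t] v st by simp
    then obtain u where "u \<in> Mor C" "Dom C u = Dom C t" "Cod C u = Dom C c''" "g' \<cdot> u = v" "c'' \<cdot> u = t" by blast
    then show ?thesis using v by auto
  qed
  show "x = y" if xy: "x \<in> Mor C" "y \<in> Mor C" "Dom C x = Dom C y" "Cod C x = Dom C c''"
    "Cod C y = Dom C c''" "(h' \<cdot> g') \<cdot> x = (h' \<cdot> g') \<cdot> y" "c'' \<cdot> x = c'' \<cdot> y" for x y
  proof -
    have "c' \<cdot> g' \<cdot> x = c' \<cdot> g' \<cdot> y" using xy by (simp add: reassoc[OF Q(9)])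
    then have "g' \<cdot> x = g' \<cdot> y" using xy by - (rule pullback_joint_mono[OF p], simp_all)
    then show ?thesis using xy by - (rule pullback_joint_mono[OF q], simp_all)
  qed
qed (use pullbackD[OF p] pullbackD[OF q] in simp_all)

lemma pullback_unique:
  assumes p: "is_pullback C g c g' c'" and q: "is_pullback C g c h' d'"
  obtains u where "iso_mor C u" "Dom C u = Dom C h'" "Cod C u = Dom C g'" "g' \<cdot> u = h'" "c' \<cdot> u = d'"
proof -
  note P = pullbackD[OF p] and Q = pullbackD[OF q]
  note [simp] = P(1-8) Q(1-8)
  obtain u where u: "u \<in> Mor C" "Dom C u = Dom C d'" "Cod C u = Dom C c'" "g' \<cdot> u = h'" "c' \<cdot> u = d'"
    using pullback_ex[OF p, of h' d'] P Q by metis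
  obtain v where v: "v \<in> Mor C" "Dom C v = Dom C c'" "Cod C v = Dom C d'" "h' \<cdot> v = g'" "d' \<cdot> v = c'"
    using pullback_ex[OF q, of g' c'] P Q by metis
  have "u \<cdot> v = Idn C (Dom C c')"
    using u v by - (rule pullback_joint_mono[OF p], simp_all add: reassoc[OF u(4)] reassoc[OF u(5)])
  moreover have "v \<cdot> u = Idn C (Dom C d')"
    using u v by - (rule pullback_joint_mono[OF q], simp_all add: reassoc[OF v(4)] reassoc[OF v(5)])
  ultimately show thesis using that[of u] iso_morI[of u v] u v by simp
qed

lemma iso_pullback:
  assumes "iso_mor C f" "c \<in> Mor C" "Cod C c = Cod C f"
  obtains c' where "is_pullback C f c (Idn C (Dom C c)) c'"
proof -
  obtain g where g: "f \<in> Mor C" "g \<in> Mor C" "Dom C g = Cod C f" "Cod C g = Dom C f"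
    "g \<cdot> f = Idn C (Dom C f)" "f \<cdot> g = Idn C (Cod C f)" using iso_morE assms by blast
  note [simp] = assms(2,3) g(1-4) reassoc[OF g(5)] reassoc[OF g(6)]
  have "is_pullback C f c (Idn C (Dom C c)) (g \<cdot> c)"
  proof (rule pullbackI)
    show "\<exists>u. u \<in> Mor C \<and> Dom C u = Dom C t \<and> Cod C u = Dom C (g \<cdot> c) \<and> Idn C (Dom C c) \<cdot> u = s
      \<and> (g \<cdot> c) \<cdot> u = t"
      if "s \<in> Mor C" "t \<in> Mor C" "Dom C s = Dom C t" "Cod C s = Dom C c" "Cod C t = Dom C f"
        "c \<cdot> s = f \<cdot> t" for s t
      using that by (intro exI[of _ s]) simp
  qed simp_all
  then show thesis using that by blast
qed

lemma pushoutI: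
  assumes "f \<in> Mor C" "a \<in> Mor C" "f' \<in> Mor C" "a' \<in> Mor C" "Dom C f = Dom C a"
    "Dom C f' = Cod C a" "Dom C a' = Cod C f" "Cod C f' = Cod C a'" "f' \<cdot> a = a' \<cdot> f"
    and ex: "\<And>s t. s \<in> Mor C \<Longrightarrow> t \<in> Mor C \<Longrightarrow> Cod C s = Cod C t \<Longrightarrow> Dom C s = Cod C a \<Longrightarrow>
      Dom C t = Cod C f \<Longrightarrow> s \<cdot> a = t \<cdot> f \<Longrightarrow>
      \<exists>u. u \<in> Mor C \<and> Cod C u = Cod C t \<and> Dom C u = Cod C a' \<and> u \<cdot> f' = s \<and> u \<cdot> a' = t"
    and un: "\<And>x y. x \<in> Mor C \<Longrightarrow> y \<in> Mor C \<Longrightarrow> Cod C x = Cod C y \<Longrightarrow> Dom C x = Cod C a' \<Longrightarrow>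
      Dom C y = Cod C a' \<Longrightarrow> x \<cdot> f' = y \<cdot> f' \<Longrightarrow> x \<cdot> a' = y \<cdot> a' \<Longrightarrow> x = y"
  shows "is_pushout C f a f' a'"
proof -
  interpret op: category "op_cat C" by (rule category_op)
  have "is_pullback (op_cat C) f a f' a'"
    by (rule op.pullbackI; unfold op_cat_simps) (fact assms(1-4) assms(5) assms(6-9) ex un)+
  then show ?thesis by simp
qed

definition epi where
  "epi p \<longleftrightarrow> p \<in> Mor C \<and> (\<forall>x\<in>Mor C. \<forall>y\<in>Mor C. Dom C x = Cod C p \<longrightarrow> Dom C y = Cod C p \<longrightarrow>
     x \<cdot> p = y \<cdot> p \<longrightarrow> x = y)"

lemma epiD:
  assumes "epi p" "x \<cdot> p = y \<cdot> p" "x \<in> Mor C" "y \<in> Mor C" "Dom C x = Cod C p" "Dom C y = Cod C p"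
  shows "x = y"
  using assms by (simp add: epi_def)

lemma split_epi_epi:
  assumes "p \<cdot> s = Idn C (Cod C p)" "p \<in> Mor C" "s \<in> Mor C" "Dom C s = Cod C p" "Cod C s = Dom C p"
  shows "epi p"
  unfolding epi_def
proof (intro conjI ballI impI)
  fix x y assume xy: "x \<in> Mor C" "y \<in> Mor C" "Dom C x = Cod C p" "Dom C y = Cod C p" "x \<cdot> p = y \<cdot> p"
  have "x = (x \<cdot> p) \<cdot> s" using xy(1-4) assms by simp
  also have "\<dots> = y" unfolding xy(5) using xy(1-4) assms by simp
  finally show "x = y" .
qed (rule assms)

end

context preadditive_category
begin

lemma kernelD:
  assumes "is_kernel C f g"
  shows "f \<in> Mor C" "g \<in> Mor C" "Cod C f = Dom C g" "g \<cdot> f = Zero C (Dom C f) (Cod C g)"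
  using assms by (auto simp: is_kernel_def)

lemma kernel_ex:
  assumes "is_kernel C f g" "h \<in> Mor C" "Cod C h = Dom C g" "g \<cdot> h = Zero C (Dom C h) (Cod C g)"
  shows "\<exists>u. u \<in> Mor C \<and> Dom C u = Dom C h \<and> Cod C u = Dom C f \<and> f \<cdot> u = h"
proof -
  have "Dom C h \<in> Obj C" "h \<in> Hom C (Dom C h) (Dom C g)" using assms by simp_all
  with assms(1,4) have "\<exists>u. u \<in> Hom C (Dom C h) (Dom C f) \<and> f \<cdot> u = h"
    unfolding is_kernel_def by meson
  then show ?thesis by simp
qed

lemma kernel_mono:
  assumes k: "is_kernel C f g" and xy: "x \<in> Mor C" "y \<in> Mor C" "Dom C x = Dom C y"
    "Cod C x = Dom C f" "Cod C y = Dom C f" "f \<cdot> x = f \<cdot> y"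
  shows "x = y"
proof -
  note D = kernelD[OF k]
  have "\<exists>!u. u \<in> Hom C (Dom C y) (Dom C f) \<and> f \<cdot> u = f \<cdot> y"
    using k xy D unfolding is_kernel_def by (simp add: reassoc[OF D(4)])
  then show ?thesis using xy by auto
qed

lemma kernelI:
  assumes "f \<in> Mor C" "g \<in> Mor C" "Cod C f = Dom C g" "g \<cdot> f = Zero C (Dom C f) (Cod C g)"
    and ex: "\<And>h. h \<in> Mor C \<Longrightarrow> Cod C h = Dom C g \<Longrightarrow> g \<cdot> h = Zero C (Dom C h) (Cod C g) \<Longrightarrow>
      \<exists>u. u \<in> Mor C \<and> Dom C u = Dom C h \<and> Cod C u = Dom C f \<and> f \<cdot> u = h"
    and un: "\<And>x y. x \<in> Mor C \<Longrightarrow> y \<in> Mor C \<Longrightarrow> Dom C x = Dom C y \<Longrightarrow> Cod C x = Dom C f \<Longrightarrow>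
      Cod C y = Dom C f \<Longrightarrow> f \<cdot> x = f \<cdot> y \<Longrightarrow> x = y"
  shows "is_kernel C f g"
proof -
  have "\<exists>!u. u \<in> Hom C W (Dom C f) \<and> f \<cdot> u = h"
    if h: "h \<in> Hom C W (Dom C g)" "g \<cdot> h = Zero C W (Cod C g)" for W h
  proof -
    have "\<exists>u. u \<in> Mor C \<and> Dom C u = Dom C h \<and> Cod C u = Dom C f \<and> f
      \<cdot> u = h"
      using ex[of h] h by simp
    then obtain u where u: "u \<in> Mor C" "Dom C u = Dom C h" "Cod C u = Dom C f" "f \<cdot> u = h" by blast
    show ?thesis
    proof (rule ex1I[of _ u])
      fix w assume "w \<in> Hom C W (Dom C f) \<and> f \<cdot> w = h"
      then show "w = u" using u h by (intro un[of w u]) simp_all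
    qed (use u h in simp)
  qed
  then show ?thesis using assms(1-4) unfolding is_kernel_def by (simp del: Hom_iff)
qed

lemma cokernelD:
  assumes "is_cokernel C g f"
  shows "f \<in> Mor C" "g \<in> Mor C" "Cod C f = Dom C g" "g \<cdot> f = Zero C (Dom C f) (Cod C g)"
  using assms by (auto simp: is_cokernel_def)

lemma cokernel_ex:
  assumes "is_cokernel C g f" "h \<in> Mor C" "Dom C h = Cod C f" "h \<cdot> f = Zero C (Dom C f) (Cod C h)"
  shows "\<exists>u. u \<in> Mor C \<and> Cod C u = Cod C h \<and> Dom C u = Cod C g \<and> u \<cdot> g = h"
proof -
  interpret op: preadditive_category "op_cat C" by (rule preadditive_op)
  show ?thesis using op.kernel_ex[of g f h] assms cokernelD[OF assms(1)] by simp
qed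

lemma cokernel_epi:
  assumes "is_cokernel C g f" shows "epi g"
proof -
  interpret op: preadditive_category "op_cat C" by (rule preadditive_op)
  have "x = y" if "x \<in> Mor C" "y \<in> Mor C" "Dom C x = Cod C g" "Dom C y = Cod C g" "x \<cdot> g = y \<cdot> g"
    for x y
  proof -
    have "Cod C (x \<cdot> g) = Cod C x" "Cod C (y \<cdot> g) = Cod C y"
      using that(1-4) cokernelD[OF assms] by simp_all
    then show ?thesis using that op.kernel_mono[of g f x y] assms by simp
  qed
  then show ?thesis using cokernelD[OF assms] by (simp add: epi_def)
qed

lemma cokernelI:
  assumes "f \<in> Mor C" "g \<in> Mor C" "Cod C f = Dom C g" "g \<cdot> f = Zero C (Dom C f) (Cod C g)"
    and ex: "\<And>h. h \<in> Mor C \<Longrightarrow> Dom C h = Cod C f \<Longrightarrow> h \<cdot> f = Zero C (Dom C f) (Cod C h) \<Longrightarrow>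
      \<exists>u. u \<in> Mor C \<and> Cod C u = Cod C h \<and> Dom C u = Cod C g \<and> u \<cdot> g = h"
    and un: "epi g"
  shows "is_cokernel C g f"
proof -
  interpret op: preadditive_category "op_cat C" by (rule preadditive_op)
  have "is_kernel (op_cat C) g f"
  proof (rule op.kernelI)
    show "\<exists>u. u \<in> Mor (op_cat C) \<and> Dom (op_cat C) u = Dom (op_cat C) h \<and>
        Cod (op_cat C) u = Dom (op_cat C) g \<and> Comp (op_cat C) g u = h"
      if "h \<in> Mor (op_cat C)" "Cod (op_cat C) h = Dom (op_cat C) f"
        "Comp (op_cat C) f h = Zero (op_cat C) (Dom (op_cat C) h) (Cod (op_cat C) f)" for h
      using ex[of h] that by simp
    show "x = y" if "x \<in> Mor (op_cat C)" "y \<in> Mor (op_cat C)" "Dom (op_cat C) x = Dom (op_cat C) y"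
      "Cod (op_cat C) x = Dom (op_cat C) g" "Cod (op_cat C) y = Dom (op_cat C) g"
      "Comp (op_cat C) g x = Comp (op_cat C) g y" for x y
      using epiD[OF un, of x y] that by simp
  qed (use assms(1-4) in simp_all)
  then show ?thesis by simp
qed

lemma kernel_unique:
  assumes "is_kernel C f g" "is_kernel C f' g"
  obtains u where "iso_mor C u" "Dom C u = Dom C f'" "Cod C u = Dom C f" "f \<cdot> u = f'"
proof -
  note D = kernelD[OF assms(1)] kernelD[OF assms(2)]
  note [simp] = D(1-3) D(5-7)
  obtain u where u: "u \<in> Mor C" "Dom C u = Dom C f'" "Cod C u = Dom C f" "f \<cdot> u = f'"
    using kernel_ex[OF assms(1), of f'] D by metis
  obtain v where v: "v \<in> Mor C" "Dom C v = Dom C f" "Cod C v = Dom C f'" "f' \<cdot> v = f"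
    using kernel_ex[OF assms(2), of f] D by metis
  have "u \<cdot> v = Idn C (Dom C f)"
    using u v by - (rule kernel_mono[OF assms(1)], simp_all add: reassoc[OF u(4)])
  moreover have "v \<cdot> u = Idn C (Dom C f')"
    using u v by - (rule kernel_mono[OF assms(2)], simp_all add: reassoc[OF v(4)])
  ultimately show thesis using that[of u] iso_morI[of u v] u v by simp
qed

lemma kernel_of_pullback:
  assumes p: "is_pullback C g c g' c'" and k: "is_kernel C k' g'"
  shows "is_kernel C (c' \<cdot> k') g"
proof (rule kernelI)
  note P = pullbackD[OF p] and K = kernelD[OF k]
  note [simp] = P(1-8) K(1-3)
  show "g \<cdot> (c' \<cdot> k') = Zero C (Dom C (c' \<cdot> k')) (Cod C g)"
    using K(4) by (simp add: reassoc[OF P(9)[symmetric]])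
  show "\<exists>u. u \<in> Mor C \<and> Dom C u = Dom C h \<and> Cod C u = Dom C (c' \<cdot> k') \<and> (c' \<cdot> k') \<cdot> u = h"
    if h: "h \<in> Mor C" "Cod C h = Dom C g" "g \<cdot> h = Zero C (Dom C h) (Cod C g)" for h
  proof -
    have "\<exists>v. v \<in> Mor C \<and> Dom C v = Dom C h \<and> Cod C v = Dom C c' \<and> g'
      \<cdot> v = Zero C (Dom C h) (Dom C c) \<and> c' \<cdot> v = h"
      using pullback_ex[OF p, of "Zero C (Dom C h) (Dom C c)" h] h by simp
    then obtain v where v: "v \<in> Mor C" "Dom C v = Dom C h" "Cod C v = Dom C c'" "g' \<cdot> v = Zero C (Dom C h) (Dom C c)" "c' \<cdot> v = h" by blast
    have "\<exists>u. u \<in> Mor C \<and> Dom C u = Dom C h \<and> Cod C u = Dom C k' \<and> k'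
      \<cdot> u = v"
      using kernel_ex[OF k, of v] v by simp
    then obtain u where "u \<in> Mor C" "Dom C u = Dom C h" "Cod C u = Dom C k'" "k' \<cdot> u = v" by blast
    then show ?thesis using v by (intro exI[of _ u]) simp
  qed
  show "x = y" if xy: "x \<in> Mor C" "y \<in> Mor C" "Dom C x = Dom C y" "Cod C x = Dom C (c' \<cdot> k')"
    "Cod C y = Dom C (c' \<cdot> k')" "(c' \<cdot> k') \<cdot> x = (c' \<cdot> k') \<cdot> y" for x y
  proof -
    have "k' \<cdot> x = k' \<cdot> y"
      using xy by - (rule pullback_joint_mono[OF p], simp_all add: reassoc[OF K(4)])
    then show ?thesis using xy by - (rule kernel_mono[OF k], simp_all)
  qed
qed (use pullbackD[OF p] kernelD[OF k] in simp_all)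

lemma pullback_of_kernel:
  assumes p: "is_pullback C g c g' c'" and k: "is_kernel C k g"
  obtains k' where "is_kernel C k' g'" "c' \<cdot> k' = k" "Dom C k' = Dom C k"
proof -
  note P = pullbackD[OF p] and K = kernelD[OF k]
  note [simp] = P(1-8) K(1-3)
  obtain k' where k': "k' \<in> Mor C" "Dom C k' = Dom C k" "Cod C k' = Dom C c'"
    "g' \<cdot> k' = Zero C (Dom C k) (Dom C c)" "c' \<cdot> k' = k"
    using pullback_ex[OF p, of "Zero C (Dom C k) (Dom C c)" k] K by (simp; blast)
  have "is_kernel C k' g'"
  proof (rule kernelI)
    show "\<exists>u. u \<in> Mor C \<and> Dom C u = Dom C h \<and> Cod C u = Dom C k' \<and> k' \<cdot> u = h"
      if h: "h \<in> Mor C" "Cod C h = Dom C g'" "g' \<cdot> h = Zero C (Dom C h) (Cod C g')" for h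
    proof -
      have "g \<cdot> c' \<cdot> h = Zero C (Dom C h) (Cod C g)" using h by (simp add: reassoc[OF P(9)[symmetric]])
      then have "\<exists>u. u \<in> Mor C \<and> Dom C u = Dom C h \<and> Cod C u = Dom C k \<and> k
        \<cdot> u = c' \<cdot> h"
        using kernel_ex[OF k, of "c' \<cdot> h"] h by simp
      then obtain u where u: "u \<in> Mor C" "Dom C u = Dom C h" "Cod C u = Dom C k" "k \<cdot> u = c' \<cdot> h" by blast
      have "k' \<cdot> u = h" using u h k'
        by - (rule pullback_joint_mono[OF p], simp_all add: reassoc[OF k'(4)] reassoc[OF k'(5)])
      then show ?thesis using u k' by auto
    qed
    show "x = y" if xy: "x \<in> Mor C" "y \<in> Mor C" "Dom C x = Dom C y" "Cod C x = Dom C k'"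
      "Cod C y = Dom C k'" "k' \<cdot> x = k' \<cdot> y" for x y
    proof -
      have "k \<cdot> x = c' \<cdot> k' \<cdot> x" "k \<cdot> y = c' \<cdot> k' \<cdot> y"
        using xy(1-5) k' by (simp_all add: reassoc[OF k'(5)])
      then have "k \<cdot> x = k \<cdot> y" using xy(6) by simp
      then show ?thesis using xy(1-5) k' by - (rule kernel_mono[OF k], simp_all)
    qed
  qed (use k' in simp_all)
  then show thesis using that k' by blast
qed

lemma kernel_iso:
  assumes k: "is_kernel C f g" and m: "f' \<in> Mor C" "g' \<in> Mor C" "Cod C f' = Dom C g'"
    and a: "iso_mor C a" "Dom C a = Dom C f" "Cod C a = Dom C f'"
    and b: "iso_mor C b" "Dom C b = Cod C f" "Cod C b = Cod C f'"
    and c: "iso_mor C c" "Dom C c = Cod C g" "Cod C c = Cod C g'"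
    and e: "b \<cdot> f = f' \<cdot> a" "c \<cdot> g = g' \<cdot> b"
  shows "is_kernel C f' g'"
proof -
  note K = kernelD[OF k]
  obtain a' where a': "a \<in> Mor C" "a' \<in> Mor C" "Dom C a' = Cod C a" "Cod C a' = Dom C a"
    "a' \<cdot> a = Idn C (Dom C a)" "a \<cdot> a' = Idn C (Cod C a)" using iso_morE a by blast
  obtain b' where b': "b \<in> Mor C" "b' \<in> Mor C" "Dom C b' = Cod C b" "Cod C b' = Dom C b"
    "b' \<cdot> b = Idn C (Dom C b)" "b \<cdot> b' = Idn C (Cod C b)" using iso_morE b by blast
  obtain c' where c': "c \<in> Mor C" "c' \<in> Mor C" "Dom C c' = Cod C c" "Cod C c' = Dom C c"
    "c' \<cdot> c = Idn C (Dom C c)" "c \<cdot> c' = Idn C (Cod C c)" using iso_morE c by blast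
  note [simp] = K(1-3) m a(2,3) b(2,3) c(2,3) a'(1-4) b'(1-4) c'(1-4)
  note r = reassoc[OF a'(5)] reassoc[OF b'(5)] reassoc[OF c'(5)]
    reassoc[OF a'(6)] reassoc[OF b'(6)] reassoc[OF c'(6)]
  have f': "f' = b \<cdot> f \<cdot> a'" using reassoc[OF e(1)] a'(6) by simp
  have g': "g' = c \<cdot> g \<cdot> b'" using reassoc[OF e(2)] b'(6) by simp
  have f'x: "f' \<cdot> x = b \<cdot> f \<cdot> a' \<cdot> x" if "x \<in> Mor C" "Cod C x = Dom C f'" for x
    using reassoc[OF f'[symmetric], of x] that by simp
  have g'x: "g' \<cdot> x = c \<cdot> g \<cdot> b' \<cdot> x" if "x \<in> Mor C" "Cod C x = Dom C g'" for x
    using reassoc[OF g'[symmetric], of x] that by simp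
  show "is_kernel C f' g'"
  proof (rule kernelI)
    show "g' \<cdot> f' = Zero C (Dom C f') (Cod C g')"
    proof -
      have "f \<cdot> a' = b' \<cdot> (b \<cdot> f) \<cdot> a'" by (simp add: r)
      also have "\<dots> = b' \<cdot> f'" unfolding e(1) by (simp add: a'(6))
      finally show ?thesis using g'x[of f'] reassoc[OF K(4), of a'] by simp
    qed
    show "\<exists>u. u \<in> Mor C \<and> Dom C u = Dom C h \<and> Cod C u = Dom C f' \<and> f' \<cdot> u = h"
      if h: "h \<in> Mor C" "Cod C h = Dom C g'" "g' \<cdot> h = Zero C (Dom C h) (Cod C g')" for h
    proof -
      have "g \<cdot> b' \<cdot> h = c' \<cdot> g' \<cdot> h" using h(1,2) by (simp add: r g'x)
      also have "\<dots> = Zero C (Dom C h) (Cod C g)" using h by simp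
      finally have "\<exists>u. u \<in> Mor C \<and> Dom C u = Dom C h \<and> Cod C u = Dom C f \<and> f \<cdot> u = b' \<cdot> h"
        using kernel_ex[OF k, of "b' \<cdot> h"] h(1,2) by simp
      then obtain u where "u \<in> Mor C" "Dom C u = Dom C h" "Cod C u = Dom C f" "f \<cdot> u = b' \<cdot> h"
        by blast
      then show ?thesis using h(1,2) by (intro exI[of _ "a \<cdot> u"]) (simp add: r f'x)
    qed
    show "x = y" if xy: "x \<in> Mor C" "y \<in> Mor C" "Dom C x = Dom C y" "Cod C x = Dom C f'"
      "Cod C y = Dom C f'" "f' \<cdot> x = f' \<cdot> y" for x y
    proof -
      have "f \<cdot> a' \<cdot> x = b' \<cdot> f' \<cdot> x" "f \<cdot> a' \<cdot> y = b' \<cdot> f' \<cdot> y"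
        using xy(1-5) by (simp_all add: r f'x)
      then have "a' \<cdot> x = a' \<cdot> y" using xy by - (rule kernel_mono[OF k], simp_all)
      then have "a \<cdot> a' \<cdot> x = a \<cdot> a' \<cdot> y" by simp
      then show ?thesis using xy by (simp add: r)
    qed
  qed simp_all
qed

lemma ker_coker_pair_iso:
  assumes "ker_coker_pair C f g" "pair_iso C (f, g) (f', g')"
  shows "ker_coker_pair C f' g'"
proof -
  obtain a b c where e: "f' \<in> Mor C" "g' \<in> Mor C" "Cod C f' = Dom C g'"
    "iso_mor C a" "Dom C a = Dom C f" "Cod C a = Dom C f'"
    "iso_mor C b" "Dom C b = Cod C f" "Cod C b = Cod C f'"
    "iso_mor C c" "Dom C c = Cod C g" "Cod C c = Cod C g'"
    "b \<cdot> f = f' \<cdot> a" "c \<cdot> g = g' \<cdot> b"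
    using assms(2) by (auto simp: pair_iso_def)
  have K: "is_kernel C f g" "is_cokernel C g f" using assms(1) by (auto simp: ker_coker_pair_def)
  note D = kernelD[OF K(1)]
  obtain a' where a': "a \<in> Mor C" "a' \<in> Mor C" "Dom C a' = Cod C a" "Cod C a' = Dom C a"
    "a' \<cdot> a = Idn C (Dom C a)" "a \<cdot> a' = Idn C (Cod C a)" using iso_morE e by blast
  obtain b' where b': "b \<in> Mor C" "b' \<in> Mor C" "Dom C b' = Cod C b" "Cod C b' = Dom C b"
    "b' \<cdot> b = Idn C (Dom C b)" "b \<cdot> b' = Idn C (Cod C b)" using iso_morE e by blast
  obtain c' where c': "c \<in> Mor C" "c' \<in> Mor C" "Dom C c' = Cod C c" "Cod C c' = Dom C c"
    "c' \<cdot> c = Idn C (Dom C c)" "c \<cdot> c' = Idn C (Cod C c)" using iso_morE e by blast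
  note [simp] = D(1-3) e(1-3,5,6,8,9,11,12) a'(1-4) b'(1-4) c'(1-4)
  have "is_kernel C f' g'" by (rule kernel_iso[OF K(1) e(1-3), of a b c]) (use e in simp_all)
  moreover interpret op: preadditive_category "op_cat C" by (rule preadditive_op)
  have "is_kernel (op_cat C) g' f'"
  proof (rule op.kernel_iso[of g f g' f' c' b' a'])
    have "g \<cdot> b' = c' \<cdot> (c \<cdot> g) \<cdot> b'" by (simp add: reassoc[OF c'(5)])
    also have "\<dots> = c' \<cdot> g'" unfolding e(14) by (simp add: b'(6))
    finally show "Comp (op_cat C) b' g = Comp (op_cat C) g' c'" by simp
    have "f \<cdot> a' = b' \<cdot> (b \<cdot> f) \<cdot> a'" by (simp add: reassoc[OF b'(5)])
    also have "\<dots> = b' \<cdot> f'" unfolding e(13) by (simp add: a'(6))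
    finally show "Comp (op_cat C) a' f = Comp (op_cat C) f' b'" by simp
    show "iso_mor (op_cat C) a'" "iso_mor (op_cat C) b'" "iso_mor (op_cat C) c'"
      using iso_morI[of a' a] iso_morI[of b' b] iso_morI[of c' c] a' b' c' by simp_all
  qed (use K in simp_all)
  ultimately show ?thesis by (simp add: ker_coker_pair_def)
qed

lemma epi_comp:
  assumes "epi p" "epi q" "Cod C p = Dom C q" shows "epi (q \<cdot> p)"
  unfolding epi_def
proof (intro conjI ballI impI)
  have m [simp]: "p \<in> Mor C" "q \<in> Mor C" using assms by (simp_all add: epi_def)
  show "q \<cdot> p \<in> Mor C" using assms by simp
  fix x y assume xy: "x \<in> Mor C" "y \<in> Mor C" "Dom C x = Cod C (q \<cdot> p)" "Dom C y = Cod C (q \<cdot> p)"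
    "x \<cdot> q \<cdot> p = y \<cdot> q \<cdot> p"
  have "x \<cdot> q = y \<cdot> q" using xy assms(3) by - (rule epiD[OF assms(1)], simp_all)
  then show "x = y" using xy assms(3) epiD[OF assms(2), of x y] by simp
qed

lemma epi_Zero:
  assumes "epi p" "x \<cdot> p = Zero C (Dom C p) (Cod C x)" "x \<in> Mor C" "Dom C x = Cod C p"
  shows "x = Zero C (Cod C p) (Cod C x)"
proof -
  have "p \<in> Mor C" using assms by (simp add: epi_def)
  then show ?thesis using assms by - (rule epiD[OF assms(1)], simp_all)
qed

lemma ker_coker_pairD:
  assumes "ker_coker_pair C f g"
  shows "f \<in> Mor C" "g \<in> Mor C" "Cod C f = Dom C g" "g \<cdot> f = Zero C (Dom C f) (Cod C g)"
    "is_kernel C f g" "is_cokernel C g f" "epi g"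
  using assms kernelD[of f g] cokernel_epi by (auto simp: ker_coker_pair_def)

text \<open>
  If \<open>t\<close> kills \<open>\<kappa>\<close>, then \<open>t p\<close> kills the kernel of \<open>e = g p\<close> and factors through \<open>e\<close>; the
  epimorphism \<open>p\<close> can then be cancelled.
\<close>

lemma ker_coker_pair_factor:
  assumes e: "ker_coker_pair C k e" and gp: "g \<cdot> p = e" "g \<in> Mor C" "Cod C p = Dom C g"
    and p: "epi p" and \<kappa>: "is_kernel C \<kappa> g"
  shows "ker_coker_pair C \<kappa> g"
proof -
  note E = ker_coker_pairD[OF e] and K = kernelD[OF \<kappa>]
  have pM: "p \<in> Mor C" using p by (simp add: epi_def)
  have ends: "Dom C e = Dom C p" "Cod C e = Cod C g" using gp pM by (auto simp: gp(1)[symmetric])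
  note [simp] = E(1-3) K(1-3) gp(2,3) pM ends
  have "is_cokernel C g \<kappa>"
  proof (rule cokernelI)
    fix h assume h: "h \<in> Mor C" "Dom C h = Cod C \<kappa>" "h \<cdot> \<kappa> = Zero C (Dom C \<kappa>) (Cod C h)"
    have "g \<cdot> p \<cdot> k = Zero C (Dom C k) (Cod C g)" by (simp add: reassoc[OF gp(1)] E(4))
    then have "\<exists>y. y \<in> Mor C \<and> Dom C y = Dom C k \<and> Cod C y = Dom C \<kappa> \<and> \<kappa> \<cdot> y = p \<cdot> k"
      using kernel_ex[OF \<kappa>, of "p \<cdot> k"] by simp
    then obtain y where y: "y \<in> Mor C" "Dom C y = Dom C k" "Cod C y = Dom C \<kappa>" "\<kappa> \<cdot> y = p \<cdot> k"
      by blast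
    have "h \<cdot> p \<cdot> k = Zero C (Dom C k) (Cod C h)"
      unfolding y(4)[symmetric] using h y(1-3) by (simp add: reassoc[OF h(3)])
    then have "\<exists>u. u \<in> Mor C \<and> Cod C u = Cod C h \<and> Dom C u = Cod C g \<and> u \<cdot> e = h \<cdot> p"
      using cokernel_ex[OF E(6), of "h \<cdot> p"] h by simp
    then obtain u where u: "u \<in> Mor C" "Cod C u = Cod C h" "Dom C u = Cod C g" "u \<cdot> e = h \<cdot> p"
      by blast
    have "(u \<cdot> g) \<cdot> p = h \<cdot> p" using u gp(1) by simp
    then have "u \<cdot> g = h" using u(1-3) h by - (rule epiD[OF p], simp_all)
    then show "\<exists>u. u \<in> Mor C \<and> Cod C u = Cod C h \<and> Dom C u = Cod C g \<and> u \<cdot> g = h"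
      using u by blast
  next
    show "epi g" unfolding epi_def
    proof (intro conjI ballI impI)
      fix x y assume xy: "x \<in> Mor C" "y \<in> Mor C" "Dom C x = Cod C g" "Dom C y = Cod C g"
        "x \<cdot> g = y \<cdot> g"
      have "x \<cdot> e = y \<cdot> e" unfolding gp(1)[symmetric] using xy by (simp add: reassoc[OF xy(5)])
      then show "x = y" using xy(1-4) by - (rule epiD[OF E(7)], simp_all)
    qed simp
  qed (use K in simp_all)
  then show ?thesis using \<kappa> by (simp add: ker_coker_pair_def)
qed

text \<open>
  A map that kills the kernel \<open>j\<close> of \<open>d' d\<close> kills the kernel of \<open>d\<close>, so it factors through \<open>d\<close>; the
  factor kills \<open>k'\<close> because \<open>p\<close> is epic, so it factors through \<open>d'\<close>.
\<close>

lemma ker_coker_pair_comp: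
  assumes d: "ker_coker_pair C k d" and d': "ker_coker_pair C k' d'" "Cod C d = Dom C d'"
    and pb: "is_pullback C d k' p j" and p: "epi p"
  shows "ker_coker_pair C j (d' \<cdot> d)"
proof -
  note E = ker_coker_pairD[OF d] and E' = ker_coker_pairD[OF d'(1)] and P = pullbackD[OF pb]
  note [simp] = E(1-3) E'(1-3) P(1-8) d'(2)
  have z: "(d' \<cdot> d) \<cdot> j = Zero C (Dom C j) (Cod C (d' \<cdot> d))"
    by (simp add: P(9)[symmetric] reassoc[OF E'(4)])
  have "is_kernel C j (d' \<cdot> d)"
  proof (rule kernelI)
    fix h assume h: "h \<in> Mor C" "Cod C h = Dom C (d' \<cdot> d)"
      "(d' \<cdot> d) \<cdot> h = Zero C (Dom C h) (Cod C (d' \<cdot> d))"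
    then have "\<exists>s. s \<in> Mor C \<and> Dom C s = Dom C h \<and> Cod C s = Dom C k' \<and> k' \<cdot> s = d \<cdot> h"
      using kernel_ex[OF E'(5), of "d \<cdot> h"] by simp
    then obtain s where s: "s \<in> Mor C" "Dom C s = Dom C h" "Cod C s = Dom C k'" "k' \<cdot> s = d \<cdot> h"
      by blast
    then have "\<exists>u. u \<in> Mor C \<and> Dom C u = Dom C h \<and> Cod C u = Dom C j \<and> p \<cdot> u = s \<and> j \<cdot> u = h"
      using pullback_ex[OF pb, of s h] h by simp
    then show "\<exists>u. u \<in> Mor C \<and> Dom C u = Dom C h \<and> Cod C u = Dom C j \<and> j \<cdot> u = h" by blast
  next
    fix x y assume xy: "x \<in> Mor C" "y \<in> Mor C" "Dom C x = Dom C y" "Cod C x = Dom C j"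
      "Cod C y = Dom C j" "j \<cdot> x = j \<cdot> y"
    have "k' \<cdot> p \<cdot> x = k' \<cdot> p \<cdot> y" using xy by (simp add: reassoc[OF P(9)])
    then have "p \<cdot> x = p \<cdot> y" using xy(1-5) by - (rule kernel_mono[OF E'(5)], simp_all)
    then show "x = y" using xy by - (rule pullback_joint_mono[OF pb], simp_all)
  qed (use z in simp_all)
  moreover have "is_cokernel C (d' \<cdot> d) j"
  proof (rule cokernelI)
    fix h assume h: "h \<in> Mor C" "Dom C h = Cod C j" "h \<cdot> j = Zero C (Dom C j) (Cod C h)"
    obtain m where m: "is_kernel C m p" "j \<cdot> m = k" "Dom C m = Dom C k"
      by (rule pullback_of_kernel[OF pb E(5)])
    note M = kernelD[OF m(1)]
    have "h \<cdot> k = Zero C (Dom C k) (Cod C h)"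
      using reassoc[OF h(3), of m] h M m(2,3) by simp
    then have "\<exists>u. u \<in> Mor C \<and> Cod C u = Cod C h \<and> Dom C u = Cod C d \<and> u \<cdot> d = h"
      using cokernel_ex[OF E(6), of h] h by simp
    then obtain u where u: "u \<in> Mor C" "Cod C u = Cod C h" "Dom C u = Cod C d" "u \<cdot> d = h" by blast
    have "(u \<cdot> k') \<cdot> p = Zero C (Dom C p) (Cod C (u \<cdot> k'))"
      using u(1-3) h(3) by (simp add: P(9) reassoc[OF u(4)])
    then have "u \<cdot> k' = Zero C (Dom C k') (Cod C u)"
      using epi_Zero[OF p, of "u \<cdot> k'"] u(1-3) by simp
    then have "\<exists>v. v \<in> Mor C \<and> Cod C v = Cod C u \<and> Dom C v = Cod C d' \<and> v \<cdot> d' = u"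
      using cokernel_ex[OF E'(6), of u] u(1-3) by simp
    then obtain v where v: "v \<in> Mor C" "Cod C v = Cod C u" "Dom C v = Cod C d'" "v \<cdot> d' = u" by blast
    then show "\<exists>v. v \<in> Mor C \<and> Cod C v = Cod C h \<and> Dom C v = Cod C (d' \<cdot> d) \<and> v \<cdot> d' \<cdot> d = h"
      using u by (intro exI[of _ v]) (simp add: reassoc[OF v(4)])
  qed (use z epi_comp E(7) E'(7) in simp_all)
  ultimately show ?thesis by (simp add: ker_coker_pair_def)
qed

section \<open>Biproducts\<close>

definition null where "null Z \<longleftrightarrow> Z \<in> Obj C \<and> Idn C Z = Zero C Z Z"

lemma null_Dom: "null Z \<Longrightarrow> f \<in> Mor C \<Longrightarrow> Dom C f = Z \<Longrightarrow> f = Zero C Z (Cod C f)"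
  using comp_Idn(1)[of f Z] by (simp add: null_def)

lemma null_Cod: "null Z \<Longrightarrow> f \<in> Mor C \<Longrightarrow> Cod C f = Z \<Longrightarrow> f = Zero C (Dom C f) Z"
  using comp_Idn(2)[of f Z] by (simp add: null_def)

definition biprod where
  "biprod P X Y i j p q \<longleftrightarrow> i \<in> Hom C X P \<and> j \<in> Hom C Y P \<and> p \<in> Hom C P X \<and> q \<in> Hom C P Y \<and>
     p \<cdot> i = Idn C X \<and> q \<cdot> j = Idn C Y \<and> q \<cdot> i = Zero C X Y \<and> p \<cdot> j = Zero C Y X \<and>
     i \<cdot> p \<^bold>+ j \<cdot> q = Idn C P"

lemma biprodD:
  assumes "biprod P X Y i j p q"
  shows "i \<in> Mor C" "Dom C i = X" "Cod C i = P" "j \<in> Mor C" "Dom C j = Y" "Cod C j = P"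
    "p \<in> Mor C" "Dom C p = P" "Cod C p = X" "q \<in> Mor C" "Dom C q = P" "Cod C q = Y"
    "X \<in> Obj C" "Y \<in> Obj C" "P \<in> Obj C"
  using assms Obj_ends[of i] Obj_ends[of j] by (auto simp: biprod_def)

lemma biprod_eqs:
  assumes "biprod P X Y i j p q"
  shows "p \<cdot> i = Idn C X" "q \<cdot> j = Idn C Y" "q \<cdot> i = Zero C X Y" "p \<cdot> j = Zero C Y X"
    "i \<cdot> p \<^bold>+ j \<cdot> q = Idn C P"
    "x \<in> Mor C \<Longrightarrow> Cod C x = X \<Longrightarrow> p \<cdot> i \<cdot> x = x"
    "x \<in> Mor C \<Longrightarrow> Cod C x = X \<Longrightarrow> q \<cdot> i \<cdot> x = Zero C (Dom C x) Y"
    "x \<in> Mor C \<Longrightarrow> Cod C x = Y \<Longrightarrow> q \<cdot> j \<cdot> x = x"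
    "x \<in> Mor C \<Longrightarrow> Cod C x = Y \<Longrightarrow> p \<cdot> j \<cdot> x = Zero C (Dom C x) X"
proof -
  note D [simp] = biprodD[OF assms]
  show e: "p \<cdot> i = Idn C X" "q \<cdot> j = Idn C Y" "q \<cdot> i = Zero C X Y" "p \<cdot> j = Zero C Y X"
    "i \<cdot> p \<^bold>+ j \<cdot> q = Idn C P" using assms by (auto simp: biprod_def)
  show "x \<in> Mor C \<Longrightarrow> Cod C x = X \<Longrightarrow> p \<cdot> i \<cdot> x = x"
    "x \<in> Mor C \<Longrightarrow> Cod C x = X \<Longrightarrow> q \<cdot> i \<cdot> x = Zero C (Dom C x) Y"
    "x \<in> Mor C \<Longrightarrow> Cod C x = Y \<Longrightarrow> q \<cdot> j \<cdot> x = x"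
    "x \<in> Mor C \<Longrightarrow> Cod C x = Y \<Longrightarrow> p \<cdot> j \<cdot> x = Zero C (Dom C x) X"
    by (simp_all add: reassoc[OF e(1)] reassoc[OF e(2)] reassoc[OF e(3)] reassoc[OF e(4)])
qed

lemma biprod_sum:
  assumes "biprod P X Y i j p q" "x \<in> Mor C" "Cod C x = P"
  shows "i \<cdot> p \<cdot> x \<^bold>+ j \<cdot> q \<cdot> x = x"
proof -
  note D [simp] = biprodD[OF assms(1)]
  have "(i \<cdot> p \<^bold>+ j \<cdot> q) \<cdot> x = x" using assms by (simp add: biprod_eqs(5)[OF assms(1)])
  then show ?thesis using assms by simp
qed

lemma biprod_joint_mono:
  assumes "biprod P X Y i j p q" "x \<in> Mor C" "Cod C x = P" "y \<in> Mor C" "Cod C y = P"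
    "p \<cdot> x = p \<cdot> y" "q \<cdot> x = q \<cdot> y"
  shows "x = y"
  using biprod_sum[OF assms(1-3)] biprod_sum[OF assms(1,4,5)] unfolding assms(6,7) by (rule subst)

lemma biprod_joint_epi:
  assumes "biprod P X Y i j p q" "x \<in> Mor C" "Dom C x = P" "y \<in> Mor C" "Dom C y = P"
    "x \<cdot> i = y \<cdot> i" "x \<cdot> j = y \<cdot> j" "Cod C x = Cod C y"
  shows "x = y"
proof -
  note D [simp] = biprodD[OF assms(1)]
  have "x \<cdot> (i \<cdot> p \<^bold>+ j \<cdot> q) = y \<cdot> (i \<cdot> p \<^bold>+ j \<cdot> q)"
    using assms(2-5,8) by (simp add: reassoc[OF assms(6)] reassoc[OF assms(7)])
  then show ?thesis using assms(2-5) by (simp add: biprod_eqs(5)[OF assms(1)])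
qed

lemma biprod_swap:
  assumes "biprod P X Y i j p q" shows "biprod P Y X j i q p"
  using assms biprodD[OF assms] by (simp add: biprod_def add_comm[of "i \<cdot> p"])

text \<open>
  Followed by the projection to \<open>Z\<close>, this pull-back \<open>(x, y) \<mapsto> (d x + g y, y)\<close> of \<open>d\<close> becomes
  \<open>(x, y) \<mapsto> d x + g y\<close>, which is how the latter is seen to be a deflation.
\<close>

lemma shear_pullback:
  assumes P: "biprod P X Y i j p q" and Q: "biprod Q Z Y i' j' p' q'"
    and d: "d \<in> Mor C" "Dom C d = X" "Cod C d = Z" and g: "g \<in> Mor C" "Dom C g = Y" "Cod C g = Z"
  shows "is_pullback C d (p' \<^bold>+ neg (g \<cdot> q')) (i' \<cdot> (d \<cdot> p \<^bold>+ g \<cdot> q) \<^bold>+ j' \<cdot> q) p"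
proof -
  note [simp] = biprodD[OF P] biprodD[OF Q] d g
  note e = biprod_eqs[OF P] biprod_eqs[OF Q]
  show ?thesis
  proof (rule pullbackI)
    show "(p' \<^bold>+ neg (g \<cdot> q')) \<cdot> (i' \<cdot> (d \<cdot> p \<^bold>+ g \<cdot> q) \<^bold>+ j' \<cdot> q) = d \<cdot> p"
      by (simp add: e)
    fix s t assume st: "s \<in> Mor C" "t \<in> Mor C" "Dom C s = Dom C t"
      "Cod C s = Dom C (p' \<^bold>+ neg (g \<cdot> q'))" "Cod C t = Dom C d" "(p' \<^bold>+ neg (g \<cdot> q')) \<cdot> s = d \<cdot> t"
    have dt: "d \<cdot> t = p' \<cdot> s \<^bold>+ neg (g \<cdot> q' \<cdot> s)" using st by simp
    have "(i' \<cdot> (d \<cdot> p \<^bold>+ g \<cdot> q) \<^bold>+ j' \<cdot> q) \<cdot> (i \<cdot> t \<^bold>+ j \<cdot> q' \<cdot> s) = s"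
      using st(1-5) dt by - (rule biprod_joint_mono[OF Q], simp_all add: e)
    then show "\<exists>u. u \<in> Mor C \<and> Dom C u = Dom C t \<and> Cod C u = Dom C p \<and>
        (i' \<cdot> (d \<cdot> p \<^bold>+ g \<cdot> q) \<^bold>+ j' \<cdot> q) \<cdot> u = s \<and> p \<cdot> u = t"
      using st(1-5) by (intro exI[of _ "i \<cdot> t \<^bold>+ j \<cdot> q' \<cdot> s"]) (simp add: e)
  next
    fix x y assume xy: "x \<in> Mor C" "y \<in> Mor C" "Dom C x = Dom C y" "Cod C x = Dom C p" "Cod C y = Dom C p"
      "(i' \<cdot> (d \<cdot> p \<^bold>+ g \<cdot> q) \<^bold>+ j' \<cdot> q) \<cdot> x = (i' \<cdot> (d \<cdot> p \<^bold>+ g \<cdot> q) \<^bold>+ j' \<cdot> q) \<cdot> y" "p \<cdot> x = p \<cdot> y"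
    have "q' \<cdot> (i' \<cdot> (d \<cdot> p \<^bold>+ g \<cdot> q) \<^bold>+ j' \<cdot> q) \<cdot> x = q' \<cdot> (i' \<cdot> (d \<cdot> p \<^bold>+ g \<cdot> q) \<^bold>+ j' \<cdot> q) \<cdot> y"
      by (simp only: xy(6))
    then have "q \<cdot> x = q \<cdot> y" using xy(1-5) by (simp add: e)
    then show "x = y" using xy(1-5,7) by - (rule biprod_joint_mono[OF P], simp_all)
  qed simp_all
qed

lemma null_pullback:
  assumes r: "r \<in> Mor C" "null (Cod C r)" and c: "c \<in> Mor C" "Cod C c = Cod C r"
    and P: "biprod P (Dom C c) (Dom C r) i j p q"
  shows "is_pullback C r c p q"
proof -
  note [simp] = biprodD[OF P] r(1) c
  note e = biprod_eqs[OF P]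
  show ?thesis
  proof (rule pullbackI)
    show "c \<cdot> p = r \<cdot> q" using null_Cod[OF r(2), of "c \<cdot> p"] null_Cod[OF r(2), of "r \<cdot> q"] by simp
    fix s t assume "s \<in> Mor C" "t \<in> Mor C" "Dom C s = Dom C t" "Cod C s = Dom C c" "Cod C t = Dom C r"
    then show "\<exists>u. u \<in> Mor C \<and> Dom C u = Dom C t \<and> Cod C u = Dom C q \<and> p \<cdot> u = s \<and> q \<cdot> u = t"
      by (intro exI[of _ "i \<cdot> s \<^bold>+ j \<cdot> t"]) (simp add: e)
  next
    fix x y assume "x \<in> Mor C" "y \<in> Mor C" "Dom C x = Dom C y" "Cod C x = Dom C q" "Cod C y = Dom C q"
      "p \<cdot> x = p \<cdot> y" "q \<cdot> x = q \<cdot> y"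
    then show "x = y" by - (rule biprod_joint_mono[OF P], simp_all)
  qed simp_all
qed

end

context additive_category
begin

lemma null_ex: "\<exists>Z. null Z"
proof -
  obtain X i p where "direct_sum C X 0 (\<lambda>_. undefined) i p"
    using direct_sums_exist[of 0] by fastforce
  then have X: "X \<in> Obj C" "finprod (hom_grp C X X) (\<lambda>k. i k \<cdot> p k) {} = Idn C X"
    by (simp_all add: direct_sum_def)
  interpret G: comm_group "hom_grp C X X" using X(1) by (intro comm_group_hom_grp)
  have "null X" using X by (simp add: null_def)
  then show ?thesis by blast
qed

lemma biprod_ex:
  assumes "X \<in> Obj C" "Y \<in> Obj C"
  shows "\<exists>P i j p q. biprod P X Y i j p q"
proof -
  define F where "F k = (if k = 0 then X else Y)" for k :: nat
  have "\<forall>k<2. F k \<in> Obj C" using assms by (simp add: F_def)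
  from direct_sums_exist[OF this] obtain P i p where s: "direct_sum C P 2 F i p" by blast
  note s' = s[unfolded direct_sum_def]
  have P: "P \<in> Obj C" using s' by blast
  have m: "i k \<in> Hom C (F k) P \<and> p k \<in> Hom C P (F k)" if "k < 2" for k
    using s' that by blast
  have o: "p l \<cdot> i k = (if k = l then Idn C (F k) else Zero C (F k) (F l))" if "k < 2" "l < 2" for k l
    using s' that by blast
  have f: "finprod (hom_grp C P P) (\<lambda>k. i k \<cdot> p k) {..<2} = Idn C P"
    using s' by blast
  interpret G: comm_group "hom_grp C P P" by (rule comm_group_hom_grp[OF P P])
  have F: "F 0 = X" "F 1 = Y" by (simp_all add: F_def)
  have m': "i 0 \<in> Hom C X P" "p 0 \<in> Hom C P X" "i 1 \<in> Hom C Y P" "p 1 \<in> Hom C P Y"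
    using m[of 0] m[of 1] by (simp_all add: F del: One_nat_def)
  have c: "i 0 \<cdot> p 0 \<in> carrier (hom_grp C P P)" "i 1 \<cdot> p 1 \<in> carrier (hom_grp C P P)"
    using m' by (simp_all del: One_nat_def)
  have two: "{..<2::nat} = insert 1 {0}" by auto
  have "finprod (hom_grp C P P) (\<lambda>k. i k \<cdot> p k) {..<2} = i 1 \<cdot> p 1 \<^bold>+ i 0 \<cdot> p 0"
    unfolding two using c by (simp del: One_nat_def)
  then have "i 0 \<cdot> p 0 \<^bold>+ i 1 \<cdot> p 1 = Idn C P"
    using f m' add_comm[of "i 0 \<cdot> p 0" "i 1 \<cdot> p 1"] by (simp del: One_nat_def)
  then have "biprod P X Y (i 0) (i 1) (p 0) (p 1)"
    using m' o[of 0 0] o[of 0 1] o[of 1 0] o[of 1 1] F unfolding biprod_def by (simp del: One_nat_def)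
  then show ?thesis by blast
qed

end

section \<open>Classes of deflations\<close>

text \<open>
  What the deflations of an exact structure and the semistable deflations have in common, and
  enough to form sums of the sieves that they generate.
\<close>

locale deflation_class = additive_category C for C :: "('o, 'm) cat" +
  fixes D :: "'m set"
  assumes D_Mor: "d \<in> D \<Longrightarrow> d \<in> Mor C"
    and D_iso: "iso_mor C f \<Longrightarrow> f \<in> D"
    and D_comp: "d \<in> D \<Longrightarrow> d' \<in> D \<Longrightarrow> Cod C d = Dom C d' \<Longrightarrow> d' \<cdot> d \<in> D"
    and D_pullback: "d \<in> D \<Longrightarrow> c \<in> Mor C \<Longrightarrow> Cod C c = Cod C d \<Longrightarrow>
      \<exists>d' c'. is_pullback C d c d' c' \<and> d' \<in> D"
    and D_null: "r \<in> Mor C \<Longrightarrow> null (Cod C r) \<Longrightarrow> r \<in> D"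
begin

lemma D_any_pullback:
  assumes "d \<in> D" "is_pullback C d c d' c'" shows "d' \<in> D"
proof -
  note P = pullbackD[OF assms(2)]
  obtain e w where e: "is_pullback C d c e w" "e \<in> D"
    using D_pullback[OF assms(1) P(2) P(5)[symmetric]] by blast
  obtain u where u: "iso_mor C u" "Dom C u = Dom C d'" "Cod C u = Dom C e" "e \<cdot> u = d'" "w \<cdot> u = c'"
    by (rule pullback_unique[OF e(1) assms(2)])
  have "e \<cdot> u \<in> D" using D_comp[OF D_iso[OF u(1)] e(2) u(3)] .
  then show ?thesis using u(4) by simp
qed

lemma D_proj:
  assumes "biprod P X Y i j p q" shows "p \<in> D" "q \<in> D"
proof -
  obtain Z where Z: "null Z" using null_ex by blast
  have first: "p \<in> D" if b: "biprod P X Y i j p q" for X Y i j p q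
  proof -
    note [simp] = biprodD[OF b] Z[unfolded null_def]
    have "is_pullback C (Zero C Y Z) (Zero C X Z) p q"
      by (rule null_pullback[of _ _ _ i j]) (use Z b in simp_all)
    moreover have "Zero C Y Z \<in> D" using Z by (intro D_null) simp_all
    ultimately show ?thesis using D_any_pullback by blast
  qed
  show "p \<in> D" "q \<in> D" using first assms biprod_swap[OF assms] by blast+
qed

lemma D_copair:
  assumes P: "biprod P (Dom C d) (Dom C c) i j p q" and d: "d \<in> D" and c: "c \<in> Mor C" "Cod C c = Cod C d"
  shows "d \<cdot> p \<^bold>+ c \<cdot> q \<in> D"
proof -
  have dM: "d \<in> Mor C" using d by (rule D_Mor)
  obtain Q i' j' p' q' where Q: "biprod Q (Cod C d) (Dom C c) i' j' p' q'"
    using biprod_ex[OF Obj_ends(2)[OF dM] Obj_ends(1)[OF c(1)]] by blast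
  note [simp] = biprodD[OF P] biprodD[OF Q] dM c
  note e = biprod_eqs[OF P] biprod_eqs[OF Q]
  define m where "m = i' \<cdot> (d \<cdot> p \<^bold>+ c \<cdot> q) \<^bold>+ j' \<cdot> q"
  have "m \<in> D"
    unfolding m_def by (rule D_any_pullback[OF d shear_pullback[OF P Q]]) simp_all
  then have "p' \<cdot> m \<in> D" using D_proj[OF Q] by (intro D_comp) (simp_all add: m_def)
  also have "p' \<cdot> m = d \<cdot> p \<^bold>+ c \<cdot> q" by (simp add: m_def e)
  finally show ?thesis .
qed

text \<open>
  The shear \<open>(x, y) \<mapsto> (x, y - h x)\<close> turns the deflation \<open>(x, y) \<mapsto> g h x + g y\<close> into
  \<open>(x, y) \<mapsto> g y\<close>.
\<close>

lemma D_stably_left_factor: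
  assumes gh: "g \<cdot> h \<in> D" and g: "g \<in> Mor C" and h: "h \<in> Mor C" "Cod C h = Dom C g"
    and P: "biprod P (Dom C h) (Dom C g) i j p q"
  shows "g \<cdot> q \<in> D"
proof -
  note [simp] = biprodD[OF P] g h
  note e = biprod_eqs[OF P]
  have d: "(g \<cdot> h) \<cdot> p \<^bold>+ g \<cdot> q \<in> D" by (rule D_copair[of P _ _ i j]) (use gh P in simp_all)
  define \<theta> where "\<theta> = Idn C P \<^bold>+ neg (j \<cdot> h \<cdot> p)"
  have \<theta> [simp]: "\<theta> \<in> Mor C" "Dom C \<theta> = P" "Cod C \<theta> = P" by (simp_all add: \<theta>_def)
  have "iso_mor C \<theta>"
  proof (rule iso_morI)
    show "(Idn C P \<^bold>+ j \<cdot> h \<cdot> p) \<cdot> \<theta> = Idn C (Dom C \<theta>)" "\<theta> \<cdot> (Idn C P \<^bold>+ j \<cdot> h \<cdot> p) = Idn C (Cod C \<theta>)"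
      by (simp_all add: \<theta>_def e)
  qed simp_all
  then have "((g \<cdot> h) \<cdot> p \<^bold>+ g \<cdot> q) \<cdot> \<theta> \<in> D"
    by - (rule D_comp[OF D_iso d], simp_all)
  also have "((g \<cdot> h) \<cdot> p \<^bold>+ g \<cdot> q) \<cdot> \<theta> = g \<cdot> q"
    by (simp add: \<theta>_def e add_ac)
  finally show ?thesis .
qed

end

section \<open>Exact structures\<close>

lemma (in category) pair_iso_sym:
  assumes "pair_iso C (f, g) (f', g')" "f \<in> Mor C" "g \<in> Mor C" "Cod C f = Dom C g"
  shows "pair_iso C (f', g') (f, g)"
proof -
  obtain a b c where e: "f' \<in> Mor C" "g' \<in> Mor C" "Cod C f' = Dom C g'"
    "iso_mor C a" "Dom C a = Dom C f" "Cod C a = Dom C f'"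
    "iso_mor C b" "Dom C b = Cod C f" "Cod C b = Cod C f'"
    "iso_mor C c" "Dom C c = Cod C g" "Cod C c = Cod C g'"
    "b \<cdot> f = f' \<cdot> a" "c \<cdot> g = g' \<cdot> b"
    using assms(1) by (auto simp: pair_iso_def)
  obtain a' where a': "a \<in> Mor C" "a' \<in> Mor C" "Dom C a' = Cod C a" "Cod C a' = Dom C a"
    "a' \<cdot> a = Idn C (Dom C a)" "a \<cdot> a' = Idn C (Cod C a)" using iso_morE e by blast
  obtain b' where b': "b \<in> Mor C" "b' \<in> Mor C" "Dom C b' = Cod C b" "Cod C b' = Dom C b"
    "b' \<cdot> b = Idn C (Dom C b)" "b \<cdot> b' = Idn C (Cod C b)" using iso_morE e by blast
  obtain c' where c': "c \<in> Mor C" "c' \<in> Mor C" "Dom C c' = Cod C c" "Cod C c' = Dom C c"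
    "c' \<cdot> c = Idn C (Dom C c)" "c \<cdot> c' = Idn C (Cod C c)" using iso_morE e by blast
  note [simp] = assms(2-4) e(1-3,5,6,8,9,11,12) a'(1-4) b'(1-4) c'(1-4)
  have i: "iso_mor C a'" "iso_mor C b'" "iso_mor C c'"
    using iso_morI[of a' a] iso_morI[of b' b] iso_morI[of c' c] a' b' c' by simp_all
  have "b' \<cdot> f' = b' \<cdot> (f' \<cdot> a) \<cdot> a'" using a'(6) by simp
  also have "\<dots> = f \<cdot> a'" unfolding e(13)[symmetric] by (simp add: reassoc[OF b'(5)])
  finally have 1: "b' \<cdot> f' = f \<cdot> a'" .
  have "c' \<cdot> g' = c' \<cdot> (g' \<cdot> b) \<cdot> b'" using b'(6) by simp
  also have "\<dots> = g \<cdot> b'" unfolding e(14)[symmetric] by (simp add: reassoc[OF c'(5)])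
  finally have 2: "c' \<cdot> g' = g \<cdot> b'" .
  show ?thesis unfolding pair_iso_def prod.case
    by (intro conjI bexI[of _ a'] bexI[of _ b'] bexI[of _ c'] i 1 2) simp_all
qed

lemma (in category) pair_iso_op:
  assumes "pair_iso (op_cat C) (g, f) (g', f')" "f \<in> Mor C" "g \<in> Mor C" "Cod C f = Dom C g"
  shows "pair_iso C (f, g) (f', g')"
proof -
  interpret op: category "op_cat C" by (rule category_op)
  have m: "f' \<in> Mor C" "g' \<in> Mor C" "Cod C f' = Dom C g'"
    using assms(1) by (auto simp: pair_iso_def)
  have "pair_iso (op_cat C) (g', f') (g, f)"
    by (rule op.pair_iso_sym) (use assms in simp_all)
  then obtain a b c where
    "a \<in> Hom C (Dom C f) (Dom C f')" "b \<in> Hom C (Cod C f) (Cod C f')" "c \<in> Hom C (Cod C g) (Cod C g')"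
    "iso_mor C a" "iso_mor C b" "iso_mor C c" "f' \<cdot> a = b \<cdot> f" "g' \<cdot> b = c \<cdot> g"
    unfolding pair_iso_def using m assms(4) by (auto simp del: Hom_iff)
  then show ?thesis unfolding pair_iso_def prod.case using m
    by (intro conjI bexI[of _ a] bexI[of _ b] bexI[of _ c]) simp_all
qed

lemma deflations_converse [simp]: "deflations (E\<inverse>) = inflations E"
  by (auto simp: deflations_def inflations_def)

lemma inflations_converse [simp]: "inflations (E\<inverse>) = deflations E"
  by (auto simp: deflations_def inflations_def)

lemma (in preadditive_category) exact_structure_op:
  assumes E: "exact_structure C E" shows "exact_structure (op_cat C) (E\<inverse>)"
proof -
  have k: "\<forall>(f, g)\<in>E\<inverse>. ker_coker_pair (op_cat C) f g"
    using E by (auto simp: exact_structure_def)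
  have i: "\<forall>d\<in>E\<inverse>. \<forall>d'. pair_iso (op_cat C) d d' \<longrightarrow> d' \<in> E\<inverse>"
  proof (intro ballI allI impI)
    fix d d' assume d: "d \<in> E\<inverse>" "pair_iso (op_cat C) d d'"
    obtain f g f' g' where fg: "d = (g, f)" "d' = (g', f')" by (cases d, cases d')
    have "ker_coker_pair C f g" using d(1) fg E by (auto simp: exact_structure_def)
    then have "pair_iso C (f, g) (f', g')"
      using d(2) fg by (intro pair_iso_op) (simp_all add: ker_coker_pairD)
    then have "(f', g') \<in> E" using E d(1) fg unfolding exact_structure_def by blast
    then show "d' \<in> E\<inverse>" using fg by simp
  qed
  have p: "is_pushout (op_cat C) f a f' a' \<longleftrightarrow> is_pullback C f a f' a'" for f a f' a'
    using is_pullback_op[of "op_cat C" f a f' a'] by simp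
  show ?thesis unfolding exact_structure_def[of "op_cat C"]
    by (intro conjI k i; use E[unfolded exact_structure_def] in \<open>simp add: p\<close>)
qed

locale exact_category = additive_category C for C :: "('o, 'm) cat" +
  fixes E :: "('m \<times> 'm) set"
  assumes exact: "exact_structure C E"
begin

lemma pairD: "(f, g) \<in> E \<Longrightarrow> ker_coker_pair C f g"
  using exact by (auto simp: exact_structure_def)

lemma pair_iso_closed: "d \<in> E \<Longrightarrow> pair_iso C d d' \<Longrightarrow> d' \<in> E"
  using exact unfolding exact_structure_def by blast

lemma Idn_deflation: "X \<in> Obj C \<Longrightarrow> Idn C X \<in> deflations E"
  using exact by (auto simp: exact_structure_def)

lemma Idn_inflation: "X \<in> Obj C \<Longrightarrow> Idn C X \<in> inflations E"
  using exact by (auto simp: exact_structure_def)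

lemma deflation_comp:
  "g \<in> deflations E \<Longrightarrow> g' \<in> deflations E \<Longrightarrow> Cod C g = Dom C g' \<Longrightarrow> g' \<cdot> g \<in> deflations E"
  using exact unfolding exact_structure_def by blast

lemma inflation_comp:
  "f \<in> inflations E \<Longrightarrow> f' \<in> inflations E \<Longrightarrow> Cod C f = Dom C f' \<Longrightarrow> f' \<cdot> f \<in> inflations E"
  using exact unfolding exact_structure_def by blast

lemma inflation_pushout:
  "f \<in> inflations E \<Longrightarrow> a \<in> Mor C \<Longrightarrow> Dom C a = Dom C f \<Longrightarrow>
    \<exists>f' a'. is_pushout C f a f' a' \<and> f' \<in> inflations E"
  using exact unfolding exact_structure_def by blast

lemma deflation_pullback:
  "g \<in> deflations E \<Longrightarrow> c \<in> Mor C \<Longrightarrow> Cod C c = Cod C g \<Longrightarrow>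
    \<exists>g' c'. is_pullback C g c g' c' \<and> g' \<in> deflations E"
  using exact unfolding exact_structure_def by blast

lemma deflation_Mor: "g \<in> deflations E \<Longrightarrow> g \<in> Mor C"
  by (auto simp: deflations_def dest!: pairD dest: ker_coker_pairD(2))

lemma pairI_kernel:
  assumes "g \<in> deflations E" "is_kernel C f g" shows "(f, g) \<in> E"
proof -
  obtain f' where f': "(f', g) \<in> E" using assms(1) by (auto simp: deflations_def)
  note F = ker_coker_pairD[OF pairD[OF f']] and K = kernelD[OF assms(2)]
  note [simp] = F(1-3) K(1-3)
  obtain u where u: "iso_mor C u" "Dom C u = Dom C f'" "Cod C u = Dom C f" "f \<cdot> u = f'"
    by (rule kernel_unique[OF assms(2) F(5)])
  have "u \<in> Mor C" using u(1) by (simp add: iso_mor_def)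
  then have "pair_iso C (f', g) (f, g)" unfolding pair_iso_def prod.case using u
    by (intro conjI bexI[of _ u] bexI[of _ "Idn C (Dom C g)"] bexI[of _ "Idn C (Cod C g)"])
      (simp_all add: iso_Idn)
  then show ?thesis using f' pair_iso_closed by blast
qed

lemma exact_category_op: "exact_category (op_cat C) (E\<inverse>)" if "additive_category (op_cat C)"
  using that exact_structure_op[OF exact] by (simp add: exact_category_def exact_category_axioms_def)

end

lemma (in additive_category) additive_op: "additive_category (op_cat C)"
proof (intro additive_category.intro preadditive_op additive_category_axioms.intro)
  fix n :: nat and Y assume "\<forall>k<n. Y k \<in> Obj (op_cat C)"
  then have "\<exists>X i p. direct_sum C X n Y i p" by (intro direct_sums_exist) simp
  then show "\<exists>X i p. direct_sum (op_cat C) X n Y i p" by auto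
qed

lemma (in preadditive_category) null_op [simp]: "preadditive_category.null (op_cat C) Z \<longleftrightarrow> null Z"
  by (simp add: preadditive_category.null_def[OF preadditive_op] null_def)

context exact_category
begin

sublocale deflation_class C "deflations E"
proof
  show "d \<in> Mor C" if "d \<in> deflations E" for d using that by (rule deflation_Mor)
  show "d' \<cdot> d \<in> deflations E" if "d \<in> deflations E" "d' \<in> deflations E" "Cod C d = Dom C d'" for d d'
    using that by (rule deflation_comp)
  show "\<exists>d' c'. is_pullback C d c d' c' \<and> d' \<in> deflations E"
    if "d \<in> deflations E" "c \<in> Mor C" "Cod C c = Cod C d" for d c
    using that by (rule deflation_pullback)
  show "f \<in> deflations E" if f: "iso_mor C f" for f
  proof -
    have fM [simp]: "f \<in> Mor C" using f by (simp add: iso_mor_def)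
    obtain k where k: "(k, Idn C (Dom C f)) \<in> E"
      using Idn_deflation[of "Dom C f"] by (auto simp: deflations_def)
    note [simp] = ker_coker_pairD(1-3)[OF pairD[OF k]]
    have "pair_iso C (k, Idn C (Dom C f)) (k, f)" unfolding pair_iso_def prod.case
      by (intro conjI bexI[of _ "Idn C (Dom C k)"] bexI[of _ "Idn C (Dom C f)"] bexI[of _ f])
        (simp_all add: f iso_Idn)
    from pair_iso_closed[OF k this] show ?thesis by (auto simp: deflations_def)
  qed
  show "r \<in> deflations E" if r: "r \<in> Mor C" "null (Cod C r)" for r
  proof -
    note [simp] = r(1)
    obtain g where g: "(Idn C (Dom C r), g) \<in> E"
      using Idn_inflation[of "Dom C r"] by (auto simp: inflations_def)
    note G = ker_coker_pairD[OF pairD[OF g]]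
    note [simp] = G(2) G(3)[simplified, symmetric]
    have g0: "g = Zero C (Dom C r) (Cod C g)" using G(4) by simp
    have "Idn C (Cod C g) \<cdot> g = Zero C (Cod C g) (Cod C g) \<cdot> g"
      by (subst (1 2 3) g0) simp
    then have "Idn C (Cod C g) = Zero C (Cod C g) (Cod C g)"
      by - (rule epiD[OF G(7)], simp_all)
    then have n: "null (Cod C g)" by (simp add: null_def)
    note n' = null_Dom[OF n] null_Cod[OF n] null_Dom[OF r(2)] null_Cod[OF r(2)]
    define c where "c = Zero C (Cod C g) (Cod C r)"
    have c [simp]: "c \<in> Mor C" "Dom C c = Cod C g" "Cod C c = Cod C r" by (simp_all add: c_def)
    have "iso_mor C c"
      by (rule iso_morI[of _ "Zero C (Cod C r) (Cod C g)"])
        (use n r(2) in \<open>simp_all add: null_def\<close>)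
    moreover have "c \<cdot> g = r" using n'(4)[of "c \<cdot> g"] n'(4)[of r] by simp
    ultimately have "pair_iso C (Idn C (Dom C r), g) (Idn C (Dom C r), r)"
      unfolding pair_iso_def prod.case
      by (intro conjI bexI[of _ "Idn C (Dom C r)"] bexI[of _ c]) (simp_all add: iso_Idn)
    from pair_iso_closed[OF g this] show ?thesis by (auto simp: deflations_def)
  qed
qed

text \<open>
  Exact structures are self-dual, so every fact about deflations gives one about inflations.
\<close>

lemma pairI_cokernel:
  assumes "f \<in> inflations E" "is_cokernel C g f" shows "(f, g) \<in> E"
proof -
  interpret op: exact_category "op_cat C" "E\<inverse>" by (rule exact_category_op[OF additive_op])
  show ?thesis using op.pairI_kernel[of f g] assms by simp
qed

text \<open>
  The obscure axiom. If \<open>g h\<close> is a deflation and \<open>g\<close> has a kernel \<open>k\<close>, then \<open>(x, y) \<mapsto> g y\<close> is a deflation with kernel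
  \<open>1 \<oplus> k\<close>, and \<open>k\<close> is a push-out of the latter.
\<close>

lemma pairI_left_factor:
  assumes gh: "g \<cdot> h \<in> deflations E" and h: "h \<in> Mor C" "Cod C h = Dom C g" and k: "is_kernel C k g"
  shows "(k, g) \<in> E"
proof -
  interpret op: exact_category "op_cat C" "E\<inverse>" by (rule exact_category_op[OF additive_op])
  note K = kernelD[OF k]
  obtain P i j p q where P: "biprod P (Dom C h) (Dom C g) i j p q"
    using biprod_ex[OF Obj_ends(1)[OF h(1)] Obj_ends(1)[OF K(2)]] by blast
  obtain Q i' j' p' q' where Q: "biprod Q (Dom C h) (Dom C k) i' j' p' q'"
    using biprod_ex[OF Obj_ends(1)[OF h(1)] Obj_ends(1)[OF K(1)]] by blast
  note [simp] = K(1-3) h biprodD[OF P] biprodD[OF Q]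
  note e = biprod_eqs[OF P] biprod_eqs[OF Q]
  have m: "g \<cdot> q \<in> deflations E" by (rule D_stably_left_factor[OF gh K(2) h P])
  define \<kappa> where "\<kappa> = i \<cdot> p' \<^bold>+ j \<cdot> k \<cdot> q'"
  have [simp]: "\<kappa> \<in> Mor C" "Dom C \<kappa> = Q" "Cod C \<kappa> = P" by (simp_all add: \<kappa>_def)
  have \<kappa>e: "p \<cdot> \<kappa> = p'" "q \<cdot> \<kappa> = k \<cdot> q'" "\<kappa> \<cdot> j' = j \<cdot> k" "\<kappa> \<cdot> i' = i" by (simp_all add: \<kappa>_def e)
  have \<kappa>x: "p \<cdot> \<kappa> \<cdot> x = p' \<cdot> x" "q \<cdot> \<kappa> \<cdot> x = k \<cdot> q' \<cdot> x" if "x \<in> Mor C" "Cod C x = Q" for x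
    using that by (simp_all add: reassoc[OF \<kappa>e(1)] reassoc[OF \<kappa>e(2)])
  have \<kappa>k: "is_kernel C \<kappa> (g \<cdot> q)"
  proof (rule kernelI)
    show "(g \<cdot> q) \<cdot> \<kappa> = Zero C (Dom C \<kappa>) (Cod C (g \<cdot> q))"
      by (simp add: \<kappa>e reassoc[OF K(4)])
    fix x assume x: "x \<in> Mor C" "Cod C x = Dom C (g \<cdot> q)" "(g \<cdot> q) \<cdot> x = Zero C (Dom C x) (Cod C (g \<cdot> q))"
    then have "\<exists>y. y \<in> Mor C \<and> Dom C y = Dom C x \<and> Cod C y = Dom C k \<and> k \<cdot> y = q \<cdot> x"
      using kernel_ex[OF k, of "q \<cdot> x"] by simp
    then obtain y where y: "y \<in> Mor C" "Dom C y = Dom C x" "Cod C y = Dom C k" "k \<cdot> y = q \<cdot> x" by blast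
    have "\<kappa> \<cdot> (i' \<cdot> p \<cdot> x \<^bold>+ j' \<cdot> y) = x"
      by (rule biprod_joint_mono[OF P]) (use x(1,2) y in \<open>simp_all add: \<kappa>x e\<close>)
    then show "\<exists>u. u \<in> Mor C \<and> Dom C u = Dom C x \<and> Cod C u = Dom C \<kappa> \<and> \<kappa> \<cdot> u = x"
      using x(1,2) y(1-3) by (intro exI[of _ "i' \<cdot> p \<cdot> x \<^bold>+ j' \<cdot> y"]) simp
  next
    fix x y assume xy: "x \<in> Mor C" "y \<in> Mor C" "Dom C x = Dom C y" "Cod C x = Dom C \<kappa>" "Cod C y = Dom C \<kappa>"
      "\<kappa> \<cdot> x = \<kappa> \<cdot> y"
    have "p \<cdot> \<kappa> \<cdot> x = p \<cdot> \<kappa> \<cdot> y" "q \<cdot> \<kappa> \<cdot> x = q \<cdot> \<kappa> \<cdot> y" by (simp_all only: xy(6))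
    then have pq: "p' \<cdot> x = p' \<cdot> y" "k \<cdot> q' \<cdot> x = k \<cdot> q' \<cdot> y" using xy(1-5) by (simp_all add: \<kappa>x)
    have "q' \<cdot> x = q' \<cdot> y" by (rule kernel_mono[OF k]) (use xy(1-5) pq in simp_all)
    then show "x = y" using pq(1) xy(1-5) by - (rule biprod_joint_mono[OF Q], simp_all)
  qed simp_all
  have \<kappa>E: "(\<kappa>, g \<cdot> q) \<in> E" by (rule pairI_kernel[OF m \<kappa>k])
  have qe: "epi q" by (rule split_epi_epi[of _ j]) (simp_all add: e)
  have "is_pushout C \<kappa> q' k q"
  proof (rule pushoutI)
    show "k \<cdot> q' = q \<cdot> \<kappa>" by (simp add: \<kappa>e)
    fix s t assume st: "s \<in> Mor C" "t \<in> Mor C" "Cod C s = Cod C t" "Dom C s = Cod C q'"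
      "Dom C t = Cod C \<kappa>" "s \<cdot> q' = t \<cdot> \<kappa>"
    have "t \<cdot> j \<cdot> k = (t \<cdot> \<kappa>) \<cdot> j'" using st(1-5) by (simp add: \<kappa>e)
    also have "\<dots> = s" unfolding st(6)[symmetric] using st(1-5) by (simp add: e)
    finally have 1: "t \<cdot> j \<cdot> k = s" .
    have "t \<cdot> i = (t \<cdot> \<kappa>) \<cdot> i'" using st(1-5) by (simp add: \<kappa>e)
    also have "\<dots> = Zero C (Dom C h) (Cod C t)" unfolding st(6)[symmetric] using st(1-5) by (simp add: e)
    finally have ti: "t \<cdot> i = Zero C (Dom C h) (Cod C t)" .
    have "(t \<cdot> j) \<cdot> q = t"
      by (rule biprod_joint_epi[OF P]) (use st(1-5) ti in \<open>simp_all add: e\<close>)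
    then show "\<exists>u. u \<in> Mor C \<and> Cod C u = Cod C t \<and> Dom C u = Cod C q \<and> u \<cdot> k = s \<and> u \<cdot> q = t"
      using st(1-5) 1 by (intro exI[of _ "t \<cdot> j"]) simp
  next
    fix x y assume "x \<in> Mor C" "y \<in> Mor C" "Cod C x = Cod C y" "Dom C x = Cod C q" "Dom C y = Cod C q"
      "x \<cdot> k = y \<cdot> k" "x \<cdot> q = y \<cdot> q"
    then show "x = y" by - (rule epiD[OF qe], simp_all)
  qed simp_all
  moreover have "\<kappa> \<in> deflations (E\<inverse>)" using \<kappa>E by (auto simp: deflations_def)
  ultimately have "k \<in> deflations (E\<inverse>)" using op.D_any_pullback[of \<kappa> q' k q] by simp
  then have "k \<in> inflations E" by simp
  moreover have "ker_coker_pair C k g"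
    by (rule ker_coker_pair_factor[OF pairD[OF \<kappa>E] refl K(2) _ qe k]) simp
  ultimately show ?thesis by (intro pairI_cokernel) (simp_all add: ker_coker_pair_def)
qed

end

section \<open>The maximal exact structure\<close>

locale weakly_idempotent_complete = additive_category C for C :: "('o, 'm) cat" +
  assumes split_epi_kernel: "r \<in> Mor C \<Longrightarrow> s \<in> Mor C \<Longrightarrow> Dom C s = Cod C r \<Longrightarrow> Cod C s = Dom C r \<Longrightarrow>
    r \<cdot> s = Idn C (Cod C r) \<Longrightarrow> \<exists>k. is_kernel C k r"

text \<open>
  The map \<open>\<pi>\<close> is the projection to the complement of the direct summand split off by \<open>s\<close>.
\<close>

lemma (in preadditive_category) kernel_of_split_epi:
  assumes k: "is_kernel C k r" and s: "s \<in> Mor C" "Dom C s = Cod C r" "Cod C s = Dom C r"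
    "r \<cdot> s = Idn C (Cod C r)"
  obtains \<pi> where "\<pi> \<in> Mor C" "Dom C \<pi> = Dom C r" "Cod C \<pi> = Dom C k" "\<pi> \<cdot> k = Idn C (Dom C k)"
    "k \<cdot> \<pi> = Idn C (Dom C r) \<^bold>+ neg (s \<cdot> r)" "\<pi> \<cdot> s = Zero C (Cod C r) (Dom C k)"
proof -
  note K = kernelD[OF k]
  note [simp] = K(1-3) s(1-3)
  have "r \<cdot> (Idn C (Dom C r) \<^bold>+ neg (s \<cdot> r)) = Zero C (Dom C r) (Cod C r)"
    by (simp add: reassoc[OF s(4)])
  then have "\<exists>\<pi>. \<pi> \<in> Mor C \<and> Dom C \<pi> = Dom C r \<and> Cod C \<pi> = Dom C k \<and>
      k \<cdot> \<pi> = Idn C (Dom C r) \<^bold>+ neg (s \<cdot> r)"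
    using kernel_ex[OF k, of "Idn C (Dom C r) \<^bold>+ neg (s \<cdot> r)"] by simp
  then obtain \<pi> where \<pi>: "\<pi> \<in> Mor C" "Dom C \<pi> = Dom C r" "Cod C \<pi> = Dom C k"
    "k \<cdot> \<pi> = Idn C (Dom C r) \<^bold>+ neg (s \<cdot> r)" by blast
  have "\<pi> \<cdot> k = Idn C (Dom C k)"
    by (rule kernel_mono[OF k]) (use \<pi>(1-3) in \<open>simp_all add: reassoc[OF \<pi>(4)] K(4)\<close>)
  moreover have "\<pi> \<cdot> s = Zero C (Cod C r) (Dom C k)"
    by (rule kernel_mono[OF k]) (use \<pi>(1-3) in \<open>simp_all add: reassoc[OF \<pi>(4)] s(4)\<close>)
  ultimately show thesis using that \<pi> by blast
qed

lemma (in weakly_idempotent_complete) weakly_idempotent_complete_op: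
  "weakly_idempotent_complete (op_cat C)"
proof (intro weakly_idempotent_complete.intro additive_op weakly_idempotent_complete_axioms.intro)
  fix s r assume "s \<in> Mor (op_cat C)" "r \<in> Mor (op_cat C)" "Dom (op_cat C) r = Cod (op_cat C) s"
    "Cod (op_cat C) r = Dom (op_cat C) s" "Comp (op_cat C) s r = Idn (op_cat C) (Cod (op_cat C) s)"
  then have rs: "s \<in> Mor C" "r \<in> Mor C" "Cod C r = Dom C s" "Dom C r = Cod C s" "r \<cdot> s = Idn C (Cod C r)"
    by simp_all
  note [simp] = rs(1-4)
  obtain k where k: "is_kernel C k r" using split_epi_kernel[of r s] rs by auto
  note K [simp] = kernelD(1-3)[OF k]
  obtain \<pi> where \<pi>: "\<pi> \<in> Mor C" "Dom C \<pi> = Dom C r" "Cod C \<pi> = Dom C k" "\<pi> \<cdot> k = Idn C (Dom C k)"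
    "k \<cdot> \<pi> = Idn C (Dom C r) \<^bold>+ neg (s \<cdot> r)" "\<pi> \<cdot> s = Zero C (Cod C r) (Dom C k)"
    by (rule kernel_of_split_epi[OF k, of s]) (use rs in simp_all)
  have "is_cokernel C \<pi> s"
  proof (rule cokernelI)
    fix h assume h: "h \<in> Mor C" "Dom C h = Cod C s" "h \<cdot> s = Zero C (Dom C s) (Cod C h)"
    have "(h \<cdot> k) \<cdot> \<pi> = h" using h \<pi>(1-3) by (simp add: \<pi>(5) reassoc[OF h(3)])
    then show "\<exists>u. u \<in> Mor C \<and> Cod C u = Cod C h \<and> Dom C u = Cod C \<pi> \<and> u \<cdot> \<pi> = h"
      using h(1,2) \<pi>(3) by (intro exI[of _ "h \<cdot> k"]) simp
  next
    show "epi \<pi>" by (rule split_epi_epi[of _ k]) (use \<pi>(1-4) in simp_all)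
  qed (use \<pi>(1-3,6) in simp_all)
  then show "\<exists>k. is_kernel (op_cat C) k s" by auto
qed

text \<open>
  In the opposite category these are the maps all of whose push-outs exist and are kernels.
\<close>

definition semistable_deflations :: "('o, 'm) cat \<Rightarrow> 'm set" where
  "semistable_deflations C = {d \<in> Mor C. \<forall>c\<in>Mor C. Cod C c = Cod C d \<longrightarrow>
     (\<exists>d' c' k. is_pullback C d c d' c' \<and> ker_coker_pair C k d')}"

definition stable_pairs :: "('o, 'm) cat \<Rightarrow> ('m \<times> 'm) set" where
  "stable_pairs C = {(f, g). ker_coker_pair C f g \<and> f \<in> semistable_deflations (op_cat C) \<and>
     g \<in> semistable_deflations C}"

text \<open>
  Pull-backs along composites give pull-backs of pull-backs, so that stability under pull-back
  only has to be required once in the definition of semistable deflations.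
\<close>

lemma (in category) pullback_cancel:
  assumes p: "is_pullback C g c g' c'" and q: "is_pullback C g (c \<cdot> b) e w"
    and b: "b \<in> Mor C" "Cod C b = Dom C c"
  obtains b' where "is_pullback C g' b e b'" "c' \<cdot> b' = w"
proof -
  note P = pullbackD[OF p] and Q = pullbackD[OF q]
  note [simp] = P(1-8) b Q(1,3,4) Q(5)[simplified] Q(6)[simplified] Q(7,8)
  have "\<exists>u. u \<in> Mor C \<and> Dom C u = Dom C w \<and> Cod C u = Dom C c' \<and> g' \<cdot> u = b \<cdot> e \<and> c' \<cdot> u = w"
    using pullback_ex[OF p, of "b \<cdot> e" w] Q(9) by simp
  then obtain b' where b': "b' \<in> Mor C" "Dom C b' = Dom C w" "Cod C b' = Dom C c'"
    "g' \<cdot> b' = b \<cdot> e" "c' \<cdot> b' = w" by blast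
  note [simp] = b'(1-3)
  have "is_pullback C g' b e b'"
  proof (rule pullbackI)
    fix s t assume st: "s \<in> Mor C" "t \<in> Mor C" "Dom C s = Dom C t" "Cod C s = Dom C b" "Cod C t = Dom C g'"
      "b \<cdot> s = g' \<cdot> t"
    have "(c \<cdot> b) \<cdot> s = g \<cdot> c' \<cdot> t" using st by (simp add: reassoc[OF P(9)])
    then have "\<exists>u. u \<in> Mor C \<and> Dom C u = Dom C t \<and> Cod C u = Dom C w \<and> e \<cdot> u = s \<and> w \<cdot> u = c' \<cdot> t"
      using pullback_ex[OF q, of s "c' \<cdot> t"] st(1-5) by simp
    then obtain u where u: "u \<in> Mor C" "Dom C u = Dom C t" "Cod C u = Dom C w" "e \<cdot> u = s" "w \<cdot> u = c' \<cdot> t"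
      by blast
    have "b' \<cdot> u = t"
      by (rule pullback_joint_mono[OF p])
        (use st u in \<open>simp_all add: reassoc[OF b'(4)] reassoc[OF b'(5)]\<close>)
    then show "\<exists>u. u \<in> Mor C \<and> Dom C u = Dom C t \<and> Cod C u = Dom C b' \<and> e \<cdot> u = s \<and> b' \<cdot> u = t"
      using u by (intro exI[of _ u]) simp
  next
    fix x y assume xy: "x \<in> Mor C" "y \<in> Mor C" "Dom C x = Dom C y" "Cod C x = Dom C b'" "Cod C y = Dom C b'"
      "e \<cdot> x = e \<cdot> y" "b' \<cdot> x = b' \<cdot> y"
    have "c' \<cdot> b' \<cdot> x = c' \<cdot> b' \<cdot> y" by (simp only: xy(7))
    then have "w \<cdot> x = w \<cdot> y" using xy(1-5) by (simp add: reassoc[OF b'(5)])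
    then show "x = y" using xy(1-6) by - (rule pullback_joint_mono[OF q], simp_all)
  qed (use b'(4) in simp_all)
  then show thesis using that b'(5) by blast
qed

context additive_category
begin

lemma ker_coker_Idn: "null Z \<Longrightarrow> X \<in> Obj C \<Longrightarrow> ker_coker_pair C (Zero C Z X) (Idn C X)"
proof -
  assume Z: "null Z" and X [simp]: "X \<in> Obj C"
  have Z' [simp]: "Z \<in> Obj C" using Z by (simp add: null_def)
  have "is_kernel C (Zero C Z X) (Idn C X)"
  proof (rule kernelI)
    fix h assume "h \<in> Mor C" "Cod C h = Dom C (Idn C X)"
      "Idn C X \<cdot> h = Zero C (Dom C h) (Cod C (Idn C X))"
    then show "\<exists>u. u \<in> Mor C \<and> Dom C u = Dom C h \<and> Cod C u = Dom C (Zero C Z X) \<and> Zero C Z X \<cdot> u = h"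
      by (intro exI[of _ "Zero C (Dom C h) Z"]) simp
  next
    fix x y assume "x \<in> Mor C" "y \<in> Mor C" "Dom C x = Dom C y" "Cod C x = Dom C (Zero C Z X)"
      "Cod C y = Dom C (Zero C Z X)"
    then show "x = y" using null_Cod[OF Z, of x] null_Cod[OF Z, of y] by simp
  qed simp_all
  moreover have "is_cokernel C (Idn C X) (Zero C Z X)"
  proof (rule cokernelI)
    show "epi (Idn C X)" by (rule split_epi_epi[of _ "Idn C X"]) simp_all
    show "\<exists>u. u \<in> Mor C \<and> Cod C u = Cod C h \<and> Dom C u = Cod C (Idn C X) \<and> u \<cdot> Idn C X = h"
      if "h \<in> Mor C" "Dom C h = Cod C (Zero C Z X)" for h
      using that by (intro exI[of _ h]) simp
  qed simp_all
  ultimately show ?thesis by (simp add: ker_coker_pair_def)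
qed

lemma ker_coker_biprod:
  assumes P: "biprod P X Y i j p q" shows "ker_coker_pair C j p"
proof -
  note [simp] = biprodD[OF P]
  note e = biprod_eqs[OF P]
  have "is_kernel C j p"
  proof (rule kernelI)
    fix h assume h: "h \<in> Mor C" "Cod C h = Dom C p" "p \<cdot> h = Zero C (Dom C h) (Cod C p)"
    have "j \<cdot> q \<cdot> h = h" using biprod_sum[OF P, of h] h by simp
    then show "\<exists>u. u \<in> Mor C \<and> Dom C u = Dom C h \<and> Cod C u = Dom C j \<and> j \<cdot> u = h"
      using h by (intro exI[of _ "q \<cdot> h"]) simp
  next
    fix x y assume xy: "x \<in> Mor C" "y \<in> Mor C" "Dom C x = Dom C y" "Cod C x = Dom C j" "Cod C y = Dom C j"
      "j \<cdot> x = j \<cdot> y"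
    then have "q \<cdot> j \<cdot> x = q \<cdot> j \<cdot> y" by simp
    then show "x = y" using xy(1-5) by (simp add: e)
  qed (simp_all add: e)
  moreover have "is_cokernel C p j"
  proof (rule cokernelI)
    show "epi p" by (rule split_epi_epi[of _ i]) (simp_all add: e)
  next
    fix h assume h: "h \<in> Mor C" "Dom C h = Cod C j" "h \<cdot> j = Zero C (Dom C j) (Cod C h)"
    have "(h \<cdot> i) \<cdot> p = h"
      by (rule biprod_joint_epi[OF P]) (use h in \<open>simp_all add: e\<close>)
    then show "\<exists>u. u \<in> Mor C \<and> Cod C u = Cod C h \<and> Dom C u = Cod C p \<and> u \<cdot> p = h"
      using h by (intro exI[of _ "h \<cdot> i"]) simp
  qed (simp_all add: e)
  ultimately show ?thesis by (simp add: ker_coker_pair_def)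
qed

lemma semistable_pullback:
  assumes d: "d \<in> semistable_deflations C" and p: "is_pullback C d c d' c'"
  shows "d' \<in> semistable_deflations C"
proof -
  note P = pullbackD[OF p]
  have "\<exists>e b' k. is_pullback C d' b e b' \<and> ker_coker_pair C k e"
    if b: "b \<in> Mor C" "Cod C b = Cod C d'" for b
  proof -
    have "c \<cdot> b \<in> Mor C" "Cod C (c \<cdot> b) = Cod C d" using P b by simp_all
    then obtain e w k where e: "is_pullback C d (c \<cdot> b) e w" "ker_coker_pair C k e"
      using d unfolding semistable_deflations_def by blast
    obtain b' where "is_pullback C d' b e b'"
      by (rule pullback_cancel[OF p e(1) b(1)]) (use P b in simp_all)
    then show ?thesis using e(2) by blast
  qed
  then show ?thesis using P(3) by (simp add: semistable_deflations_def)
qed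

lemma semistable_ker_coker:
  assumes d: "d \<in> semistable_deflations C" obtains k where "ker_coker_pair C k d"
proof -
  have dM [simp]: "d \<in> Mor C" using d by (simp add: semistable_deflations_def)
  have "Idn C (Cod C d) \<in> Mor C" "Cod C (Idn C (Cod C d)) = Cod C d" by simp_all
  then obtain d' c' k where p: "is_pullback C d (Idn C (Cod C d)) d' c'" and k: "ker_coker_pair C k d'"
    using d unfolding semistable_deflations_def by blast
  note P = pullbackD[OF p]
  note [simp] = P(3,4) P(6,7,8)[simplified]
  have "\<exists>u. u \<in> Mor C \<and> Dom C u = Dom C d \<and> Cod C u = Dom C c' \<and> d' \<cdot> u = d \<and> c' \<cdot> u = Idn C (Dom C d)"
    using pullback_ex[OF p, of d "Idn C (Dom C d)"] by simp
  then obtain u where u: "u \<in> Mor C" "Dom C u = Dom C d" "Cod C u = Dom C c'" "c' \<cdot> u = Idn C (Dom C d)"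
    by blast
  have "epi c'" by (rule split_epi_epi[of _ u]) (use u in simp_all)
  moreover have "is_kernel C (c' \<cdot> k) d" by (rule kernel_of_pullback[OF p ker_coker_pairD(5)[OF k]])
  moreover have "d \<cdot> c' = d'" using P(9) by simp
  ultimately show thesis using that[of "c' \<cdot> k"] ker_coker_pair_factor[OF k, of d c' "c' \<cdot> k"] by simp
qed

lemma semistable_Mor: "d \<in> semistable_deflations C \<Longrightarrow> d \<in> Mor C"
  by (simp add: semistable_deflations_def)

lemma semistable_ex_pullback:
  assumes "d \<in> semistable_deflations C" "c \<in> Mor C" "Cod C c = Cod C d"
  obtains d' c' where "is_pullback C d c d' c'" "d' \<in> semistable_deflations C"
proof -
  obtain d' c' where "is_pullback C d c d' c'"
    using assms unfolding semistable_deflations_def by blast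
  then show thesis using that semistable_pullback assms(1) by blast
qed

lemma semistableI:
  assumes "d \<in> Mor C" "\<And>c. c \<in> Mor C \<Longrightarrow> Cod C c = Cod C d \<Longrightarrow>
    \<exists>d' c' k. is_pullback C d c d' c' \<and> ker_coker_pair C k d'"
  shows "d \<in> semistable_deflations C"
  using assms by (simp add: semistable_deflations_def)

text \<open>
  Semistable deflations compose because the pull-back of \<open>d\<close> along the kernel of \<open>d'\<close> is epic.
\<close>

lemma deflation_class_semistable: "deflation_class C (semistable_deflations C)"
proof
  show "d \<in> Mor C" if "d \<in> semistable_deflations C" for d using that by (rule semistable_Mor)
  show "\<exists>d' c'. is_pullback C d c d' c' \<and> d' \<in> semistable_deflations C"
    if "d \<in> semistable_deflations C" "c \<in> Mor C" "Cod C c = Cod C d" for d c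
    by (rule semistable_ex_pullback[OF that]) blast
  obtain Z where Z: "null Z" using null_ex by blast
  show "f \<in> semistable_deflations C" if f: "iso_mor C f" for f
  proof (rule semistableI)
    show "f \<in> Mor C" using f by (simp add: iso_mor_def)
    fix c assume c: "c \<in> Mor C" "Cod C c = Cod C f"
    obtain c' where "is_pullback C f c (Idn C (Dom C c)) c'" by (rule iso_pullback[OF f c])
    moreover have "ker_coker_pair C (Zero C Z (Dom C c)) (Idn C (Dom C c))"
      using Z c by (intro ker_coker_Idn) simp_all
    ultimately show "\<exists>d' c' k. is_pullback C f c d' c' \<and> ker_coker_pair C k d'" by blast
  qed
  show "r \<in> semistable_deflations C" if r: "r \<in> Mor C" "null (Cod C r)" for r
  proof (rule semistableI)
    fix c assume c: "c \<in> Mor C" "Cod C c = Cod C r"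
    obtain P i j p q where P: "biprod P (Dom C c) (Dom C r) i j p q"
      using biprod_ex[OF Obj_ends(1)[OF c(1)] Obj_ends(1)[OF r(1)]] by blast
    show "\<exists>d' c' k. is_pullback C r c d' c' \<and> ker_coker_pair C k d'"
      using null_pullback[OF r c P] ker_coker_biprod[OF P] by blast
  qed (rule r)
  show "d' \<cdot> d \<in> semistable_deflations C"
    if d: "d \<in> semistable_deflations C" "d' \<in> semistable_deflations C" "Cod C d = Dom C d'" for d d'
  proof (rule semistableI)
    note m [simp] = semistable_Mor[OF d(1)] semistable_Mor[OF d(2)] d(3)
    show "d' \<cdot> d \<in> Mor C" by simp
    fix c assume c: "c \<in> Mor C" "Cod C c = Cod C (d' \<cdot> d)"
    obtain e' c1 where e': "is_pullback C d' c e' c1" "e' \<in> semistable_deflations C"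
      by (rule semistable_ex_pullback[OF d(2) c(1)]) (use c in simp_all)
    obtain e c2 where e: "is_pullback C d c1 e c2" "e \<in> semistable_deflations C"
      by (rule semistable_ex_pullback[OF d(1), of c1]) (use pullbackD[OF e'(1)] in simp_all)
    obtain k' where k': "ker_coker_pair C k' e'" by (rule semistable_ker_coker[OF e'(2)])
    obtain k where k: "ker_coker_pair C k e" by (rule semistable_ker_coker[OF e(2)])
    have ee: "Cod C e = Dom C e'" using pullbackD[OF e(1)] pullbackD[OF e'(1)] by simp
    obtain p j where p: "is_pullback C e k' p j" "p \<in> semistable_deflations C"
      by (rule semistable_ex_pullback[OF e(2), of k']) (use ee ker_coker_pairD[OF k'] in simp_all)
    obtain l where l: "ker_coker_pair C l p" by (rule semistable_ker_coker[OF p(2)])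
    have "ker_coker_pair C j (e' \<cdot> e)"
      by (rule ker_coker_pair_comp[OF k k' ee p(1) ker_coker_pairD(7)[OF l]])
    then show "\<exists>e c' k. is_pullback C (d' \<cdot> d) c e c' \<and> ker_coker_pair C k e"
      using pullback_paste[OF e'(1) e(1)] by blast
  qed
qed

end

context weakly_idempotent_complete
begin

text \<open>
  The pull-back of \<open>(x, y) \<mapsto> g y\<close> along \<open>c\<close> has \<open>X\<close> as a direct summand; its complement, which
  exists by weak idempotent completeness, is the pull-back of \<open>g\<close> along \<open>c\<close>.
\<close>

lemma semistable_left_factor:
  assumes gh: "g \<cdot> h \<in> semistable_deflations C" and h: "h \<in> Mor C" "Cod C h = Dom C g"
    and k: "is_kernel C k g"
  shows "g \<in> semistable_deflations C"
proof (rule semistableI)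
  interpret S: deflation_class C "semistable_deflations C" by (rule deflation_class_semistable)
  note K = kernelD[OF k]
  obtain P i j p q where P: "biprod P (Dom C h) (Dom C g) i j p q"
    using biprod_ex[OF Obj_ends(1)[OF h(1)] Obj_ends(1)[OF K(2)]] by blast
  note [simp] = K(1-3) h biprodD[OF P]
  note e = biprod_eqs[OF P]
  show "g \<in> Mor C" by simp
  have m: "g \<cdot> q \<in> semistable_deflations C" by (rule S.D_stably_left_factor[OF gh K(2) h P])
  fix c assume c [simp]: "c \<in> Mor C" "Cod C c = Cod C g"
  obtain f w where f: "is_pullback C (g \<cdot> q) c f w" "f \<in> semistable_deflations C"
    by (rule semistable_ex_pullback[OF m, of c]) simp_all
  obtain l where l: "ker_coker_pair C l f" by (rule semistable_ker_coker[OF f(2)])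
  note F = pullbackD[OF f(1)]
  note [simp] = F(3,4) F(6-8)[simplified]
  have "\<exists>\<sigma>. \<sigma> \<in> Mor C \<and> Dom C \<sigma> = Dom C h \<and> Cod C \<sigma> = Dom C w \<and>
      f \<cdot> \<sigma> = Zero C (Dom C h) (Dom C c) \<and> w \<cdot> \<sigma> = i"
    using pullback_ex[OF f(1), of "Zero C (Dom C h) (Dom C c)" i] by (simp add: e)
  then obtain \<sigma> where \<sigma>: "\<sigma> \<in> Mor C" "Dom C \<sigma> = Dom C h" "Cod C \<sigma> = Dom C w"
    "f \<cdot> \<sigma> = Zero C (Dom C h) (Dom C c)" "w \<cdot> \<sigma> = i" by blast
  note [simp] = \<sigma>(1-3)
  have ps: "(p \<cdot> w) \<cdot> \<sigma> = Idn C (Cod C (p \<cdot> w))" by (simp add: \<sigma>(5) e)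
  obtain t where t: "is_kernel C t (p \<cdot> w)"
    using split_epi_kernel[of "p \<cdot> w" \<sigma>] ps by auto
  obtain \<pi> where \<pi>: "\<pi> \<in> Mor C" "Dom C \<pi> = Dom C (p \<cdot> w)" "Cod C \<pi> = Dom C t" "\<pi> \<cdot> t = Idn C (Dom C t)"
    "t \<cdot> \<pi> = Idn C (Dom C (p \<cdot> w)) \<^bold>+ neg (\<sigma> \<cdot> p \<cdot> w)"
    by (rule kernel_of_split_epi[OF t, of \<sigma>]) (use ps in simp_all)
  note T = kernelD[OF t]
  note [simp] = T(1) T(3)[simplified] \<pi>(1) \<pi>(2)[simplified] \<pi>(3)
  have pwt: "p \<cdot> w \<cdot> t = Zero C (Dom C t) (Dom C h)" using T(4) by simp
  have pb: "is_pullback C g c (f \<cdot> t) (q \<cdot> w \<cdot> t)"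
  proof (rule pullbackI)
    show "c \<cdot> f \<cdot> t = g \<cdot> q \<cdot> w \<cdot> t" using F(9) by (simp add: reassoc[OF F(9)])
    fix s y assume sy: "s \<in> Mor C" "y \<in> Mor C" "Dom C s = Dom C y" "Cod C s = Dom C c" "Cod C y = Dom C g"
      "c \<cdot> s = g \<cdot> y"
    then have "\<exists>v. v \<in> Mor C \<and> Dom C v = Dom C y \<and> Cod C v = Dom C w \<and> f \<cdot> v = s \<and> w \<cdot> v = j \<cdot> y"
      using pullback_ex[OF f(1), of s "j \<cdot> y"] by (simp add: e)
    then obtain v where v: "v \<in> Mor C" "Dom C v = Dom C y" "Cod C v = Dom C w" "f \<cdot> v = s" "w \<cdot> v = j \<cdot> y"
      by blast
    have "\<exists>u. u \<in> Mor C \<and> Dom C u = Dom C y \<and> Cod C u = Dom C t \<and> t \<cdot> u = v"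
      using kernel_ex[OF t, of v] v sy(1-5) by (simp add: e)
    then obtain u where u: "u \<in> Mor C" "Dom C u = Dom C y" "Cod C u = Dom C t" "t \<cdot> u = v" by blast
    then show "\<exists>u. u \<in> Mor C \<and> Dom C u = Dom C y \<and> Cod C u = Dom C (q \<cdot> w \<cdot> t) \<and> (f \<cdot> t) \<cdot> u = s \<and>
        (q \<cdot> w \<cdot> t) \<cdot> u = y"
      using v sy(1-5) by (intro exI[of _ u]) (simp add: e)
  next
    fix x y assume xy: "x \<in> Mor C" "y \<in> Mor C" "Dom C x = Dom C y" "Cod C x = Dom C (q \<cdot> w \<cdot> t)"
      "Cod C y = Dom C (q \<cdot> w \<cdot> t)" "(f \<cdot> t) \<cdot> x = (f \<cdot> t) \<cdot> y" "(q \<cdot> w \<cdot> t) \<cdot> x = (q \<cdot> w \<cdot> t) \<cdot> y"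
    have pz: "p \<cdot> w \<cdot> t \<cdot> z = Zero C (Dom C z) (Dom C h)" if "z \<in> Mor C" "Cod C z = Dom C t" for z
      using reassoc[OF pwt, of z] that by simp
    have "w \<cdot> t \<cdot> x = w \<cdot> t \<cdot> y"
      by (rule biprod_joint_mono[OF P]) (use xy in \<open>simp_all add: pz\<close>)
    then have "t \<cdot> x = t \<cdot> y" using xy(1-6) by - (rule pullback_joint_mono[OF f(1)], simp_all)
    then show "x = y" using xy(1-5) by - (rule kernel_mono[OF t], simp_all)
  qed simp_all
  have "(f \<cdot> t) \<cdot> \<pi> = f" by (simp add: \<pi>(5) reassoc[OF \<sigma>(4)])
  moreover have "epi \<pi>" by (rule split_epi_epi[of _ t]) (use \<pi>(4) in simp_all)
  moreover obtain \<kappa> where "is_kernel C \<kappa> (f \<cdot> t)" by (rule pullback_of_kernel[OF pb k])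
  ultimately have "ker_coker_pair C \<kappa> (f \<cdot> t)"
    using ker_coker_pair_factor[OF l, of "f \<cdot> t" \<pi>] by simp
  then show "\<exists>d' c' k. is_pullback C g c d' c' \<and> ker_coker_pair C k d'" using pb by blast
qed

end

lemma stable_pairs_op: "stable_pairs (op_cat C) = (stable_pairs C)\<inverse>"
  by (auto simp: stable_pairs_def)

lemma (in preadditive_category) ker_coker_pair_kernel:
  assumes "ker_coker_pair C k d" "is_kernel C k' d" shows "ker_coker_pair C k' d"
proof -
  note D = ker_coker_pairD[OF assms(1)]
  have "epi (Idn C (Dom C d))"
    by (rule split_epi_epi[of _ "Idn C (Dom C d)"]) (use D(2) in simp_all)
  then show ?thesis
    using ker_coker_pair_factor[OF assms(1), of d "Idn C (Dom C d)" k'] D(2) assms(2) by simp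
qed

context weakly_idempotent_complete
begin

lemma deflation_class_semistable_op: "deflation_class (op_cat C) (semistable_deflations (op_cat C))"
  by (rule additive_category.deflation_class_semistable[OF additive_op])

text \<open>
  The dual of \<open>semistable_left_factor\<close>; it is what keeps kernels of pull-backs and of composites
  of deflations semistable.
\<close>

lemma semistable_right_factor:
  assumes "h \<cdot> f \<in> semistable_deflations (op_cat C)" "h \<in> Mor C" "Dom C h = Cod C f" "is_cokernel C g f"
  shows "f \<in> semistable_deflations (op_cat C)"
proof -
  interpret op: weakly_idempotent_complete "op_cat C" by (rule weakly_idempotent_complete_op)
  show ?thesis using op.semistable_left_factor[of f h g] assms by simp
qed

text \<open>
  The kernel \<open>P \<rightarrow> X\<close> of a composite deflation \<open>X \<rightarrow> Y \<rightarrow> Z\<close> is the pull-back of the kernel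
  \<open>K \<rightarrow> Y\<close> of the second factor. It is an inflation because its composite with \<open>(1, d) : X \<rightarrow> X \<oplus> Y\<close>
  is also the composite \<open>P \<rightarrow> X \<oplus> K \<rightarrow> X \<oplus> Y\<close> of a push-out of the kernel of the first factor and a
  push-out of \<open>K \<rightarrow> Y\<close>.
\<close>

lemma stable_pairs_comp:
  assumes s: "(i, d) \<in> stable_pairs C" and s': "(i', d') \<in> stable_pairs C" and dd: "Cod C d = Dom C d'"
  shows "\<exists>j. (j, d' \<cdot> d) \<in> stable_pairs C"
proof -
  interpret S: deflation_class C "semistable_deflations C" by (rule deflation_class_semistable)
  interpret I: deflation_class "op_cat C" "semistable_deflations (op_cat C)"
    by (rule deflation_class_semistable_op)
  have A: "ker_coker_pair C i d" "i \<in> semistable_deflations (op_cat C)" "d \<in> semistable_deflations C"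
    using s by (simp_all add: stable_pairs_def)
  have A': "ker_coker_pair C i' d'" "i' \<in> semistable_deflations (op_cat C)" "d' \<in> semistable_deflations C"
    using s' by (simp_all add: stable_pairs_def)
  note K = ker_coker_pairD[OF A(1)] and K' = ker_coker_pairD[OF A'(1)]
  note [simp] = K(1-3) K'(1-3) dd
  obtain r j where pb: "is_pullback C d i' r j" "r \<in> semistable_deflations C"
    by (rule semistable_ex_pullback[OF A(3), of i']) simp_all
  note P = pullbackD[OF pb(1)]
  note [simp] = P(3,4) P(6,7,8)[simplified]
  obtain k0 where k0: "ker_coker_pair C k0 r" by (rule semistable_ker_coker[OF pb(2)])
  obtain k where k: "is_kernel C k r" "j \<cdot> k = i" "Dom C k = Dom C i"
    by (rule pullback_of_kernel[OF pb(1) K(5)])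
  note R = ker_coker_pairD[OF ker_coker_pair_kernel[OF k0 k(1)]]
  have j: "ker_coker_pair C j (d' \<cdot> d)" by (rule ker_coker_pair_comp[OF A(1) A'(1) dd pb(1) R(7)])
  note [simp] = R(1) R(3)[simplified] k(3)
  obtain Q a b pa qb where Q: "biprod Q (Dom C d) (Dom C i') a b pa qb"
    using biprod_ex[OF Obj_ends(1)[OF K(2)] Obj_ends(1)[OF K'(1)]] by blast
  obtain U a' b' pa' qb' where U: "biprod U (Dom C d) (Dom C d') a' b' pa' qb'"
    using biprod_ex[OF Obj_ends(1)[OF K(2)] Obj_ends(1)[OF K'(2)]] by blast
  note [simp] = biprodD[OF Q] biprodD[OF U]
  note e = biprod_eqs[OF Q] biprod_eqs[OF U]
  \<comment> \<open>The two maps \<open>m : P \<rightarrow> X \<oplus> K\<close> and \<open>n : X \<oplus> K \<rightarrow> X \<oplus> Y\<close> of the factorization.\<close>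
  define m where "m = a \<cdot> j \<^bold>+ b \<cdot> r"
  define n where "n = a' \<cdot> pa \<^bold>+ b' \<cdot> i' \<cdot> qb"
  have [simp]: "m \<in> Mor C" "Dom C m = Dom C j" "Cod C m = Q" "n \<in> Mor C" "Dom C n = Q" "Cod C n = U"
    by (simp_all add: m_def n_def)
  have "is_pushout C i k m a"
  proof (rule pushoutI)
    show "m \<cdot> k = a \<cdot> i" using R(4) by (simp add: m_def k(2))
    fix s t assume st: "s \<in> Mor C" "t \<in> Mor C" "Cod C s = Cod C t" "Dom C s = Cod C k" "Dom C t = Cod C i"
      "s \<cdot> k = t \<cdot> i"
    have "(s \<^bold>+ neg (t \<cdot> j)) \<cdot> k = Zero C (Dom C k) (Cod C (s \<^bold>+ neg (t \<cdot> j)))"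
      using st by (simp add: k(2))
    then have "\<exists>v. v \<in> Mor C \<and> Cod C v = Cod C t \<and> Dom C v = Dom C i' \<and> v \<cdot> r = s \<^bold>+ neg (t \<cdot> j)"
      using cokernel_ex[OF R(6), of "s \<^bold>+ neg (t \<cdot> j)"] st(1-5) by simp
    then obtain v where v: "v \<in> Mor C" "Cod C v = Cod C t" "Dom C v = Dom C i'" "v \<cdot> r = s \<^bold>+ neg (t \<cdot> j)"
      by blast
    have "(t \<cdot> pa \<^bold>+ v \<cdot> qb) \<cdot> m = s" using st(1-5) v by (simp add: m_def e add_ac)
    then show "\<exists>u. u \<in> Mor C \<and> Cod C u = Cod C t \<and> Dom C u = Cod C a \<and> u \<cdot> m = s \<and> u \<cdot> a = t"
      using st(1-5) v(1-3) by (intro exI[of _ "t \<cdot> pa \<^bold>+ v \<cdot> qb"]) (simp add: e)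
  next
    fix x y assume xy: "x \<in> Mor C" "y \<in> Mor C" "Cod C x = Cod C y" "Dom C x = Cod C a" "Dom C y = Cod C a"
      "x \<cdot> m = y \<cdot> m" "x \<cdot> a = y \<cdot> a"
    have "y \<cdot> a \<cdot> j \<^bold>+ x \<cdot> b \<cdot> r = y \<cdot> a \<cdot> j \<^bold>+ y \<cdot> b \<cdot> r"
      using xy(1-6) by (simp add: m_def reassoc[OF xy(7)])
    then have "x \<cdot> b \<cdot> r = y \<cdot> b \<cdot> r"
      by (rule add_left_cancel) (use xy(1-5) in simp_all)
    then have "x \<cdot> b = y \<cdot> b"
      using xy(1-5) by - (rule epiD[OF R(7)], simp_all)
    then show "x = y" using xy(1-5,7) by - (rule biprod_joint_epi[OF Q], simp_all)
  qed simp_all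
  then have mI: "m \<in> semistable_deflations (op_cat C)"
    using I.D_any_pullback[OF A(2), of k m a] by simp
  have "is_pushout C i' b n b'"
  proof (rule pushoutI)
    show "n \<cdot> b = b' \<cdot> i'" by (simp add: n_def e)
    fix s t assume st: "s \<in> Mor C" "t \<in> Mor C" "Cod C s = Cod C t" "Dom C s = Cod C b" "Dom C t = Cod C i'"
      "s \<cdot> b = t \<cdot> i'"
    have "((s \<cdot> a) \<cdot> pa' \<^bold>+ t \<cdot> qb') \<cdot> n = s"
      by (rule biprod_joint_epi[OF Q]) (use st in \<open>simp_all add: n_def e\<close>)
    then show "\<exists>u. u \<in> Mor C \<and> Cod C u = Cod C t \<and> Dom C u = Cod C b' \<and> u \<cdot> n = s \<and> u \<cdot> b' = t"
      using st(1-5) by (intro exI[of _ "(s \<cdot> a) \<cdot> pa' \<^bold>+ t \<cdot> qb'"]) (simp add: e)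
  next
    fix x y assume xy: "x \<in> Mor C" "y \<in> Mor C" "Cod C x = Cod C y" "Dom C x = Cod C b'" "Dom C y = Cod C b'"
      "x \<cdot> n = y \<cdot> n" "x \<cdot> b' = y \<cdot> b'"
    have "x \<cdot> n \<cdot> a = y \<cdot> n \<cdot> a" using xy(1-5) by (simp add: reassoc[OF xy(6)])
    then have "x \<cdot> a' = y \<cdot> a'" using xy(1-5) by (simp add: n_def e)
    then show "x = y" using xy(1-5,7) by - (rule biprod_joint_epi[OF U], simp_all)
  qed simp_all
  then have nI: "n \<in> semistable_deflations (op_cat C)"
    using I.D_any_pullback[OF A'(2), of b n b'] by simp
  have "n \<cdot> m \<in> semistable_deflations (op_cat C)" using I.D_comp[OF nI mI] by simp
  also have "n \<cdot> m = (a' \<^bold>+ b' \<cdot> d) \<cdot> j" by (simp add: n_def m_def e P(9))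
  finally have "j \<in> semistable_deflations (op_cat C)"
    by (rule semistable_right_factor) (use ker_coker_pairD(6)[OF j] in simp_all)
  then have "(j, d' \<cdot> d) \<in> stable_pairs C" using j S.D_comp[OF A(3) A'(3)] by (simp add: stable_pairs_def)
  then show ?thesis by blast
qed

lemma stable_pairs_pullback:
  assumes s: "(i, d) \<in> stable_pairs C" and c: "c \<in> Mor C" "Cod C c = Cod C d"
  shows "\<exists>d' c' i'. is_pullback C d c d' c' \<and> (i', d') \<in> stable_pairs C"
proof -
  have A: "ker_coker_pair C i d" "i \<in> semistable_deflations (op_cat C)" "d \<in> semistable_deflations C"
    using s by (simp_all add: stable_pairs_def)
  obtain d' c' where p: "is_pullback C d c d' c'" "d' \<in> semistable_deflations C"
    by (rule semistable_ex_pullback[OF A(3) c])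
  obtain k0 where k0: "ker_coker_pair C k0 d'" by (rule semistable_ker_coker[OF p(2)])
  obtain i' where i': "is_kernel C i' d'" "c' \<cdot> i' = i" "Dom C i' = Dom C i"
    by (rule pullback_of_kernel[OF p(1) ker_coker_pairD(5)[OF A(1)]])
  have k: "ker_coker_pair C i' d'" by (rule ker_coker_pair_kernel[OF k0 i'(1)])
  have "i' \<in> semistable_deflations (op_cat C)"
    by (rule semistable_right_factor[of c' i' d'])
      (use i' A(2) pullbackD[OF p(1)] ker_coker_pairD[OF k] in simp_all)
  then show ?thesis using p k by (auto simp: stable_pairs_def)
qed

lemma stable_pairs_Idn: "X \<in> Obj C \<Longrightarrow> Idn C X \<in> deflations (stable_pairs C)"
proof -
  interpret S: deflation_class C "semistable_deflations C" by (rule deflation_class_semistable)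
  interpret I: deflation_class "op_cat C" "semistable_deflations (op_cat C)"
    by (rule deflation_class_semistable_op)
  assume X: "X \<in> Obj C"
  obtain Z where Z: "null Z" using null_ex by blast
  then have "Zero C Z X \<in> semistable_deflations (op_cat C)"
    using X by (intro I.D_null) (simp_all add: null_def)
  then have "(Zero C Z X, Idn C X) \<in> stable_pairs C"
    using ker_coker_Idn[OF Z X] S.D_iso[OF iso_Idn[OF X]] by (simp add: stable_pairs_def)
  then show ?thesis by (auto simp: deflations_def)
qed

lemma semistable_iso:
  assumes "g \<in> semistable_deflations C" "iso_mor C b" "iso_mor C c" "Dom C b = Dom C g" "Dom C c = Cod C g"
    "g' \<in> Mor C" "Cod C b = Dom C g'" "c \<cdot> g = g' \<cdot> b"
  shows "g' \<in> semistable_deflations C"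
proof -
  interpret S: deflation_class C "semistable_deflations C" by (rule deflation_class_semistable)
  obtain b' where b': "b \<in> Mor C" "b' \<in> Mor C" "Dom C b' = Cod C b" "Cod C b' = Dom C b"
    "b' \<cdot> b = Idn C (Dom C b)" "b \<cdot> b' = Idn C (Cod C b)" using iso_morE assms(2) by blast
  have gM: "g \<in> Mor C" using assms(1) by (rule semistable_Mor)
  have "iso_mor C b'" by (rule iso_morI[of b' b]) (use b' in simp_all)
  moreover have "c \<cdot> g \<in> semistable_deflations C"
    using S.D_comp[OF assms(1) S.D_iso[OF assms(3)]] assms(5) by simp
  ultimately have "(c \<cdot> g) \<cdot> b' \<in> semistable_deflations C"
    using S.D_comp[OF S.D_iso, of b' "c \<cdot> g"] assms b' gM by (simp add: iso_mor_def)
  also have "(c \<cdot> g) \<cdot> b' = g'" unfolding assms(8) using assms(4,6,7) b' by simp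
  finally show ?thesis .
qed

lemma exact_stable_pairs: "exact_structure C (stable_pairs C)"
proof -
  interpret op: weakly_idempotent_complete "op_cat C" by (rule weakly_idempotent_complete_op)
  have k: "\<forall>(f, g)\<in>stable_pairs C. ker_coker_pair C f g" by (auto simp: stable_pairs_def)
  have i: "\<forall>d\<in>stable_pairs C. \<forall>d'. pair_iso C d d' \<longrightarrow> d' \<in> stable_pairs C"
  proof (intro ballI allI impI)
    fix d d' assume d: "d \<in> stable_pairs C" "pair_iso C d d'"
    obtain f g f' g' where fg: "d = (f, g)" "d' = (f', g')" by (cases d, cases d')
    have A: "ker_coker_pair C f g" "f \<in> semistable_deflations (op_cat C)" "g \<in> semistable_deflations C"
      using d(1) fg by (simp_all add: stable_pairs_def)
    note K = ker_coker_pairD[OF A(1)]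
    obtain a b c where e: "f' \<in> Mor C" "g' \<in> Mor C" "Cod C f' = Dom C g'"
      "iso_mor C a" "Dom C a = Dom C f" "Cod C a = Dom C f'"
      "iso_mor C b" "Dom C b = Cod C f" "Cod C b = Cod C f'"
      "iso_mor C c" "Dom C c = Cod C g" "Cod C c = Cod C g'"
      "b \<cdot> f = f' \<cdot> a" "c \<cdot> g = g' \<cdot> b"
      using d(2) fg by (auto simp: pair_iso_def)
    have "ker_coker_pair C f' g'" using ker_coker_pair_iso A(1) d(2) fg by blast
    moreover have "g' \<in> semistable_deflations C"
      by (rule semistable_iso[OF A(3) e(7,10)]) (use e K(3) in simp_all)
    moreover have "f' \<in> semistable_deflations (op_cat C)"
    proof -
      obtain a' where a': "a \<in> Mor C" "a' \<in> Mor C" "Dom C a' = Cod C a" "Cod C a' = Dom C a"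
        "a' \<cdot> a = Idn C (Dom C a)" "a \<cdot> a' = Idn C (Cod C a)" using iso_morE e by blast
      obtain b' where b': "b \<in> Mor C" "b' \<in> Mor C" "Dom C b' = Cod C b" "Cod C b' = Dom C b"
        "b' \<cdot> b = Idn C (Dom C b)" "b \<cdot> b' = Idn C (Cod C b)" using iso_morE e by blast
      note [simp] = e(1,2,3,5,6,8,9) K(1-3) a'(1-4) b'(1-4)
      have "f \<cdot> a' = b' \<cdot> (b \<cdot> f) \<cdot> a'" by (simp add: reassoc[OF b'(5)])
      also have "\<dots> = b' \<cdot> f'" unfolding e(13) by (simp add: a'(6))
      finally have "f \<cdot> a' = b' \<cdot> f'" .
      moreover have "iso_mor C a'" "iso_mor C b'"
        using iso_morI[of a' a] iso_morI[of b' b] a' b' by simp_all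
      ultimately show ?thesis
        by - (rule op.semistable_iso[OF A(2), of b' a'], simp_all)
    qed
    ultimately show "d' \<in> stable_pairs C" using fg by (simp add: stable_pairs_def)
  qed
  have comp: "\<forall>g\<in>deflations (stable_pairs C). \<forall>g'\<in>deflations (stable_pairs C).
      Cod C g = Dom C g' \<longrightarrow> g' \<cdot> g \<in> deflations (stable_pairs C)"
    using stable_pairs_comp unfolding deflations_def by blast
  have pb: "\<forall>g\<in>deflations (stable_pairs C). \<forall>c\<in>Mor C. Cod C c = Cod C g \<longrightarrow>
      (\<exists>g' c'. is_pullback C g c g' c' \<and> g' \<in> deflations (stable_pairs C))"
    using stable_pairs_pullback unfolding deflations_def by blast
  have comp': "\<forall>f\<in>inflations (stable_pairs C). \<forall>f'\<in>inflations (stable_pairs C).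
      Cod C f = Dom C f' \<longrightarrow> f' \<cdot> f \<in> inflations (stable_pairs C)"
  proof (intro ballI impI)
    fix f f' assume f: "f \<in> inflations (stable_pairs C)" "f' \<in> inflations (stable_pairs C)"
      "Cod C f = Dom C f'"
    obtain g g' where "(g, f) \<in> stable_pairs (op_cat C)" "(g', f') \<in> stable_pairs (op_cat C)"
      using f by (auto simp: inflations_def stable_pairs_op)
    then obtain j where "(j, Comp (op_cat C) f f') \<in> stable_pairs (op_cat C)"
      using op.stable_pairs_comp[of g' f' g f] f(3) by auto
    then show "f' \<cdot> f \<in> inflations (stable_pairs C)" by (auto simp: inflations_def stable_pairs_op)
  qed
  have po: "\<forall>f\<in>inflations (stable_pairs C). \<forall>a\<in>Mor C. Dom C a = Dom C f \<longrightarrow>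
      (\<exists>f' a'. is_pushout C f a f' a' \<and> f' \<in> inflations (stable_pairs C))"
  proof (intro ballI impI)
    fix f a assume f: "f \<in> inflations (stable_pairs C)" "a \<in> Mor C" "Dom C a = Dom C f"
    obtain g where "(g, f) \<in> stable_pairs (op_cat C)"
      using f by (auto simp: inflations_def stable_pairs_op)
    then have "\<exists>f' a' i'. is_pullback (op_cat C) f a f' a' \<and> (i', f') \<in> stable_pairs (op_cat C)"
      using op.stable_pairs_pullback[of g f a] f(2,3) by simp
    then show "\<exists>f' a'. is_pushout C f a f' a' \<and> f' \<in> inflations (stable_pairs C)"
      by (auto simp: inflations_def stable_pairs_op)
  qed
  have id: "\<forall>X\<in>Obj C. Idn C X \<in> inflations (stable_pairs C) \<and> Idn C X \<in> deflations (stable_pairs C)"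
    using stable_pairs_Idn op.stable_pairs_Idn by (simp add: stable_pairs_op)
  show ?thesis unfolding exact_structure_def by (intro conjI k i id comp comp' po pb)
qed

end

lemma (in exact_category) deflation_semistable: "g \<in> deflations E \<Longrightarrow> g \<in> semistable_deflations C"
proof (rule semistableI)
  assume g: "g \<in> deflations E"
  then show "g \<in> Mor C" by (rule deflation_Mor)
  fix c assume c: "c \<in> Mor C" "Cod C c = Cod C g"
  obtain g' c' where "is_pullback C g c g' c'" "g' \<in> deflations E"
    using deflation_pullback[OF g c] by blast
  moreover from this obtain k where "ker_coker_pair C k g'" using pairD by (auto simp: deflations_def)
  ultimately show "\<exists>d' c' k. is_pullback C g c d' c' \<and> ker_coker_pair C k d'" by blast
qed

lemma (in exact_category) exact_subset_stable_pairs: "E \<subseteq> stable_pairs C"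
proof
  interpret op: exact_category "op_cat C" "E\<inverse>" by (rule exact_category_op[OF additive_op])
  fix d assume d: "d \<in> E"
  obtain f g where fg: "d = (f, g)" by (cases d)
  have "g \<in> deflations E" "f \<in> deflations (E\<inverse>)"
    using d fg by (auto simp: deflations_def inflations_def simp del: deflations_converse)
  then show "d \<in> stable_pairs C"
    using fg d pairD[of f g] deflation_semistable op.deflation_semistable by (auto simp: stable_pairs_def)
qed

lemma (in weakly_idempotent_complete) max_exact_structure_eq: "max_exact_structure C = stable_pairs C"
  unfolding max_exact_structure_def
proof (rule Greatest_equality)
  show "exact_structure C (stable_pairs C)" by (rule exact_stable_pairs)
  fix E assume "exact_structure C E"
  then interpret exact_category C E by unfold_locales
  show "E \<subseteq> stable_pairs C" by (rule exact_subset_stable_pairs)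
qed

section \<open>Krull-Schmidt categories are weakly idempotent complete\<close>

context preadditive_category
begin

text \<open>
  The \<open>finprod\<close> in the definition of direct sums, in a form that distributes over composition.
\<close>

primrec fsum where
  "fsum X Y x 0 = Zero C X Y"
| "fsum X Y x (Suc n) = x n \<^bold>+ fsum X Y x n"

lemma fsum_Mor:
  assumes "X \<in> Obj C" "Y \<in> Obj C" "\<forall>k<n. x k \<in> Hom C X Y"
  shows "fsum X Y x n \<in> Mor C" "Dom C (fsum X Y x n) = X" "Cod C (fsum X Y x n) = Y"
  using assms by (induction n) simp_all

lemma finprod_fsum:
  assumes "X \<in> Obj C" "Y \<in> Obj C" "\<forall>k<n. x k \<in> Hom C X Y"
  shows "finprod (hom_grp C X Y) x {..<n} = fsum X Y x n"
proof -
  interpret G: comm_group "hom_grp C X Y" using assms by (intro comm_group_hom_grp)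
  have "finprod (hom_grp C X Y) x {..<n} = fsum X Y x n" if "\<forall>k<n. x k \<in> Hom C X Y" for n
    using that
  proof (induction n)
    case (Suc n)
    have "finprod (hom_grp C X Y) x (insert n {..<n}) = x n \<otimes>\<^bsub>hom_grp C X Y\<^esub> finprod (hom_grp C X Y) x {..<n}"
      using Suc.prems by (intro G.finprod_insert) (auto simp: Pi_iff)
    then show ?case using Suc by (simp add: lessThan_Suc)
  qed simp
  then show ?thesis using assms by blast
qed

lemma comp_fsum:
  assumes "X \<in> Obj C" "\<forall>k<n. x k \<in> Hom C X Y" "g \<in> Mor C" "Dom C g = Y"
  shows "g \<cdot> fsum X Y x n = fsum X (Cod C g) (\<lambda>k. g \<cdot> x k) n"
proof -
  have Y: "Y \<in> Obj C" using assms(3,4) by auto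
  show ?thesis using assms(2)
  proof (induction n)
    case 0 show ?case using assms Y by simp
  next
    case (Suc n)
    then have "\<forall>k<n. x k \<in> Hom C X Y" "x n \<in> Hom C X Y" by simp_all
    then show ?case using Suc.IH assms(1,3,4) fsum_Mor[OF assms(1) Y, of n x] by simp
  qed
qed

lemma fsum_comp:
  assumes "Y \<in> Obj C" "\<forall>k<n. x k \<in> Hom C X Y" "g \<in> Mor C" "Cod C g = X"
  shows "fsum X Y x n \<cdot> g = fsum (Dom C g) Y (\<lambda>k. x k \<cdot> g) n"
proof -
  have X: "X \<in> Obj C" using assms(3,4) by auto
  show ?thesis using assms(2)
  proof (induction n)
    case 0 show ?case using assms X by simp
  next
    case (Suc n)
    then have "\<forall>k<n. x k \<in> Hom C X Y" "x n \<in> Hom C X Y" by simp_all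
    then show ?case using Suc.IH assms(1,3,4) fsum_Mor[OF X assms(1), of n x] by simp
  qed
qed

lemma fsum_cong: "(\<And>k. k < n \<Longrightarrow> x k = y k) \<Longrightarrow> fsum X Y x n = fsum X Y y n"
  by (induction n) simp_all

lemma fsum_delta:
  assumes "x \<in> Mor C" "Dom C x = X" "Cod C x = Y"
  shows "fsum X Y (\<lambda>k. if k = l then x else Zero C X Y) n = (if l < n then x else Zero C X Y)"
proof -
  have "X \<in> Obj C" "Y \<in> Obj C" using assms by auto
  then show ?thesis using assms by (induction n) (simp_all add: less_Suc_eq)
qed

lemma direct_sumD:
  assumes "direct_sum C X n Y i p"
  shows "X \<in> Obj C" "\<And>k. k < n \<Longrightarrow> Y k \<in> Obj C"
    "\<And>k. k < n \<Longrightarrow> i k \<in> Mor C" "\<And>k. k < n \<Longrightarrow> Dom C (i k) = Y k" "\<And>k. k < n \<Longrightarrow> Cod C (i k) = X"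
    "\<And>k. k < n \<Longrightarrow> p k \<in> Mor C" "\<And>k. k < n \<Longrightarrow> Dom C (p k) = X" "\<And>k. k < n \<Longrightarrow> Cod C (p k) = Y k"
    "\<And>k l. k < n \<Longrightarrow> l < n \<Longrightarrow> p l \<cdot> i k = (if k = l then Idn C (Y k) else Zero C (Y k) (Y l))"
    "fsum X X (\<lambda>k. i k \<cdot> p k) n = Idn C X"
proof -
  note a = assms[unfolded direct_sum_def]
  show m: "X \<in> Obj C" "\<And>k. k < n \<Longrightarrow> Y k \<in> Obj C"
    "\<And>k. k < n \<Longrightarrow> i k \<in> Mor C" "\<And>k. k < n \<Longrightarrow> Dom C (i k) = Y k" "\<And>k. k < n \<Longrightarrow> Cod C (i k) = X"
    "\<And>k. k < n \<Longrightarrow> p k \<in> Mor C" "\<And>k. k < n \<Longrightarrow> Dom C (p k) = X" "\<And>k. k < n \<Longrightarrow> Cod C (p k) = Y k"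
    "\<And>k l. k < n \<Longrightarrow> l < n \<Longrightarrow> p l \<cdot> i k = (if k = l then Idn C (Y k) else Zero C (Y k) (Y l))"
    using a by simp_all
  show "fsum X X (\<lambda>k. i k \<cdot> p k) n = Idn C X"
    using a finprod_fsum[OF m(1) m(1), of n "\<lambda>k. i k \<cdot> p k"] m by simp
qed

lemma direct_sum_joint_mono:
  assumes s: "direct_sum C X n Y i p" and xy: "x \<in> Mor C" "y \<in> Mor C" "Cod C x = X" "Cod C y = X"
    "Dom C x = Dom C y" and e: "\<And>k. k < n \<Longrightarrow> p k \<cdot> x = p k \<cdot> y"
  shows "x = y"
proof -
  note S = direct_sumD[OF s]
  have f: "fsum (Dom C z) X (\<lambda>k. i k \<cdot> p k \<cdot> z) n = z" if z: "z \<in> Mor C" "Cod C z = X" for z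
  proof -
    have "fsum X X (\<lambda>k. i k \<cdot> p k) n \<cdot> z = fsum (Dom C z) X (\<lambda>k. (i k \<cdot> p k) \<cdot> z) n"
      by (rule fsum_comp) (use S z in simp_all)
    also have "\<dots> = fsum (Dom C z) X (\<lambda>k. i k \<cdot> p k \<cdot> z) n"
      by (rule fsum_cong) (use S z in simp)
    finally show ?thesis using S(10) z by simp
  qed
  have "x = fsum (Dom C x) X (\<lambda>k. i k \<cdot> p k \<cdot> x) n" by (rule f[OF xy(1,3), symmetric])
  also have "\<dots> = fsum (Dom C x) X (\<lambda>k. i k \<cdot> p k \<cdot> y) n"
    by (rule fsum_cong) (simp add: e)
  also have "\<dots> = y" using f[OF xy(2,4)] by (simp only: xy(5))
  finally show ?thesis .
qed

lemma direct_sum_tuple: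
  assumes s: "direct_sum C X n Y i p" and W: "W \<in> Obj C" and x: "\<And>k. k < n \<Longrightarrow> x k \<in> Hom C W (Y k)"
  obtains u where "u \<in> Mor C" "Dom C u = W" "Cod C u = X" "\<And>k. k < n \<Longrightarrow> p k \<cdot> u = x k"
proof -
  note S = direct_sumD[OF s]
  define u where "u = fsum W X (\<lambda>k. i k \<cdot> x k) n"
  have "p l \<cdot> u = x l" if l: "l < n" for l
  proof -
    have "p l \<cdot> u = fsum W (Cod C (p l)) (\<lambda>k. p l \<cdot> i k \<cdot> x k) n"
      unfolding u_def by (rule comp_fsum) (use S W x l in simp_all)
    also have "\<dots> = fsum W (Y l) (\<lambda>k. if k = l then x l else Zero C W (Y l)) n"
      unfolding S(8)[OF l]
    proof (rule fsum_cong)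
      fix k assume k: "k < n"
      have "p l \<cdot> i k \<cdot> x k = (if k = l then Idn C (Y k) else Zero C (Y k) (Y l)) \<cdot> x k"
        by (rule reassoc[OF S(9)]) (use S k l x in simp_all)
      then show "p l \<cdot> i k \<cdot> x k = (if k = l then x l else Zero C W (Y l))"
        using x[OF k] S(2)[OF l] by auto
    qed
    also have "\<dots> = x l" using fsum_delta[of "x l" W "Y l" l n] x[OF l] l by simp
    finally show ?thesis .
  qed
  moreover have "u \<in> Mor C" "Dom C u = W" "Cod C u = X"
    using fsum_Mor[OF W S(1), of n "\<lambda>k. i k \<cdot> x k"] S x unfolding u_def by simp_all
  ultimately show thesis using that by blast
qed

lemma Units_End_ring:
  "x \<in> Units (End_ring C X) \<longleftrightarrow> x \<in> Hom C X X \<and> (\<exists>y\<in>Hom C X X. y \<cdot> x = Idn C X \<and> x \<cdot> y = Idn C X)"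
  by (simp add: Units_def End_ring_def)

lemma local_ring_add:
  assumes "local_ring (End_ring C X)" "x \<in> Hom C X X" "y \<in> Hom C X X" "x \<^bold>+ y \<in> Units (End_ring C X)"
  shows "x \<in> Units (End_ring C X) \<or> y \<in> Units (End_ring C X)"
  using assms by (simp add: local_ring_def) (auto simp: End_ring_def)

lemma local_ring_nonzero: "local_ring (End_ring C X) \<Longrightarrow> Idn C X \<noteq> Zero C X X"
  by (simp add: local_ring_def End_ring_def)

lemma local_ring_fsum:
  assumes X: "local_ring (End_ring C X)" "X \<in> Obj C" and "\<forall>k<n. x k \<in> Hom C X X"
    "fsum X X x n \<in> Units (End_ring C X)"
  shows "\<exists>k<n. x k \<in> Units (End_ring C X)"
  using assms(3,4)
proof (induction n)
  case 0
  then obtain y where y: "y \<in> Hom C X X" "y \<cdot> Zero C X X = Idn C X" by (auto simp: Units_End_ring simp del: Hom_iff)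
  then show ?case using local_ring_nonzero[OF X(1)] X(2) by simp
next
  case (Suc n)
  then have h: "\<forall>k<n. x k \<in> Hom C X X" "x n \<in> Hom C X X" by simp_all
  have "x n \<in> Units (End_ring C X) \<or> fsum X X x n \<in> Units (End_ring C X)"
    using Suc.prems(2) fsum_Mor[OF X(2,2) h(1)] h(2) by (intro local_ring_add[OF X(1)]) simp_all
  then show ?case using Suc.IH h by (auto simp del: Hom_iff intro: less_SucI)
qed

text \<open>
  If \<open>a b = 1\<close> then \<open>b a\<close> is idempotent, hence 0 or 1 in a local ring.
\<close>

lemma local_split_epi_iso:
  assumes Q: "local_ring (End_ring C Q)" and Y: "Idn C Y \<noteq> Zero C Y Y"
    and ab: "a \<in> Mor C" "Dom C a = Q" "Cod C a = Y" "b \<in> Mor C" "Dom C b = Y" "Cod C b = Q" "a \<cdot> b = Idn C Y"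
  shows "b \<cdot> a = Idn C Q"
proof -
  note [simp] = ab(1-6)
  have [simp]: "Q \<in> Obj C" "Y \<in> Obj C" using Obj_ends[OF ab(1)] by simp_all
  define e where "e = b \<cdot> a"
  have [simp]: "e \<in> Mor C" "Dom C e = Q" "Cod C e = Q" by (simp_all add: e_def)
  have ee: "e \<cdot> e = e" by (simp add: e_def reassoc[OF ab(7)])
  have "Idn C Q \<in> Units (End_ring C Q)" by (auto simp: Units_End_ring intro: bexI[of _ "Idn C Q"])
  moreover have "e \<^bold>+ (Idn C Q \<^bold>+ neg e) = Idn C Q"
    using add_lcomm[of e "Idn C Q" "neg e"] by simp
  ultimately have "e \<in> Units (End_ring C Q) \<or> Idn C Q \<^bold>+ neg e \<in> Units (End_ring C Q)"
    by (intro local_ring_add[OF Q]) simp_all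
  then show ?thesis
  proof
    assume "e \<in> Units (End_ring C Q)"
    then obtain w where w: "w \<in> Mor C" "Dom C w = Q" "Cod C w = Q" "e \<cdot> w = Idn C Q"
      by (auto simp: Units_End_ring)
    have "e = e \<cdot> e \<cdot> w" using w(4) by simp
    also have "\<dots> = (e \<cdot> e) \<cdot> w" using w(1-3) by simp
    also have "\<dots> = Idn C Q" unfolding ee by (rule w(4))
    finally show ?thesis by (simp add: e_def)
  next
    assume "Idn C Q \<^bold>+ neg e \<in> Units (End_ring C Q)"
    then obtain w where w: "w \<in> Mor C" "Dom C w = Q" "Cod C w = Q" "(Idn C Q \<^bold>+ neg e) \<cdot> w = Idn C Q"
      by (auto simp: Units_End_ring simp del: add_comp)
    have "e = e \<cdot> (Idn C Q \<^bold>+ neg e) \<cdot> w" using w(4) by simp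
    also have "\<dots> = (e \<^bold>+ neg (e \<cdot> e)) \<cdot> w" using w(1-3) by simp
    also have "\<dots> = Zero C Q Q" unfolding ee using w(1-3) by simp
    finally have e0: "e = Zero C Q Q" .
    have "Idn C Y = a \<cdot> e \<cdot> b" by (simp add: e_def ab(7))
    also have "\<dots> = Zero C Y Y" unfolding e0 by simp
    finally show ?thesis using Y by simp
  qed
qed

end

context additive_category
begin

lemma summand_complement:
  assumes s: "direct_sum C X n Y i p" and l: "l < n"
  obtains \<alpha> \<beta> where "\<alpha> \<in> Mor C" "\<beta> \<in> Mor C" "Cod C \<alpha> = X" "Dom C \<beta> = X" "Dom C \<alpha> = Cod C \<beta>"
    "\<beta> \<cdot> \<alpha> = Idn C (Dom C \<alpha>)" "\<alpha> \<cdot> \<beta> = Idn C X \<^bold>+ neg (i l \<cdot> p l)"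
proof -
  note S = direct_sumD[OF s]
  obtain Z where Z: "null Z" using null_ex by blast
  have [simp]: "Z \<in> Obj C" using Z by (simp add: null_def)
  \<comment> \<open>The complement is the direct sum with the summand number \<open>l\<close> replaced by zero.\<close>
  define Y' where "Y' k = (if k = l then Z else Y k)" for k
  have "\<forall>k<n. Y' k \<in> Obj C" using S(2) by (simp add: Y'_def)
  then obtain K i' p' where K: "direct_sum C K n Y' i' p'" using direct_sums_exist by blast
  note S' = direct_sumD[OF K]
  define \<delta> where "\<delta> k = (if k = l then Zero C Z (Y k) else Idn C (Y k))" for k
  define \<delta>' where "\<delta>' k = (if k = l then Zero C (Y k) Z else Idn C (Y k))" for k
  have \<delta>: "\<delta> k \<in> Mor C" "Dom C (\<delta> k) = Y' k" "Cod C (\<delta> k) = Y k"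
    "\<delta>' k \<in> Mor C" "Dom C (\<delta>' k) = Y k" "Cod C (\<delta>' k) = Y' k" if "k < n" for k
    using S(2)[OF that] S(2)[OF l] by (simp_all add: \<delta>_def \<delta>'_def Y'_def)
  have \<delta>\<delta>: "\<delta>' k \<cdot> \<delta> k = Idn C (Y' k)" if "k < n" for k
    using S(2)[OF that] S(2)[OF l] Z by (simp add: \<delta>_def \<delta>'_def Y'_def null_def)
  obtain \<alpha> where \<alpha>: "\<alpha> \<in> Mor C" "Dom C \<alpha> = K" "Cod C \<alpha> = X" "\<And>k. k < n \<Longrightarrow> p k \<cdot> \<alpha> = \<delta> k \<cdot> p' k"
    by (rule direct_sum_tuple[OF s S'(1), of "\<lambda>k. \<delta> k \<cdot> p' k"]) (use \<delta> S' in simp_all)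
  obtain \<beta> where \<beta>: "\<beta> \<in> Mor C" "Dom C \<beta> = X" "Cod C \<beta> = K" "\<And>k. k < n \<Longrightarrow> p' k \<cdot> \<beta> = \<delta>' k \<cdot> p k"
    by (rule direct_sum_tuple[OF K S(1), of "\<lambda>k. \<delta>' k \<cdot> p k"]) (use \<delta> S in simp_all)
  note [simp] = \<alpha>(1-3) \<beta>(1-3) S(1) S'(1)
  have "\<beta> \<cdot> \<alpha> = Idn C K"
  proof (rule direct_sum_joint_mono[OF K])
    fix k assume k: "k < n"
    note [simp] = S(2-8)[OF k] S'(2-8)[OF k] \<delta>[OF k]
    show "p' k \<cdot> \<beta> \<cdot> \<alpha> = p' k \<cdot> Idn C K"
      using k by (simp add: reassoc[OF \<beta>(4)[OF k]] \<alpha>(4) reassoc[OF \<delta>\<delta>[OF k]])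
  qed simp_all
  moreover have "\<alpha> \<cdot> \<beta> = Idn C X \<^bold>+ neg (i l \<cdot> p l)"
  proof (rule direct_sum_joint_mono[OF s])
    note [simp] = S(2-8)[OF l]
    fix k assume k: "k < n"
    note [simp] = S(2-8)[OF k] S'(2-8)[OF k] \<delta>[OF k]
    have *: "p k \<cdot> \<alpha> \<cdot> \<beta> = (\<delta> k \<cdot> \<delta>' k) \<cdot> p k"
      using k by (simp add: reassoc[OF \<alpha>(4)[OF k]] \<beta>(4))
    have **: "p k \<cdot> i l \<cdot> p l = (if l = k then Idn C (Y l) else Zero C (Y l) (Y k)) \<cdot> p l"
      by (rule reassoc[OF S(9)[OF l k]]) simp_all
    show "p k \<cdot> \<alpha> \<cdot> \<beta> = p k \<cdot> (Idn C X \<^bold>+ neg (i l \<cdot> p l))"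
      using * ** by (cases "k = l") (simp_all add: \<delta>_def \<delta>'_def)
  qed (use S(2-8)[OF l] in simp_all)
  ultimately show thesis using that[of \<alpha> \<beta>] by simp
qed

text \<open>
  If a map \<open>r\<close> restricts to an isomorphism on one direct summand, then the complement of this
  summand, sheared along \<open>r\<close>, is the kernel of \<open>r\<close>.
\<close>

lemma kernel_of_iso_on_summand:
  assumes s: "direct_sum C X n Y i p" and l: "l < n"
    and r: "r \<in> Mor C" "Dom C r = X" and b: "b \<in> Mor C" "Dom C b = Cod C r" "Cod C b = Y l"
    "r \<cdot> i l \<cdot> b = Idn C (Cod C r)" "b \<cdot> r \<cdot> i l = Idn C (Y l)"
  shows "\<exists>k. is_kernel C k r"
proof -
  note S = direct_sumD[OF s]
  note [simp] = S(1) S(2-8)[OF l] r b(1-3)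
  obtain \<alpha> \<beta> where \<alpha>: "\<alpha> \<in> Mor C" "\<beta> \<in> Mor C" "Cod C \<alpha> = X" "Dom C \<beta> = X" "Dom C \<alpha> = Cod C \<beta>"
    "\<beta> \<cdot> \<alpha> = Idn C (Dom C \<alpha>)" "\<alpha> \<cdot> \<beta> = Idn C X \<^bold>+ neg (i l \<cdot> p l)"
    by (rule summand_complement[OF s l])
  note [simp] = \<alpha>(1-5)
  have pi: "p l \<cdot> i l = Idn C (Y l)" using S(9)[OF l l] by simp
  have \<beta>i: "\<beta> \<cdot> i l = Zero C (Y l) (Cod C \<beta>)"
  proof -
    have "\<beta> \<cdot> i l = \<beta> \<cdot> (\<alpha> \<cdot> \<beta>) \<cdot> i l" using \<alpha>(6) by (simp add: reassoc[OF \<alpha>(6)])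
    also have "(\<alpha> \<cdot> \<beta>) \<cdot> i l = Zero C (Y l) X" unfolding \<alpha>(7) by (simp add: pi)
    finally show ?thesis by simp
  qed
  define k where "k = \<alpha> \<^bold>+ neg (i l \<cdot> b \<cdot> r \<cdot> \<alpha>)"
  have [simp]: "k \<in> Mor C" "Dom C k = Cod C \<beta>" "Cod C k = X" by (simp_all add: k_def)
  have rib: "r \<cdot> i l \<cdot> b \<cdot> x = x" if "x \<in> Mor C" "Cod C x = Cod C r" for x
    using reassoc[OF b(4), of x] that by simp
  have bri: "b \<cdot> r \<cdot> i l \<cdot> x = x" if "x \<in> Mor C" "Cod C x = Y l" for x
    using reassoc[OF b(5), of x] that by simp
  have \<beta>k: "\<beta> \<cdot> k = Idn C (Cod C \<beta>)"
    using \<alpha>(6) by (simp add: k_def reassoc[OF \<beta>i])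
  have "is_kernel C k r"
  proof (rule kernelI)
    show "r \<cdot> k = Zero C (Dom C k) (Cod C r)" by (simp add: k_def rib)
    fix h assume h: "h \<in> Mor C" "Cod C h = Dom C r" "r \<cdot> h = Zero C (Dom C h) (Cod C r)"
    have "\<alpha> \<cdot> \<beta> \<cdot> h = h \<^bold>+ neg (i l \<cdot> p l \<cdot> h)" using h(1,2) by (simp add: reassoc[OF \<alpha>(7)])
    then have "k \<cdot> \<beta> \<cdot> h = h" using h by (simp add: k_def bri)
    then show "\<exists>u. u \<in> Mor C \<and> Dom C u = Dom C h \<and> Cod C u = Dom C k \<and> k \<cdot> u = h"
      using h(1,2) by (intro exI[of _ "\<beta> \<cdot> h"]) simp
  next
    fix x y assume xy: "x \<in> Mor C" "y \<in> Mor C" "Dom C x = Dom C y" "Cod C x = Dom C k" "Cod C y = Dom C k"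
      "k \<cdot> x = k \<cdot> y"
    have "\<beta> \<cdot> k \<cdot> x = \<beta> \<cdot> k \<cdot> y" by (simp only: xy(6))
    then show "x = y" using xy(1-5) by (simp add: reassoc[OF \<beta>k])
  qed simp_all
  then show ?thesis by blast
qed

lemma local_split_epi_kernel:
  assumes Q: "direct_sum C Q n Y i p" "\<forall>k<n. local_ring (End_ring C (Y k))"
    and T: "local_ring (End_ring C T)"
    and r: "r \<in> Mor C" "Dom C r = Q" "Cod C r = T" and s: "s \<in> Mor C" "Dom C s = T" "Cod C s = Q"
    and rs: "r \<cdot> s = Idn C T"
  shows "\<exists>k. is_kernel C k r"
proof -
  note S = direct_sumD[OF Q(1)]
  have T' [simp]: "T \<in> Obj C" using Obj_ends[OF r(1)] r by simp
  note [simp] = r s S(1)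
  have "Idn C T = r \<cdot> fsum Q Q (\<lambda>k. i k \<cdot> p k) n \<cdot> s" using rs S(10) by simp
  also have "fsum Q Q (\<lambda>k. i k \<cdot> p k) n \<cdot> s = fsum T Q (\<lambda>k. (i k \<cdot> p k) \<cdot> s) n"
    using fsum_comp[of Q n "\<lambda>k. i k \<cdot> p k" Q s] S by simp
  also have "r \<cdot> \<dots> = fsum T T (\<lambda>k. r \<cdot> (i k \<cdot> p k) \<cdot> s) n"
    using comp_fsum[of T n "\<lambda>k. (i k \<cdot> p k) \<cdot> s" Q r] S by simp
  finally have sum: "fsum T T (\<lambda>k. r \<cdot> (i k \<cdot> p k) \<cdot> s) n = Idn C T" by simp
  have "Idn C T \<in> Units (End_ring C T)" by (auto simp: Units_End_ring intro: bexI[of _ "Idn C T"])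
  then obtain l where l: "l < n" "r \<cdot> (i l \<cdot> p l) \<cdot> s \<in> Units (End_ring C T)"
    using local_ring_fsum[OF T T', of n "\<lambda>k. r \<cdot> (i k \<cdot> p k) \<cdot> s"] sum S by auto
  note [simp] = S(2-8)[OF l(1)]
  obtain v where v: "v \<in> Mor C" "Dom C v = T" "Cod C v = T" "(r \<cdot> (i l \<cdot> p l) \<cdot> s) \<cdot> v = Idn C T"
    using l(2) by (auto simp: Units_End_ring simp del: comp_assoc)
  define b where "b = p l \<cdot> s \<cdot> v"
  have b: "b \<in> Mor C" "Dom C b = T" "Cod C b = Y l" using v by (simp_all add: b_def)
  have rib: "(r \<cdot> i l) \<cdot> b = Idn C T" using v by (simp add: b_def)
  have "b \<cdot> (r \<cdot> i l) = Idn C (Y l)"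
    by (rule local_split_epi_iso[OF _ local_ring_nonzero[OF T]]) (use Q(2) l(1) b rib in simp_all)
  then show ?thesis
    using kernel_of_iso_on_summand[OF Q(1) l(1), of r b] b rib by simp
qed

end

text \<open>
  By induction on \<open>m\<close>, the first \<open>m\<close> components of a split epimorphism \<open>r\<close> have a common kernel \<open>j\<close>: on
  the previous common kernel, the next component is still split, and its target has a local
  endomorphism ring.
\<close>

lemma Krull_Schmidt_weakly_idempotent_complete:
  assumes KS: "Krull_Schmidt C" shows "weakly_idempotent_complete C"
proof -
  interpret additive_category C using KS by (simp add: Krull_Schmidt_def)
  have dec: "\<exists>n Y i p. direct_sum C X n Y i p \<and> (\<forall>k<n. local_ring (End_ring C (Y k)))" if "X \<in> Obj C" for X
    using KS that by (simp add: Krull_Schmidt_def)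
  show ?thesis
  proof
    fix r s assume rs: "r \<in> Mor C" "s \<in> Mor C" "Dom C s = Cod C r" "Cod C s = Dom C r"
      "r \<cdot> s = Idn C (Cod C r)"
    note [simp] = rs(1-4)
    obtain n Y i p where Y: "direct_sum C (Cod C r) n Y i p" "\<forall>k<n. local_ring (End_ring C (Y k))"
      using dec[OF Obj_ends(2)[OF rs(1)]] by blast
    note S = direct_sumD[OF Y(1)]
    have "\<exists>j. j \<in> Mor C \<and> Cod C j = Dom C r \<and> (\<forall>k<m. p k \<cdot> r \<cdot> j = Zero C (Dom C j) (Y k)) \<and>
        (\<forall>h\<in>Mor C. Cod C h = Dom C r \<longrightarrow> (\<forall>k<m. p k \<cdot> r \<cdot> h = Zero C (Dom C h) (Y k)) \<longrightarrow>
          (\<exists>u\<in>Mor C. Dom C u = Dom C h \<and> Cod C u = Dom C j \<and> j \<cdot> u = h)) \<and>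
        (\<forall>x\<in>Mor C. \<forall>y\<in>Mor C. Dom C x = Dom C y \<longrightarrow> Cod C x = Dom C j \<longrightarrow> Cod C y = Dom C j \<longrightarrow>
          j \<cdot> x = j \<cdot> y \<longrightarrow> x = y)" (is "\<exists>j. ?P m j") if "m \<le> n" for m
      using that
    proof (induction m)
      case 0
      have "?P 0 (Idn C (Dom C r))" by (auto intro!: bexI)
      then show ?case by blast
    next
      case (Suc m)
      then obtain j where j: "?P m j" by auto
      have m: "m < n" using Suc.prems by simp
      note j1 = j[THEN conjunct1] j[THEN conjunct2, THEN conjunct1]
        j[THEN conjunct2, THEN conjunct2, THEN conjunct1, rule_format]
      note j2 = j[THEN conjunct2, THEN conjunct2, THEN conjunct2, THEN conjunct1, rule_format]
      note j3 = j[THEN conjunct2, THEN conjunct2, THEN conjunct2, THEN conjunct2, rule_format]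
      note [simp] = j1(1,2) S(2-8)[OF m]
      have z: "p k \<cdot> r \<cdot> s \<cdot> i m = Zero C (Y m) (Y k)" if k: "k < m" for k
      proof -
        have "k < n" using k m by simp
        note [simp] = S(2-8)[OF this]
        show ?thesis using S(9)[OF m \<open>k < n\<close>] k by (simp add: reassoc[OF rs(5)])
      qed
      obtain t where t: "t \<in> Mor C" "Dom C t = Y m" "Cod C t = Dom C j" "j \<cdot> t = s \<cdot> i m"
        using j2[of "s \<cdot> i m"] z by auto
      have "(p m \<cdot> r \<cdot> j) \<cdot> t = Idn C (Y m)"
        using t S(9)[OF m m] by (simp add: reassoc[OF rs(5)])
      moreover obtain n' Y' i' p' where
        "direct_sum C (Dom C j) n' Y' i' p'" "\<forall>k<n'. local_ring (End_ring C (Y' k))"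
        using dec[OF Obj_ends(1)[OF j1(1)]] by blast
      ultimately obtain k where k: "is_kernel C k (p m \<cdot> r \<cdot> j)"
        using local_split_epi_kernel[of "Dom C j" n' Y' i' p' "Y m" "p m \<cdot> r \<cdot> j" t] t Y(2) m by auto
      note K = kernelD[OF k]
      note [simp] = K(1) K(3)[simplified]
      have kz: "p m \<cdot> r \<cdot> j \<cdot> k = Zero C (Dom C k) (Y m)" using K(4) by simp
      have "?P (Suc m) (j \<cdot> k)"
      proof (intro conjI ballI impI allI)
        fix l assume l: "l < Suc m"
        then have "l < n" using m by simp
        note [simp] = S(2-8)[OF this]
        show "p l \<cdot> r \<cdot> j \<cdot> k = Zero C (Dom C (j \<cdot> k)) (Y l)"
        proof (cases "l = m")
          case False
          then have "p l \<cdot> r \<cdot> j = Zero C (Dom C j) (Y l)" using l j1(3)[of l] by simp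
          then have "(p l \<cdot> r \<cdot> j) \<cdot> k = Zero C (Dom C k) (Y l)" by simp
          then show ?thesis by simp
        qed (use kz in simp)
      next
        fix h assume h: "h \<in> Mor C" "Cod C h = Dom C r" "\<forall>k<Suc m. p k \<cdot> r \<cdot> h = Zero C (Dom C h) (Y k)"
        obtain u where u: "u \<in> Mor C" "Dom C u = Dom C h" "Cod C u = Dom C j" "j \<cdot> u = h"
          using j2[of h] h by auto
        have "\<exists>w. w \<in> Mor C \<and> Dom C w = Dom C u \<and> Cod C w = Dom C k \<and> k \<cdot> w = u"
          using kernel_ex[OF k, of u] u h(3) by simp
        then obtain w where w: "w \<in> Mor C" "Dom C w = Dom C u" "Cod C w = Dom C k" "k \<cdot> w = u" by blast
        then show "\<exists>u\<in>Mor C. Dom C u = Dom C h \<and> Cod C u = Dom C (j \<cdot> k) \<and> (j \<cdot> k) \<cdot> u = h"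
          using u by (intro bexI[of _ w]) simp_all
      next
        fix x y assume xy: "x \<in> Mor C" "y \<in> Mor C" "Dom C x = Dom C y" "Cod C x = Dom C (j \<cdot> k)"
          "Cod C y = Dom C (j \<cdot> k)" "(j \<cdot> k) \<cdot> x = (j \<cdot> k) \<cdot> y"
        have "k \<cdot> x = k \<cdot> y" by (rule j3) (use xy in simp_all)
        then show "x = y" using xy(1-5) by - (rule kernel_mono[OF k], simp_all)
      qed simp_all
      then show ?case by blast
    qed
    then obtain j where j: "?P n j" by blast
    note j1 = j[THEN conjunct1] j[THEN conjunct2, THEN conjunct1]
      j[THEN conjunct2, THEN conjunct2, THEN conjunct1, rule_format]
    note j2 = j[THEN conjunct2, THEN conjunct2, THEN conjunct2, THEN conjunct1, rule_format]
    note j3 = j[THEN conjunct2, THEN conjunct2, THEN conjunct2, THEN conjunct2, rule_format]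
    note [simp] = j1(1,2)
    have "is_kernel C j r"
    proof (rule kernelI)
      show "r \<cdot> j = Zero C (Dom C j) (Cod C r)"
        by (rule direct_sum_joint_mono[OF Y(1)]) (use j1(3) S in simp_all)
      fix h assume h: "h \<in> Mor C" "Cod C h = Dom C r" "r \<cdot> h = Zero C (Dom C h) (Cod C r)"
      then have "p k \<cdot> r \<cdot> h = Zero C (Dom C h) (Y k)" if "k < n" for k
        using S(2-8)[OF that] by simp
      then show "\<exists>u. u \<in> Mor C \<and> Dom C u = Dom C h \<and> Cod C u = Dom C j \<and> j \<cdot> u = h"
        using j2[of h] h(1,2) by blast
    next
      fix x y assume "x \<in> Mor C" "y \<in> Mor C" "Dom C x = Dom C y" "Cod C x = Dom C j" "Cod C y = Dom C j"
        "j \<cdot> x = j \<cdot> y"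
      then show "x = y" by (rule j3)
    qed simp_all
    then show "\<exists>k. is_kernel C k r" by blast
  qed
qed

section \<open>Chains of bounded length\<close>

text \<open>
  \<open>height_le L n S T\<close> says that strictly increasing chains in \<open>L\<close> that start at \<open>S\<close> and stay below \<open>T\<close>
  have at most \<open>n\<close> steps.
\<close>

primrec height_le :: "'s set set \<Rightarrow> nat \<Rightarrow> 's set \<Rightarrow> 's set \<Rightarrow> bool" where
  "height_le L 0 S T \<longleftrightarrow> (\<forall>U\<in>L. S \<subset> U \<longrightarrow> U \<subseteq> T \<longrightarrow> False)"
| "height_le L (Suc n) S T \<longleftrightarrow> (\<forall>U\<in>L. S \<subset> U \<longrightarrow> U \<subseteq> T \<longrightarrow> height_le L n U T)"

lemma height_le_iff:
  "height_le L n S T \<longleftrightarrow> (\<forall>U\<in>L. S \<subset> U \<longrightarrow> U \<subseteq> T \<longrightarrow> 0 < n \<and> height_le L (n - 1) U T)"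
  by (cases n) simp_all

lemma height_le_bot: "height_le L n S T \<Longrightarrow> S \<subseteq> S' \<Longrightarrow> height_le L n S' T"
  using height_le_iff[of L n S T] height_le_iff[of L n S' T] by blast

lemma height_le_proper_top: "height_le L (Suc n) S X \<Longrightarrow> T \<subset> X \<Longrightarrow> X \<in> L \<Longrightarrow> height_le L n S T"
proof (induction n arbitrary: S)
  case 0
  show ?case unfolding height_le.simps(1)
  proof (intro ballI impI)
    fix U assume U: "U \<in> L" "S \<subset> U" "U \<subseteq> T"
    then have "U \<subseteq> X" using 0(2) by blast
    then have "height_le L 0 U X" using 0(1) U unfolding height_le.simps by blast
    then have "\<not> U \<subset> X" using 0(3) unfolding height_le.simps by blast
    then show False using 0(2) U by blast
  qed
next
  case (Suc n)
  show ?case unfolding height_le.simps(2)[of L n]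
  proof (intro ballI impI)
    fix U assume U: "U \<in> L" "S \<subset> U" "U \<subseteq> T"
    then have "U \<subseteq> X" using Suc.prems(2) by blast
    then have "height_le L (Suc n) U X" using Suc.prems(1) U unfolding height_le.simps(2)[of L "Suc n"] by blast
    then show "height_le L n U T" using Suc by blast
  qed
qed

lemma height_le_map:
  assumes "height_le L' n (F S) T'" "S0 \<subseteq> S" "S \<in> L" "S \<subseteq> T"
    and F: "\<And>U. U \<in> L \<Longrightarrow> S0 \<subseteq> U \<Longrightarrow> U \<subseteq> T \<Longrightarrow> F U \<in> L' \<and> F U \<subseteq> T'"
    and mono: "\<And>U V. U \<in> L \<Longrightarrow> V \<in> L \<Longrightarrow> S0 \<subseteq> U \<Longrightarrow> U \<subset> V \<Longrightarrow> V \<subseteq> T \<Longrightarrow> F U \<subset> F V"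
  shows "height_le L n S T"
  using assms(1-4)
proof (induction n arbitrary: S)
  case 0
  show ?case unfolding height_le.simps(1)
  proof (intro ballI impI)
    fix U assume U: "U \<in> L" "S \<subset> U" "U \<subseteq> T"
    then have "F S \<subset> F U" "F U \<in> L'" "F U \<subseteq> T'" using mono[of S U] F[of U] 0 by blast+
    then show False using 0(1) by simp
  qed
next
  case (Suc n)
  show ?case unfolding height_le.simps(2)
  proof (intro ballI impI)
    fix U assume U: "U \<in> L" "S \<subset> U" "U \<subseteq> T"
    then have "F S \<subset> F U" "F U \<in> L'" "F U \<subseteq> T'" using mono[of S U] F[of U] Suc.prems by blast+
    then have "height_le L' n (F U) T'" using Suc.prems(1) by simp
    then show "height_le L n U T" using Suc.IH[of U] U Suc.prems by blast
  qed
qed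

text \<open>
  A strict step of a chain is strict after intersecting with \<open>T\<close> or after joining with \<open>T\<close>, by
  modularity.
\<close>

lemma height_le_extension:
  assumes meet: "\<And>U. U \<in> L \<Longrightarrow> m U \<in> L \<and> m U \<subseteq> T" and join: "\<And>U. U \<in> L \<Longrightarrow> j U \<in> L"
    and mono: "\<And>U V. U \<in> L \<Longrightarrow> V \<in> L \<Longrightarrow> U \<subseteq> V \<Longrightarrow> m U \<subseteq> m V \<and> j U \<subseteq> j V"
    and modular: "\<And>U V. U \<in> L \<Longrightarrow> V \<in> L \<Longrightarrow> U \<subseteq> V \<Longrightarrow> m U = m V \<Longrightarrow> j U = j V \<Longrightarrow> U = V"
    and X: "\<And>U. U \<in> L \<Longrightarrow> U \<subseteq> X \<Longrightarrow> j U \<subseteq> X"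
  shows "U \<in> L \<Longrightarrow> height_le L a (m U) T \<Longrightarrow> height_le L b (j U) X \<Longrightarrow> height_le L (a + b) U X"
proof (induction "a + b" arbitrary: a b U rule: less_induct)
  case less
  show ?case unfolding height_le_iff[of L "a + b"]
  proof (intro ballI impI)
    fix V assume V: "V \<in> L" "U \<subset> V" "V \<subseteq> X"
    then have mn: "m U \<subseteq> m V" "j U \<subseteq> j V" using mono[of U V] less.prems by auto
    show "0 < a + b \<and> height_le L (a + b - 1) V X"
    proof (cases "m U = m V")
      case False
      then have "0 < a \<and> height_le L (a - 1) (m V) T"
        using less.prems(2) meet[OF V(1)] mn unfolding height_le_iff[of L a] by blast
      moreover have "height_le L b (j V) X" using height_le_bot less.prems(3) mn by blast
      ultimately have "height_le L (a - 1 + b) V X" using less.hyps[of "a - 1" b V] V by simp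
      then show ?thesis using \<open>0 < a \<and> _\<close> by simp
    next
      case True
      then have "j U \<noteq> j V" using modular[of U V] less.prems(1) V by blast
      then have "0 < b \<and> height_le L (b - 1) (j V) X"
        using less.prems(3) join[OF V(1)] X[OF V(1,3)] mn unfolding height_le_iff[of L b] by blast
      moreover have "height_le L a (m V) T" using True less.prems(2) by simp
      ultimately have "height_le L (a + (b - 1)) V X" using less.hyps[of a "b - 1" V] V by simp
      then show ?thesis using \<open>0 < b \<and> _\<close> by simp
    qed
  qed
qed

section \<open>Sieves generated by deflations\<close>

context category
begin

definition gen where "gen g = {g \<cdot> x |x. x \<in> Mor C \<and> Cod C x = Dom C g}"
definition top_sieve where "top_sieve X = {x \<in> Mor C. Cod C x = X}"
definition pull where "pull c S = {x \<in> Mor C. Cod C x = Dom C c \<and> c \<cdot> x \<in> S}"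
definition push where "push c S = (\<lambda>x. c \<cdot> x) ` S"

lemma genI: "x \<in> Mor C \<Longrightarrow> Cod C x = Dom C g \<Longrightarrow> g \<cdot> x \<in> gen g"
  by (auto simp: gen_def)

lemma gen_self: "g \<in> Mor C \<Longrightarrow> g \<in> gen g"
  using genI[of "Idn C (Dom C g)" g] by simp

lemma genE:
  assumes "y \<in> gen g" obtains x where "x \<in> Mor C" "Cod C x = Dom C g" "y = g \<cdot> x"
  using assms unfolding gen_def by blast

lemma gen_Idn: "X \<in> Obj C \<Longrightarrow> gen (Idn C X) = top_sieve X"
  by (force simp: gen_def top_sieve_def)

lemma pull_gen:
  assumes p: "is_pullback C g c g' c'" shows "pull c (gen g) = gen g'"
proof (intro Set.set_eqI iffI)
  note P = pullbackD[OF p]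
  fix x
  { assume "x \<in> pull c (gen g)"
    then have x: "x \<in> Mor C" "Cod C x = Dom C c" "c \<cdot> x \<in> gen g" by (simp_all add: pull_def)
    obtain y where y: "y \<in> Mor C" "Cod C y = Dom C g" "c \<cdot> x = g \<cdot> y" by (rule genE[OF x(3)])
    have "Dom C (c \<cdot> x) = Dom C (g \<cdot> y)" using y(3) by simp
    then have "Dom C x = Dom C y" using x(1,2) y(1,2) P by simp
    then have "\<exists>u. u \<in> Mor C \<and> Dom C u = Dom C y \<and> Cod C u = Dom C c' \<and> g' \<cdot> u = x \<and> c' \<cdot> u = y"
      using pullback_ex[OF p, of x y] x(1,2) y by simp
    then obtain u where u: "u \<in> Mor C" "Cod C u = Dom C c'" "g' \<cdot> u = x" by blast
    then show "x \<in> gen g'" using genI[of u g'] P(8) by simp }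
  { assume "x \<in> gen g'"
    then obtain u where u: "u \<in> Mor C" "Cod C u = Dom C g'" "x = g' \<cdot> u" by (rule genE)
    have "c \<cdot> g' \<cdot> u = g \<cdot> c' \<cdot> u" using u(1,2) P by (simp add: reassoc[OF P(9)])
    then have "c \<cdot> g' \<cdot> u \<in> gen g" using genI[of "c' \<cdot> u" g] u(1,2) P by simp
    then show "x \<in> pull c (gen g)" unfolding u(3) pull_def using u(1,2) P by simp }
qed

lemma push_gen:
  assumes [simp]: "k \<in> Mor C" "h \<in> Mor C" "Cod C k = Dom C h" shows "push h (gen k) = gen (h \<cdot> k)"
proof (intro Set.set_eqI iffI)
  fix x
  { assume "x \<in> push h (gen k)"
    then obtain z where z: "z \<in> gen k" "x = h \<cdot> z" by (auto simp: push_def)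
    obtain y where y: "y \<in> Mor C" "Cod C y = Dom C k" "z = k \<cdot> y" by (rule genE[OF z(1)])
    then show "x \<in> gen (h \<cdot> k)" unfolding z(2) y(3) using genI[of y "h \<cdot> k"] by simp }
  { assume "x \<in> gen (h \<cdot> k)"
    then obtain y where y: "y \<in> Mor C" "Cod C y = Dom C (h \<cdot> k)" "x = (h \<cdot> k) \<cdot> y" by (rule genE)
    then have "x = h \<cdot> (k \<cdot> y)" "k \<cdot> y \<in> gen k" using genI[of y k] by simp_all
    then show "x \<in> push h (gen k)" unfolding push_def by blast }
qed

lemma gen_comp_subset:
  assumes [simp]: "k \<in> Mor C" "h \<in> Mor C" "Cod C k = Dom C h" shows "gen (h \<cdot> k) \<subseteq> gen h"
proof
  fix x assume "x \<in> gen (h \<cdot> k)"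
  then obtain y where y: "y \<in> Mor C" "Cod C y = Dom C (h \<cdot> k)" "x = (h \<cdot> k) \<cdot> y" by (rule genE)
  then show "x \<in> gen h" using genI[of "k \<cdot> y" h] by simp
qed

lemma pull_mono: "S \<subseteq> T \<Longrightarrow> pull c S \<subseteq> pull c T"
  by (auto simp: pull_def)

lemma push_mono: "S \<subseteq> T \<Longrightarrow> push c S \<subseteq> push c T"
  by (auto simp: push_def)

end

context preadditive_category
begin

definition is_sieve where
  "is_sieve X S \<longleftrightarrow> S \<subseteq> top_sieve X \<and>
     (\<forall>x\<in>S. \<forall>u\<in>Mor C. Cod C u = Dom C x \<longrightarrow> x \<cdot> u \<in> S) \<and>
     (\<forall>x\<in>S. \<forall>y\<in>S. Dom C x = Dom C y \<longrightarrow> x \<^bold>+ y \<in> S) \<and> (\<forall>W\<in>Obj C. Zero C W X \<in> S)"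

definition join where "join S T = {x \<^bold>+ y |x y. x \<in> S \<and> y \<in> T \<and> Dom C x = Dom C y}"

lemma is_sieveD:
  assumes "is_sieve X S"
  shows "x \<in> S \<Longrightarrow> x \<in> Mor C" "x \<in> S \<Longrightarrow> Cod C x = X"
    "x \<in> S \<Longrightarrow> u \<in> Mor C \<Longrightarrow> Cod C u = Dom C x \<Longrightarrow> x \<cdot> u \<in> S"
    "x \<in> S \<Longrightarrow> y \<in> S \<Longrightarrow> Dom C x = Dom C y \<Longrightarrow> x \<^bold>+ y \<in> S"
    "W \<in> Obj C \<Longrightarrow> Zero C W X \<in> S"
  using assms by (auto simp: is_sieve_def top_sieve_def)

lemma is_sieve_neg:
  assumes "is_sieve X S" "x \<in> S" shows "neg x \<in> S"
proof -
  note D = is_sieveD[OF assms(1)]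
  note m = D(1)[OF assms(2)]
  have "x \<cdot> neg (Idn C (Dom C x)) \<in> S" using D(3)[OF assms(2), of "neg (Idn C (Dom C x))"] m by simp
  then show ?thesis using m by simp
qed

lemma is_sieve_diff:
  assumes S: "is_sieve X S" and x: "x \<in> S" "y \<in> S" "Dom C x = Dom C y" shows "x \<^bold>+ neg y \<in> S"
  using is_sieveD[OF S] is_sieve_neg[OF S x(2)] x by simp

lemma gen_sieve:
  assumes [simp]: "g \<in> Mor C" "Cod C g = X" shows "is_sieve X (gen g)"
  unfolding is_sieve_def
proof (intro conjI subsetI ballI impI)
  fix x assume "x \<in> gen g"
  then obtain a where a: "a \<in> Mor C" "Cod C a = Dom C g" "x = g \<cdot> a" by (rule genE)
  then show "x \<in> top_sieve X" by (simp add: top_sieve_def)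
next
  fix x u assume x: "x \<in> gen g" and u: "u \<in> Mor C" "Cod C u = Dom C x"
  obtain a where a: "a \<in> Mor C" "Cod C a = Dom C g" "x = g \<cdot> a" by (rule genE[OF x])
  then show "x \<cdot> u \<in> gen g" using genI[of "a \<cdot> u" g] u by simp
next
  fix x y assume x: "x \<in> gen g" and y: "y \<in> gen g" and d: "Dom C x = Dom C y"
  obtain a where a: "a \<in> Mor C" "Cod C a = Dom C g" "x = g \<cdot> a" by (rule genE[OF x])
  obtain b where b: "b \<in> Mor C" "Cod C b = Dom C g" "y = g \<cdot> b" by (rule genE[OF y])
  show "x \<^bold>+ y \<in> gen g" using genI[of "a \<^bold>+ b" g] a b d by simp
next
  fix W assume W: "W \<in> Obj C"
  then have "g \<cdot> Zero C W (Dom C g) \<in> gen g" by (intro genI) simp_all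
  then show "Zero C W X \<in> gen g" using W by simp
qed

lemma joinI: "x \<in> S \<Longrightarrow> y \<in> T \<Longrightarrow> Dom C x = Dom C y \<Longrightarrow> x \<^bold>+ y \<in> join S T"
  by (auto simp: join_def)

lemma join_upper:
  assumes S: "is_sieve X S" and T: "is_sieve X T" shows "S \<subseteq> join S T" "T \<subseteq> join S T"
proof -
  show "S \<subseteq> join S T"
  proof
    fix x assume x: "x \<in> S"
    note m = is_sieveD(1,2)[OF S x]
    have "Zero C (Dom C x) X \<in> T" "x \<^bold>+ Zero C (Dom C x) X = x" "Dom C (Zero C (Dom C x) X) = Dom C x"
      using m(1) m(2)[symmetric] is_sieveD(5)[OF T] by simp_all
    then show "x \<in> join S T" using joinI[OF x, of "Zero C (Dom C x) X" T] by simp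
  qed
  show "T \<subseteq> join S T"
  proof
    fix x assume x: "x \<in> T"
    note m = is_sieveD(1,2)[OF T x]
    have "Zero C (Dom C x) X \<in> S" "Zero C (Dom C x) X \<^bold>+ x = x" "Dom C (Zero C (Dom C x) X) = Dom C x"
      using m(1) m(2)[symmetric] is_sieveD(5)[OF S] by simp_all
    then show "x \<in> join S T" using joinI[of "Zero C (Dom C x) X" S x T] x by simp
  qed
qed

lemma join_least:
  assumes "is_sieve X U" "S \<subseteq> U" "T \<subseteq> U" shows "join S T \<subseteq> U"
  unfolding join_def using is_sieveD(4)[OF assms(1)] assms(2,3) by blast

lemma join_gen:
  assumes P: "biprod P (Dom C g) (Dom C c) i j p q" and g: "g \<in> Mor C" "c \<in> Mor C" "Cod C c = Cod C g"
  shows "join (gen g) (gen c) = gen (g \<cdot> p \<^bold>+ c \<cdot> q)"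
proof (intro Set.set_eqI iffI)
  note [simp] = biprodD[OF P] g
  note e = biprod_eqs[OF P]
  fix x
  { assume "x \<in> join (gen g) (gen c)"
    then obtain y z where yz: "y \<in> gen g" "z \<in> gen c" "Dom C y = Dom C z" "x = y \<^bold>+ z"
      by (auto simp: join_def)
    obtain a where a: "a \<in> Mor C" "Cod C a = Dom C g" "y = g \<cdot> a" by (rule genE[OF yz(1)])
    obtain b where b: "b \<in> Mor C" "Cod C b = Dom C c" "z = c \<cdot> b" by (rule genE[OF yz(2)])
    have ab: "Dom C a = Dom C b" using yz(3) a b by simp
    have "(g \<cdot> p \<^bold>+ c \<cdot> q) \<cdot> (i \<cdot> a \<^bold>+ j \<cdot> b) = x" unfolding yz(4) using a b ab by (simp add: e)
    then show "x \<in> gen (g \<cdot> p \<^bold>+ c \<cdot> q)" using genI[of "i \<cdot> a \<^bold>+ j \<cdot> b" "g \<cdot> p \<^bold>+ c \<cdot> q"] a b ab by simp }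
  { assume "x \<in> gen (g \<cdot> p \<^bold>+ c \<cdot> q)"
    then obtain a where a: "a \<in> Mor C" "Cod C a = Dom C (g \<cdot> p \<^bold>+ c \<cdot> q)" "x = (g \<cdot> p \<^bold>+ c \<cdot> q) \<cdot> a"
      by (rule genE)
    then have "x = g \<cdot> p \<cdot> a \<^bold>+ c \<cdot> q \<cdot> a" by simp
    moreover have "g \<cdot> p \<cdot> a \<in> gen g" "c \<cdot> q \<cdot> a \<in> gen c" "Dom C (g \<cdot> p \<cdot> a) = Dom C (c \<cdot> q \<cdot> a)"
      using a genI[of "p \<cdot> a" g] genI[of "q \<cdot> a" c] by simp_all
    ultimately show "x \<in> join (gen g) (gen c)" using joinI by simp }
qed

end

context exact_category
begin

definition sieves where "sieves X = {gen g |g. g \<in> deflations E \<and> Cod C g = X}"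

lemma sievesI: "g \<in> deflations E \<Longrightarrow> Cod C g = X \<Longrightarrow> gen g \<in> sieves X"
  by (auto simp: sieves_def)

lemma sievesE:
  assumes "S \<in> sieves X" obtains g where "g \<in> deflations E" "g \<in> Mor C" "Cod C g = X" "S = gen g"
  using assms deflation_Mor unfolding sieves_def by blast

lemma sieves_is_sieve: assumes "S \<in> sieves X" shows "is_sieve X S"
proof -
  obtain g where "g \<in> deflations E" "g \<in> Mor C" "Cod C g = X" "S = gen g" by (rule sievesE[OF assms])
  then show ?thesis using gen_sieve by blast
qed

lemma sieves_subset_top: "S \<in> sieves X \<Longrightarrow> S \<subseteq> top_sieve X"
  using sieves_is_sieve by (simp add: is_sieve_def)

lemma sieves_top: assumes X: "X \<in> Obj C" shows "top_sieve X \<in> sieves X"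
  using sievesI[OF Idn_deflation[OF X], of X] gen_Idn[OF X] X by simp

lemma sieves_pull:
  assumes S: "S \<in> sieves X" and c: "c \<in> Mor C" "Cod C c = X" shows "pull c S \<in> sieves (Dom C c)"
proof -
  obtain g where g: "g \<in> deflations E" "g \<in> Mor C" "Cod C g = X" "S = gen g" by (rule sievesE[OF S])
  obtain g' c' where p: "is_pullback C g c g' c'" "g' \<in> deflations E"
    using deflation_pullback[OF g(1) c(1)] c g by metis
  then show ?thesis using pull_gen[OF p(1)] sievesI[OF p(2)] pullbackD[OF p(1)] g by simp
qed

lemma sieves_push:
  assumes R: "R \<in> sieves (Dom C h)" and h: "h \<in> deflations E" shows "push h R \<in> sieves (Cod C h)"
proof -
  obtain k where k: "k \<in> deflations E" "k \<in> Mor C" "Cod C k = Dom C h" "R = gen k" by (rule sievesE[OF R])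
  note [simp] = deflation_Mor[OF h]
  show ?thesis using sievesI[OF deflation_comp[OF k(1) h k(3)]] push_gen[of k h] k by simp
qed

text \<open>
  The sum is generated by \<open>(x, y) \<mapsto> g x + c y\<close>, which is a deflation for every map \<open>c\<close>.
\<close>

lemma sieves_join_gen:
  assumes S: "S \<in> sieves X" and c: "c \<in> Mor C" "Cod C c = X" shows "join S (gen c) \<in> sieves X"
proof -
  obtain g where g: "g \<in> deflations E" "g \<in> Mor C" "Cod C g = X" "S = gen g" by (rule sievesE[OF S])
  obtain P i j p q where P: "biprod P (Dom C g) (Dom C c) i j p q"
    using biprod_ex[OF Obj_ends(1)[OF g(2)] Obj_ends(1)[OF c(1)]] by blast
  have "g \<cdot> p \<^bold>+ c \<cdot> q \<in> deflations E" using D_copair[OF P g(1) c(1)] c g by simp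
  moreover have "Cod C (g \<cdot> p \<^bold>+ c \<cdot> q) = X" using biprodD[OF P] g c by simp
  ultimately show ?thesis using sievesI join_gen[OF P g(2) c(1)] g c by simp
qed

lemma sieves_join: "S \<in> sieves X \<Longrightarrow> T \<in> sieves X \<Longrightarrow> join S T \<in> sieves X"
  using sieves_join_gen sievesE[of T X] by metis

lemma push_pull:
  assumes h: "h \<in> Mor C" and S: "is_sieve (Cod C h) S" shows "push h (pull h S) = S \<inter> gen h"
proof (intro Set.set_eqI iffI)
  fix x
  { assume "x \<in> push h (pull h S)"
    then obtain y where "y \<in> Mor C" "Cod C y = Dom C h" "h \<cdot> y \<in> S" "x = h \<cdot> y"
      by (auto simp: push_def pull_def)
    then show "x \<in> S \<inter> gen h" using genI by simp }
  { assume "x \<in> S \<inter> gen h"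
    then obtain y where "y \<in> Mor C" "Cod C y = Dom C h" "x = h \<cdot> y" "x \<in> S" using genE by blast
    then show "x \<in> push h (pull h S)" by (auto simp: push_def pull_def) }
qed

text \<open>
  If \<open>h\<close> generates \<open>T\<close>, then \<open>S \<inter> T\<close> is the image under \<open>h\<close> of the pull-back of \<open>S\<close> along \<open>h\<close>.
\<close>

lemma sieves_meet: assumes S: "S \<in> sieves X" and T: "T \<in> sieves X" shows "S \<inter> T \<in> sieves X"
proof -
  obtain h where h: "h \<in> deflations E" "h \<in> Mor C" "Cod C h = X" "T = gen h" by (rule sievesE[OF T])
  have "push h (pull h S) \<in> sieves (Cod C h)" by (rule sieves_push) (use sieves_pull[OF S h(2,3)] h in simp_all)
  then show ?thesis using push_pull[OF h(2)] sieves_is_sieve[OF S] h by simp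
qed

lemma sieve_modular:
  assumes U: "is_sieve X U" and V: "is_sieve X V" and T: "is_sieve X T"
    and UV: "U \<subseteq> V" "U \<inter> T = V \<inter> T" "join U T = join V T"
  shows "U = V"
proof
  show "V \<subseteq> U"
  proof
    fix v assume v: "v \<in> V"
    then have "v \<in> join U T" using join_upper(1)[OF V T] UV(3) by blast
    then obtain u t where ut: "u \<in> U" "t \<in> T" "Dom C u = Dom C t" "v = u \<^bold>+ t" by (auto simp: join_def)
    note m = is_sieveD(1,2)[OF U ut(1)] is_sieveD(1,2)[OF T ut(2)]
    have "v \<^bold>+ neg u = t" using m ut(3,4) add_comm[of u t] by simp
    moreover have "v \<^bold>+ neg u \<in> V" by (rule is_sieve_diff[OF V v]) (use UV(1) ut m in auto)
    ultimately have "t \<in> U" using ut(2) UV(2) by blast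
    then show "v \<in> U" using is_sieveD(4)[OF U ut(1)] ut by simp
  qed
qed (rule UV(1))

lemma height_extension:
  assumes S: "S \<in> sieves X" and T: "T \<in> sieves X" and ST: "S \<subseteq> T"
    and h: "height_le (sieves X) a S T" "height_le (sieves X) b T (top_sieve X)"
  shows "height_le (sieves X) (a + b) S (top_sieve X)"
proof (rule height_le_extension[where m = "\<lambda>U. U \<inter> T" and j = "\<lambda>U. join U T" and T = T])
  have "S \<inter> T = S" "join S T = T"
    using ST join_upper(2)[OF sieves_is_sieve[OF S] sieves_is_sieve[OF T]] join_least[OF sieves_is_sieve[OF T] ST] by blast+
  then show "height_le (sieves X) a (S \<inter> T) T" "height_le (sieves X) b (join S T) (top_sieve X)" using h by simp_all
  show "U = V" if "U \<in> sieves X" "V \<in> sieves X" "U \<subseteq> V" "U \<inter> T = V \<inter> T" "join U T = join V T" for U V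
    using sieve_modular sieves_is_sieve that T by blast
  show "U \<inter> T \<subseteq> V \<inter> T \<and> join U T \<subseteq> join V T" if "U \<subseteq> V" for U V
    using that unfolding join_def by blast
  show "join U T \<subseteq> top_sieve X" if "U \<in> sieves X" for U
    using sieves_subset_top sieves_join that T by blast
qed (use S T sieves_meet sieves_join in auto)

lemma sieve_pull_cancel:
  assumes V: "is_sieve X V" and c: "c \<in> Mor C" "Dom C c = X" and S: "pull c S \<subseteq> V"
    and x: "x \<in> Mor C" "Cod C x = X" "v \<in> V" "Dom C v = Dom C x" "c \<cdot> (x \<^bold>+ neg v) \<in> S"
  shows "x \<in> V"
proof -
  note v = is_sieveD(1,2)[OF V x(3)]
  have "x \<^bold>+ neg v \<in> V" using S x v c by (auto simp: pull_def simp del: comp_add)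
  then have "(x \<^bold>+ neg v) \<^bold>+ v \<in> V" using is_sieveD(4)[OF V, of "x \<^bold>+ neg v" v] x v by simp
  then show ?thesis using x v by simp
qed

text \<open>
  A chain of sieves on \<open>Y\<close> above \<open>pull c S\<close> is the pull-back of the chain of sieves
  \<open>S + push c T\<close> on \<open>X\<close>.
\<close>

lemma height_pull:
  assumes S: "S \<in> sieves X" and c: "c \<in> Mor C" "Cod C c = X" and h: "height_le (sieves X) n S (top_sieve X)"
  shows "height_le (sieves (Dom C c)) n (pull c S) (top_sieve (Dom C c))"
proof (rule height_le_map[where F = "\<lambda>T. join S (push c T)" and ?S0.0 = "pull c S"])
  have sp: "is_sieve X (push c T)" "join S (push c T) \<in> sieves X" if T: "T \<in> sieves (Dom C c)" for T
  proof -
    obtain t where t: "t \<in> deflations E" "t \<in> Mor C" "Cod C t = Dom C c" "T = gen t" by (rule sievesE[OF T])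
    have "push c T = gen (c \<cdot> t)" using push_gen[of t c] t c by simp
    then show "is_sieve X (push c T)" "join S (push c T) \<in> sieves X"
      using sieves_join_gen[OF S, of "c \<cdot> t"] gen_sieve[of "c \<cdot> t" X] t(2,3) c by simp_all
  qed
  show "pull c S \<in> sieves (Dom C c)" by (rule sieves_pull[OF S c])
  then show "pull c S \<subseteq> top_sieve (Dom C c)" by (rule sieves_subset_top)
  show "height_le (sieves X) n (join S (push c (pull c S))) (top_sieve X)"
    by (rule height_le_bot[OF h join_upper(1)[OF sieves_is_sieve[OF S] sp(1)]]) (rule sieves_pull[OF S c])
  show "join S (push c T) \<in> sieves X \<and> join S (push c T) \<subseteq> top_sieve X" if "T \<in> sieves (Dom C c)" for T
    using sp(2)[OF that] sieves_subset_top by blast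
  have pull_join: "pull c (join S (push c T)) \<subseteq> T" if T: "T \<in> sieves (Dom C c)" "pull c S \<subseteq> T" for T
  proof
    note T' = sieves_is_sieve[OF T(1)]
    fix x assume "x \<in> pull c (join S (push c T))"
    then have x: "x \<in> Mor C" "Cod C x = Dom C c" "c \<cdot> x \<in> join S (push c T)" by (simp_all add: pull_def)
    then obtain s t where st: "s \<in> S" "t \<in> T" "Dom C s = Dom C (c \<cdot> t)" "c \<cdot> x = s \<^bold>+ c \<cdot> t"
      by (auto simp: join_def push_def)
    note m = is_sieveD(1,2)[OF sieves_is_sieve[OF S] st(1)] is_sieveD(1,2)[OF T' st(2)]
    have d: "Dom C t = Dom C x"
    proof -
      have "Dom C (c \<cdot> x) = Dom C (s \<^bold>+ c \<cdot> t)" using st(4) by simp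
      then show ?thesis using m st(3) x c by simp
    qed
    have "c \<cdot> (x \<^bold>+ neg t) = s" using m st x c d by simp
    then show "x \<in> T" using sieve_pull_cancel[OF T' c(1) refl T(2) x(1,2) st(2) d] st(1) by simp
  qed
  show "join S (push c U) \<subset> join S (push c V)"
    if U: "U \<in> sieves (Dom C c)" and V: "V \<in> sieves (Dom C c)" and UV: "pull c S \<subseteq> U" "U \<subset> V" for U V
  proof
    show "join S (push c U) \<subseteq> join S (push c V)" using UV(2) unfolding join_def push_def by blast
    show "join S (push c U) \<noteq> join S (push c V)"
    proof
      assume eq: "join S (push c U) = join S (push c V)"
      have "V \<subseteq> pull c (join S (push c V))"
      proof
        fix v assume v: "v \<in> V"
        note m = is_sieveD(1,2)[OF sieves_is_sieve[OF V] v]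
        have "c \<cdot> v \<in> push c V" using v by (auto simp: push_def)
        then show "v \<in> pull c (join S (push c V))"
          using join_upper(2)[OF sieves_is_sieve[OF S] sp(1)[OF V]] m by (auto simp: pull_def)
      qed
      then have "V \<subseteq> U" using pull_join[OF U UV(1)] unfolding eq by blast
      then show False using UV(2) by blast
    qed
  qed
qed simp

text \<open>
  Pulling back along \<open>h\<close> and pushing forward along \<open>h\<close> identify the sieves between \<open>S\<close> and \<open>gen h\<close>
  with the sieves above \<open>pull h S\<close>.
\<close>

lemma height_restrict:
  assumes h: "h \<in> deflations E" and S: "S \<in> sieves (Cod C h)" "S \<subseteq> gen h"
  shows "height_le (sieves (Dom C h)) n (pull h S) (top_sieve (Dom C h)) \<longleftrightarrow>
    height_le (sieves (Cod C h)) n S (gen h)"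
proof
  have hM: "h \<in> Mor C" using h by (rule deflation_Mor)
  have pp: "push h (pull h U) = U" if "U \<in> sieves (Cod C h)" "U \<subseteq> gen h" for U
    using push_pull[OF hM sieves_is_sieve[OF that(1)]] that(2) by blast
  {
    assume H: "height_le (sieves (Dom C h)) n (pull h S) (top_sieve (Dom C h))"
    show "height_le (sieves (Cod C h)) n S (gen h)"
    proof (rule height_le_map[where F = "pull h" and ?S0.0 = S])
      show "pull h U \<in> sieves (Dom C h) \<and> pull h U \<subseteq> top_sieve (Dom C h)" if "U \<in> sieves (Cod C h)" for U
        using sieves_pull[OF that hM refl] sieves_subset_top by blast
      show "pull h U \<subset> pull h V"
        if UV: "U \<in> sieves (Cod C h)" "V \<in> sieves (Cod C h)" "U \<subset> V" "V \<subseteq> gen h" for U V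
      proof
        show "pull h U \<subseteq> pull h V" using pull_mono UV(3) by blast
        have "U \<subseteq> gen h" "U \<noteq> V" using UV(3,4) by blast+
        then show "pull h U \<noteq> pull h V" using pp[OF UV(1)] pp[OF UV(2,4)] by metis
      qed
    qed (use H S in auto)
  }
  {
    assume H: "height_le (sieves (Cod C h)) n S (gen h)"
    show "height_le (sieves (Dom C h)) n (pull h S) (top_sieve (Dom C h))"
    proof (rule height_le_map[where F = "push h" and ?S0.0 = "pull h S"])
      show "height_le (sieves (Cod C h)) n (push h (pull h S)) (gen h)" using pp[OF S] H by simp
      show "pull h S \<in> sieves (Dom C h)" by (rule sieves_pull[OF S(1) hM refl])
      then show "pull h S \<subseteq> top_sieve (Dom C h)" by (rule sieves_subset_top)
      show "push h V \<in> sieves (Cod C h) \<and> push h V \<subseteq> gen h" if V: "V \<in> sieves (Dom C h)" for V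
      proof -
        have "push h V \<subseteq> gen h" using genI is_sieveD(1,2)[OF sieves_is_sieve[OF V]] by (auto simp: push_def)
        then show ?thesis using sieves_push[OF V h] by blast
      qed
      show "push h U \<subset> push h V"
        if U: "U \<in> sieves (Dom C h)" and V: "V \<in> sieves (Dom C h)" and UV: "pull h S \<subseteq> U" "U \<subset> V" for U V
      proof
        show "push h U \<subseteq> push h V" using push_mono UV(2) by blast
        show "push h U \<noteq> push h V"
        proof
          assume eq: "push h U = push h V"
          have "V \<subseteq> U"
          proof
            fix v assume v: "v \<in> V"
            note m = is_sieveD(1,2)[OF sieves_is_sieve[OF V] v]
            have "h \<cdot> v \<in> push h U" unfolding eq using v by (auto simp: push_def)
            then obtain u where u: "u \<in> U" "h \<cdot> v = h \<cdot> u" by (auto simp: push_def)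
            note mu = is_sieveD(1,2)[OF sieves_is_sieve[OF U] u(1)]
            have "Dom C (h \<cdot> v) = Dom C (h \<cdot> u)" using u(2) by simp
            then have d: "Dom C u = Dom C v" using m mu hM by simp
            have "h \<cdot> (v \<^bold>+ neg u) = Zero C (Dom C v) (Cod C h)" using m mu hM d u(2) by simp
            then have "h \<cdot> (v \<^bold>+ neg u) \<in> S" using is_sieveD(5)[OF sieves_is_sieve[OF S(1)], of "Dom C v"] m by simp
            then show "v \<in> U" using sieve_pull_cancel[OF sieves_is_sieve[OF U] hM refl UV(1) m u(1) d] by simp
          qed
          then show False using UV(2) by blast
        qed
      qed
    qed simp
  }
qed

end

section \<open>Conflations with bounded chains\<close>

lemma height_le_cong:
  assumes "\<And>U. S \<subseteq> U \<Longrightarrow> U \<in> L \<longleftrightarrow> U \<in> L'"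
  shows "height_le L n S T \<longleftrightarrow> height_le L' n S T"
  using assms
proof (induction n arbitrary: S)
  case 0
  then show ?case unfolding height_le.simps by blast
next
  case (Suc n)
  have "height_le L n U T \<longleftrightarrow> height_le L' n U T" if "S \<subset> U" for U
    using Suc.prems that by (intro Suc.IH) blast
  then show ?case unfolding height_le.simps using Suc.prems by blast
qed

context exact_category
begin

definition bounded where
  "bounded X S \<longleftrightarrow> S \<in> sieves X \<and> (\<exists>n. height_le (sieves X) n S (top_sieve X))"

lemma bounded_mono: "bounded X S \<Longrightarrow> S \<subseteq> T \<Longrightarrow> T \<in> sieves X \<Longrightarrow> bounded X T"
  using height_le_bot unfolding bounded_def by blast

lemma bounded_pull:
  assumes "bounded X S" "c \<in> Mor C" "Cod C c = X" shows "bounded (Dom C c) (pull c S)"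
  using assms height_pull[of S X c] sieves_pull[of S X c] unfolding bounded_def by blast

lemma bounded_top: "X \<in> Obj C \<Longrightarrow> bounded X (top_sieve X)"
proof -
  assume "X \<in> Obj C"
  moreover have "height_le (sieves X) 0 (top_sieve X) (top_sieve X)" by auto
  ultimately show ?thesis unfolding bounded_def using sieves_top by blast
qed

text \<open>
  The retraction \<open>c\<close> of cokernels maps the sieve of \<open>g\<close> into that of \<open>g'\<close>, so the pull-back of the
  sieve of \<open>g\<close> along \<open>v\<close> lies in the sieve of \<open>g'\<close>. This covers isomorphic conflations and push-outs.
\<close>

lemma bounded_retract:
  assumes b: "bounded (Cod C g) (gen g)" and g: "g \<in> Mor C" and g': "g' \<in> deflations E"
    and v: "v \<in> Mor C" "Dom C v = Cod C g'" "Cod C v = Cod C g"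
    and c: "c \<in> Mor C" "Dom C c = Cod C g" "Cod C c = Cod C g'" "c \<cdot> v = Idn C (Cod C g')"
    and w: "w \<in> Mor C" "Dom C w = Dom C g" "Cod C w = Dom C g'" "c \<cdot> g = g' \<cdot> w"
  shows "bounded (Cod C g') (gen g')"
proof -
  note [simp] = g deflation_Mor[OF g'] v c(1-3) w(1-3)
  have "pull v (gen g) \<subseteq> gen g'"
  proof
    fix y assume "y \<in> pull v (gen g)"
    then have y: "y \<in> Mor C" "Cod C y = Dom C v" "v \<cdot> y \<in> gen g" by (simp_all add: pull_def)
    obtain x where x: "x \<in> Mor C" "Cod C x = Dom C g" "v \<cdot> y = g \<cdot> x" by (rule genE[OF y(3)])
    have "y = c \<cdot> v \<cdot> y" using y(1,2) by (simp add: reassoc[OF c(4)])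
    also have "\<dots> = g' \<cdot> w \<cdot> x" unfolding x(3) using x(1,2) by (simp add: reassoc[OF w(4)])
    also have "\<dots> \<in> gen g'" using x(1,2) by (intro genI) simp_all
    finally show "y \<in> gen g'" .
  qed
  then show ?thesis using bounded_mono bounded_pull[OF b v(1,3)] sievesI[OF g' refl] by simp
qed

definition fin_pairs where "fin_pairs = {(f, g) \<in> E. bounded (Cod C g) (gen g)}"

lemma fin_deflations: "g \<in> deflations fin_pairs \<longleftrightarrow> g \<in> deflations E \<and> bounded (Cod C g) (gen g)"
  by (auto simp: deflations_def fin_pairs_def)

text \<open>
  A chain above the sieve of \<open>g' g\<close> is divided at the sieve of \<open>g'\<close>; its lower part pulls back along
  \<open>g'\<close> to a chain above the sieve of \<open>g\<close>.
\<close>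

lemma fin_deflation_comp:
  assumes g: "g \<in> deflations fin_pairs" and g': "g' \<in> deflations fin_pairs" and gg: "Cod C g = Dom C g'"
  shows "g' \<cdot> g \<in> deflations fin_pairs"
proof -
  have D: "g \<in> deflations E" "g' \<in> deflations E" and B: "bounded (Cod C g) (gen g)" "bounded (Cod C g') (gen g')"
    using g g' by (simp_all add: fin_deflations)
  note [simp] = deflation_Mor[OF D(1)] deflation_Mor[OF D(2)] gg
  have d: "g' \<cdot> g \<in> deflations E" by (rule deflation_comp[OF D gg])
  have S: "gen (g' \<cdot> g) \<in> sieves (Cod C g')" "gen (g' \<cdot> g) \<subseteq> gen g'"
    using sievesI[OF d] gen_comp_subset[of g g'] by simp_all
  obtain n where n: "height_le (sieves (Dom C g')) n (gen g) (top_sieve (Dom C g'))"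
    using B(1) unfolding bounded_def gg by blast
  have "gen g \<subseteq> pull g' (gen (g' \<cdot> g))"
  proof
    fix y assume "y \<in> gen g"
    then obtain x where x: "x \<in> Mor C" "Cod C x = Dom C g" "y = g \<cdot> x" by (rule genE)
    then show "y \<in> pull g' (gen (g' \<cdot> g))" using genI[of x "g' \<cdot> g"] by (simp add: pull_def)
  qed
  then have "height_le (sieves (Dom C g')) n (pull g' (gen (g' \<cdot> g))) (top_sieve (Dom C g'))"
    using height_le_bot n by blast
  then have "height_le (sieves (Cod C g')) n (gen (g' \<cdot> g)) (gen g')"
    using height_restrict[OF D(2) S] by blast
  moreover obtain m where "height_le (sieves (Cod C g')) m (gen g') (top_sieve (Cod C g'))"
    using B(2) unfolding bounded_def by blast
  ultimately have "height_le (sieves (Cod C g')) (n + m) (gen (g' \<cdot> g)) (top_sieve (Cod C g'))"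
    using height_extension[OF S(1) sievesI[OF D(2) refl] S(2)] by blast
  then have "bounded (Cod C g') (gen (g' \<cdot> g))" using S(1) unfolding bounded_def by blast
  then show ?thesis using d by (simp add: fin_deflations)
qed

text \<open>
  For inflations \<open>f\<close> and \<open>f'\<close>, the cokernels form a conflation \<open>k\<close>, \<open>q\<close>; here is its exactness in
  the middle. Deflations are locally surjective: \<open>z\<close> and the kernel of \<open>k\<close> are first lifted along
  deflations, where the diagram can be chased, and the result descends.
\<close>

lemma kernel_of_induced_cokernel_map:
  assumes fg: "(f, g) \<in> E" and fg': "(f', g') \<in> E" and ff: "Cod C f = Dom C f'" and h: "(f' \<cdot> f, h) \<in> E"
    and k: "k \<in> Mor C" "Dom C k = Cod C g" "Cod C k = Cod C h" "k \<cdot> g = h \<cdot> f'"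
    and q: "q \<in> Mor C" "Dom C q = Cod C h" "Cod C q = Cod C g'" "q \<cdot> h = g'"
    and z: "z \<in> Mor C" "Cod C z = Cod C h" "q \<cdot> z = Zero C (Dom C z) (Cod C g')"
  shows "z \<in> gen k"
proof -
  note G = ker_coker_pairD[OF pairD[OF fg]] and G' = ker_coker_pairD[OF pairD[OF fg']]
    and H = ker_coker_pairD[OF pairD[OF h]]
  note [simp] = G(1-3) G'(1-3) H(2) ff[symmetric] k(1-3) q(1-3) z(1,2)
  have [simp]: "Dom C h = Cod C f'" using H(3) by simp
  have defl: "g \<in> deflations E" "h \<in> deflations E" using fg h by (auto simp: deflations_def)
  have k0: "w = Zero C (Dom C w) (Dom C k)"
    if w: "w \<in> Mor C" "Cod C w = Dom C k" "k \<cdot> w = Zero C (Dom C w) (Cod C k)" for w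
  proof -
    note [simp] = w(1,2)
    obtain g1 w1 where p: "is_pullback C g w g1 w1" "g1 \<in> deflations E"
      using deflation_pullback[OF defl(1), of w] by auto
    note P = pullbackD[OF p(1)]
    note [simp] = P(3,4) P(6-8)[simplified]
    have "h \<cdot> f' \<cdot> w1 = k \<cdot> g \<cdot> w1" by (simp add: reassoc[OF k(4)])
    also have "\<dots> = (k \<cdot> w) \<cdot> g1" by (simp add: P(9))
    also have "\<dots> = Zero C (Dom C w1) (Cod C h)" unfolding w(3) by simp
    finally have "\<exists>u. u \<in> Mor C \<and> Dom C u = Dom C w1 \<and> Cod C u = Dom C f \<and> (f' \<cdot> f) \<cdot> u = f' \<cdot> w1"
      using kernel_ex[OF H(5), of "f' \<cdot> w1"] by simp
    then obtain u where u: "u \<in> Mor C" "Dom C u = Dom C w1" "Cod C u = Dom C f" "(f' \<cdot> f) \<cdot> u = f' \<cdot> w1"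
      by blast
    have "f \<cdot> u = w1" by (rule kernel_mono[OF G'(5)]) (use u in simp_all)
    then have "g \<cdot> w1 = g \<cdot> f \<cdot> u" by simp
    also have "\<dots> = Zero C (Dom C w1) (Cod C g)" using u(1-3) by (simp add: reassoc[OF G(4)])
    finally have "w \<cdot> g1 = Zero C (Dom C g1) (Cod C w)" using P(9) by simp
    moreover obtain f1 where "(f1, g1) \<in> E" using p(2) by (auto simp: deflations_def)
    ultimately show ?thesis using epi_Zero[OF ker_coker_pairD(7)[OF pairD], of f1 g1 w] by simp
  qed
  obtain h1 z1 where p: "is_pullback C h z h1 z1" "h1 \<in> deflations E"
    using deflation_pullback[OF defl(2), of z] by auto
  note P = pullbackD[OF p(1)]
  note [simp] = P(3,4) P(6-8)[simplified]
  obtain f1 where f1: "(f1, h1) \<in> E" using p(2) by (auto simp: deflations_def)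
  note F = ker_coker_pairD[OF pairD[OF f1]]
  note [simp] = F(1,3)
  have "g' \<cdot> z1 = (q \<cdot> h) \<cdot> z1" using q(4) by simp
  also have "\<dots> = (q \<cdot> z) \<cdot> h1" by (simp add: P(9))
  also have "\<dots> = Zero C (Dom C z1) (Cod C g')" unfolding z(3) by simp
  finally have "\<exists>y. y \<in> Mor C \<and> Dom C y = Dom C z1 \<and> Cod C y = Dom C f' \<and> f' \<cdot> y = z1"
    using kernel_ex[OF G'(5), of z1] by simp
  then obtain y where y: "y \<in> Mor C" "Dom C y = Dom C z1" "Cod C y = Dom C f'" "f' \<cdot> y = z1" by blast
  note [simp] = y(1-3)
  have ky: "k \<cdot> g \<cdot> y = z \<cdot> h1" using y(4) by (simp add: reassoc[OF k(4)] P(9))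
  have "k \<cdot> g \<cdot> y \<cdot> f1 = Zero C (Dom C f1) (Cod C h)" using reassoc[OF ky, of f1] F(4) by simp
  then have "(g \<cdot> y) \<cdot> f1 = Zero C (Dom C f1) (Cod C (g \<cdot> y))" using k0[of "g \<cdot> y \<cdot> f1"] by simp
  then have "\<exists>c. c \<in> Mor C \<and> Cod C c = Cod C g \<and> Dom C c = Cod C h1 \<and> c \<cdot> h1 = g \<cdot> y"
    using cokernel_ex[OF F(6), of "g \<cdot> y"] by simp
  then obtain c where c: "c \<in> Mor C" "Cod C c = Cod C g" "Dom C c = Cod C h1" "c \<cdot> h1 = g \<cdot> y" by blast
  have "(k \<cdot> c) \<cdot> h1 = z \<cdot> h1" using c ky by simp
  then have "k \<cdot> c = z" using c(1-3) by - (rule epiD[OF F(7)], simp_all)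
  then show ?thesis using genI[of c k] c(1,2) by simp
qed

text \<open>
  For \<open>A \<rightarrow> B \<rightarrow> B'\<close>, the cokernels of the two maps and of the composite form a conflation
  \<open>B / A \<rightarrow> B' / A \<rightarrow> B' / B\<close>. A chain above the sieve of \<open>B' \<rightarrow> B' / A\<close> is divided at the preimage of
  the sieve of \<open>B' \<rightarrow> B' / B\<close>; its lower part pulls back to a chain above the sieve of \<open>B \<rightarrow> B / A\<close>.
\<close>

lemma fin_inflation_comp:
  assumes fg: "(f, g) \<in> fin_pairs" and fg': "(f', g') \<in> fin_pairs" and ff: "Cod C f = Dom C f'"
  shows "f' \<cdot> f \<in> inflations fin_pairs"
proof -
  have A: "(f, g) \<in> E" "(f', g') \<in> E" and B: "bounded (Cod C g) (gen g)" "bounded (Cod C g') (gen g')"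
    using fg fg' by (auto simp: fin_pairs_def)
  have "f' \<cdot> f \<in> inflations E" using A by (intro inflation_comp) (auto simp: inflations_def ff)
  then obtain h where h: "(f' \<cdot> f, h) \<in> E" by (auto simp: inflations_def)
  note G = ker_coker_pairD[OF pairD[OF A(1)]] and G' = ker_coker_pairD[OF pairD[OF A(2)]]
    and H = ker_coker_pairD[OF pairD[OF h]]
  note [simp] = G(1-3) G'(1-3) H(2) ff[symmetric]
  have [simp]: "Dom C h = Cod C f'" using H(3) by simp
  have "\<exists>k. k \<in> Mor C \<and> Cod C k = Cod C h \<and> Dom C k = Cod C g \<and> k \<cdot> g = h \<cdot> f'"
    using cokernel_ex[OF G(6), of "h \<cdot> f'"] H(4) by simp
  then obtain k where k: "k \<in> Mor C" "Cod C k = Cod C h" "Dom C k = Cod C g" "k \<cdot> g = h \<cdot> f'" by blast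
  have "\<exists>q. q \<in> Mor C \<and> Cod C q = Cod C g' \<and> Dom C q = Cod C h \<and> q \<cdot> h = g'"
    using cokernel_ex[OF H(6), of g'] G'(4) by (simp add: reassoc[OF G'(4)])
  then obtain q where q: "q \<in> Mor C" "Cod C q = Cod C g'" "Dom C q = Cod C h" "q \<cdot> h = g'" by blast
  note [simp] = k(1-3) q(1-3)
  have hd: "h \<in> deflations E" using h by (auto simp: deflations_def)
  have SL: "gen h \<in> sieves (Cod C h)" by (rule sievesI[OF hd refl])
  define T where "T = pull q (gen g')"
  have BT: "bounded (Cod C h) T" using bounded_pull[OF B(2) q(1,2)] by (simp add: T_def)
  then have TL: "T \<in> sieves (Cod C h)" by (simp add: bounded_def)
  note SS = sieves_is_sieve[OF SL] and TT = sieves_is_sieve[OF TL]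
  have ST: "gen h \<subseteq> T"
  proof
    fix y assume "y \<in> gen h"
    then obtain x where x: "x \<in> Mor C" "Cod C x = Dom C h" "y = h \<cdot> x" by (rule genE)
    then show "y \<in> T" using genI[of x g'] by (simp add: T_def pull_def reassoc[OF q(4)])
  qed
  \<comment> \<open>The preimage \<open>T\<close> is the sum of the sieve of \<open>h\<close> and of the image of \<open>k\<close>.\<close>
  have Tk: "\<exists>s c. s \<in> gen h \<and> c \<in> Mor C \<and> Cod C c = Cod C g \<and> Dom C s = Dom C c \<and> x = s \<^bold>+ k \<cdot> c"
    if "x \<in> T" for x
  proof -
    have x: "x \<in> Mor C" "Cod C x = Cod C h" "q \<cdot> x \<in> gen g'" using that by (simp_all add: T_def pull_def)
    obtain y where y: "y \<in> Mor C" "Cod C y = Dom C g'" "q \<cdot> x = g' \<cdot> y" by (rule genE[OF x(3)])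
    have "Dom C (q \<cdot> x) = Dom C (g' \<cdot> y)" using y(3) by simp
    then have d: "Dom C x = Dom C y" using x(1,2) y(1,2) by simp
    have "x \<^bold>+ neg (h \<cdot> y) \<in> gen k"
      by (rule kernel_of_induced_cokernel_map[OF A ff h k(1,3,2,4) q(1,3,2,4)])
        (use x y d in \<open>simp_all add: reassoc[OF q(4)]\<close>)
    then obtain c where c: "c \<in> Mor C" "Cod C c = Dom C k" "x \<^bold>+ neg (h \<cdot> y) = k \<cdot> c" by (rule genE)
    have "Dom C (x \<^bold>+ neg (h \<cdot> y)) = Dom C (k \<cdot> c)" using c(3) by simp
    then have d': "Dom C c = Dom C y" using x(1,2) y(1,2) c(1,2) d by simp
    have "h \<cdot> y \<^bold>+ k \<cdot> c = x" unfolding c(3)[symmetric] using x(1,2) y(1,2) d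
      by (simp add: add_comm[of "h \<cdot> y" "x \<^bold>+ neg (h \<cdot> y)"])
    then show ?thesis using genI[of y h] y(1,2) c(1,2) d' by (intro exI[of _ "h \<cdot> y"] exI[of _ c]) simp
  qed
  obtain n where n: "height_le (sieves (Cod C g)) n (gen g) (top_sieve (Cod C g))"
    using B(1) by (auto simp: bounded_def)
  have "height_le (sieves (Cod C h)) n (gen h) T"
  proof (rule height_le_map[where F = "pull k" and ?S0.0 = "gen h"])
    have "gen g \<subseteq> pull k (gen h)"
    proof
      fix y assume "y \<in> gen g"
      then obtain x where x: "x \<in> Mor C" "Cod C x = Dom C g" "y = g \<cdot> x" by (rule genE)
      then show "y \<in> pull k (gen h)" using genI[of "f' \<cdot> x" h] by (simp add: pull_def reassoc[OF k(4)])
    qed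
    then show "height_le (sieves (Cod C g)) n (pull k (gen h)) (top_sieve (Cod C g))"
      using height_le_bot n by blast
    show "pull k U \<in> sieves (Cod C g) \<and> pull k U \<subseteq> top_sieve (Cod C g)" if "U \<in> sieves (Cod C h)" for U
      using sieves_pull[OF that k(1,2)] sieves_subset_top by simp
    show "pull k U \<subset> pull k V"
      if UV: "U \<in> sieves (Cod C h)" "V \<in> sieves (Cod C h)" "gen h \<subseteq> U" "U \<subset> V" "V \<subseteq> T" for U V
    proof
      note U = sieves_is_sieve[OF UV(1)] and V = sieves_is_sieve[OF UV(2)]
      show "pull k U \<subseteq> pull k V" using pull_mono UV(4) by blast
      show "pull k U \<noteq> pull k V"
      proof
        assume eq: "pull k U = pull k V"
        have "V \<subseteq> U"
        proof
          fix x assume x: "x \<in> V"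
          then have "x \<in> T" using UV(5) by blast
          then obtain s c where sc: "s \<in> gen h" "c \<in> Mor C" "Cod C c = Cod C g" "Dom C s = Dom C c"
            "x = s \<^bold>+ k \<cdot> c" using Tk by blast
          note m = is_sieveD(1,2)[OF SS sc(1)]
          have sU: "s \<in> U" and sV: "s \<in> V" using sc(1) UV(3,4) by blast+
          have dx: "Dom C x = Dom C s" using sc m by simp
          have "x \<^bold>+ neg s \<in> V" by (rule is_sieve_diff[OF V x sV dx])
          moreover have "x \<^bold>+ neg s = k \<cdot> c"
            using sc m add_comm[of s "k \<cdot> c"] by simp
          ultimately have "c \<in> pull k V" using sc by (simp add: pull_def)
          then have "k \<cdot> c \<in> U" unfolding eq[symmetric] by (simp add: pull_def)
          then show "x \<in> U" unfolding sc(5) using is_sieveD(4)[OF U sU] sc by simp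
        qed
        then show False using UV(4) by blast
      qed
    qed
  qed (use SL ST in auto)
  moreover obtain m where "height_le (sieves (Cod C h)) m T (top_sieve (Cod C h))"
    using BT by (auto simp: bounded_def)
  ultimately have "bounded (Cod C h) (gen h)"
    using height_extension[OF SL TL ST] SL unfolding bounded_def by blast
  then have "(f' \<cdot> f, h) \<in> fin_pairs" using h by (simp add: fin_pairs_def)
  then show ?thesis by (auto simp: inflations_def)
qed

text \<open>
  A push-out induces an isomorphism of cokernels, which can only enlarge the sieve of the deflation.
\<close>

lemma fin_inflation_pushout:
  assumes fg: "(f, g) \<in> fin_pairs" and a: "a \<in> Mor C" "Dom C a = Dom C f"
  shows "\<exists>f' a'. is_pushout C f a f' a' \<and> f' \<in> inflations fin_pairs"
proof -
  have A: "(f, g) \<in> E" and B: "bounded (Cod C g) (gen g)" using fg by (auto simp: fin_pairs_def)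
  have fi: "f \<in> inflations E" using A by (auto simp: inflations_def)
  obtain f' a' where p: "is_pushout C f a f' a'" "f' \<in> inflations E"
    using inflation_pushout[OF fi a] by blast
  obtain g' where g': "(f', g') \<in> E" using p(2) by (auto simp: inflations_def)
  interpret op: preadditive_category "op_cat C" by (rule preadditive_op)
  have po: "is_pullback (op_cat C) f a f' a'" using p(1) by simp
  note P = op.pullbackD[OF po, simplified]
  note G = ker_coker_pairD[OF pairD[OF A]] and G' = ker_coker_pairD[OF pairD[OF g']]
  note [simp] = G(1-3) G'(1-3) a P(4) P(6,7) P(8)[symmetric]
  have e1: "(g' \<cdot> a') \<cdot> f = Zero C (Dom C f) (Cod C g')"
    using P(9)[symmetric] P(3) by (simp add: reassoc[OF G'(4)])
  then have "\<exists>c. c \<in> Mor C \<and> Cod C c = Cod C g' \<and> Dom C c = Cod C g \<and> c \<cdot> g = g' \<cdot> a'"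
    using cokernel_ex[OF G(6), of "g' \<cdot> a'"] P(3) by simp
  then obtain c where c: "c \<in> Mor C" "Cod C c = Cod C g'" "Dom C c = Cod C g" "c \<cdot> g = g' \<cdot> a'" by blast
  have "\<exists>w. w \<in> Mor C \<and> Cod C w = Cod C g \<and> Dom C w = Dom C g' \<and> w \<cdot> f' = Zero C (Dom C f') (Cod C g) \<and>
      w \<cdot> a' = g"
    using op.pullback_ex[OF po, of "Zero C (Dom C f') (Cod C g)" g] G(4) P(3) by simp
  then obtain w where w: "w \<in> Mor C" "Cod C w = Cod C g" "Dom C w = Dom C g'"
    "w \<cdot> f' = Zero C (Dom C f') (Cod C g)" "w \<cdot> a' = g" by blast
  have "\<exists>v. v \<in> Mor C \<and> Cod C v = Cod C g \<and> Dom C v = Cod C g' \<and> v \<cdot> g' = w"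
    using cokernel_ex[OF G'(6), of w] w by simp
  then obtain v where v: "v \<in> Mor C" "Cod C v = Cod C g" "Dom C v = Cod C g'" "v \<cdot> g' = w" by blast
  note [simp] = c(1-3) w(1-3) v(1-3)
  have "c \<cdot> w = g'"
  proof (rule op.pullback_joint_mono[OF po])
    show "Comp (op_cat C) f' (c \<cdot> w) = Comp (op_cat C) f' g'" using w(4) G'(4) by simp
    show "Comp (op_cat C) a' (c \<cdot> w) = Comp (op_cat C) a' g'" using w(5) c(4) P(3) by simp
  qed (use P(3) in simp_all)
  then have "(c \<cdot> v) \<cdot> g' = Idn C (Cod C g') \<cdot> g'" using v(4) by simp
  then have cv: "c \<cdot> v = Idn C (Cod C g')" by - (rule epiD[OF G'(7)], simp_all)
  have gd: "g' \<in> deflations E" using g' by (auto simp: deflations_def)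
  have "bounded (Cod C g') (gen g')"
    by (rule bounded_retract[OF B G(2) gd v(1,3,2) c(1,3,2) cv, of a']) (use c(4) P(3) in simp_all)
  then have "(f', g') \<in> fin_pairs" using g' by (simp add: fin_pairs_def)
  then show ?thesis using p(1) by (auto simp: inflations_def)
qed

lemma fin_pair_iso:
  assumes fg: "(f, g) \<in> fin_pairs" and i: "pair_iso C (f, g) (f', g')" shows "(f', g') \<in> fin_pairs"
proof -
  have A: "(f, g) \<in> E" and B: "bounded (Cod C g) (gen g)" using fg by (auto simp: fin_pairs_def)
  have A': "(f', g') \<in> E" by (rule pair_iso_closed[OF A i])
  note G = ker_coker_pairD[OF pairD[OF A]] and G' = ker_coker_pairD[OF pairD[OF A']]
  obtain b c where e: "b \<in> Mor C" "Dom C b = Cod C f" "Cod C b = Cod C f'"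
    "iso_mor C c" "Dom C c = Cod C g" "Cod C c = Cod C g'" "c \<cdot> g = g' \<cdot> b"
    using i by (auto simp: pair_iso_def)
  obtain c' where c': "c \<in> Mor C" "c' \<in> Mor C" "Dom C c' = Cod C c" "Cod C c' = Dom C c"
    "c' \<cdot> c = Idn C (Dom C c)" "c \<cdot> c' = Idn C (Cod C c)" using iso_morE e(4) by blast
  have gd: "g' \<in> deflations E" using A' by (auto simp: deflations_def)
  have "bounded (Cod C g') (gen g')"
    by (rule bounded_retract[OF B G(2) gd, of c' c b]) (use c' e G(3) G'(3) in simp_all)
  then show ?thesis using A' by (simp add: fin_pairs_def)
qed

lemma exact_fin_pairs: "exact_structure C fin_pairs"
proof -
  have k: "\<forall>(f, g)\<in>fin_pairs. ker_coker_pair C f g" using pairD by (auto simp: fin_pairs_def)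
  have i: "\<forall>d\<in>fin_pairs. \<forall>d'. pair_iso C d d' \<longrightarrow> d' \<in> fin_pairs"
    using fin_pair_iso by fast
  have id: "\<forall>X\<in>Obj C. Idn C X \<in> inflations fin_pairs \<and> Idn C X \<in> deflations fin_pairs"
  proof
    fix X assume X [simp]: "X \<in> Obj C"
    have "bounded X (gen (Idn C X))" using bounded_top[OF X] gen_Idn[OF X] by simp
    then have 1: "Idn C X \<in> deflations fin_pairs" using Idn_deflation[OF X] by (simp add: fin_deflations)
    obtain Z where Z: "null Z" using null_ex by blast
    have ZO [simp]: "Z \<in> Obj C" using Z by (simp add: null_def)
    have kc: "ker_coker_pair C (Idn C X) (Zero C X Z)"
      using additive_category.ker_coker_Idn[OF additive_op, of Z X] Z by simp
    have d: "Zero C X Z \<in> deflations E" using Z by (intro D_null) simp_all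
    have E: "(Idn C X, Zero C X Z) \<in> E" by (rule pairI_kernel[OF d ker_coker_pairD(5)[OF kc]])
    have "gen (Zero C X Z) = top_sieve Z"
    proof
      show "gen (Zero C X Z) \<subseteq> top_sieve Z" using sieves_subset_top[OF sievesI[OF d refl]] by simp
      show "top_sieve Z \<subseteq> gen (Zero C X Z)"
      proof
        fix x assume "x \<in> top_sieve Z"
        then have x: "x \<in> Mor C" "Cod C x = Z" by (simp_all add: top_sieve_def)
        have "x = Zero C X Z \<cdot> Zero C (Dom C x) X" using null_Cod[OF Z x] x by simp
        then show "x \<in> gen (Zero C X Z)" using genI[of "Zero C (Dom C x) X" "Zero C X Z"] x by simp
      qed
    qed
    then have "bounded (Cod C (Zero C X Z)) (gen (Zero C X Z))" using bounded_top[OF ZO] by simp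
    then have "(Idn C X, Zero C X Z) \<in> fin_pairs" using E by (simp add: fin_pairs_def)
    then show "Idn C X \<in> inflations fin_pairs \<and> Idn C X \<in> deflations fin_pairs"
      using 1 by (auto simp: inflations_def)
  qed
  have comp: "\<forall>f\<in>inflations fin_pairs. \<forall>f'\<in>inflations fin_pairs.
      Cod C f = Dom C f' \<longrightarrow> f' \<cdot> f \<in> inflations fin_pairs"
    using fin_inflation_comp unfolding inflations_def[of fin_pairs] by blast
  have comp': "\<forall>g\<in>deflations fin_pairs. \<forall>g'\<in>deflations fin_pairs.
      Cod C g = Dom C g' \<longrightarrow> g' \<cdot> g \<in> deflations fin_pairs"
    using fin_deflation_comp by blast
  have po: "\<forall>f\<in>inflations fin_pairs. \<forall>a\<in>Mor C. Dom C a = Dom C f \<longrightarrow>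
      (\<exists>f' a'. is_pushout C f a f' a' \<and> f' \<in> inflations fin_pairs)"
    using fin_inflation_pushout by (auto simp: inflations_def[of fin_pairs])
  have pb: "\<forall>g\<in>deflations fin_pairs. \<forall>c\<in>Mor C. Cod C c = Cod C g \<longrightarrow>
      (\<exists>g' c'. is_pullback C g c g' c' \<and> g' \<in> deflations fin_pairs)"
  proof (intro ballI impI)
    fix g c assume g: "g \<in> deflations fin_pairs" and c: "c \<in> Mor C" "Cod C c = Cod C g"
    have D: "g \<in> deflations E" and B: "bounded (Cod C g) (gen g)" using g by (simp_all add: fin_deflations)
    obtain g' c' where p: "is_pullback C g c g' c'" "g' \<in> deflations E"
      using deflation_pullback[OF D c] by blast
    have "bounded (Cod C g') (gen g')"
      using bounded_pull[OF B c] pull_gen[OF p(1)] pullbackD(6)[OF p(1)] by simp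
    then show "\<exists>g' c'. is_pullback C g c g' c' \<and> g' \<in> deflations fin_pairs"
      using p by (auto simp: fin_deflations)
  qed
  show ?thesis unfolding exact_structure_def by (intro conjI k i id comp comp' po pb)
qed

text \<open>
  A generator of the smaller sieve factors through \<open>h\<close>, so the obscure axiom applies to \<open>h\<close>.
\<close>

lemma gen_upward:
  assumes g: "g \<in> deflations E" and h: "is_kernel C k h" "Cod C h = Cod C g" "gen g \<subseteq> gen h"
  shows "(k, h) \<in> E"
proof -
  have "g \<in> gen h" using h(3) gen_self[OF deflation_Mor[OF g]] by blast
  then obtain v where v: "v \<in> Mor C" "Cod C v = Dom C h" "g = h \<cdot> v" by (rule genE)
  then show ?thesis using pairI_left_factor[OF _ v(1,2) h(1)] g by simp
qed

lemma sieves_subset: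
  assumes F: "exact_structure C F" "E \<subseteq> F" shows "sieves X \<subseteq> exact_category.sieves C F X"
proof -
  interpret F: exact_category C F by unfold_locales (rule F)
  have "deflations E \<subseteq> deflations F" using F(2) by (auto simp: deflations_def)
  then show ?thesis unfolding sieves_def F.sieves_def by blast
qed

lemma sieves_upward:
  assumes F: "exact_structure C F" "E \<subseteq> F" and S: "S \<in> sieves X" "S \<subseteq> U"
  shows "U \<in> sieves X \<longleftrightarrow> U \<in> exact_category.sieves C F X"
proof
  interpret F: exact_category C F by unfold_locales (rule F)
  show "U \<in> sieves X \<Longrightarrow> U \<in> F.sieves X" using sieves_subset[OF F] by blast
  assume "U \<in> F.sieves X"
  then obtain h where h: "h \<in> deflations F" "h \<in> Mor C" "Cod C h = X" "U = gen h" by (rule F.sievesE)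
  then obtain k where "(k, h) \<in> F" by (auto simp: deflations_def)
  then have "is_kernel C k h" by (rule ker_coker_pairD(5)[OF F.pairD])
  moreover obtain g where g: "g \<in> deflations E" "g \<in> Mor C" "Cod C g = X" "S = gen g" by (rule sievesE[OF S(1)])
  ultimately have "(k, h) \<in> E" using gen_upward[OF g(1)] h g S(2) by simp
  then have "h \<in> deflations E" by (auto simp: deflations_def)
  then show "U \<in> sieves X" using sievesI h by blast
qed

text \<open>
  Only the sieves above \<open>S\<close> matter, and these are the same for \<open>E\<close> and for a larger exact structure.
\<close>

lemma bounded_sub:
  assumes F: "exact_structure C F" "E \<subseteq> F" and S: "S \<in> sieves X"
  shows "bounded X S \<longleftrightarrow> exact_category.bounded C F X S"
proof -
  interpret F: exact_category C F by unfold_locales (rule F)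
  have "height_le (sieves X) n S (top_sieve X) \<longleftrightarrow> height_le (F.sieves X) n S (top_sieve X)" for n
    by (rule height_le_cong) (rule sieves_upward[OF F S])
  moreover have "S \<in> F.sieves X" using S sieves_subset[OF F] by blast
  ultimately show ?thesis using S unfolding bounded_def F.bounded_def by blast
qed

end

section \<open>Modules with one generator\<close>

abbreviation el :: "('o, 'm, 'e) modul \<Rightarrow> 'o \<Rightarrow> 'e set" where "el M X \<equiv> carrier (Fobj M X)"
abbreviation unit_el :: "('o, 'm, 'e) modul \<Rightarrow> 'o \<Rightarrow> 'e" where "unit_el M X \<equiv> \<one>\<^bsub>Fobj M X\<^esub>"

lemma nat_transD:
  assumes "is_nat_trans C \<eta>"
  shows "is_module C (Ndom \<eta>)" "is_module C (Ncod \<eta>)"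
    "X \<in> Obj C \<Longrightarrow> Ncomp \<eta> X \<in> hom (Fobj (Ndom \<eta>) X) (Fobj (Ncod \<eta>) X)"
    "X \<in> Obj C \<Longrightarrow> x \<in> el (Ndom \<eta>) X \<Longrightarrow> Ncomp \<eta> X x \<in> el (Ncod \<eta>) X"
    "u \<in> Hom C X Y \<Longrightarrow> X \<in> Obj C \<Longrightarrow> Y \<in> Obj C \<Longrightarrow> x \<in> el (Ndom \<eta>) Y \<Longrightarrow>
      Ncomp \<eta> X (Fmap (Ndom \<eta>) u x) = Fmap (Ncod \<eta>) u (Ncomp \<eta> Y x)"
  using assms unfolding is_nat_trans_def hom_def by (simp_all del: Hom_iff) blast

lemma nat_trans_unit:
  assumes "is_nat_trans C \<eta>" "X \<in> Obj C"
  shows "Ncomp \<eta> X (unit_el (Ndom \<eta>) X) = unit_el (Ncod \<eta>) X"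
proof -
  have "comm_group (Fobj (Ndom \<eta>) X)" "comm_group (Fobj (Ncod \<eta>) X)"
    using nat_transD(1,2)[OF assms(1)] assms(2) by (simp_all add: is_module_def)
  then show ?thesis
    using hom_one[OF nat_transD(3)[OF assms]] by (simp add: comm_group_def)
qed

lemma nat_trans_eqI:
  assumes \<eta>: "is_nat_trans C \<eta>" and \<theta>: "is_nat_trans C \<theta>"
    and ends: "Ndom \<eta> = Ndom \<theta>" "Ncod \<eta> = Ncod \<theta>"
    and eq: "\<And>X x. X \<in> Obj C \<Longrightarrow> x \<in> el (Ndom \<theta>) X \<Longrightarrow> Ncomp \<eta> X x = Ncomp \<theta> X x"
  shows "\<eta> = \<theta>"
proof -
  have "Ncomp \<eta> X = Ncomp \<theta> X" for X
  proof (cases "X \<in> Obj C")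
    case True
    then have "Ncomp \<eta> X \<in> extensional (el (Ndom \<theta>) X)" "Ncomp \<theta> X \<in> extensional (el (Ndom \<theta>) X)"
      using \<eta> \<theta> ends(1) by (simp_all add: is_nat_trans_def)
    then show ?thesis using eq[OF True] by (rule extensionalityI)
  next
    case False
    then show ?thesis using \<eta> \<theta> by (simp add: is_nat_trans_def extensional_def)
  qed
  then have "Ncomp \<eta> = Ncomp \<theta>" by (rule ext)
  then show ?thesis using ends by simp
qed

definition nat_of where
  "nat_of C M N t = \<lparr>Ndom = M, Ncod = N, Ncomp = (\<lambda>X\<in>Obj C. \<lambda>x\<in>el M X. t X x)\<rparr>"

lemma nat_of_simps [simp]:
  "Ndom (nat_of C M N t) = M" "Ncod (nat_of C M N t) = N"
  "X \<in> Obj C \<Longrightarrow> x \<in> el M X \<Longrightarrow> Ncomp (nat_of C M N t) X x = t X x"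
  by (simp_all add: nat_of_def)

lemma Mod_cat_simps [simp]:
  "Obj (Mod_cat C) = {F. is_module C F}" "Mor (Mod_cat C) = {\<eta>. is_nat_trans C \<eta>}"
  "Dom (Mod_cat C) = Ndom" "Cod (Mod_cat C) = Ncod"
  "Idn (Mod_cat C) F = nat_of C F F (\<lambda>X x. x)"
  "Comp (Mod_cat C) \<eta> \<theta> = nat_of C (Ndom \<theta>) (Ncod \<eta>) (\<lambda>X x. Ncomp \<eta> X (Ncomp \<theta> X x))"
  "Zero (Mod_cat C) F G = nat_of C F G (\<lambda>X x. unit_el G X)"
  by (simp_all add: Mod_cat_def nat_of_def)

context preadditive_category
begin

lemma moduleD:
  assumes "is_module C F"
  shows "X \<in> Obj C \<Longrightarrow> comm_group (Fobj F X)"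
    "u \<in> Mor C \<Longrightarrow> Fmap F u \<in> hom (Fobj F (Cod C u)) (Fobj F (Dom C u))"
    "X \<in> Obj C \<Longrightarrow> x \<in> el F X \<Longrightarrow> Fmap F (Idn C X) x = x"
    "u \<in> Mor C \<Longrightarrow> v \<in> Mor C \<Longrightarrow> Cod C u = Dom C v \<Longrightarrow> x \<in> el F (Cod C v) \<Longrightarrow>
      Fmap F (v \<cdot> u) x = Fmap F u (Fmap F v x)"
    "u \<in> Mor C \<Longrightarrow> v \<in> Mor C \<Longrightarrow> Dom C u = Dom C v \<Longrightarrow> Cod C u = Cod C v \<Longrightarrow> x \<in> el F (Cod C v) \<Longrightarrow>
      Fmap F (u \<^bold>+ v) x = Fmap F u x \<otimes>\<^bsub>Fobj F (Dom C v)\<^esub> Fmap F v x"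
    "u \<in> Mor C \<Longrightarrow> x \<in> el F (Cod C u) \<Longrightarrow> Fmap F u x \<in> el F (Dom C u)"
proof -
  note m = assms[unfolded is_module_def]
  show "X \<in> Obj C \<Longrightarrow> comm_group (Fobj F X)" using m by blast
  show h: "u \<in> Mor C \<Longrightarrow> Fmap F u \<in> hom (Fobj F (Cod C u)) (Fobj F (Dom C u))" for u
    using m Obj_ends by simp
  show "X \<in> Obj C \<Longrightarrow> x \<in> el F X \<Longrightarrow> Fmap F (Idn C X) x = x" using m by blast
  show "u \<in> Mor C \<Longrightarrow> v \<in> Mor C \<Longrightarrow> Cod C u = Dom C v \<Longrightarrow> x \<in> el F (Cod C v) \<Longrightarrow>
      Fmap F (v \<cdot> u) x = Fmap F u (Fmap F v x)"
    by (rule m[THEN conjunct2, THEN conjunct2, THEN conjunct2, THEN conjunct1, rule_format,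
      of "Dom C u" "Cod C u" "Cod C v"]) simp_all
  show "u \<in> Mor C \<Longrightarrow> v \<in> Mor C \<Longrightarrow> Dom C u = Dom C v \<Longrightarrow> Cod C u = Cod C v \<Longrightarrow> x \<in> el F (Cod C v) \<Longrightarrow>
      Fmap F (u \<^bold>+ v) x = Fmap F u x \<otimes>\<^bsub>Fobj F (Dom C v)\<^esub> Fmap F v x"
    by (rule m[THEN conjunct2, THEN conjunct2, THEN conjunct2, THEN conjunct2, rule_format,
      of "Dom C v" "Cod C v"]) simp_all
  show "u \<in> Mor C \<Longrightarrow> x \<in> el F (Cod C u) \<Longrightarrow> Fmap F u x \<in> el F (Dom C u)"
    using h[of u] by (simp add: hom_in_carrier)
qed

lemma module_unit_closed: "is_module C F \<Longrightarrow> X \<in> Obj C \<Longrightarrow> unit_el F X \<in> el F X"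
  using moduleD(1) comm_group_def group.is_monoid monoid.one_closed by blast

lemma module_act_unit:
  assumes F: "is_module C F" and u: "u \<in> Mor C"
  shows "Fmap F u (unit_el F (Cod C u)) = unit_el F (Dom C u)"
proof -
  have "comm_group (Fobj F (Cod C u))" "comm_group (Fobj F (Dom C u))"
    using moduleD(1)[OF F] u by simp_all
  then show ?thesis using hom_one[OF moduleD(2)[OF F u]] by (simp add: comm_group_def)
qed

lemma module_act_Zero:
  assumes F: "is_module C F" and x: "X \<in> Obj C" "Y \<in> Obj C" "x \<in> el F Y"
  shows "Fmap F (Zero C X Y) x = unit_el F X"
proof -
  interpret G: comm_group "Fobj F X" by (rule moduleD(1)[OF F x(1)])
  have m: "Fmap F (Zero C X Y) x \<in> el F X" using moduleD(6)[OF F, of "Zero C X Y" x] x by simp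
  have "Fmap F (Zero C X Y) x \<otimes>\<^bsub>Fobj F X\<^esub> Fmap F (Zero C X Y) x = Fmap F (Zero C X Y) x"
    using moduleD(5)[OF F, of "Zero C X Y" "Zero C X Y" x] x by simp
  then show ?thesis using G.r_cancel_one'[OF m m] m by (metis G.r_cancel_one)
qed

lemma module_act_diff:
  assumes F: "is_module C F" and u: "u \<in> Mor C" "v \<in> Mor C" "Dom C u = Dom C v" "Cod C u = Cod C v"
    and x: "x \<in> el F (Cod C v)"
  shows "Fmap F (u \<^bold>+ neg v) x = unit_el F (Dom C v) \<longleftrightarrow> Fmap F u x = Fmap F v x"
proof -
  interpret G: comm_group "Fobj F (Dom C v)" by (rule moduleD(1)[OF F]) (use u in simp)
  have m: "Fmap F u x \<in> el F (Dom C v)" "Fmap F v x \<in> el F (Dom C v)" "Fmap F (neg v) x \<in> el F (Dom C v)"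
    using moduleD(6)[OF F, of u x] moduleD(6)[OF F, of v x] moduleD(6)[OF F, of "neg v" x] u x by simp_all
  have s: "Fmap F (u \<^bold>+ neg v) x = Fmap F u x \<otimes>\<^bsub>Fobj F (Dom C v)\<^esub> Fmap F (neg v) x"
    using moduleD(5)[OF F, of u "neg v" x] u x by simp
  have "Fmap F v x \<otimes>\<^bsub>Fobj F (Dom C v)\<^esub> Fmap F (neg v) x = unit_el F (Dom C v)"
    using moduleD(5)[OF F, of v "neg v" x] module_act_Zero[OF F, of "Dom C v" "Cod C v" x] u x by simp
  then show ?thesis unfolding s using m G.right_cancel[of "Fmap F (neg v) x" "Fmap F u x" "Fmap F v x"] by auto
qed

lemma nat_ofI:
  assumes M: "is_module C M" and N: "is_module C N"
    and closed: "\<And>X x. X \<in> Obj C \<Longrightarrow> x \<in> el M X \<Longrightarrow> t X x \<in> el N X"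
    and mult: "\<And>X x y. X \<in> Obj C \<Longrightarrow> x \<in> el M X \<Longrightarrow> y \<in> el M X \<Longrightarrow>
      t X (x \<otimes>\<^bsub>Fobj M X\<^esub> y) = t X x \<otimes>\<^bsub>Fobj N X\<^esub> t X y"
    and natural: "\<And>u x. u \<in> Mor C \<Longrightarrow> x \<in> el M (Cod C u) \<Longrightarrow>
      t (Dom C u) (Fmap M u x) = Fmap N u (t (Cod C u) x)"
  shows "is_nat_trans C (nat_of C M N t)"
proof -
  have "Ncomp (nat_of C M N t) X \<in> hom (Fobj M X) (Fobj N X)" if X: "X \<in> Obj C" for X
  proof (rule homI)
    interpret G: comm_group "Fobj M X" by (rule moduleD(1)[OF M X])
    fix x y assume x: "x \<in> el M X" "y \<in> el M X"
    then show "Ncomp (nat_of C M N t) X (x \<otimes>\<^bsub>Fobj M X\<^esub> y) =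
        Ncomp (nat_of C M N t) X x \<otimes>\<^bsub>Fobj N X\<^esub> Ncomp (nat_of C M N t) X y"
      using mult[OF X x] X G.m_closed[OF x] by simp
  qed (use closed X in simp)
  moreover have "Ncomp (nat_of C M N t) (Dom C u) (Fmap M u x) = Fmap N u (Ncomp (nat_of C M N t) (Cod C u) x)"
    if "u \<in> Mor C" "x \<in> el M (Cod C u)" for u x
    using natural[OF that] moduleD(6)[OF M that] that by simp
  ultimately show ?thesis using M N by (auto simp: is_nat_trans_def) (auto simp: nat_of_def)
qed

lemma nat_trans_Idn: "is_module C M \<Longrightarrow> is_nat_trans C (nat_of C M M (\<lambda>X x. x))"
  by (rule nat_ofI) simp_all

lemma nat_trans_Zero:
  assumes M: "is_module C M" and N: "is_module C N"
  shows "is_nat_trans C (nat_of C M N (\<lambda>X x. unit_el N X))"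
proof (rule nat_ofI[OF M N])
  show "unit_el N X = unit_el N X \<otimes>\<^bsub>Fobj N X\<^esub> unit_el N X" if X: "X \<in> Obj C" for X
  proof -
    interpret G: comm_group "Fobj N X" by (rule moduleD(1)[OF N X])
    show ?thesis by simp
  qed
qed (use module_unit_closed[OF N] module_act_unit[OF N] in simp_all)

lemma nat_trans_comp:
  assumes \<theta>: "is_nat_trans C \<theta>" and \<eta>: "is_nat_trans C \<eta>" and e: "Ncod \<theta> = Ndom \<eta>"
  shows "is_nat_trans C (nat_of C (Ndom \<theta>) (Ncod \<eta>) (\<lambda>X x. Ncomp \<eta> X (Ncomp \<theta> X x)))"
proof (rule nat_ofI)
  note T = nat_transD[OF \<theta>] and H = nat_transD[OF \<eta>]
  show "is_module C (Ndom \<theta>)" "is_module C (Ncod \<eta>)" by (rule T(1), rule H(2))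
  show "Ncomp \<eta> X (Ncomp \<theta> X x) \<in> el (Ncod \<eta>) X" if "X \<in> Obj C" "x \<in> el (Ndom \<theta>) X" for X x
    using H(4) T(4) that e by simp
  show "Ncomp \<eta> X (Ncomp \<theta> X (x \<otimes>\<^bsub>Fobj (Ndom \<theta>) X\<^esub> y)) =
      Ncomp \<eta> X (Ncomp \<theta> X x) \<otimes>\<^bsub>Fobj (Ncod \<eta>) X\<^esub> Ncomp \<eta> X (Ncomp \<theta> X y)"
    if "X \<in> Obj C" "x \<in> el (Ndom \<theta>) X" "y \<in> el (Ndom \<theta>) X" for X x y
    using hom_mult[OF T(3)[OF that(1)] that(2,3)] hom_mult[OF H(3)[OF that(1)]] T(4)[OF that(1)] that e
    by simp
  show "Ncomp \<eta> (Dom C u) (Ncomp \<theta> (Dom C u) (Fmap (Ndom \<theta>) u x)) =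
      Fmap (Ncod \<eta>) u (Ncomp \<eta> (Cod C u) (Ncomp \<theta> (Cod C u) x))"
    if "u \<in> Mor C" "x \<in> el (Ndom \<theta>) (Cod C u)" for u x
    using T(5)[of u "Dom C u" "Cod C u" x] H(5)[of u "Dom C u" "Cod C u" "Ncomp \<theta> (Cod C u) x"]
      T(4)[of "Cod C u" x] that e by simp
qed

text \<open>
  \<open>M\<close> is generated by \<open>m \<in> M(X)\<close>, with annihilator \<open>S\<close>; that is, \<open>M\<close> is the quotient of the
  representable functor of \<open>X\<close> by the sieve \<open>S\<close>.
\<close>

definition pres :: "('o, 'm, 'e) modul \<Rightarrow> 'o \<Rightarrow> 'm set \<Rightarrow> 'e \<Rightarrow> bool" where
  "pres M X S m \<longleftrightarrow> is_module C M \<and> X \<in> Obj C \<and> m \<in> el M X \<and>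
     (\<forall>W\<in>Obj C. \<forall>y\<in>el M W. \<exists>u\<in>Hom C W X. y = Fmap M u m) \<and>
     S = {u \<in> Mor C. Cod C u = X \<and> Fmap M u m = unit_el M (Dom C u)}"

lemma presD:
  assumes "pres M X S m"
  shows "is_module C M" "X \<in> Obj C" "m \<in> el M X"
    "u \<in> Mor C \<Longrightarrow> Cod C u = X \<Longrightarrow> u \<in> S \<longleftrightarrow> Fmap M u m = unit_el M (Dom C u)"
    "u \<in> S \<Longrightarrow> u \<in> Mor C" "u \<in> S \<Longrightarrow> Cod C u = X"
    "u \<in> Mor C \<Longrightarrow> Cod C u = X \<Longrightarrow> Fmap M u m \<in> el M (Dom C u)"
  using assms moduleD(6)[of M u m] by (auto simp: pres_def)

lemma presE:
  assumes "pres M X S m" "y \<in> el M W" "W \<in> Obj C"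
  obtains u where "u \<in> Mor C" "Dom C u = W" "Cod C u = X" "y = Fmap M u m"
proof -
  obtain u where "u \<in> Hom C W X" "y = Fmap M u m" using assms unfolding pres_def by blast
  then show thesis using that[of u] by simp
qed

lemma pres_eq_iff:
  assumes p: "pres M X S m" and u: "u \<in> Mor C" "v \<in> Mor C" "Dom C u = Dom C v" "Cod C u = X" "Cod C v = X"
  shows "Fmap M u m = Fmap M v m \<longleftrightarrow> u \<^bold>+ neg v \<in> S"
proof -
  note P = presD[OF p]
  have "u \<^bold>+ neg v \<in> S \<longleftrightarrow> Fmap M (u \<^bold>+ neg v) m = unit_el M (Dom C v)"
    using P(4)[of "u \<^bold>+ neg v"] u by simp
  then show ?thesis using module_act_diff[OF P(1), of u v m] u P(3) by simp
qed

lemma pres_act_cong: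
  assumes p: "pres M X S m" and N: "is_module C N" "w \<in> el N X"
    and ann: "\<And>u. u \<in> S \<Longrightarrow> Fmap N u w = unit_el N (Dom C u)"
    and u: "u \<in> Mor C" "v \<in> Mor C" "Dom C u = Dom C v" "Cod C u = X" "Cod C v = X"
    and eq: "Fmap M u m = Fmap M v m"
  shows "Fmap N u w = Fmap N v w"
proof -
  have "u \<^bold>+ neg v \<in> S" using pres_eq_iff[OF p u] eq by simp
  then have "Fmap N (u \<^bold>+ neg v) w = unit_el N (Dom C v)" using ann[of "u \<^bold>+ neg v"] u by simp
  then show ?thesis using module_act_diff[OF N(1), of u v w] u N(2) by simp
qed

text \<open>
  Maps out of the quotient of a representable functor by \<open>S\<close> are the elements killed by \<open>S\<close>, by the
  Yoneda lemma.
\<close>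

lemma pres_map:
  assumes p: "pres M X S m" and N: "is_module C N" "w \<in> el N X"
    and ann: "\<And>u. u \<in> S \<Longrightarrow> Fmap N u w = unit_el N (Dom C u)"
  obtains \<eta> where "is_nat_trans C \<eta>" "Ndom \<eta> = M" "Ncod \<eta> = N" "Ncomp \<eta> X m = w"
proof -
  note P = presD[OF p]
  \<comment> \<open>Every element is \<open>u m\<close> for some \<open>u\<close>, and the choice of \<open>u\<close> does not matter by \<open>pres_act_cong\<close>.\<close>
  define pick where "pick W y = (SOME u. u \<in> Mor C \<and> Dom C u = W \<and> Cod C u = X \<and> y = Fmap M u m)" for W y
  have pick: "pick W y \<in> Mor C" "Dom C (pick W y) = W" "Cod C (pick W y) = X" "Fmap M (pick W y) m = y"
    if "W \<in> Obj C" "y \<in> el M W" for W y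
  proof -
    have "\<exists>u. u \<in> Mor C \<and> Dom C u = W \<and> Cod C u = X \<and> y = Fmap M u m"
      using presE[OF p that(2,1)] by metis
    from someI_ex[OF this] show "pick W y \<in> Mor C" "Dom C (pick W y) = W" "Cod C (pick W y) = X"
      "Fmap M (pick W y) m = y" unfolding pick_def by auto
  qed
  define t where "t W y = Fmap N (pick W y) w" for W y
  have t: "t (Dom C u) (Fmap M u m) = Fmap N u w" if u: "u \<in> Mor C" "Cod C u = X" for u
  proof -
    note q = pick[OF Obj_ends(1)[OF u(1)] P(7)[OF u]]
    show ?thesis unfolding t_def
      by (rule pres_act_cong[OF p N ann]) (use q u in simp_all)
  qed
  have "is_nat_trans C (nat_of C M N t)"
  proof (rule nat_ofI[OF P(1) N(1)])
    fix W x assume W: "W \<in> Obj C" and x: "x \<in> el M W"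
    obtain u where u: "u \<in> Mor C" "Dom C u = W" "Cod C u = X" "x = Fmap M u m" by (rule presE[OF p x W])
    show "t W x \<in> el N W" using t[OF u(1,3)] moduleD(6)[OF N(1) u(1), of w] u N(2) by simp
    fix y assume y: "y \<in> el M W"
    obtain v where v: "v \<in> Mor C" "Dom C v = W" "Cod C v = X" "y = Fmap M v m" by (rule presE[OF p y W])
    have "Fmap M (u \<^bold>+ v) m = x \<otimes>\<^bsub>Fobj M W\<^esub> y" using moduleD(5)[OF P(1), of u v m] u v P(3) by simp
    then have "t W (x \<otimes>\<^bsub>Fobj M W\<^esub> y) = Fmap N (u \<^bold>+ v) w" using t[of "u \<^bold>+ v"] u v by simp
    also have "\<dots> = Fmap N u w \<otimes>\<^bsub>Fobj N W\<^esub> Fmap N v w"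
      using moduleD(5)[OF N(1), of u v w] u v N(2) by simp
    also have "\<dots> = t W x \<otimes>\<^bsub>Fobj N W\<^esub> t W y" using t[OF u(1,3)] t[OF v(1,3)] u v by simp
    finally show "t W (x \<otimes>\<^bsub>Fobj M W\<^esub> y) = t W x \<otimes>\<^bsub>Fobj N W\<^esub> t W y" .
  next
    fix v x assume v: "v \<in> Mor C" and x: "x \<in> el M (Cod C v)"
    obtain u where u: "u \<in> Mor C" "Dom C u = Cod C v" "Cod C u = X" "x = Fmap M u m"
      by (rule presE[OF p x Obj_ends(2)[OF v]])
    have "Fmap M v x = Fmap M (u \<cdot> v) m" using moduleD(4)[OF P(1) v u(1), of m] u P(3) by simp
    then have "t (Dom C v) (Fmap M v x) = Fmap N (u \<cdot> v) w" using t[of "u \<cdot> v"] u v by simp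
    also have "\<dots> = Fmap N v (Fmap N u w)" using moduleD(4)[OF N(1) v u(1), of w] u N(2) by simp
    also have "Fmap N u w = t (Cod C v) x" using t[OF u(1,3)] u by simp
    finally show "t (Dom C v) (Fmap M v x) = Fmap N v (t (Cod C v) x)" .
  qed
  moreover have "t X m = w"
    using t[of "Idn C X"] P(2,3) moduleD(3)[OF P(1)] moduleD(3)[OF N(1)] N(2) by simp
  ultimately show thesis using that[of "nat_of C M N t"] P(2,3) by simp
qed

lemma pres_apply:
  assumes p: "pres M X S m" and \<eta>: "is_nat_trans C \<eta>" "Ndom \<eta> = M" and u: "u \<in> Mor C" "Cod C u = X"
  shows "Ncomp \<eta> (Dom C u) (Fmap M u m) = Fmap (Ncod \<eta>) u (Ncomp \<eta> X m)"
  using nat_transD(5)[OF \<eta>(1), of u "Dom C u" "Cod C u" m] presD[OF p] \<eta>(2) u by simp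

lemma pres_eqI:
  assumes p: "pres M X S m" and \<eta>: "is_nat_trans C \<eta>" "is_nat_trans C \<theta>" "Ndom \<eta> = M" "Ndom \<theta> = M"
    "Ncod \<eta> = Ncod \<theta>" and eq: "Ncomp \<eta> X m = Ncomp \<theta> X m"
  shows "\<eta> = \<theta>"
proof (rule nat_trans_eqI[OF \<eta>(1,2)])
  fix W x assume W: "W \<in> Obj C" and x: "x \<in> el (Ndom \<theta>) W"
  obtain u where u: "u \<in> Mor C" "Dom C u = W" "Cod C u = X" "x = Fmap M u m"
    using presE[OF p _ W] x \<eta>(4) by metis
  show "Ncomp \<eta> W x = Ncomp \<theta> W x"
    using pres_apply[OF p \<eta>(1,3) u(1,3)] pres_apply[OF p \<eta>(2,4) u(1,3)] u eq \<eta>(5) by simp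
qed (use \<eta> in simp_all)

text \<open>
  Properties of annihilators that are stable under pull-back, such as boundedness, are thus
  independent of the generator.
\<close>

lemma pres_change:
  assumes p: "pres M X S m" and p': "pres M X' S' m'"
  obtains c where "c \<in> Mor C" "Dom C c = X" "Cod C c = X'" "m = Fmap M c m'" "S = pull c S'"
proof -
  note P = presD[OF p] and P' = presD[OF p']
  obtain c where c: "c \<in> Mor C" "Dom C c = X" "Cod C c = X'" "m = Fmap M c m'"
    by (rule presE[OF p' P(3,2)])
  have "u \<in> S \<longleftrightarrow> u \<in> pull c S'" for u
  proof (cases "u \<in> Mor C \<and> Cod C u = X")
    case True
    then have "Fmap M (c \<cdot> u) m' = Fmap M u m" using moduleD(4)[OF P(1), of u c m'] c P'(3) by simp
    then show ?thesis using True P(4)[of u] P'(4)[of "c \<cdot> u"] c by (simp add: pull_def)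
  next
    case False
    then show ?thesis using P(5,6) c(2) by (auto simp: pull_def)
  qed
  then have "S = pull c S'" by blast
  then show thesis using that c by blast
qed

lemma pres_iso:
  assumes p: "pres M X S m" and p': "pres N X S n" shows "iso_obj (Mod_cat C) M N"
proof -
  note P = presD[OF p] and P' = presD[OF p']
  obtain \<eta> where \<eta>: "is_nat_trans C \<eta>" "Ndom \<eta> = M" "Ncod \<eta> = N" "Ncomp \<eta> X m = n"
    by (rule pres_map[OF p P'(1,3)]) (use P'(4,5,6) in blast)
  obtain \<theta> where \<theta>: "is_nat_trans C \<theta>" "Ndom \<theta> = N" "Ncod \<theta> = M" "Ncomp \<theta> X n = m"
    by (rule pres_map[OF p' P(1,3)]) (use P(4,5,6) in blast)
  have "Comp (Mod_cat C) \<theta> \<eta> = Idn (Mod_cat C) M"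
    by (rule pres_eqI[OF p]) (use \<eta> \<theta> P nat_trans_comp[OF \<eta>(1) \<theta>(1)] nat_trans_Idn[OF P(1)] in simp_all)
  moreover have "Comp (Mod_cat C) \<eta> \<theta> = Idn (Mod_cat C) N"
    by (rule pres_eqI[OF p']) (use \<eta> \<theta> P' nat_trans_comp[OF \<theta>(1) \<eta>(1)] nat_trans_Idn[OF P'(1)] in simp_all)
  ultimately have "iso_mor (Mod_cat C) \<eta>"
    unfolding iso_mor_def using \<eta> \<theta> by (intro conjI bexI[of _ \<theta>]) simp_all
  then show ?thesis unfolding iso_obj_def using \<eta> by (intro bexI[of _ \<eta>]) simp_all
qed

lemma iso_pres:
  assumes i: "iso_obj (Mod_cat C) M N" and p: "pres N X S n"
  obtains m where "pres M X S m"
proof -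
  note P = presD[OF p]
  obtain \<eta> \<theta> where \<eta>: "is_nat_trans C \<eta>" "Ndom \<eta> = M" "Ncod \<eta> = N" and \<theta>: "is_nat_trans C \<theta>" "Ndom \<theta> = N" "Ncod \<theta> = M"
    and e: "Comp (Mod_cat C) \<theta> \<eta> = Idn (Mod_cat C) M" "Comp (Mod_cat C) \<eta> \<theta> = Idn (Mod_cat C) N"
    using i by (auto simp: iso_obj_def iso_mor_def simp del: Mod_cat_simps(5,6))
  have M: "is_module C M" using nat_transD(1)[OF \<eta>(1)] \<eta>(2) by simp
  have te: "Ncomp \<theta> W (Ncomp \<eta> W x) = x" if "W \<in> Obj C" "x \<in> el M W" for W x
  proof -
    have "Ncomp (Comp (Mod_cat C) \<theta> \<eta>) W x = Ncomp (Idn (Mod_cat C) M) W x" using e(1) by simp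
    then show ?thesis using that \<eta>(2) by simp
  qed
  have et: "Ncomp \<eta> W (Ncomp \<theta> W x) = x" if "W \<in> Obj C" "x \<in> el N W" for W x
  proof -
    have "Ncomp (Comp (Mod_cat C) \<eta> \<theta>) W x = Ncomp (Idn (Mod_cat C) N) W x" using e(2) by simp
    then show ?thesis using that \<theta>(2) by simp
  qed
  define m where "m = Ncomp \<theta> X n"
  have m: "m \<in> el M X" using nat_transD(4)[OF \<theta>(1) P(2)] P(3) \<theta> by (simp add: m_def)
  have act: "Ncomp \<theta> (Dom C u) (Fmap N u n) = Fmap M u m" if "u \<in> Mor C" "Cod C u = X" for u
    using pres_apply[OF p \<theta>(1,2) that] \<theta>(3) by (simp add: m_def)
  have "pres M X S m" unfolding pres_def
  proof (intro conjI ballI)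
    fix W y assume W: "W \<in> Obj C" and y: "y \<in> el M W"
    have "Ncomp \<eta> W y \<in> el N W" using nat_transD(4)[OF \<eta>(1) W] y \<eta> by simp
    then obtain u where u: "u \<in> Mor C" "Dom C u = W" "Cod C u = X" "Ncomp \<eta> W y = Fmap N u n"
      by (rule presE[OF p _ W])
    have "y = Fmap M u m" using te[OF W y] act[OF u(1,3)] u by simp
    then show "\<exists>u\<in>Hom C W X. y = Fmap M u m" using u by (intro bexI[of _ u]) simp_all
  next
    have "u \<in> S \<longleftrightarrow> Fmap M u m = unit_el M (Dom C u)" if u: "u \<in> Mor C" "Cod C u = X" for u
    proof -
      have "Fmap N u n = unit_el N (Dom C u) \<longleftrightarrow> Fmap M u m = unit_el M (Dom C u)"
        using act[OF u] et[OF _ P(7)[OF u]] nat_trans_unit[OF \<eta>(1), of "Dom C u"]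
          nat_trans_unit[OF \<theta>(1), of "Dom C u"] \<eta> \<theta> u by (metis Obj_ends(1))
      then show ?thesis using P(4)[OF u] by simp
    qed
    then show "S = {u \<in> Mor C. Cod C u = X \<and> Fmap M u m = unit_el M (Dom C u)}"
      using P(5,6) by blast
  qed (use M P m in simp_all)
  then show thesis using that by blast
qed

text \<open>
  The generator is the coset of the identity. From here on, a defect is only used through this
  presentation, and no longer through cosets.
\<close>

lemma defect_pres:
  assumes g: "g \<in> Mor C" shows "\<exists>m. pres (defect C (f, g)) (Cod C g) (gen g) m"
proof -
  define Z where "Z = Cod C g"
  define G where "G X = hom_grp C X Z" for X
  define H where "H X = {y \<in> gen g. Dom C y = X}" for X
  define M where "M = defect C (f, g)"
  have Z [simp]: "Z \<in> Obj C" using g by (simp add: Z_def)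
  note S = gen_sieve[OF g Z_def[symmetric]]
  note SD = is_sieveD[OF S]
  have G: "comm_group (G X)" if "X \<in> Obj C" for X
    unfolding G_def using that by (intro comm_group_hom_grp) simp_all
  have cG: "carrier (G X) = Hom C X Z" "mult (G X) = Plus C" "one (G X) = Zero C X Z" for X
    by (simp_all add: G_def)
  have img: "img (rep_trans C g) X = H X" if X: "X \<in> Obj C" for X
  proof (intro Set.set_eqI iffI)
    fix y
    { assume "y \<in> img (rep_trans C g) X"
      then obtain x where x: "x \<in> Mor C" "Dom C x = X" "Cod C x = Dom C g" "y = g \<cdot> x"
        using X by (auto simp: img_def rep_trans_def rep_mod_def)
      then show "y \<in> H X" using genI[of x g] g by (simp add: H_def) }
    { assume "y \<in> H X"
      then have y: "y \<in> gen g" "Dom C y = X" by (simp_all add: H_def)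
      obtain x where x: "x \<in> Mor C" "Cod C x = Dom C g" "y = g \<cdot> x" by (rule genE[OF y(1)])
      then have "Dom C x = X" using y(2) g by simp
      then show "y \<in> img (rep_trans C g) X" unfolding img_def
        using x X by (intro image_eqI[of _ _ x]) (simp_all add: rep_trans_def rep_mod_def) }
  qed
  have sub: "subgroup (H X) (G X)" if X: "X \<in> Obj C" for X
  proof -
    interpret comm_group "G X" by (rule G[OF X])
    have inv: "inv\<^bsub>G X\<^esub> x = neg x" if "x \<in> H X" for x
      using SD(2)[of x] that by (simp add: neg_def G_def H_def)
    have zero: "Zero C X Z \<in> gen g" "Dom C (Zero C X Z) = X" using SD(5)[OF X] X by simp_all
    show ?thesis
    proof (rule subgroupI)
      show "H X \<subseteq> carrier (G X)" using SD(1,2) by (auto simp: H_def cG)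
      show "H X \<noteq> {}" using zero by (auto simp: H_def)
      show "inv\<^bsub>G X\<^esub> x \<in> H X" if "x \<in> H X" for x
        using inv[OF that] is_sieve_neg[OF S, of x] SD(1)[of x] that by (simp add: H_def)
      show "x \<otimes>\<^bsub>G X\<^esub> y \<in> H X" if "x \<in> H X" "y \<in> H X" for x y
      proof -
        have xy: "x \<in> gen g" "y \<in> gen g" "Dom C x = X" "Dom C y = X" using that by (simp_all add: H_def)
        show ?thesis using SD(4)[OF xy(1,2)] SD(1,2)[OF xy(1)] SD(1,2)[OF xy(2)] xy(3,4)
          by (simp add: H_def cG)
      qed
    qed
  qed
  have Fo: "Fobj M X = G X Mod H X" if "X \<in> Obj C" for X
    using img[OF that] by (simp add: M_def defect_def Coker_def rep_trans_def rep_mod_def G_def Z_def)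
  have Fm: "Fmap M u K = (\<Union>k\<in>K. H (Dom C u) #>\<^bsub>G (Dom C u)\<^esub> (k \<cdot> u))" if "u \<in> Mor C" for u K
    using img[of "Dom C u"] that by (simp add: M_def defect_def Coker_def rep_trans_def rep_mod_def G_def Z_def)
  have cos: "el M X = {H X #>\<^bsub>G X\<^esub> k |k. k \<in> Hom C X Z}" if "X \<in> Obj C" for X
    unfolding Fo[OF that] FactGroup_def RCOSETS_def using cG(1) by auto
  have cosI: "H X #>\<^bsub>G X\<^esub> k \<in> el M X" if "X \<in> Obj C" "k \<in> Mor C" "Dom C k = X" "Cod C k = Z" for X k
    using cos[OF that(1)] that by auto
  have cosE: "\<exists>k. k \<in> Mor C \<and> Dom C k = X \<and> Cod C k = Z \<and> K = H X #>\<^bsub>G X\<^esub> k"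
    if "X \<in> Obj C" "K \<in> el M X" for X K
    using cos[OF that(1)] that by auto
  have one: "unit_el M X = H X" if "X \<in> Obj C" for X
    unfolding Fo[OF that] by (simp add: FactGroup_def)
  have Hrep: "k' \<in> H X #>\<^bsub>G X\<^esub> k \<Longrightarrow> \<exists>h. h \<in> H X \<and> k' = h \<^bold>+ k" for X k k'
    by (auto simp: r_coset_def cG)
  have same: "H X #>\<^bsub>G X\<^esub> (h \<^bold>+ k) = H X #>\<^bsub>G X\<^esub> k"
    if X: "X \<in> Obj C" and h: "h \<in> H X" and k: "k \<in> Mor C" "Dom C k = X" "Cod C k = Z" for X h k
  proof -
    interpret comm_group "G X" by (rule G[OF X])
    have sc: "H X \<subseteq> carrier (G X)" by (rule subgroup.subset[OF sub[OF X]])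
    have "h \<otimes>\<^bsub>G X\<^esub> k \<in> H X #>\<^bsub>G X\<^esub> k" using h by (auto simp: r_coset_def)
    then have "H X #>\<^bsub>G X\<^esub> k = H X #>\<^bsub>G X\<^esub> (h \<otimes>\<^bsub>G X\<^esub> k)"
      by (rule repr_independence[OF _ _ sub[OF X]]) (use k cG in simp)
    then show ?thesis by (simp add: cG)
  qed
  have act: "Fmap M u (H (Cod C u) #>\<^bsub>G (Cod C u)\<^esub> k) = H (Dom C u) #>\<^bsub>G (Dom C u)\<^esub> (k \<cdot> u)"
    if u: "u \<in> Mor C" and k: "k \<in> Mor C" "Dom C k = Cod C u" "Cod C k = Z" for u k
  proof -
    note U = Obj_ends[OF u]
    interpret GC: comm_group "G (Cod C u)" by (rule G[OF U(2)])
    have "H (Dom C u) #>\<^bsub>G (Dom C u)\<^esub> (k' \<cdot> u) = H (Dom C u) #>\<^bsub>G (Dom C u)\<^esub> (k \<cdot> u)"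
      if k': "k' \<in> H (Cod C u) #>\<^bsub>G (Cod C u)\<^esub> k" for k'
    proof -
      obtain h where h: "h \<in> H (Cod C u)" "k' = h \<^bold>+ k" using Hrep[OF k'] by blast
      then have hg: "h \<in> gen g" "Dom C h = Cod C u" by (simp_all add: H_def)
      note hm = SD(1,2)[OF hg(1)]
      have "h \<cdot> u \<in> H (Dom C u)" using SD(3)[OF hg(1) u] hg(2) hm u by (simp add: H_def)
      moreover have "k' \<cdot> u = h \<cdot> u \<^bold>+ k \<cdot> u" using h(2) hm hg(2) k u by simp
      ultimately show ?thesis using same[OF U(1), of "h \<cdot> u" "k \<cdot> u"] k u by simp
    qed
    moreover have "k \<in> H (Cod C u) #>\<^bsub>G (Cod C u)\<^esub> k"
      by (rule GC.rcos_self[OF _ sub[OF U(2)]]) (use k cG in simp)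
    ultimately show ?thesis unfolding Fm[OF u] by blast
  qed
  have mlt: "(H X #>\<^bsub>G X\<^esub> k) \<otimes>\<^bsub>Fobj M X\<^esub> (H X #>\<^bsub>G X\<^esub> k') = H X #>\<^bsub>G X\<^esub> (k \<^bold>+ k')"
    if X: "X \<in> Obj C" and k: "k \<in> Mor C" "Dom C k = X" "Cod C k = Z" "k' \<in> Mor C" "Dom C k' = X" "Cod C k' = Z"
    for X k k'
  proof -
    interpret comm_group "G X" by (rule G[OF X])
    interpret N: normal "H X" "G X" by (rule subgroup_imp_normal[OF sub[OF X]])
    have kc: "k \<in> carrier (G X)" "k' \<in> carrier (G X)" using k cG(1) by simp_all
    have "(H X #>\<^bsub>G X\<^esub> k) <#>\<^bsub>G X\<^esub> (H X #>\<^bsub>G X\<^esub> k') = H X #>\<^bsub>G X\<^esub> (k \<otimes>\<^bsub>G X\<^esub> k')"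
      by (rule N.rcos_sum[OF kc])
    then show ?thesis unfolding Fo[OF X] cG by (simp add: FactGroup_def)
  qed
  have M: "is_module C M" unfolding is_module_def
  proof (intro conjI ballI)
    show "comm_group (Fobj M X)" if X: "X \<in> Obj C" for X
      unfolding Fo[OF X] by (rule comm_group.abelian_FactGroup[OF G[OF X] sub[OF X]])
    fix X Y u assume X: "X \<in> Obj C" and Y: "Y \<in> Obj C" and u: "u \<in> Hom C X Y"
    then have u': "u \<in> Mor C" "Dom C u = X" "Cod C u = Y" by simp_all
    show "Fmap M u \<in> hom (Fobj M Y) (Fobj M X)"
    proof (rule homI)
      fix K assume K: "K \<in> el M Y"
      obtain k where k: "k \<in> Mor C" "Dom C k = Y" "Cod C k = Z" "K = H Y #>\<^bsub>G Y\<^esub> k" using cosE[OF Y K] by blast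
      show "Fmap M u K \<in> el M X" using act[OF u'(1), of k] cosI[OF X, of "k \<cdot> u"] k u' by simp
      fix K' assume K': "K' \<in> el M Y"
      obtain k' where k': "k' \<in> Mor C" "Dom C k' = Y" "Cod C k' = Z" "K' = H Y #>\<^bsub>G Y\<^esub> k'" using cosE[OF Y K'] by blast
      show "Fmap M u (K \<otimes>\<^bsub>Fobj M Y\<^esub> K') = Fmap M u K \<otimes>\<^bsub>Fobj M X\<^esub> Fmap M u K'"
        using mlt[OF Y, of k k'] mlt[OF X, of "k \<cdot> u" "k' \<cdot> u"] act[OF u'(1), of k] act[OF u'(1), of k']
          act[OF u'(1), of "k \<^bold>+ k'"] k k' u' by simp
    qed
    fix v K assume "v \<in> Hom C X Y" and K: "K \<in> el M Y"
    then have v: "v \<in> Mor C" "Dom C v = X" "Cod C v = Y" by simp_all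
    obtain k where k: "k \<in> Mor C" "Dom C k = Y" "Cod C k = Z" "K = H Y #>\<^bsub>G Y\<^esub> k" using cosE[OF Y K] by blast
    show "Fmap M (u \<^bold>+ v) K = Fmap M u K \<otimes>\<^bsub>Fobj M X\<^esub> Fmap M v K"
      using mlt[OF X, of "k \<cdot> u" "k \<cdot> v"] act[OF u'(1), of k] act[OF v(1), of k] act[of "u \<^bold>+ v" k] k u' v by simp
  next
    fix X K assume X: "X \<in> Obj C" and K: "K \<in> el M X"
    obtain k where k: "k \<in> Mor C" "Dom C k = X" "Cod C k = Z" "K = H X #>\<^bsub>G X\<^esub> k" using cosE[OF X K] by blast
    show "Fmap M (Idn C X) K = K" using act[of "Idn C X" k] k X by simp
  next
    fix X Y W u v K assume "X \<in> Obj C" "Y \<in> Obj C" and W: "W \<in> Obj C" and "u \<in> Hom C X Y" "v \<in> Hom C Y W" and K: "K \<in> el M W"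
    then have u: "u \<in> Mor C" "Dom C u = X" "Cod C u = Y" "v \<in> Mor C" "Dom C v = Y" "Cod C v = W" by simp_all
    obtain k where k: "k \<in> Mor C" "Dom C k = W" "Cod C k = Z" "K = H W #>\<^bsub>G W\<^esub> k" using cosE[OF W K] by blast
    show "Fmap M (v \<cdot> u) K = Fmap M u (Fmap M v K)"
      using act[OF u(4), of k] act[OF u(1), of "k \<cdot> v"] act[of "v \<cdot> u" k] k u by simp
  qed
  define m where "m = H Z #>\<^bsub>G Z\<^esub> Idn C Z"
  have mu: "Fmap M u m = H (Dom C u) #>\<^bsub>G (Dom C u)\<^esub> u" if "u \<in> Mor C" "Cod C u = Z" for u
    using act[of u "Idn C Z"] that by (simp add: m_def)
  have "pres M Z (gen g) m" unfolding pres_def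
  proof (intro conjI ballI)
    show "m \<in> el M Z" unfolding m_def by (rule cosI) simp_all
    fix W K assume W: "W \<in> Obj C" and K: "K \<in> el M W"
    obtain k where k: "k \<in> Mor C" "Dom C k = W" "Cod C k = Z" "K = H W #>\<^bsub>G W\<^esub> k" using cosE[OF W K] by blast
    then show "\<exists>u\<in>Hom C W Z. K = Fmap M u m" using mu[of k] by (intro bexI[of _ k]) simp_all
  next
    have "u \<in> gen g \<longleftrightarrow> Fmap M u m = unit_el M (Dom C u)" if u: "u \<in> Mor C" "Cod C u = Z" for u
    proof -
      note U = Obj_ends(1)[OF u(1)]
      interpret comm_group "G (Dom C u)" by (rule G[OF U])
      have uc: "u \<in> carrier (G (Dom C u))" using u cG(1) by simp
      have "H (Dom C u) #>\<^bsub>G (Dom C u)\<^esub> u = H (Dom C u) \<longleftrightarrow> u \<in> H (Dom C u)"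
        using coset_join1[OF _ uc sub[OF U]] coset_join2[OF uc sub[OF U]] subgroup.subset[OF sub[OF U]] by blast
      then show ?thesis unfolding mu[OF u] one[OF U] by (simp add: H_def)
    qed
    then show "gen g = {u \<in> Mor C. Cod C u = Z \<and> Fmap M u m = unit_el M (Dom C u)}"
      using SD(1,2) by blast
  qed (use M in simp_all)
  then show ?thesis unfolding M_def Z_def by blast
qed

end

section \<open>Finite length in the category of defects\<close>

lemma height_le_cover:
  assumes "height_le L n S X" "S \<in> L" "X \<in> L" "S \<subset> X"
  obtains T where "T \<in> L" "S \<subseteq> T" "T \<subset> X" "height_le L 1 T X"
proof -
  have "\<exists>T\<in>L. S \<subseteq> T \<and> T \<subset> X \<and> height_le L 1 T X"
    using assms
  proof (induction n arbitrary: S)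
    case 0
    then show ?case unfolding height_le.simps by blast
  next
    case (Suc n)
    show ?case
    proof (cases "\<exists>U\<in>L. S \<subset> U \<and> U \<subset> X")
      case True
      then obtain U where U: "U \<in> L" "S \<subset> U" "U \<subset> X" by blast
      then have "height_le L n U X" using Suc.prems(1) unfolding height_le.simps by blast
      then obtain T where "T \<in> L" "U \<subseteq> T" "T \<subset> X" "height_le L 1 T X" using Suc U by blast
      then show ?thesis using U by blast
    next
      case False
      have "height_le L 1 S X" unfolding One_nat_def height_le.simps using False by blast
      then show ?thesis using Suc.prems by blast
    qed
  qed
  then show thesis using that by blast
qed

lemma nat_trans_injective:
  assumes \<eta>: "is_nat_trans C \<eta>" and W: "W \<in> Obj C"
    and ker: "\<And>x. x \<in> el (Ndom \<eta>) W \<Longrightarrow> Ncomp \<eta> W x = unit_el (Ncod \<eta>) W \<Longrightarrow> x = unit_el (Ndom \<eta>) W"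
    and xy: "x \<in> el (Ndom \<eta>) W" "y \<in> el (Ndom \<eta>) W" "Ncomp \<eta> W x = Ncomp \<eta> W y"
  shows "x = y"
proof -
  have "comm_group (Fobj (Ndom \<eta>) W)" "comm_group (Fobj (Ncod \<eta>) W)"
    using nat_transD(1,2)[OF \<eta>] W by (simp_all add: is_module_def)
  then interpret h: group_hom "Fobj (Ndom \<eta>) W" "Fobj (Ncod \<eta>) W" "Ncomp \<eta> W"
    using nat_transD(3)[OF \<eta> W] by (simp add: group_hom_def group_hom_axioms_def comm_group_def)
  have "kernel (Fobj (Ndom \<eta>) W) (Fobj (Ncod \<eta>) W) (Ncomp \<eta> W) = {unit_el (Ndom \<eta>) W}"
    using ker unfolding kernel_def by (auto simp: h.hom_one)
  then have "inj_on (Ncomp \<eta> W) (el (Ndom \<eta>) W)" by (rule h.trivial_ker_imp_inj)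
  then show ?thesis using xy by (simp add: inj_on_def)
qed

lemma Ncomp_cong: "\<eta> = \<theta> \<Longrightarrow> Ncomp \<eta> X x = Ncomp \<theta> X x"
  by simp

context exact_category
begin

lemma eff_simps [simp]:
  "Dom (eff C E) = Ndom" "Cod (eff C E) = Ncod"
  "Idn (eff C E) F = nat_of C F F (\<lambda>X x. x)"
  "Comp (eff C E) \<eta> \<theta> = nat_of C (Ndom \<theta>) (Ncod \<eta>) (\<lambda>X x. Ncomp \<eta> X (Ncomp \<theta> X x))"
  "Zero (eff C E) F G = nat_of C F G (\<lambda>X x. unit_el G X)"
  by (simp_all add: eff_def full_subcategory_def Mod_cat_def nat_of_def)

lemma sieves_gen_ex:
  assumes "S \<in> sieves X" obtains M :: "('o, 'm, 'm set) modul" and m where "pres M X S m"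
proof -
  obtain g where g: "g \<in> deflations E" "g \<in> Mor C" "Cod C g = X" "S = gen g" by (rule sievesE[OF assms])
  then show thesis using that defect_pres[OF g(2)] by blast
qed

lemma eff_Obj: "M \<in> Obj (eff C E) \<longleftrightarrow> (\<exists>X S m. S \<in> sieves X \<and> pres M X S m)"
proof
  assume "M \<in> Obj (eff C E)"
  then obtain f g where fg: "(f, g) \<in> E" "iso_obj (Mod_cat C) M (defect C (f, g))"
    by (auto simp: eff_def full_subcategory_def)
  have d: "g \<in> deflations E" using fg(1) by (auto simp: deflations_def)
  obtain m where "pres (defect C (f, g)) (Cod C g) (gen g) m" using defect_pres[OF deflation_Mor[OF d]] by blast
  then obtain m' where "pres M (Cod C g) (gen g) m'" by (rule iso_pres[OF fg(2)])
  then show "\<exists>X S m. S \<in> sieves X \<and> pres M X S m" using sievesI[OF d refl] by blast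
next
  assume "\<exists>X S m. S \<in> sieves X \<and> pres M X S m"
  then obtain X S m where S: "S \<in> sieves X" and p: "pres M X S m" by blast
  obtain g where g: "g \<in> deflations E" "g \<in> Mor C" "Cod C g = X" "S = gen g" by (rule sievesE[OF S])
  obtain f where f: "(f, g) \<in> E" using g(1) by (auto simp: deflations_def)
  obtain m' where "pres (defect C (f, g)) X S m'" using defect_pres[OF g(2)] g by blast
  then have "iso_obj (Mod_cat C) M (defect C (f, g))" by (rule pres_iso[OF p])
  then show "M \<in> Obj (eff C E)"
    using f presD(1)[OF p] by (auto simp: eff_def full_subcategory_def)
qed

lemma eff_ObjI: "pres M X S m \<Longrightarrow> S \<in> sieves X \<Longrightarrow> M \<in> Obj (eff C E)"
  using eff_Obj by blast

lemma eff_ObjE: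
  assumes "M \<in> Obj (eff C E)" obtains X S m where "S \<in> sieves X" "pres M X S m"
  using assms eff_Obj by blast

lemma eff_Obj_module: "M \<in> Obj (eff C E) \<Longrightarrow> is_module C M"
  using eff_ObjE presD(1) by metis

lemma eff_Mor: "\<eta> \<in> Mor (eff C E) \<longleftrightarrow>
    is_nat_trans C \<eta> \<and> Ndom \<eta> \<in> Obj (eff C E) \<and> Ncod \<eta> \<in> Obj (eff C E)"
  by (auto simp: eff_def full_subcategory_def is_nat_trans_def)

lemma eff_MorD:
  assumes "\<eta> \<in> Mor (eff C E)"
  shows "is_nat_trans C \<eta>" "Ndom \<eta> \<in> Obj (eff C E)" "Ncod \<eta> \<in> Obj (eff C E)"
  using assms eff_Mor by blast+

lemma pres_sieve: assumes p: "pres M X S m" and M: "M \<in> Obj (eff C E)" shows "S \<in> sieves X"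
proof -
  obtain X' S' m' where p': "S' \<in> sieves X'" "pres M X' S' m'" by (rule eff_ObjE[OF M])
  obtain c where c: "c \<in> Mor C" "Dom C c = X" "Cod C c = X'" "m = Fmap M c m'" "S = pull c S'"
    by (rule pres_change[OF p p'(2)])
  then show ?thesis using sieves_pull[OF p'(1) c(1,3)] by simp
qed

lemma eff_zero_obj: "zero_obj (eff C E) M \<longleftrightarrow>
    M \<in> Obj (eff C E) \<and> (\<forall>W\<in>Obj C. \<forall>x\<in>el M W. x = unit_el M W)"
proof (intro iffI conjI ballI)
  assume z: "zero_obj (eff C E) M"
  show M: "M \<in> Obj (eff C E)" using z by (simp add: zero_obj_def)
  note mod = eff_Obj_module[OF M]
  fix W x assume W: "W \<in> Obj C" and x: "x \<in> el M W"
  have "\<exists>!f. f \<in> Hom (eff C E) M M" using z M by (simp add: zero_obj_def del: Hom_iff)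
  moreover have "nat_of C M M (\<lambda>X x. x) \<in> Hom (eff C E) M M"
    "nat_of C M M (\<lambda>X x. unit_el M X) \<in> Hom (eff C E) M M"
    using M nat_trans_Idn[OF mod] nat_trans_Zero[OF mod mod] by (simp_all add: eff_Mor)
  ultimately have "nat_of C M M (\<lambda>X x. x) = nat_of C M M (\<lambda>X x. unit_el M X)" by blast
  from Ncomp_cong[OF this, of W x] show "x = unit_el M W" using W x by simp
next
  assume M: "M \<in> Obj (eff C E) \<and> (\<forall>W\<in>Obj C. \<forall>x\<in>el M W. x = unit_el M W)"
  then have MO: "M \<in> Obj (eff C E)" and triv: "\<And>W x. W \<in> Obj C \<Longrightarrow> x \<in> el M W \<Longrightarrow> x = unit_el M W" by blast+
  note mod = eff_Obj_module[OF MO]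
  show "zero_obj (eff C E) M" unfolding zero_obj_def
  proof (intro conjI ballI MO)
    fix Y assume Y: "Y \<in> Obj (eff C E)"
    note Ym = eff_Obj_module[OF Y]
    show "\<exists>!f. f \<in> Hom (eff C E) M Y"
    proof (rule ex1I)
      show "nat_of C M Y (\<lambda>X x. unit_el Y X) \<in> Hom (eff C E) M Y"
        using MO Y nat_trans_Zero[OF mod Ym] by (simp add: eff_Mor)
      fix f assume "f \<in> Hom (eff C E) M Y"
      then have f: "is_nat_trans C f" "Ndom f = M" "Ncod f = Y" by (simp_all add: eff_Mor)
      show "f = nat_of C M Y (\<lambda>X x. unit_el Y X)"
      proof (rule nat_trans_eqI[OF f(1) nat_trans_Zero[OF mod Ym]])
        fix W x assume "W \<in> Obj C" "x \<in> el (Ndom (nat_of C M Y (\<lambda>X x. unit_el Y X))) W"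
        then show "Ncomp f W x = Ncomp (nat_of C M Y (\<lambda>X x. unit_el Y X)) W x"
          using triv[of W x] nat_trans_unit[OF f(1), of W] f by simp
      qed (use f in simp_all)
    qed
    show "\<exists>!f. f \<in> Hom (eff C E) Y M"
    proof (rule ex1I)
      show "nat_of C Y M (\<lambda>X x. unit_el M X) \<in> Hom (eff C E) Y M"
        using MO Y nat_trans_Zero[OF Ym mod] by (simp add: eff_Mor)
      fix f assume "f \<in> Hom (eff C E) Y M"
      then have f: "is_nat_trans C f" "Ndom f = Y" "Ncod f = M" by (simp_all add: eff_Mor)
      show "f = nat_of C Y M (\<lambda>X x. unit_el M X)"
      proof (rule nat_trans_eqI[OF f(1) nat_trans_Zero[OF Ym mod]])
        fix W x assume "W \<in> Obj C" "x \<in> el (Ndom (nat_of C Y M (\<lambda>X x. unit_el M X))) W"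
        then show "Ncomp f W x = Ncomp (nat_of C Y M (\<lambda>X x. unit_el M X)) W x"
          using triv[of W "Ncomp f W x"] nat_transD(4)[OF f(1), of W x] f by simp
      qed (use f in simp_all)
    qed
  qed
qed

lemma pres_zero_obj:
  assumes p: "pres M X S m" and S: "S \<in> sieves X"
  shows "zero_obj (eff C E) M \<longleftrightarrow> S = top_sieve X"
proof
  note P = presD[OF p]
  assume z: "zero_obj (eff C E) M"
  have "u \<in> S" if "u \<in> top_sieve X" for u
  proof -
    have u: "u \<in> Mor C" "Cod C u = X" using that by (simp_all add: top_sieve_def)
    then have "Fmap M u m = unit_el M (Dom C u)" using z P(7)[OF u] by (simp add: eff_zero_obj)
    then show ?thesis using P(4)[OF u] by simp
  qed
  then show "S = top_sieve X" using sieves_subset_top[OF S] by blast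
next
  note P = presD[OF p]
  assume S': "S = top_sieve X"
  have "x = unit_el M W" if W: "W \<in> Obj C" and x: "x \<in> el M W" for W x
  proof -
    obtain u where u: "u \<in> Mor C" "Dom C u = W" "Cod C u = X" "x = Fmap M u m" by (rule presE[OF p x W])
    then have "u \<in> S" unfolding S' by (simp add: top_sieve_def)
    then show ?thesis using P(4)[OF u(1,3)] u by simp
  qed
  then show "zero_obj (eff C E) M" using eff_ObjI[OF p S] by (simp add: eff_zero_obj)
qed

lemma eff_mono:
  assumes \<rho>: "\<rho> \<in> Mor (eff C E)"
    and ker: "\<And>W x. W \<in> Obj C \<Longrightarrow> x \<in> el (Ndom \<rho>) W \<Longrightarrow> Ncomp \<rho> W x = unit_el (Ncod \<rho>) W \<Longrightarrow>
      x = unit_el (Ndom \<rho>) W"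
  shows "mono_mor (eff C E) \<rho>"
  unfolding mono_mor_def
proof (intro conjI ballI impI \<rho>)
  note R = eff_MorD[OF \<rho>]
  fix W g h assume "W \<in> Obj (eff C E)" and g: "g \<in> Hom (eff C E) W (Dom (eff C E) \<rho>)"
    and h: "h \<in> Hom (eff C E) W (Dom (eff C E) \<rho>)"
    and eq: "Comp (eff C E) \<rho> g = Comp (eff C E) \<rho> h"
  have g': "is_nat_trans C g" "Ndom g = W" "Ncod g = Ndom \<rho>" and h': "is_nat_trans C h" "Ndom h = W" "Ncod h = Ndom \<rho>"
    using g h by (simp_all add: eff_Mor)
  show "g = h"
  proof (rule nat_trans_eqI[OF g'(1) h'(1)])
    fix X x assume X: "X \<in> Obj C" and x: "x \<in> el (Ndom h) X"
    have "Ncomp \<rho> X (Ncomp g X x) = Ncomp \<rho> X (Ncomp h X x)"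
      using Ncomp_cong[OF eq, of X x] X x g' h' by simp
    then show "Ncomp g X x = Ncomp h X x"
      using nat_transD(4)[OF g'(1) X, of x] nat_transD(4)[OF h'(1) X, of x] x g' h'
      by - (rule nat_trans_injective[OF R(1) X ker[OF X]], simp_all)
  qed (use g' h' in simp_all)
qed

text \<open>
  The kernel of a map of defects is the image of a map from a defect: the elements \<open>u n\<close> that \<open>\<rho>\<close>
  kills form the pull-back of a sieve of \<open>E\<close>, and a deflation \<open>h\<close> generating it gives a
  map of defects with image generated by \<open>h n\<close>.
\<close>

lemma eff_mono_injective:
  assumes \<rho>: "mono_mor (eff C E) \<rho>" and W: "W \<in> Obj C" and x: "x \<in> el (Ndom \<rho>) W"
    and x0: "Ncomp \<rho> W x = unit_el (Ncod \<rho>) W"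
  shows "x = unit_el (Ndom \<rho>) W"
proof -
  define N where "N = Ndom \<rho>"
  define Q where "Q = Ncod \<rho>"
  have \<rho>M: "\<rho> \<in> Mor (eff C E)" using \<rho> by (simp add: mono_mor_def)
  note R = eff_MorD[OF \<rho>M, folded N_def Q_def]
  obtain D S n where n: "S \<in> sieves D" "pres N D S n" by (rule eff_ObjE[OF R(2)])
  obtain C' T q where q: "T \<in> sieves C'" "pres Q C' T q" by (rule eff_ObjE[OF R(3)])
  note PN = presD[OF n(2)] and PQ = presD[OF q(2)]
  have "Ncomp \<rho> D n \<in> el Q D" using nat_transD(4)[OF R(1) PN(2)] PN(3) by (simp add: N_def Q_def)
  then obtain d where d: "d \<in> Mor C" "Dom C d = D" "Cod C d = C'" "Ncomp \<rho> D n = Fmap Q d q"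
    by (rule presE[OF q(2) _ PN(2)])
  have \<rho>act: "Ncomp \<rho> (Dom C u) (Fmap N u n) = Fmap Q (d \<cdot> u) q" if "u \<in> Mor C" "Cod C u = D" for u
    using pres_apply[OF n(2) R(1) N_def[symmetric] that] moduleD(4)[OF PQ(1) that(1) d(1)] that d PQ(3)
    by (simp add: Q_def)
  have pT: "pull d T \<in> sieves D" using sieves_pull[OF q(1) d(1,3)] d(2) by simp
  obtain h where h: "h \<in> deflations E" "h \<in> Mor C" "Cod C h = D" "pull d T = gen h" by (rule sievesE[OF pT])
  have hS: "pull h S \<in> sieves (Dom C h)" by (rule sieves_pull[OF n(1) h(2,3)])
  obtain K :: "('o, 'm, 'm set) modul" and k where k: "pres K (Dom C h) (pull h S) k" by (rule sieves_gen_ex[OF hS])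
  note PK = presD[OF k]
  have hn: "Fmap N h n \<in> el N (Dom C h)" by (rule PN(7)[OF h(2,3)])
  obtain \<kappa> where \<kappa>: "is_nat_trans C \<kappa>" "Ndom \<kappa> = K" "Ncod \<kappa> = N" "Ncomp \<kappa> (Dom C h) k = Fmap N h n"
  proof (rule pres_map[OF k PN(1) hn])
    fix u assume "u \<in> pull h S"
    then have u: "u \<in> Mor C" "Cod C u = Dom C h" "h \<cdot> u \<in> S" by (simp_all add: pull_def)
    show "Fmap N u (Fmap N h n) = unit_el N (Dom C u)"
      using moduleD(4)[OF PN(1) u(1) h(2) u(2), of n] PN(4)[of "h \<cdot> u"] u h PN(3) by simp
  qed
  define \<zeta> where "\<zeta> = nat_of C K N (\<lambda>X x. unit_el N X)"
  have \<zeta>: "is_nat_trans C \<zeta>" "Ndom \<zeta> = K" "Ncod \<zeta> = N" using nat_trans_Zero[OF PK(1) PN(1)] by (simp_all add: \<zeta>_def)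
  have KO: "K \<in> Obj (eff C E)" by (rule eff_ObjI[OF k hS])
  have "h \<in> pull d T" using h(4) gen_self[OF h(2)] by simp
  then have "d \<cdot> h \<in> T" by (simp add: pull_def)
  then have z: "Fmap Q (d \<cdot> h) q = unit_el Q (Dom C h)" using PQ(4)[of "d \<cdot> h"] d h by simp
  have "Comp (eff C E) \<rho> \<kappa> = Comp (eff C E) \<rho> \<zeta>"
  proof (rule pres_eqI[OF k])
    show "is_nat_trans C (Comp (eff C E) \<rho> \<kappa>)" "is_nat_trans C (Comp (eff C E) \<rho> \<zeta>)"
      using nat_trans_comp[OF \<kappa>(1) R(1)] nat_trans_comp[OF \<zeta>(1) R(1)] \<kappa>(3) \<zeta>(3) by (simp_all add: N_def)
    show "Ncomp (Comp (eff C E) \<rho> \<kappa>) (Dom C h) k = Ncomp (Comp (eff C E) \<rho> \<zeta>) (Dom C h) k"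
      using \<rho>act[OF h(2,3)] z nat_trans_unit[OF R(1) PK(2)] PK(2,3) \<kappa> \<zeta>(2)
      by (simp add: \<zeta>_def N_def Q_def)
  qed (use \<kappa> \<zeta> in simp_all)
  moreover have "\<kappa> \<in> Hom (eff C E) K (Dom (eff C E) \<rho>)" "\<zeta> \<in> Hom (eff C E) K (Dom (eff C E) \<rho>)"
    using \<kappa> \<zeta> KO R(2) by (simp_all add: eff_Mor N_def)
  ultimately have "\<kappa> = \<zeta>" using \<rho> KO unfolding mono_mor_def by blast
  then have "Fmap N h n = unit_el N (Dom C h)" using \<kappa>(4) PK(2,3) by (simp add: \<zeta>_def)
  then have hS': "h \<in> S" using PN(4)[OF h(2,3)] by simp
  have xN: "x \<in> el N W" using x by (simp add: N_def)
  obtain u where u: "u \<in> Mor C" "Dom C u = W" "Cod C u = D" "x = Fmap N u n" by (rule presE[OF n(2) xN W])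
  have "Fmap Q (d \<cdot> u) q = unit_el Q W" using \<rho>act[OF u(1,3)] x0 u by (simp add: Q_def)
  then have "u \<in> pull d T" using PQ(4)[of "d \<cdot> u"] u d by (simp add: pull_def)
  then have "u \<in> gen h" using h(4) by simp
  then obtain y where y: "y \<in> Mor C" "Cod C y = Dom C h" "u = h \<cdot> y" by (rule genE)
  then have "u \<in> S" using is_sieveD(3)[OF sieves_is_sieve[OF n(1)] hS' y(1,2)] by simp
  then show ?thesis using PN(4)[OF u(1,3)] u by (simp add: N_def)
qed

lemma eff_iso:
  assumes \<rho>: "mono_mor (eff C E) \<rho>" and q: "pres (Ncod \<rho>) X T q"
    and x: "x \<in> el (Ndom \<rho>) X" "Ncomp \<rho> X x = q"
  shows "iso_mor (eff C E) \<rho>"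
proof -
  have \<rho>M: "\<rho> \<in> Mor (eff C E)" using \<rho> by (simp add: mono_mor_def)
  note R = eff_MorD[OF \<rho>M] and P = presD[OF q]
  note N = eff_Obj_module[OF R(2)]
  obtain \<sigma> where \<sigma>: "is_nat_trans C \<sigma>" "Ndom \<sigma> = Ncod \<rho>" "Ncod \<sigma> = Ndom \<rho>" "Ncomp \<sigma> X q = x"
  proof (rule pres_map[OF q N x(1)])
    fix u assume u: "u \<in> T"
    note m = P(5,6)[OF u]
    have "Ncomp \<rho> (Dom C u) (Fmap (Ndom \<rho>) u x) = unit_el (Ncod \<rho>) (Dom C u)"
      using nat_transD(5)[OF R(1), of u "Dom C u" "Cod C u" x] x P(2) P(4)[OF m] u m by simp
    then show "Fmap (Ndom \<rho>) u x = unit_el (Ndom \<rho>) (Dom C u)"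
      using moduleD(6)[OF N m(1), of x] x(1) m by (intro eff_mono_injective[OF \<rho>]) simp_all
  qed
  have rs: "Comp (eff C E) \<rho> \<sigma> = nat_of C (Ncod \<rho>) (Ncod \<rho>) (\<lambda>X x. x)"
    by (rule pres_eqI[OF q])
      (use nat_trans_comp[OF \<sigma>(1) R(1)] nat_trans_Idn[OF P(1)] \<sigma> x P in simp_all)
  have "Comp (eff C E) \<sigma> \<rho> = nat_of C (Ndom \<rho>) (Ndom \<rho>) (\<lambda>X x. x)"
  proof (rule nat_trans_eqI)
    fix W y assume W: "W \<in> Obj C" and "y \<in> el (Ndom (nat_of C (Ndom \<rho>) (Ndom \<rho>) (\<lambda>X x. x))) W"
    then have y: "y \<in> el (Ndom \<rho>) W" by simp
    have ry: "Ncomp \<rho> W y \<in> el (Ncod \<rho>) W" by (rule nat_transD(4)[OF R(1) W y])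
    have sry: "Ncomp \<sigma> W (Ncomp \<rho> W y) \<in> el (Ndom \<rho>) W" using nat_transD(4)[OF \<sigma>(1) W] ry \<sigma> by simp
    have "Ncomp \<rho> W (Ncomp \<sigma> W (Ncomp \<rho> W y)) = Ncomp \<rho> W y"
      using Ncomp_cong[OF rs, of W "Ncomp \<rho> W y"] W ry \<sigma>(2) by simp
    then have "Ncomp \<sigma> W (Ncomp \<rho> W y) = y"
      by - (rule nat_trans_injective[OF R(1) W _ sry y], rule eff_mono_injective[OF \<rho> W], simp_all)
    then show "Ncomp (Comp (eff C E) \<sigma> \<rho>) W y = Ncomp (nat_of C (Ndom \<rho>) (Ndom \<rho>) (\<lambda>X x. x)) W y"
      using W y by simp
  qed (use nat_trans_comp[OF R(1) \<sigma>(1)] nat_trans_Idn[OF N] \<sigma> in simp_all)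
  then show ?thesis unfolding iso_mor_def using \<rho>M rs \<sigma> R
    by (intro conjI bexI[of _ \<sigma>]) (simp_all add: eff_Mor)
qed

text \<open>
  A sieve \<open>U\<close> of \<open>E\<close> above \<open>S\<close>, generated by \<open>h\<close>, gives the subobject of \<open>Q\<close> generated by \<open>h q\<close>.
\<close>

lemma simple_obj_height:
  assumes s: "simple_obj (eff C E) Q" and q: "pres Q X S q"
  shows "height_le (sieves X) 1 S (top_sieve X)"
proof -
  have QO: "Q \<in> Obj (eff C E)" using s by (simp add: simple_obj_def)
  note P = presD[OF q]
  have S: "S \<in> sieves X" by (rule pres_sieve[OF q QO])
  have "U = top_sieve X" if U: "U \<in> sieves X" "S \<subset> U" for U
  proof -
    obtain h where h: "h \<in> deflations E" "h \<in> Mor C" "Cod C h = X" "U = gen h" by (rule sievesE[OF U(1)])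
    have hS: "pull h S \<in> sieves (Dom C h)" by (rule sieves_pull[OF S h(2,3)])
    obtain N :: "('o, 'm, 'm set) modul" and n where n: "pres N (Dom C h) (pull h S) n" by (rule sieves_gen_ex[OF hS])
    note PN = presD[OF n]
    have hq: "Fmap Q h q \<in> el Q (Dom C h)" by (rule P(7)[OF h(2,3)])
    have act: "Fmap Q u (Fmap Q h q) = Fmap Q (h \<cdot> u) q" if "u \<in> Mor C" "Cod C u = Dom C h" for u
      using moduleD(4)[OF P(1) that(1) h(2) that(2), of q] h P(3) by simp
    have mem: "u \<in> pull h S \<longleftrightarrow> Fmap Q (h \<cdot> u) q = unit_el Q (Dom C u)" if "u \<in> Mor C" "Cod C u = Dom C h" for u
      using P(4)[of "h \<cdot> u"] that h by (simp add: pull_def)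
    have ann: "Fmap Q u (Fmap Q h q) = unit_el Q (Dom C u)" if "u \<in> pull h S" for u
      using act[of u] mem[of u] PN(5,6)[OF that] that by simp
    obtain \<rho> where \<rho>: "is_nat_trans C \<rho>" "Ndom \<rho> = N" "Ncod \<rho> = Q" "Ncomp \<rho> (Dom C h) n = Fmap Q h q"
      by (rule pres_map[OF n P(1) hq ann])
    have \<rho>act: "Ncomp \<rho> (Dom C u) (Fmap N u n) = Fmap Q (h \<cdot> u) q" if "u \<in> Mor C" "Cod C u = Dom C h" for u
      using pres_apply[OF n \<rho>(1,2) that] act[OF that] \<rho> by simp
    have NO: "N \<in> Obj (eff C E)" by (rule eff_ObjI[OF n hS])
    have mono: "mono_mor (eff C E) \<rho>"
    proof (rule eff_mono)
      show "\<rho> \<in> Mor (eff C E)" using \<rho> NO QO by (simp add: eff_Mor)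
      fix W x assume W: "W \<in> Obj C" and x: "x \<in> el (Ndom \<rho>) W" "Ncomp \<rho> W x = unit_el (Ncod \<rho>) W"
      have xN: "x \<in> el N W" using x(1) \<rho>(2) by simp
      obtain u where u: "u \<in> Mor C" "Dom C u = W" "Cod C u = Dom C h" "x = Fmap N u n"
        by (rule presE[OF n xN W])
      have "u \<in> pull h S" using mem[OF u(1,3)] \<rho>act[OF u(1,3)] u x(2) \<rho>(3) by simp
      then show "x = unit_el (Ndom \<rho>) W" using PN(4)[OF u(1,3)] u \<rho>(2) by simp
    qed
    then have "zero_obj (eff C E) N \<or> iso_mor (eff C E) \<rho>" using s \<rho> by (auto simp: simple_obj_def)
    then show "U = top_sieve X"
    proof
      assume "zero_obj (eff C E) N"
      then have "Idn C (Dom C h) \<in> pull h S" using pres_zero_obj[OF n hS] h(2) by (simp add: top_sieve_def)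
      then have "h \<in> S" using h by (simp add: pull_def)
      then have "U \<subseteq> S" unfolding h(4) gen_def using is_sieveD(3)[OF sieves_is_sieve[OF S]] by blast
      then show ?thesis using U(2) by blast
    next
      assume "iso_mor (eff C E) \<rho>"
      then obtain \<sigma> where "\<sigma> \<in> Hom (eff C E) (Cod (eff C E) \<rho>) (Dom (eff C E) \<rho>)"
        "Comp (eff C E) \<rho> \<sigma> = Idn (eff C E) (Cod (eff C E) \<rho>)" by (auto simp: iso_mor_def simp del: Hom_iff eff_simps)
      then have \<sigma>: "is_nat_trans C \<sigma>" "Ndom \<sigma> = Q" "Ncod \<sigma> = N"
        and e: "Comp (eff C E) \<rho> \<sigma> = nat_of C Q Q (\<lambda>X x. x)" using \<rho> by (simp_all add: eff_Mor)
      have "Ncomp \<sigma> X q \<in> el N X" using nat_transD(4)[OF \<sigma>(1) P(2)] P(3) \<sigma> by simp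
      then obtain u where u: "u \<in> Mor C" "Dom C u = X" "Cod C u = Dom C h" "Ncomp \<sigma> X q = Fmap N u n"
        by (rule presE[OF n _ P(2)])
      have "Fmap Q (h \<cdot> u) q = q" using Ncomp_cong[OF e, of X q] \<rho>act[OF u(1,3)] u P(2,3) \<sigma>(2) by simp
      then have "Fmap Q (Idn C X) q = Fmap Q (h \<cdot> u) q" using moduleD(3)[OF P(1,2,3)] by simp
      then have "Idn C X \<^bold>+ neg (h \<cdot> u) \<in> S" using pres_eq_iff[OF q, of "Idn C X" "h \<cdot> u"] u h P(2) by simp
      then have iU: "Idn C X \<^bold>+ neg (h \<cdot> u) \<in> U" using U(2) by blast
      have hu: "h \<cdot> u \<in> U" unfolding h(4) by (rule genI[OF u(1,3)])
      have "(Idn C X \<^bold>+ neg (h \<cdot> u)) \<^bold>+ h \<cdot> u \<in> U"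
        by (rule is_sieveD(4)[OF sieves_is_sieve[OF U(1)] iU hu]) (use u h P(2) in simp)
      then have id: "Idn C X \<in> U" using u h P(2) by simp
      have "x \<in> U" if "x \<in> top_sieve X" for x
        using is_sieveD(3)[OF sieves_is_sieve[OF U(1)] id, of x] that P(2) by (simp add: top_sieve_def)
      then show ?thesis using sieves_subset_top[OF U(1)] by blast
    qed
  qed
  then show ?thesis unfolding One_nat_def height_le.simps by blast
qed

text \<open>
  Conversely, a subobject of \<open>Q\<close> generated by \<open>d q\<close> comes from the sieve \<open>T\<close> extended by \<open>d\<close>.
\<close>

lemma simple_objI_height:
  assumes q: "pres Q X T q" and T: "T \<in> sieves X" "T \<noteq> top_sieve X" and h: "height_le (sieves X) 1 T (top_sieve X)"
  shows "simple_obj (eff C E) Q"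
  unfolding simple_obj_def
proof (intro conjI allI impI)
  show QO: "Q \<in> Obj (eff C E)" by (rule eff_ObjI[OF q T(1)])
  show "\<not> zero_obj (eff C E) Q" using pres_zero_obj[OF q T(1)] T(2) by simp
  note P = presD[OF q]
  fix \<rho> assume "mono_mor (eff C E) \<rho> \<and> Cod (eff C E) \<rho> = Q"
  then have \<rho>: "mono_mor (eff C E) \<rho>" "Ncod \<rho> = Q" by simp_all
  have \<rho>M: "\<rho> \<in> Mor (eff C E)" using \<rho> by (simp add: mono_mor_def)
  note R = eff_MorD[OF \<rho>M]
  obtain D S n where n: "S \<in> sieves D" "pres (Ndom \<rho>) D S n" by (rule eff_ObjE[OF R(2)])
  note PN = presD[OF n(2)]
  have "Ncomp \<rho> D n \<in> el Q D" using nat_transD(4)[OF R(1) PN(2)] PN(3) \<rho>(2) by simp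
  then obtain d where d: "d \<in> Mor C" "Dom C d = D" "Cod C d = X" "Ncomp \<rho> D n = Fmap Q d q"
    by (rule presE[OF q _ PN(2)])
  have \<rho>act: "Ncomp \<rho> (Dom C u) (Fmap (Ndom \<rho>) u n) = Fmap Q (d \<cdot> u) q" if "u \<in> Mor C" "Cod C u = D" for u
    using pres_apply[OF n(2) R(1) refl that] moduleD(4)[OF P(1) that(1) d(1)] that d P(3) \<rho>(2) by simp
  define U where "U = join T (gen d)"
  have UL: "U \<in> sieves X" unfolding U_def by (rule sieves_join_gen[OF T(1) d(1,3)])
  note up = join_upper[OF sieves_is_sieve[OF T(1)] gen_sieve[OF d(1,3)]]
  have "U = T \<or> U = top_sieve X"
    using h UL up(1) sieves_subset_top[OF UL] sieves_top[OF P(2)] unfolding One_nat_def height_le.simps U_def by blast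
  then show "zero_obj (eff C E) (Dom (eff C E) \<rho>) \<or> iso_mor (eff C E) \<rho>"
  proof
    assume "U = T"
    then have dT: "d \<in> T" using up(2) gen_self[OF d(1)] unfolding U_def by blast
    have "Ncomp \<rho> D n = unit_el Q D" using P(4)[OF d(1,3)] dT d by simp
    then have "n = unit_el (Ndom \<rho>) D"
      using eff_mono_injective[OF \<rho>(1) PN(2,3)] \<rho>(2) by simp
    then have n1: "Fmap (Ndom \<rho>) u n = unit_el (Ndom \<rho>) (Dom C u)" if "u \<in> Mor C" "Cod C u = D" for u
      using module_act_unit[OF PN(1) that(1)] that by simp
    have "top_sieve D \<subseteq> S" using n1 PN(4) by (auto simp: top_sieve_def)
    then have "zero_obj (eff C E) (Ndom \<rho>)" using pres_zero_obj[OF n(2,1)] sieves_subset_top[OF n(1)] by blast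
    then show ?thesis by simp
  next
    assume "U = top_sieve X"
    then have "Idn C X \<in> join T (gen d)" using P(2) unfolding U_def by (simp add: top_sieve_def)
    then obtain t y where ty: "t \<in> T" "y \<in> gen d" "Dom C t = Dom C y" "Idn C X = t \<^bold>+ y" by (auto simp: join_def)
    obtain u where u: "u \<in> Mor C" "Cod C u = Dom C d" "y = d \<cdot> u" by (rule genE[OF ty(2)])
    note t = P(5,6)[OF ty(1)]
    have "Dom C (Idn C X) = Dom C (t \<^bold>+ y)" using ty(4) by simp
    then have dx: "Dom C u = X" using t ty(3) u d P(2) by simp
    have "Idn C X \<^bold>+ neg (d \<cdot> u) = t" unfolding ty(4) using t u d ty(3) by simp
    then have "Fmap Q (Idn C X) q = Fmap Q (d \<cdot> u) q"
      using pres_eq_iff[OF q, of "Idn C X" "d \<cdot> u"] ty(1) u d dx P(2) by simp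
    then have "Ncomp \<rho> X (Fmap (Ndom \<rho>) u n) = q"
      using \<rho>act[of u] u d dx moduleD(3)[OF P(1,2,3)] by simp
    moreover have "Fmap (Ndom \<rho>) u n \<in> el (Ndom \<rho>) X" using PN(7)[of u] u d dx by simp
    moreover have "pres (Ncod \<rho>) X T q" using q \<rho>(2) by simp
    ultimately show ?thesis using eff_iso[OF \<rho>(1)] by blast
  qed
qed

text \<open>
  For an extension of a simple object by \<open>N\<close>, the preimage of \<open>N\<close> in \<open>Hom(-, X)\<close> is a sieve \<open>T\<close> of \<open>E\<close>
  with only one step above it. Chains between \<open>S\<close> and \<open>T\<close> restrict along a generator \<open>k\<close> of \<open>T\<close> to
  chains above a pull-back of the annihilator of \<open>N\<close>, because the quotient \<open>T / S\<close> maps to \<open>N\<close> by the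
  universal property of the kernel.
\<close>

lemma finite_length_bounded:
  assumes "finite_length (eff C E) M" "pres M X S m" shows "bounded X S"
  using assms
proof (induction arbitrary: X S m rule: finite_length.induct)
  case (zero M)
  then have "M \<in> Obj (eff C E)" by (simp add: zero_obj_def)
  then have S: "S \<in> sieves X" by (rule pres_sieve[OF zero.prems])
  then have "S = top_sieve X" using pres_zero_obj[OF zero.prems S] zero.hyps by simp
  then show ?case using bounded_top[OF presD(2)[OF zero.prems]] by simp
next
  case (extension \<phi> \<psi>)
  define M where "M = Ncod \<phi>"
  define N where "N = Ndom \<phi>"
  define Q where "Q = Ncod \<psi>"
  have p: "pres M X S m" using extension.prems by (simp add: M_def)
  note P = presD[OF p]
  have ker: "is_kernel (eff C E) \<phi> \<psi>" using extension.hyps(1) by (simp add: ker_coker_pair_def)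
  have m\<phi>: "\<phi> \<in> Mor (eff C E)" and m\<psi>: "\<psi> \<in> Mor (eff C E)" and ends: "Ndom \<psi> = M"
    using ker by (simp_all add: is_kernel_def M_def)
  note F = eff_MorD[OF m\<phi>, folded M_def N_def] and G = eff_MorD[OF m\<psi>, folded Q_def, unfolded ends]
  have S: "S \<in> sieves X" by (rule pres_sieve[OF p F(3)])
  obtain D R n where n: "R \<in> sieves D" "pres N D R n" by (rule eff_ObjE[OF F(2)])
  obtain X' S' q where q: "S' \<in> sieves X'" "pres Q X' S' q" by (rule eff_ObjE[OF G(3)])
  note PN = presD[OF n(2)] and PQ = presD[OF q(2)]
  have R: "bounded D R" using extension.IH n(2) by (simp add: N_def)
  have "Ncomp \<psi> X m \<in> el Q X" using nat_transD(4)[OF G(1) P(2)] P(3) ends by (simp add: Q_def)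
  then obtain c where c: "c \<in> Mor C" "Dom C c = X" "Cod C c = X'" "Ncomp \<psi> X m = Fmap Q c q"
    by (rule presE[OF q(2) _ P(2)])
  have \<psi>act: "Ncomp \<psi> (Dom C u) (Fmap M u m) = Fmap Q (c \<cdot> u) q" if "u \<in> Mor C" "Cod C u = X" for u
    using pres_apply[OF p G(1) ends that] moduleD(4)[OF PQ(1) that(1) c(1)] that c PQ(3) by (simp add: Q_def)
  define T where "T = pull c S'"
  have TL: "T \<in> sieves X" using sieves_pull[OF q(1) c(1,3)] c(2) by (simp add: T_def)
  have memT: "u \<in> T \<longleftrightarrow> Fmap Q (c \<cdot> u) q = unit_el Q (Dom C u)" if "u \<in> Mor C" "Cod C u = X" for u
    using PQ(4)[of "c \<cdot> u"] that c by (simp add: T_def pull_def)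
  have "height_le (sieves X') 1 S' (top_sieve X')"
    by (rule simple_obj_height[OF _ q(2)]) (use extension.hyps(3) in \<open>simp add: Q_def\<close>)
  from height_pull[OF q(1) c(1,3) this] have hT: "height_le (sieves X) 1 T (top_sieve X)"
    unfolding T_def c(2) .
  have ST: "S \<subseteq> T"
  proof
    fix u assume uS: "u \<in> S"
    note u = P(5,6)[OF uS]
    have "Fmap M u m = unit_el M (Dom C u)" using P(4)[OF u] uS by simp
    then have "Fmap Q (c \<cdot> u) q = unit_el Q (Dom C u)"
      using \<psi>act[OF u] nat_trans_unit[OF G(1), of "Dom C u"] u ends by (simp add: Q_def)
    then show "u \<in> T" using memT[OF u] by simp
  qed
  obtain k where k: "k \<in> deflations E" "k \<in> Mor C" "Cod C k = X" "T = gen k" by (rule sievesE[OF TL])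
  have kS: "pull k S \<in> sieves (Dom C k)" by (rule sieves_pull[OF S k(2,3)])
  obtain K :: "('o, 'm, 'm set) modul" and \<kappa> where \<kappa>: "pres K (Dom C k) (pull k S) \<kappa>" by (rule sieves_gen_ex[OF kS])
  note PK = presD[OF \<kappa>]
  have KO: "K \<in> Obj (eff C E)" by (rule eff_ObjI[OF \<kappa> kS])
  have km: "Fmap M k m \<in> el M (Dom C k)" by (rule P(7)[OF k(2,3)])
  have act: "Fmap M u (Fmap M k m) = Fmap M (k \<cdot> u) m" if "u \<in> Mor C" "Cod C u = Dom C k" for u
    using moduleD(4)[OF P(1) that(1) k(2) that(2), of m] k P(3) by simp
  have mem: "u \<in> pull k S \<longleftrightarrow> Fmap M (k \<cdot> u) m = unit_el M (Dom C u)" if "u \<in> Mor C" "Cod C u = Dom C k" for u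
    using P(4)[of "k \<cdot> u"] that k by (simp add: pull_def)
  have ann: "Fmap M u (Fmap M k m) = unit_el M (Dom C u)" if "u \<in> pull k S" for u
    using act[of u] mem[of u] PK(5,6)[OF that] that by simp
  obtain \<chi> where \<chi>: "is_nat_trans C \<chi>" "Ndom \<chi> = K" "Ncod \<chi> = M" "Ncomp \<chi> (Dom C k) \<kappa> = Fmap M k m"
    by (rule pres_map[OF \<kappa> P(1) km ann])
  have "k \<in> T" using k(4) gen_self[OF k(2)] by simp
  then have kz: "Fmap Q (c \<cdot> k) q = unit_el Q (Dom C k)" using memT[OF k(2,3)] by simp
  have "Comp (eff C E) \<psi> \<chi> = Zero (eff C E) K (Cod (eff C E) \<psi>)"
  proof (rule pres_eqI[OF \<kappa>])
    show "is_nat_trans C (Comp (eff C E) \<psi> \<chi>)" "is_nat_trans C (Zero (eff C E) K (Cod (eff C E) \<psi>))"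
      using nat_trans_comp[OF \<chi>(1) G(1)] nat_trans_Zero[OF PK(1) PQ(1)] \<chi>(3) ends by (simp_all add: Q_def)
    show "Ncomp (Comp (eff C E) \<psi> \<chi>) (Dom C k) \<kappa> = Ncomp (Zero (eff C E) K (Cod (eff C E) \<psi>)) (Dom C k) \<kappa>"
      using \<psi>act[OF k(2,3)] kz \<chi> PK(2,3) by (simp add: Q_def)
  qed (use \<chi> in simp_all)
  moreover have "\<chi> \<in> Hom (eff C E) K (Dom (eff C E) \<psi>)" using \<chi> KO F(3) ends by (simp add: eff_Mor)
  ultimately obtain \<mu> where "\<mu> \<in> Hom (eff C E) K (Dom (eff C E) \<phi>)" and \<mu>c: "Comp (eff C E) \<phi> \<mu> = \<chi>"
    using ker KO unfolding is_kernel_def by blast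
  then have \<mu>: "is_nat_trans C \<mu>" "Ndom \<mu> = K" "Ncod \<mu> = N" by (simp_all add: eff_Mor N_def)
  define n' where "n' = Ncomp \<mu> (Dom C k) \<kappa>"
  have n'N: "n' \<in> el N (Dom C k)" using nat_transD(4)[OF \<mu>(1) PK(2)] PK(3) \<mu> by (simp add: n'_def)
  have \<phi>n': "Ncomp \<phi> (Dom C k) n' = Fmap M k m"
    using Ncomp_cong[OF \<mu>c, of "Dom C k" \<kappa>] PK(2,3) \<mu>(2) \<chi>(4) by (simp add: n'_def)
  obtain e where e: "e \<in> Mor C" "Dom C e = Dom C k" "Cod C e = D" "n' = Fmap N e n"
    by (rule presE[OF n(2) n'N PK(2)])
  have "u \<in> pull k S \<longleftrightarrow> u \<in> pull e R" for u
  proof (cases "u \<in> Mor C \<and> Cod C u = Dom C k")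
    case True
    then have u: "u \<in> Mor C" "Cod C u = Dom C k" by simp_all
    have "Fmap N (e \<cdot> u) n = Fmap N u n'" using moduleD(4)[OF PN(1) u(1) e(1), of n] u e PN(3) by simp
    then have "u \<in> pull e R \<longleftrightarrow> Fmap N u n' = unit_el N (Dom C u)"
      using PN(4)[of "e \<cdot> u"] u e by (simp add: pull_def)
    also have "\<dots> \<longleftrightarrow> u \<in> pull k S"
    proof
      assume "Fmap N u n' = unit_el N (Dom C u)"
      then have "Ncomp \<phi> (Dom C u) (Fmap N u n') = unit_el M (Dom C u)"
        using nat_trans_unit[OF F(1), of "Dom C u"] u by (simp add: M_def N_def)
      moreover have "Ncomp \<phi> (Dom C u) (Fmap N u n') = Fmap M u (Ncomp \<phi> (Cod C u) n')"
        using nat_transD(5)[OF F(1), of u "Dom C u" "Cod C u" n'] u n'N PK(2) by (simp add: M_def N_def)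
      ultimately show "u \<in> pull k S" using mem[OF u] act[OF u] \<phi>n' u by simp
    next
      assume "u \<in> pull k S"
      then have "Fmap K u \<kappa> = unit_el K (Dom C u)" using PK(4)[OF u] by simp
      then show "Fmap N u n' = unit_el N (Dom C u)"
        using pres_apply[OF \<kappa> \<mu>(1,2) u] nat_trans_unit[OF \<mu>(1), of "Dom C u"] u \<mu> by (simp add: n'_def)
    qed
    finally show ?thesis by simp
  next
    case False
    then show ?thesis using e(2) by (auto simp: pull_def)
  qed
  then have "pull k S = pull e R" by blast
  then have "bounded (Dom C k) (pull k S)" using bounded_pull[OF R e(1,3)] e(2) by simp
  then obtain l where "height_le (sieves (Dom C k)) l (pull k S) (top_sieve (Dom C k))" by (auto simp: bounded_def)
  then have "height_le (sieves X) l S T" using height_restrict[OF k(1), of S l] S ST k by simp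
  then have "height_le (sieves X) (l + 1) S (top_sieve X)" by (rule height_extension[OF S TL ST _ hT])
  then show ?case using S unfolding bounded_def by blast
qed

text \<open>
  A maximal proper sieve \<open>T\<close> above \<open>S\<close> gives the exact sequence of \<open>T / S\<close>, \<open>M\<close> and the simple quotient
  of \<open>M\<close> by \<open>T / S\<close>, and chains between \<open>S\<close> and \<open>T\<close> are shorter than chains above \<open>S\<close>.
\<close>

lemma height_finite_length:
  assumes "height_le (sieves X) n S (top_sieve X)" "pres M X S m" "S \<in> sieves X"
  shows "finite_length (eff C E) M"
  using assms
proof (induction n arbitrary: X S M m)
  case 0
  note P = presD[OF 0(2)]
  have "S = top_sieve X" using 0 sieves_top[OF P(2)] sieves_subset_top[OF 0(3)] unfolding height_le.simps by blast
  then have "zero_obj (eff C E) M" using pres_zero_obj[OF 0(2,3)] by simp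
  then show ?case by (rule finite_length.zero)
next
  case (Suc i)
  note p = Suc.prems(2) and S = Suc.prems(3)
  note P = presD[OF p]
  show ?case
  proof (cases "S = top_sieve X")
    case True
    then have "zero_obj (eff C E) M" using pres_zero_obj[OF p S] by simp
    then show ?thesis by (rule finite_length.zero)
  next
    case False
    then have "S \<subset> top_sieve X" using sieves_subset_top[OF S] by blast
    then obtain T where T: "T \<in> sieves X" "S \<subseteq> T" "T \<subset> top_sieve X" "height_le (sieves X) 1 T (top_sieve X)"
      by (rule height_le_cover[OF Suc.prems(1) S sieves_top[OF P(2)]])
    obtain h where h: "h \<in> deflations E" "h \<in> Mor C" "Cod C h = X" "T = gen h" by (rule sievesE[OF T(1)])
    have hS: "pull h S \<in> sieves (Dom C h)" by (rule sieves_pull[OF S h(2,3)])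
    have "height_le (sieves X) i S T" by (rule height_le_proper_top[OF Suc.prems(1) T(3) sieves_top[OF P(2)]])
    then have ht: "height_le (sieves (Dom C h)) i (pull h S) (top_sieve (Dom C h))"
      using height_restrict[OF h(1), of S i] S T(2) h by simp
    obtain N :: "('o, 'm, 'm set) modul" and n where n: "pres N (Dom C h) (pull h S) n" by (rule sieves_gen_ex[OF hS])
    obtain Q :: "('o, 'm, 'm set) modul" and q where q: "pres Q X T q" by (rule sieves_gen_ex[OF T(1)])
    note PN = presD[OF n] and PQ = presD[OF q]
    have NO: "N \<in> Obj (eff C E)" and QO: "Q \<in> Obj (eff C E)" and MO: "M \<in> Obj (eff C E)"
      using eff_ObjI n hS q T(1) p S by blast+
    have hm: "Fmap M h m \<in> el M (Dom C h)" by (rule P(7)[OF h(2,3)])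
    have act: "Fmap M u (Fmap M h m) = Fmap M (h \<cdot> u) m" if "u \<in> Mor C" "Cod C u = Dom C h" for u
      using moduleD(4)[OF P(1) that(1) h(2) that(2), of m] h P(3) by simp
    have mem: "u \<in> pull h S \<longleftrightarrow> Fmap M (h \<cdot> u) m = unit_el M (Dom C u)" if "u \<in> Mor C" "Cod C u = Dom C h" for u
      using P(4)[of "h \<cdot> u"] that h by (simp add: pull_def)
    have ann: "Fmap M u (Fmap M h m) = unit_el M (Dom C u)" if "u \<in> pull h S" for u
      using act[of u] mem[of u] PN(5,6)[OF that] that by simp
    obtain \<phi> where \<phi>: "is_nat_trans C \<phi>" "Ndom \<phi> = N" "Ncod \<phi> = M" "Ncomp \<phi> (Dom C h) n = Fmap M h m"
      by (rule pres_map[OF n P(1) hm ann])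
    obtain \<psi> where \<psi>: "is_nat_trans C \<psi>" "Ndom \<psi> = M" "Ncod \<psi> = Q" "Ncomp \<psi> X m = q"
      by (rule pres_map[OF p PQ(1,3)]) (use PQ(4,5,6) T(2) in blast)
    have \<phi>act: "Ncomp \<phi> (Dom C u) (Fmap N u n) = Fmap M (h \<cdot> u) m" if "u \<in> Mor C" "Cod C u = Dom C h" for u
      using pres_apply[OF n \<phi>(1,2) that] act[OF that] \<phi> by simp
    have \<psi>act: "Ncomp \<psi> (Dom C u) (Fmap M u m) = Fmap Q u q" if "u \<in> Mor C" "Cod C u = X" for u
      using pres_apply[OF p \<psi>(1,2) that] \<psi> by simp
    have mor: "\<phi> \<in> Mor (eff C E)" "\<psi> \<in> Mor (eff C E)" using \<phi> \<psi> NO QO MO by (simp_all add: eff_Mor)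
    have inj0: "x = unit_el N W" if W: "W \<in> Obj C" and x: "x \<in> el N W" "Ncomp \<phi> W x = unit_el M W" for W x
    proof -
      obtain u where u: "u \<in> Mor C" "Dom C u = W" "Cod C u = Dom C h" "x = Fmap N u n"
        by (rule presE[OF n x(1) W])
      have "u \<in> pull h S" using mem[OF u(1,3)] \<phi>act[OF u(1,3)] u x(2) by simp
      then show ?thesis using PN(4)[OF u(1,3)] u by simp
    qed
    have inj: "x = y" if W: "W \<in> Obj C" and xy: "x \<in> el N W" "y \<in> el N W" "Ncomp \<phi> W x = Ncomp \<phi> W y" for W x y
      by (rule nat_trans_injective[OF \<phi>(1) W]) (use inj0[OF W] xy \<phi> in simp_all)
    have hq: "Fmap Q h q = unit_el Q (Dom C h)"
      using PQ(4)[OF h(2,3)] h(4) gen_self[OF h(2)] by simp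
    have zero: "Comp (eff C E) \<psi> \<phi> = Zero (eff C E) N Q"
    proof (rule pres_eqI[OF n])
      show "is_nat_trans C (Comp (eff C E) \<psi> \<phi>)" "is_nat_trans C (Zero (eff C E) N Q)"
        using nat_trans_comp[OF \<phi>(1) \<psi>(1)] nat_trans_Zero[OF PN(1) PQ(1)] \<phi> \<psi> by simp_all
      show "Ncomp (Comp (eff C E) \<psi> \<phi>) (Dom C h) n = Ncomp (Zero (eff C E) N Q) (Dom C h) n"
        using \<psi>act[OF h(2,3)] hq \<phi> PN(2,3) by simp
    qed (use \<phi> \<psi> in simp_all)
    have "is_kernel (eff C E) \<phi> \<psi>" unfolding is_kernel_def
    proof (intro conjI ballI impI mor)
      show "Cod (eff C E) \<phi> = Dom (eff C E) \<psi>" using \<phi> \<psi> by simp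
      show "Comp (eff C E) \<psi> \<phi> = Zero (eff C E) (Dom (eff C E) \<phi>) (Cod (eff C E) \<psi>)" using zero \<phi> \<psi> by simp
      fix V \<chi> assume V: "V \<in> Obj (eff C E)" and "\<chi> \<in> Hom (eff C E) V (Dom (eff C E) \<psi>)"
        and \<chi>0: "Comp (eff C E) \<psi> \<chi> = Zero (eff C E) V (Cod (eff C E) \<psi>)"
      then have \<chi>: "is_nat_trans C \<chi>" "Ndom \<chi> = V" "Ncod \<chi> = M" using \<psi> by (simp_all add: eff_Mor)
      obtain D R v where v: "R \<in> sieves D" "pres V D R v" by (rule eff_ObjE[OF V])
      note PV = presD[OF v(2)]
      have "Ncomp \<chi> D v \<in> el M D" using nat_transD(4)[OF \<chi>(1) PV(2)] PV(3) \<chi> by simp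
      then obtain a where a: "a \<in> Mor C" "Dom C a = D" "Cod C a = X" "Ncomp \<chi> D v = Fmap M a m"
        by (rule presE[OF p _ PV(2)])
      have "Fmap Q a q = unit_el Q D"
        using Ncomp_cong[OF \<chi>0, of D v] \<psi>act[OF a(1,3)] a PV(2,3) \<chi> \<psi> by simp
      then have "a \<in> gen h" using PQ(4)[OF a(1,3)] a h(4) by simp
      then obtain b where b: "b \<in> Mor C" "Cod C b = Dom C h" "a = h \<cdot> b" by (rule genE)
      have db: "Dom C b = D" using a(2) b h(2) by simp
      define w where "w = Fmap N b n"
      have w: "w \<in> el N D" using PN(7)[OF b(1,2)] db by (simp add: w_def)
      have \<phi>w: "Ncomp \<phi> D w = Ncomp \<chi> D v" using \<phi>act[OF b(1,2)] b a db by (simp add: w_def)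
      obtain \<mu> where \<mu>: "is_nat_trans C \<mu>" "Ndom \<mu> = V" "Ncod \<mu> = N" "Ncomp \<mu> D v = w"
      proof (rule pres_map[OF v(2) PN(1) w])
        fix u assume uR: "u \<in> R"
        note u = PV(5,6)[OF uR]
        have "Ncomp \<phi> (Dom C u) (Fmap N u w) = Fmap M u (Ncomp \<chi> D v)"
          using nat_transD(5)[OF \<phi>(1), of u "Dom C u" "Cod C u" w] u w \<phi> \<phi>w PV(2) by simp
        also have "\<dots> = Ncomp \<chi> (Dom C u) (Fmap V u v)" using pres_apply[OF v(2) \<chi>(1,2) u] \<chi> by simp
        also have "\<dots> = unit_el M (Dom C u)"
          using PV(4)[OF u] uR nat_trans_unit[OF \<chi>(1), of "Dom C u"] u \<chi> by simp
        finally show "Fmap N u w = unit_el N (Dom C u)"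
          using inj0[of "Dom C u" "Fmap N u w"] moduleD(6)[OF PN(1) u(1), of w] u w by simp
      qed
      show "\<exists>!u. u \<in> Hom (eff C E) V (Dom (eff C E) \<phi>) \<and> Comp (eff C E) \<phi> u = \<chi>"
      proof (rule ex1I[of _ \<mu>])
        have "Comp (eff C E) \<phi> \<mu> = \<chi>"
        proof (rule pres_eqI[OF v(2)])
          show "is_nat_trans C (Comp (eff C E) \<phi> \<mu>)" using nat_trans_comp[OF \<mu>(1) \<phi>(1)] \<mu> \<phi> by simp
          show "Ncomp (Comp (eff C E) \<phi> \<mu>) D v = Ncomp \<chi> D v" using \<phi>w \<mu> PV(2,3) by simp
        qed (use \<mu> \<phi> \<chi> in simp_all)
        then show "\<mu> \<in> Hom (eff C E) V (Dom (eff C E) \<phi>) \<and> Comp (eff C E) \<phi> \<mu> = \<chi>"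
          using \<mu> \<phi>(2) V NO by (simp add: eff_Mor)
        fix \<nu> assume \<nu>': "\<nu> \<in> Hom (eff C E) V (Dom (eff C E) \<phi>) \<and> Comp (eff C E) \<phi> \<nu> = \<chi>"
        then have \<nu>c: "Comp (eff C E) \<phi> \<nu> = \<chi>" by blast
        have \<nu>: "is_nat_trans C \<nu>" "Ndom \<nu> = V" "Ncod \<nu> = N" using \<nu>' \<phi>(2) by (simp_all add: eff_Mor)
        have "Ncomp \<phi> D (Ncomp \<nu> D v) = Ncomp \<phi> D w"
          using Ncomp_cong[OF \<nu>c, of D v] PV(2,3) \<nu>(2) \<phi>w by simp
        moreover have "Ncomp \<nu> D v \<in> el N D" using nat_transD(4)[OF \<nu>(1) PV(2)] PV(3) \<nu> by simp
        ultimately have "Ncomp \<nu> D v = w" using inj[OF PV(2) _ w] by simp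
        then show "\<nu> = \<mu>" using \<nu> \<mu> by (intro pres_eqI[OF v(2)]) simp_all
      qed
    qed
    moreover have "is_cokernel (eff C E) \<psi> \<phi>" unfolding is_cokernel_def
    proof (intro conjI ballI impI mor)
      show "Cod (eff C E) \<phi> = Dom (eff C E) \<psi>" using \<phi> \<psi> by simp
      show "Comp (eff C E) \<psi> \<phi> = Zero (eff C E) (Dom (eff C E) \<phi>) (Cod (eff C E) \<psi>)" using zero \<phi> \<psi> by simp
      fix V \<chi> assume V: "V \<in> Obj (eff C E)" and "\<chi> \<in> Hom (eff C E) (Cod (eff C E) \<phi>) V"
        and \<chi>0: "Comp (eff C E) \<chi> \<phi> = Zero (eff C E) (Dom (eff C E) \<phi>) V"
      then have \<chi>: "is_nat_trans C \<chi>" "Ndom \<chi> = M" "Ncod \<chi> = V" using \<phi> by (simp_all add: eff_Mor)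
      note Vm = eff_Obj_module[OF V]
      define w where "w = Ncomp \<chi> X m"
      have w: "w \<in> el V X" using nat_transD(4)[OF \<chi>(1) P(2)] P(3) \<chi> by (simp add: w_def)
      obtain \<mu> where \<mu>: "is_nat_trans C \<mu>" "Ndom \<mu> = Q" "Ncod \<mu> = V" "Ncomp \<mu> X q = w"
      proof (rule pres_map[OF q Vm w])
        fix u assume "u \<in> T"
        then have "u \<in> gen h" using h(4) by simp
        then obtain b where b: "b \<in> Mor C" "Cod C b = Dom C h" "u = h \<cdot> b" by (rule genE)
        have u: "u \<in> Mor C" "Cod C u = X" "Dom C u = Dom C b" using b h by simp_all
        have nb: "Fmap N b n \<in> el N (Dom C b)" by (rule PN(7)[OF b(1,2)])
        have "Fmap V u w = Ncomp \<chi> (Dom C u) (Fmap M u m)" using pres_apply[OF p \<chi>(1,2) u(1,2)] \<chi> by (simp add: w_def)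
        also have "\<dots> = Ncomp \<chi> (Dom C b) (Ncomp \<phi> (Dom C b) (Fmap N b n))" using \<phi>act[OF b(1,2)] b(3) u(3) by simp
        also have "\<dots> = unit_el V (Dom C u)"
          using Ncomp_cong[OF \<chi>0, of "Dom C b" "Fmap N b n"] nb b(1) u(3) \<phi>(2) \<chi>(3) by simp
        finally show "Fmap V u w = unit_el V (Dom C u)" .
      qed
      show "\<exists>!u. u \<in> Hom (eff C E) (Cod (eff C E) \<psi>) V \<and> Comp (eff C E) u \<psi> = \<chi>"
      proof (rule ex1I[of _ \<mu>])
        have "Comp (eff C E) \<mu> \<psi> = \<chi>"
        proof (rule pres_eqI[OF p])
          show "is_nat_trans C (Comp (eff C E) \<mu> \<psi>)" using nat_trans_comp[OF \<psi>(1) \<mu>(1)] \<mu> \<psi> by simp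
          show "Ncomp (Comp (eff C E) \<mu> \<psi>) X m = Ncomp \<chi> X m" using \<mu> \<psi> P(2,3) by (simp add: w_def)
        qed (use \<mu> \<psi> \<chi> in simp_all)
        then show "\<mu> \<in> Hom (eff C E) (Cod (eff C E) \<psi>) V \<and> Comp (eff C E) \<mu> \<psi> = \<chi>"
          using \<mu> \<psi>(3) V QO by (simp add: eff_Mor)
        fix \<nu> assume \<nu>': "\<nu> \<in> Hom (eff C E) (Cod (eff C E) \<psi>) V \<and> Comp (eff C E) \<nu> \<psi> = \<chi>"
        then have \<nu>c: "Comp (eff C E) \<nu> \<psi> = \<chi>" by blast
        have \<nu>: "is_nat_trans C \<nu>" "Ndom \<nu> = Q" "Ncod \<nu> = V" using \<nu>' \<psi>(3) by (simp_all add: eff_Mor)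
        have "Ncomp \<nu> X q = w" using Ncomp_cong[OF \<nu>c, of X m] P(2,3) \<psi> by (simp add: w_def)
        then show "\<nu> = \<mu>" using \<nu> \<mu> by (intro pres_eqI[OF q]) simp_all
      qed
    qed
    ultimately have kc: "ker_coker_pair (eff C E) \<phi> \<psi>" by (simp add: ker_coker_pair_def)
    have "finite_length (eff C E) (Dom (eff C E) \<phi>)" using Suc.IH[OF ht n hS] \<phi>(2) by simp
    moreover have "simple_obj (eff C E) (Cod (eff C E) \<psi>)"
      using simple_objI_height[OF q T(1) _ T(4)] T(3) \<psi>(3) by simp
    ultimately have "finite_length (eff C E) (Cod (eff C E) \<phi>)" by (rule finite_length.extension[OF kc])
    then show ?thesis using \<phi>(3) by simp
  qed
qed

lemma finite_length_iff_bounded: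
  assumes "pres M X S m" "S \<in> sieves X" shows "finite_length (eff C E) M \<longleftrightarrow> bounded X S"
  using assms finite_length_bounded height_finite_length unfolding bounded_def by blast

end

section \<open>The maximal admissible exact structure\<close>

lemma full_subcategory_Mod_eq_iff:
  "full_subcategory (Mod_cat A) S = full_subcategory (full_subcategory (Mod_cat A) T) P \<longleftrightarrow>
     Obj (full_subcategory (Mod_cat A) S) = Obj (full_subcategory (Mod_cat A) T) \<inter> P"
  (is "?sieves = ?R \<longleftrightarrow> _")
proof
  assume eq: "Obj (full_subcategory (Mod_cat A) S) = Obj (full_subcategory (Mod_cat A) T) \<inter> P"
  then have *: "M \<in> S \<longleftrightarrow> M \<in> T \<and> M \<in> P" if "is_module A M" for M
    using that by (auto simp: full_subcategory_def)
  have "\<eta> \<in> Mor ?sieves \<longleftrightarrow> \<eta> \<in> Mor ?R" for \<eta>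
  proof (cases "is_nat_trans A \<eta>")
    case True
    then show ?thesis using *[OF nat_transD(1)] *[OF nat_transD(2)] by (auto simp: full_subcategory_def)
  qed (simp add: full_subcategory_def)
  then have "Mor ?sieves = Mor ?R" by blast
  moreover have "Obj ?sieves = Obj ?R" using eq by (auto simp: full_subcategory_def)
  ultimately show "?sieves = ?R" by (auto simp: full_subcategory_def)
next
  assume "?sieves = ?R"
  then have "Obj ?sieves = Obj ?R" by simp
  then show "Obj ?sieves = Obj (full_subcategory (Mod_cat A) T) \<inter> P" by (auto simp: full_subcategory_def)
qed

context exact_category
begin

lemma defect_eff:
  assumes "(f, g) \<in> E"
  shows "defect C (f, g) \<in> Obj (eff C E)"
    "finite_length (eff C E) (defect C (f, g)) \<longleftrightarrow> bounded (Cod C g) (gen g)"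
proof -
  have d: "g \<in> deflations E" using assms by (auto simp: deflations_def)
  note g = sievesI[OF d refl]
  obtain m where m: "pres (defect C (f, g)) (Cod C g) (gen g) m"
    using defect_pres[OF deflation_Mor[OF d]] by blast
  show "defect C (f, g) \<in> Obj (eff C E)" by (rule eff_ObjI[OF m g])
  show "finite_length (eff C E) (defect C (f, g)) \<longleftrightarrow> bounded (Cod C g) (gen g)"
    by (rule finite_length_iff_bounded[OF m g])
qed

lemma admissible_iff: "admissible C E \<longleftrightarrow> (\<forall>X. \<forall>S\<in>sieves X. bounded X S)"
proof
  assume a: "admissible C E"
  show "\<forall>X. \<forall>S\<in>sieves X. bounded X S"
  proof (intro allI ballI)
    fix X S assume S: "S \<in> sieves X"
    obtain M :: "('o, 'm, 'm set) modul" and m where m: "pres M X S m" by (rule sieves_gen_ex[OF S])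
    then have "finite_length (eff C E) M" using a eff_ObjI[OF m S] by (simp add: admissible_def)
    then show "bounded X S" by (rule finite_length_bounded[OF _ m])
  qed
next
  assume b: "\<forall>X. \<forall>S\<in>sieves X. bounded X S"
  show "admissible C E" unfolding admissible_def
  proof (intro conjI exact ballI)
    fix M assume "M \<in> Obj (eff C E)"
    then obtain X S m where "S \<in> sieves X" "pres M X S m" by (rule eff_ObjE)
    then show "finite_length (eff C E) M" using b finite_length_iff_bounded by blast
  qed
qed

lemma fin_pairs_L: "S \<in> exact_category.sieves C fin_pairs X \<longleftrightarrow> S \<in> sieves X \<and> bounded X S"
proof -
  interpret F: exact_category C fin_pairs by unfold_locales (rule exact_fin_pairs)
  show ?thesis unfolding F.sieves_def sieves_def using fin_deflations by auto
qed

lemma admissible_fin_pairs: "admissible C fin_pairs"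
proof -
  interpret F: exact_category C fin_pairs by unfold_locales (rule exact_fin_pairs)
  have sub: "fin_pairs \<subseteq> E" by (auto simp: fin_pairs_def)
  show ?thesis unfolding F.admissible_iff using F.bounded_sub[OF exact sub] fin_pairs_L by blast
qed

lemma admissible_subset_fin_pairs:
  assumes "admissible C F" "F \<subseteq> E" shows "F \<subseteq> fin_pairs"
proof
  interpret F: exact_category C F by unfold_locales (use assms in \<open>simp add: admissible_def\<close>)
  fix d assume d: "d \<in> F"
  obtain f g where fg: "d = (f, g)" by (cases d)
  have "g \<in> deflations F" using d fg by (auto simp: deflations_def)
  then have S: "gen g \<in> F.sieves (Cod C g)" by (rule F.sievesI[OF _ refl])
  then have "F.bounded (Cod C g) (gen g)" using assms(1) F.admissible_iff by blast
  then have "bounded (Cod C g) (gen g)" using F.bounded_sub[OF exact assms(2) S] by blast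
  then show "d \<in> fin_pairs" using d fg assms(2) by (auto simp: fin_pairs_def)
qed

lemma eff_fin_pairs_Obj: "Obj (eff C fin_pairs) = Obj (eff C E) \<inter> {M. finite_length (eff C E) M}"
proof (intro Set.set_eqI iffI)
  interpret F: exact_category C fin_pairs by unfold_locales (rule exact_fin_pairs)
  fix M
  { assume "M \<in> Obj (eff C fin_pairs)"
    then obtain X S m where "S \<in> F.sieves X" "pres M X S m" by (rule F.eff_ObjE)
    then show "M \<in> Obj (eff C E) \<inter> {M. finite_length (eff C E) M}"
      using fin_pairs_L eff_ObjI finite_length_iff_bounded by blast }
  { assume "M \<in> Obj (eff C E) \<inter> {M. finite_length (eff C E) M}"
    then have M: "M \<in> Obj (eff C E)" "finite_length (eff C E) M" by simp_all
    obtain X S m where S: "S \<in> sieves X" "pres M X S m" by (rule eff_ObjE[OF M(1)])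
    then have "S \<in> F.sieves X" using fin_pairs_L finite_length_bounded[OF M(2)] by blast
    then show "M \<in> Obj (eff C fin_pairs)" by (rule F.eff_ObjI[OF S(2)]) }
qed

text \<open>
  An exact structure is determined by its defects: a deflation is recognised by the sieve that it
  generates.
\<close>

lemma subset_of_eff_Obj_subset:
  assumes F: "exact_structure C F" and sub: "Obj (eff C E) \<subseteq> Obj (eff C F)" shows "E \<subseteq> F"
proof
  interpret F: exact_category C F by unfold_locales (rule F)
  fix d assume d: "d \<in> E"
  obtain f g where fg: "d = (f, g)" by (cases d)
  have p: "(f, g) \<in> E" using d fg by simp
  note G = ker_coker_pairD[OF pairD[OF p]]
  have D: "defect C (f, g) \<in> Obj (eff C F)" using defect_eff(1)[OF p] sub by blast
  obtain m where "pres (defect C (f, g)) (Cod C g) (gen g) m" using defect_pres[OF G(2)] by blast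
  then have "gen g \<in> F.sieves (Cod C g)" by (rule F.pres_sieve[OF _ D])
  then obtain h where "h \<in> deflations F" "h \<in> Mor C" "Cod C h = Cod C g" "gen g = gen h" by (rule F.sievesE)
  then show "d \<in> F" using F.gen_upward[of h f g] G(5) fg by simp
qed

end

theorem theorem3:
  fixes A :: "('o, 'm) cat"
  assumes "Krull_Schmidt A"
  shows "\<exists>E. admissible A E \<and>
     (\<forall>E'. admissible A E' \<longrightarrow> E' \<subseteq> E) \<and>
     (\<forall>E'. maximal_admissible A E' \<longleftrightarrow> E' = E) \<and>
     (\<forall>E'. exact_structure A E' \<and>
           eff A E' = full_subcategory (eff A (max_exact_structure A))
             {M. finite_length (eff A (max_exact_structure A)) M} \<longleftrightarrow> E' = E)"
proof -
  interpret weakly_idempotent_complete A by (rule Krull_Schmidt_weakly_idempotent_complete[OF assms])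
  define F where "F = max_exact_structure A"
  have "exact_structure A F" using exact_stable_pairs max_exact_structure_eq by (simp add: F_def)
  then interpret F: exact_category A F by unfold_locales
  define E where "E = F.fin_pairs"
  have max: "E' \<subseteq> F" if "exact_structure A E'" for E'
  proof -
    interpret E': exact_category A E' by unfold_locales (rule that)
    show ?thesis using E'.exact_subset_stable_pairs max_exact_structure_eq by (simp add: F_def)
  qed
  have adm: "admissible A E" unfolding E_def by (rule F.admissible_fin_pairs)
  have greatest: "E' \<subseteq> E" if "admissible A E'" for E'
    unfolding E_def by (rule F.admissible_subset_fin_pairs[OF that max])
      (use that in \<open>simp add: admissible_def\<close>)
  have maximal: "maximal_admissible A E' \<longleftrightarrow> E' = E" for E'
    unfolding maximal_admissible_def using adm greatest by blast
  have eff_eq: "eff A E' = full_subcategory (eff A F) {M. finite_length (eff A F) M} \<longleftrightarrow>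
      Obj (eff A E') = Obj (eff A E)" for E'
    unfolding eff_def full_subcategory_Mod_eq_iff
    using F.eff_fin_pairs_Obj unfolding E_def eff_def by simp
  have "exact_structure A E' \<and> eff A E' = full_subcategory (eff A F) {M. finite_length (eff A F) M} \<longleftrightarrow>
      E' = E" for E'
  proof
    have Ex: "exact_structure A E" using adm by (simp add: admissible_def)
    then interpret E: exact_category A E by unfold_locales
    {
      assume e: "exact_structure A E' \<and>
        eff A E' = full_subcategory (eff A F) {M. finite_length (eff A F) M}"
      then have E': "exact_structure A E'" and O: "Obj (eff A E') = Obj (eff A E)" using eff_eq by blast+
      interpret E': exact_category A E' by unfold_locales (rule E')
      show "E' = E"
        using E.subset_of_eff_Obj_subset[OF E'] E'.subset_of_eff_Obj_subset[OF Ex] O by simp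
    }
    {
      assume "E' = E"
      then show "exact_structure A E' \<and>
          eff A E' = full_subcategory (eff A F) {M. finite_length (eff A F) M}"
        using Ex eff_eq by blast
    }
  qed
  then show ?thesis using adm greatest maximal unfolding F_def by blast
qed

end
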